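(* Let $n\ge2$, $j\ge1$, $j\not\equiv0\pmod n$. Let $\gamma(x,t)$ be a solution of the $j$-th central affine curve flow $\gamma_t=gZ_{j,0}(u)e_1$ on $\mathcal{M}_n(\mathbb{R})$, with $g(\cdot,t)$ and $u(\cdot,t)$ the central affine moving frame and curvature of $\gamma(\cdot,t)$, and let $E(x,t,\lambda)$ be a frame of the solution $u$ of the $j$-th $A_{n-1}^{(1)}$-KdV flow, holomorphic in $\lambda$ near $0$, with $E(0,0,0)=g(0,0)$. Let $E_1(x,t)=\frac{\partial}{\partial\lambda}\big|_{\lambda=0}E(x,t,\lambda)$, let $\mathbf{c}_0=(c_1,\ldots,c_{n-1},-1)^t\in\mathbb{R}^n$ be constant, $(v_1,\ldots,v_n)^t:=g^{-1}\mathbf{c}_0$, and $h=-\frac{v_{n-1}}{v_n}$ (where $v_n\neq0$). Then $$\tilde\gamma=(e_{1n}g+AE_1)\,f_{u,h}^{\sharp}(x,t,0)\,e_1$$ is a solution of the $j$-th central affine curve flow, where $A=b+\sum_{i=1}^{n-1}c_ie_{i+1,n}$ and $f_{u,h}^\sharp$ is the cofactor matrix of $f_{u,h}$.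
   Context: $\mathcal{M}_n(\mathbb{R})$ is the set of smooth $\gamma:\mathbb{R}\to\mathbb{R}^n\setminus\{0\}$ with $\det(\gamma,\gamma_x,\ldots,\gamma_x^{(n-1)})=1$. For such $\gamma$ the central affine moving frame $g=(\gamma,\ldots,\gamma_x^{(n-1)})$ satisfies $g_x=g(b+u)$ with $b=\sum_{i=1}^{n-1}e_{i+1,i}$ and central affine curvature $u=\sum_{i=1}^{n-1}u_ie_{in}$, where $\gamma_x^{(n)}=u_1\gamma+\cdots+u_{n-1}\gamma_x^{(n-2)}$. $V_n=\bigoplus_{i=1}^{n-1}\mathbb{R}e_{in}$, $e_1=(1,0,\ldots,0)^t$. A solution of the $j$-th central affine curve flow is a smooth $\gamma(x,t)$ with $\gamma(\cdot,t)$ satisfying $\det(\gamma,\ldots,\gamma_x^{(n-1)})=1$ and $\gamma_t=gZ_{j,0}(u)e_1$. Let $J=e_{1n}\lambda+b$. For smooth $V_n$-valued $u$, let $Y(u,\lambda)=e_{1n}\lambda+\sum_{i\le 0}Y_{1,i}(u)\lambda^i$ be the unique formal series with smooth $sl(n)$-valued coefficients satisfying $Y_x+[J+u,Y]=0$ and $Y^n=\lambda I_n$; its coefficients are differential polynomials in $u$. Write $Y^j=\sum_i Y_{j,i}(u)\lambda^i$. There is a unique strictly upper triangular $\zeta_j(u)$ with $[\partial_x+b+u,\,Y_{j,0}(u)-\zeta_j(u)]\in V_n$, where $[\partial_x+A,B]=B_x+[A,B]$. Set $Z_j(u,\lambda)=\sum_{i\ge0}Y_{j,i}(u)\lambda^i-\zeta_j(u)$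 and $Z_{j,0}(u)=Z_j(u,0)$. The $j$-th $A^{(1)}_{n-1}$-KdV flow is $u_t=[\partial_x+b+u,Z_{j,0}(u)]$; a frame of a solution $u$ is $E(x,t,\lambda)\in GL(n,\mathbb{C})$ with $E^{-1}E_x=J+u$, $E^{-1}E_t=Z_j(u,\lambda)$, $\overline{E(x,t,\bar\lambda)}=E(x,t,\lambda)$. Given functions $u_1,\dots,u_{n-1},h$ of $(x,t)$, define $w_n=1$, $w_{n-1}=-h$, $w_{i-1}=-(w_i)_x-hw_i-u_i$ for $i=n-1,\ldots,2$; $s_i(u,h)=(w_i)_x-\sum_{m=i+1}^{n}\binom{m-1}{i-1}w_m h_x^{(m-i)}$ for $1\le i\le n-1$; and $f_{u,h}(x,t,\lambda)=J+hI_n+N(u,h)$ where $N$ is strictly upper triangular with $N_{ij}=\binom{j-1}{i-1}h_x^{(j-i)}$ for $1\le i<j<n$ and $N_{in}=u_i+s_i(u,h)+\binom{n-1}{i-1}h_x^{(n-i)}$ for $1\le i\le n-1$. The cofactor matrix $M^\sharp$ has $ij$-entry $(-1)^{i+j}$ times the determinant of $M$ with the $j$-th row and $i$-th column removed, so $MM^\sharp=\det(M)I_n$. *)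

theory Defs
  imports
    "HOL-Complex_Analysis.Complex_Analysis"
    "HOL-Computational_Algebra.Formal_Laurent_Series"
    "Jordan_Normal_Form.Determinant"
    "Jordan_Normal_Form.Gauss_Jordan_Elimination"
begin

no_notation vec_nth (infixl \<open>$\<close> 90)
no_notation fps_nth (infixl \<open>$\<close> 75)
no_notation fls_nth (infixl \<open>$$\<close> 75)

text \<open>
  Points \<open>p = (x, t)\<close> have type \<^typ>\<open>real \<times> real\<close>; all functions of \<open>(x, t)\<close> live on an open set \<open>S\<close>.
  Matrix entries are 0-based (as in the matrix library), whereas the families \<open>u 1, \<dots>, u (n - 1)\<close>,
  the \<open>w\<close> and \<open>s\<close> below and the elementary matrices are indexed from 1.
\<close>

section \<open>Calculus on the plane\<close>

primrec differentiable_times :: "nat \<Rightarrow> 'a::real_normed_vector set \<Rightarrow> ('a \<Rightarrow> 'b::real_normed_vector) \<Rightarrow> bool"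
  where
    "differentiable_times 0 S f \<longleftrightarrow> continuous_on S f"
  | "differentiable_times (Suc k) S f \<longleftrightarrow>
       (\<forall>x\<in>S. f differentiable (at x)) \<and>
       (\<forall>v. differentiable_times k S (\<lambda>x. frechet_derivative f (at x) v))"

text \<open>Only used for open \<open>S\<close>.\<close>

definition smooth_on :: "'a::real_normed_vector set \<Rightarrow> ('a \<Rightarrow> 'b::real_normed_vector) \<Rightarrow> bool"
  where "smooth_on S f \<longleftrightarrow> (\<forall>k. differentiable_times k S f)"

definition Dx :: "(real \<times> real \<Rightarrow> 'a::real_normed_vector) \<Rightarrow> real \<times> real \<Rightarrow> 'a"
  where "Dx f p = vector_derivative (\<lambda>s. f (s, snd p)) (at (fst p))"

definition Dt :: "(real \<times> real \<Rightarrow> 'a::real_normed_vector) \<Rightarrow> real \<times> real \<Rightarrow> 'a"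
  where "Dt f p = vector_derivative (\<lambda>s. f (fst p, s)) (at (snd p))"

definition mat_Dx :: "(real \<times> real \<Rightarrow> 'a::real_normed_vector mat) \<Rightarrow> real \<times> real \<Rightarrow> 'a mat"
  where "mat_Dx M p = mat (dim_row (M p)) (dim_col (M p)) (\<lambda>rc. Dx (\<lambda>q. M q $$ rc) p)"

definition mat_Dt :: "(real \<times> real \<Rightarrow> 'a::real_normed_vector mat) \<Rightarrow> real \<times> real \<Rightarrow> 'a mat"
  where "mat_Dt M p = mat (dim_row (M p)) (dim_col (M p)) (\<lambda>rc. Dt (\<lambda>q. M q $$ rc) p)"

definition smooth_mat_on ::
  "nat \<Rightarrow> (real \<times> real) set \<Rightarrow> (real \<times> real \<Rightarrow> 'a::real_normed_vector mat) \<Rightarrow> bool"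
  where "smooth_mat_on n S M \<longleftrightarrow>
    (\<forall>p\<in>S. M p \<in> carrier_mat n n) \<and> (\<forall>r<n. \<forall>c<n. smooth_on S (\<lambda>p. M p $$ (r, c)))"

text \<open>\<open>[\<partial>\<^sub>x + A, B] = B\<^sub>x + [A, B]\<close>\<close>

definition bracket_Dx ::
  "(real \<times> real \<Rightarrow> real mat) \<Rightarrow> (real \<times> real \<Rightarrow> real mat) \<Rightarrow> real \<times> real \<Rightarrow> real mat"
  where "bracket_Dx A B p = mat_Dx B p + (A p * B p - B p * A p)"

definition inv_mat :: "'a::field mat \<Rightarrow> 'a mat"
  where "inv_mat A = the (mat_inverse A)"

section \<open>Constant matrices\<close>

definition elem_mat :: "nat \<Rightarrow> nat \<Rightarrow> nat \<Rightarrow> 'a::comm_ring_1 mat"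
  where "elem_mat n i k = mat n n (\<lambda>(r, c). if r + 1 = i \<and> c + 1 = k then 1 else 0)"

definition b_mat :: "nat \<Rightarrow> 'a::comm_ring_1 mat"
  where "b_mat n = mat n n (\<lambda>(r, c). if r = c + 1 then 1 else 0)"

definition J_mat :: "nat \<Rightarrow> 'a::comm_ring_1 \<Rightarrow> 'a mat"
  where "J_mat n l = l \<cdot>\<^sub>m elem_mat n 1 n + b_mat n"

definition u_mat :: "nat \<Rightarrow> (nat \<Rightarrow> 'a::comm_ring_1) \<Rightarrow> 'a mat"
  where "u_mat n a = mat n n (\<lambda>(r, c). if c + 1 = n \<and> r + 1 < n then a (r + 1) else 0)"

definition V_space :: "nat \<Rightarrow> real mat set"
  where "V_space n = range (u_mat n)"

section \<open>The flows of the hierarchy\<close>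

text \<open>
  Formal series in \<open>\<lambda>\<close> with finitely many positive powers are formal Laurent series in the variable
  \<open>1 / \<lambda>\<close>: the element \<open>\<lambda>\<close> is \<^term>\<open>fls_X_inv\<close> and the coefficient of \<open>\<lambda>\<^sup>i\<close> is the one at index \<open>- i\<close>.
\<close>

definition lam_coeff :: "real fls mat \<Rightarrow> int \<Rightarrow> real mat"
  where "lam_coeff M i = map_mat (\<lambda>f. fls_nth f (- i)) M"

text \<open>The part \<open>\<Sum>\<^bsub>i \<ge> 0\<^esub>\<close> of a series, as a polynomial in \<open>\<lambda>\<close>; \<^const>\<open>fls_prpart\<close> omits the constant term.\<close>

definition lam_poly_part :: "real fls \<Rightarrow> real poly"
  where "lam_poly_part f = fls_prpart f + [: fls_nth f 0 :]"

text \<open>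
  \<open>Y = Y(u, \<lambda>)\<close>. The conditions determine \<open>Y\<close> on \<open>S\<close>; its coefficients being differential
  polynomials in \<open>u\<close>, they are smooth jointly in \<open>(x, t)\<close>.
\<close>

definition is_Y ::
  "nat \<Rightarrow> (real \<times> real) set \<Rightarrow> (nat \<Rightarrow> real \<times> real \<Rightarrow> real) \<Rightarrow> (real \<times> real \<Rightarrow> real fls mat) \<Rightarrow> bool"
  where "is_Y n S u Y \<longleftrightarrow>
    (\<forall>i. smooth_mat_on n S (\<lambda>p. lam_coeff (Y p) i)) \<and>
    (\<forall>p\<in>S.
       (\<forall>i. (\<Sum>r<n. lam_coeff (Y p) i $$ (r, r)) = 0) \<and>
       (\<forall>i>1. lam_coeff (Y p) i = 0\<^sub>m n n) \<and>
       lam_coeff (Y p) 1 = elem_mat n 1 n \<and>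
       (let L = J_mat n fls_X_inv + map_mat fls_const (u_mat n (\<lambda>i. u i p)) in
         \<forall>i. mat_Dx (\<lambda>q. lam_coeff (Y q) i) p + lam_coeff (L * Y p - Y p * L) i = 0\<^sub>m n n) \<and>
       Y p ^\<^sub>m n = fls_X_inv \<cdot>\<^sub>m 1\<^sub>m n)"

definition is_zeta ::
  "nat \<Rightarrow> nat \<Rightarrow> (real \<times> real) set \<Rightarrow> (nat \<Rightarrow> real \<times> real \<Rightarrow> real) \<Rightarrow>
    (real \<times> real \<Rightarrow> real fls mat) \<Rightarrow> (real \<times> real \<Rightarrow> real mat) \<Rightarrow> bool"
  where "is_zeta n j S u Y \<zeta> \<longleftrightarrow>
    smooth_mat_on n S \<zeta> \<and>
    (\<forall>p\<in>S.
       (\<forall>r<n. \<forall>c\<le>r. \<zeta> p $$ (r, c) = 0) \<and>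
       bracket_Dx (\<lambda>q. b_mat n + u_mat n (\<lambda>i. u i q)) (\<lambda>q. lam_coeff (Y q ^\<^sub>m j) 0 - \<zeta> q) p
         \<in> V_space n)"

text \<open>\<open>Z = Z\<^sub>j(u, \<lambda>)\<close>, a matrix of polynomials in \<open>\<lambda>\<close>, determined on \<open>S\<close> since \<open>Y\<close> and \<open>\<zeta>\<^sub>j\<close> are.\<close>

definition is_Z ::
  "nat \<Rightarrow> nat \<Rightarrow> (real \<times> real) set \<Rightarrow> (nat \<Rightarrow> real \<times> real \<Rightarrow> real) \<Rightarrow>
    (real \<times> real \<Rightarrow> real poly mat) \<Rightarrow> bool"
  where "is_Z n j S u Z \<longleftrightarrow>
    (\<exists>Y \<zeta>. is_Y n S u Y \<and> is_zeta n j S u Y \<zeta> \<and>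
      (\<forall>p\<in>S. Z p = map_mat lam_poly_part (Y p ^\<^sub>m j) - map_mat (\<lambda>a. [: a :]) (\<zeta> p)))"

definition Z_zero :: "real poly mat \<Rightarrow> real mat"
  where "Z_zero M = map_mat (\<lambda>q. poly q 0) M"

definition Z_eval :: "real poly mat \<Rightarrow> complex \<Rightarrow> complex mat"
  where "Z_eval M l = map_mat (\<lambda>q. poly (map_poly complex_of_real q) l) M"

definition kdv_solution ::
  "nat \<Rightarrow> nat \<Rightarrow> (real \<times> real) set \<Rightarrow> (nat \<Rightarrow> real \<times> real \<Rightarrow> real) \<Rightarrow> bool"
  where "kdv_solution n j S u \<longleftrightarrow>
    (\<forall>i\<in>{1..n - 1}. smooth_on S (u i)) \<and>
    (\<exists>Z. is_Z n j S u Z \<and>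
      (\<forall>p\<in>S. u_mat n (\<lambda>i. Dt (u i) p) =
        bracket_Dx (\<lambda>q. b_mat n + u_mat n (\<lambda>i. u i q)) (\<lambda>q. Z_zero (Z q)) p))"

text \<open>A frame of the solution \<open>u\<close>, for spectral parameters in a conjugation-invariant set \<open>\<Lambda>\<close>.\<close>

definition is_frame ::
  "nat \<Rightarrow> nat \<Rightarrow> (real \<times> real) set \<Rightarrow> complex set \<Rightarrow> (nat \<Rightarrow> real \<times> real \<Rightarrow> real) \<Rightarrow>
    (real \<times> real \<Rightarrow> complex \<Rightarrow> complex mat) \<Rightarrow> bool"
  where "is_frame n j S \<Lambda> u E \<longleftrightarrow>
    kdv_solution n j S u \<and>
    (\<exists>Z. is_Z n j S u Z \<and>
      (\<forall>l\<in>\<Lambda>. cnj l \<in> \<Lambda> \<and> smooth_mat_on n S (\<lambda>p. E p l) \<and>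
        (\<forall>p\<in>S. invertible_mat (E p l) \<and>
          inv_mat (E p l) * mat_Dx (\<lambda>q. E q l) p
            = J_mat n l + map_mat complex_of_real (u_mat n (\<lambda>i. u i p)) \<and>
          inv_mat (E p l) * mat_Dt (\<lambda>q. E q l) p = Z_eval (Z p) l \<and>
          map_mat cnj (E p (cnj l)) = E p l)))"

section \<open>Central affine curves\<close>

definition ca_frame :: "nat \<Rightarrow> (real \<times> real \<Rightarrow> real vec) \<Rightarrow> real \<times> real \<Rightarrow> real mat"
  where "ca_frame n \<gamma> p = mat n n (\<lambda>(r, c). (Dx ^^ c) (\<lambda>q. \<gamma> q $ r) p)"

definition is_ca_curvature ::
  "nat \<Rightarrow> (real \<times> real) set \<Rightarrow> (real \<times> real \<Rightarrow> real vec) \<Rightarrow> (nat \<Rightarrow> real \<times> real \<Rightarrow> real) \<Rightarrow> bool"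
  where "is_ca_curvature n S \<gamma> u \<longleftrightarrow>
    (\<forall>p\<in>S. \<forall>r<n. (Dx ^^ n) (\<lambda>q. \<gamma> q $ r) p
      = (\<Sum>i=1..n - 1. u i p * (Dx ^^ (i - 1)) (\<lambda>q. \<gamma> q $ r) p))"

definition ca_flow_solution ::
  "nat \<Rightarrow> nat \<Rightarrow> (real \<times> real) set \<Rightarrow> (real \<times> real \<Rightarrow> real vec) \<Rightarrow> bool"
  where "ca_flow_solution n j S \<gamma> \<longleftrightarrow>
    open S \<and>
    (\<forall>p\<in>S. \<gamma> p \<in> carrier_vec n \<and> \<gamma> p \<noteq> 0\<^sub>v n) \<and>
    (\<forall>r<n. smooth_on S (\<lambda>p. \<gamma> p $ r)) \<and>
    (\<forall>p\<in>S. det (ca_frame n \<gamma> p) = 1) \<and>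
    (\<exists>u Z. is_ca_curvature n S \<gamma> u \<and> is_Z n j S u Z \<and>
      (\<forall>p\<in>S. vec n (\<lambda>r. Dt (\<lambda>q. \<gamma> q $ r) p)
        = (ca_frame n \<gamma> p * Z_zero (Z p)) *\<^sub>v unit_vec n 0))"

section \<open>The Darboux matrix\<close>

text \<open>\<open>bt_w_aux n u h k\<close> is \<open>w\<^sub>i\<close> for \<open>i = n - k\<close>.\<close>

fun bt_w_aux ::
  "nat \<Rightarrow> (nat \<Rightarrow> real \<times> real \<Rightarrow> real) \<Rightarrow> (real \<times> real \<Rightarrow> real) \<Rightarrow> nat \<Rightarrow> real \<times> real \<Rightarrow> real"
  where
    "bt_w_aux n u h 0 = (\<lambda>p. 1)"
  | "bt_w_aux n u h (Suc 0) = (\<lambda>p. - h p)"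
  | "bt_w_aux n u h (Suc (Suc k)) =
      (\<lambda>p. - Dx (bt_w_aux n u h (Suc k)) p - h p * bt_w_aux n u h (Suc k) p - u (n - Suc k) p)"

definition bt_w ::
  "nat \<Rightarrow> (nat \<Rightarrow> real \<times> real \<Rightarrow> real) \<Rightarrow> (real \<times> real \<Rightarrow> real) \<Rightarrow> nat \<Rightarrow> real \<times> real \<Rightarrow> real"
  where "bt_w n u h i = bt_w_aux n u h (n - i)"

definition bt_s ::
  "nat \<Rightarrow> (nat \<Rightarrow> real \<times> real \<Rightarrow> real) \<Rightarrow> (real \<times> real \<Rightarrow> real) \<Rightarrow> nat \<Rightarrow> real \<times> real \<Rightarrow> real"
  where "bt_s n u h i p = Dx (bt_w n u h i) p
    - (\<Sum>m=i + 1..n. real ((m - 1) choose (i - 1)) * bt_w n u h m p * (Dx ^^ (m - i)) h p)"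

text \<open>In terms of the 1-based \<open>i = r + 1\<close> and \<open>k = c + 1\<close> one has \<open>k - i = c - r\<close>.\<close>

definition bt_N ::
  "nat \<Rightarrow> (nat \<Rightarrow> real \<times> real \<Rightarrow> real) \<Rightarrow> (real \<times> real \<Rightarrow> real) \<Rightarrow> real \<times> real \<Rightarrow> real mat"
  where "bt_N n u h p = mat n n (\<lambda>(r, c).
    if r < c then
      (if c + 1 = n then u (r + 1) p + bt_s n u h (r + 1) p else 0)
        + real (c choose r) * (Dx ^^ (c - r)) h p
    else 0)"

definition bt_f ::
  "nat \<Rightarrow> (nat \<Rightarrow> real \<times> real \<Rightarrow> real) \<Rightarrow> (real \<times> real \<Rightarrow> real) \<Rightarrow> real \<times> real \<Rightarrow> complex \<Rightarrow> complex mat"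
  where "bt_f n u h p l =
    J_mat n l + complex_of_real (h p) \<cdot>\<^sub>m 1\<^sub>m n + map_mat complex_of_real (bt_N n u h p)"

definition bt_c0 :: "nat \<Rightarrow> (nat \<Rightarrow> real) \<Rightarrow> real vec"
  where "bt_c0 n c = vec n (\<lambda>r. if r + 1 = n then - 1 else c (r + 1))"

text \<open>\<open>A = b + \<Sum> c\<^sub>i e\<^bsub>i+1,n\<^esub>\<close>: the 0-based row of the entry \<open>c\<^sub>i\<close> is \<open>i\<close>.\<close>

definition bt_A :: "nat \<Rightarrow> (nat \<Rightarrow> real) \<Rightarrow> real mat"
  where "bt_A n c = b_mat n + mat n n (\<lambda>(r, k). if k + 1 = n \<and> 1 \<le> r then c r else 0)"

definition lam_deriv_mat ::
  "nat \<Rightarrow> (real \<times> real \<Rightarrow> complex \<Rightarrow> complex mat) \<Rightarrow> real \<times> real \<Rightarrow> complex mat"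
  where "lam_deriv_mat n E p = mat n n (\<lambda>rc. deriv (\<lambda>l. E p l $$ rc) 0)"

end

theory Submission
  imports Defs
begin

text \<open>
  Normalise \<open>g\<^sup>-\<^sup>1 c\<^sub>0\<close> by its last entry to a vector \<open>w\<close>. It spans the kernel of \<open>f\<^bsub>u,h\<^esub>\<close> at \<open>\<lambda> = 0\<close>, and \<open>c\<^sub>0\<close> spans
  the kernel of \<open>A\<close>; hence \<open>\<Phi> = (e\<^bsub>1n\<^esub>\<lambda> + A) E f\<^bsub>u,h\<^esub>\<^sup>-\<^sup>1\<close> is regular at \<open>\<lambda> = 0\<close>. The gauge transform by \<open>f\<^bsub>u,h\<^esub>\<close> preserves
  the form \<open>J + u\<close> of the \<open>x\<close>-connection. It maps \<open>Y\<close> to \<open>f\<^bsub>u,h\<^esub> Y f\<^bsub>u,h\<^esub>\<^sup>-\<^sup>1\<close>, which is the series of the new curvature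
  because that series is unique, so the \<open>t\<close>-connection keeps its form as well. Therefore \<open>\<Phi>\<close> at \<open>\<lambda> = 0\<close> is the
  frame of a new solution, whose curve is its first column; up to the sign \<open>(-1)\<^sup>n\<^sup>-\<^sup>1\<close> the first column of
  the cofactor matrix of \<open>f\<^bsub>u,h\<^esub>\<close> at \<open>\<lambda> = 0\<close> is \<open>w\<close>.
\<close>

section \<open>Calculus in the plane\<close>

text \<open>The delicate point is regularity in \<lambda>. The frame \<open>E\<close> is smooth in
  (x, t) for each fixed \<lambda> and holomorphic in \<lambda> for each fixed point, and nothing is
  given jointly; yet \<open>E1\<close> has to be smooth and to satisfy the differentiated equations.
  For R = E g^{-1} the system becomes R_x = \<lambda> R B, and a growth estimate for it justifies
  the exchange of derivatives. Uniqueness of \<open>Y\<close> is a leading-term argument: in a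
  grading that makes J homogeneous, the leading coefficient of a difference of two solutions is a
  multiple a of a power of the cyclic shift, and the n-th powers then differ by a term with the
  factor n a, which is not zero. A matrix M with [\<partial>_x + b + u, M] in V_n is determined by
  its first column. This extends the flow from the curve to its whole frame and makes \<zeta>_j
  unique. That E at \<lambda> = 0 equals g is obtained on all of S, which is convex; the set where
  v_n is nonzero need not be connected. The sign of the cofactor column is harmless, n (n - 1) being
  even.\<close>

lemma has_derivative_cong_open:
  assumes "open S" "x \<in> S" "\<And>y. y \<in> S \<Longrightarrow> f y = g y"
  shows "(f has_derivative f') (at x) \<longleftrightarrow> (g has_derivative f') (at x)"
  using has_derivative_transform_within_open[OF _ assms(1,2), of f f' UNIV g]
    has_derivative_transform_within_open[OF _ assms(1,2), of g f' UNIV f] assms(3) by auto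

lemma frechet_derivative_cong:
  assumes "open S" "x \<in> S" "\<And>y. y \<in> S \<Longrightarrow> f y = g y"
  shows "frechet_derivative f (at x) = frechet_derivative g (at x)"
  unfolding frechet_derivative_def by (simp add: has_derivative_cong_open[OF assms])

lemma differentiable_cong_open:
  assumes "open S" "x \<in> S" "\<And>y. y \<in> S \<Longrightarrow> f y = g y"
  shows "f differentiable (at x) \<longleftrightarrow> g differentiable (at x)"
  unfolding differentiable_def by (simp add: has_derivative_cong_open[OF assms])

lemma differentiable_times_cong:
  assumes "open S" "\<And>x. x \<in> S \<Longrightarrow> f x = g x"
  shows "differentiable_times k S f \<longleftrightarrow> differentiable_times k S g"
  using assms(2)
proof (induction k arbitrary: f g)
  case 0
  then show ?case by (simp cong: continuous_on_cong)
next
  case (Suc k)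
  have "differentiable_times k S (\<lambda>x. frechet_derivative f (at x) v)
      = differentiable_times k S (\<lambda>x. frechet_derivative g (at x) v)" for v
    by (rule Suc.IH) (simp add: frechet_derivative_cong[OF assms(1) _ Suc.prems])
  then show ?case
    using differentiable_cong_open[OF assms(1) _ Suc.prems] by simp
qed

lemma differentiable_times_Suc_imp:
  "differentiable_times (Suc k) S f \<Longrightarrow> differentiable_times k S f"
proof (induction k arbitrary: f)
  case 0
  then show ?case
    by (auto intro!: continuous_at_imp_continuous_on differentiable_imp_continuous_within)
next
  case (Suc k)
  have "\<forall>x\<in>S. f differentiable (at x)"
    and "\<forall>v. differentiable_times (Suc k) S (\<lambda>x. frechet_derivative f (at x) v)"
    using Suc.prems differentiable_times.simps(2)[of "Suc k" S f] by blast+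
  then show ?case using Suc.IH differentiable_times.simps(2)[of k S f] by blast
qed

lemma differentiable_times_SucI:
  assumes "open S" "\<And>x. x \<in> S \<Longrightarrow> (f has_derivative f' x) (at x)"
    and "\<And>v. differentiable_times k S (\<lambda>x. f' x v)"
  shows "differentiable_times (Suc k) S f"
proof -
  have eq: "frechet_derivative f (at x) = f' x" if "x \<in> S" for x
    using frechet_derivative_at[OF assms(2)[OF that]] by simp
  have "differentiable_times k S (\<lambda>x. frechet_derivative f (at x) v)" for v
    using differentiable_times_cong[OF assms(1), of "\<lambda>x. frechet_derivative f (at x) v" "\<lambda>x. f' x v"]
      assms(3) by (simp add: eq)
  then show ?thesis using assms(2) by (auto simp: differentiable_def)
qed

lemma differentiable_times_SucD:
  assumes "differentiable_times (Suc k) S f"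
  shows "x \<in> S \<Longrightarrow> (f has_derivative frechet_derivative f (at x)) (at x)"
    and "differentiable_times k S (\<lambda>x. frechet_derivative f (at x) v)"
  using assms by (auto simp: frechet_derivative_works)

lemma differentiable_times_const: "differentiable_times k S (\<lambda>_. c)"
  by (induction k arbitrary: c) (auto)

lemma differentiable_times_add:
  assumes "open S" "differentiable_times k S f" "differentiable_times k S g"
  shows "differentiable_times k S (\<lambda>x. f x + g x)"
  using assms(2,3)
proof (induction k arbitrary: f g)
  case 0
  then show ?case by (auto intro: continuous_intros)
next
  case (Suc k)
  show ?case
    by (rule differentiable_times_SucI[OF assms(1)
          has_derivative_add[OF differentiable_times_SucD(1)[OF Suc.prems(1)]
            differentiable_times_SucD(1)[OF Suc.prems(2)]]])
      (auto intro!: Suc.IH differentiable_times_SucD(2)[OF Suc.prems(1)]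
         differentiable_times_SucD(2)[OF Suc.prems(2)])
qed

lemma differentiable_times_bounded_linear:
  assumes "open S" "bounded_linear B" "differentiable_times k S f"
  shows "differentiable_times k S (\<lambda>x. B (f x))"
  using assms(3)
proof (induction k arbitrary: f)
  case 0
  then show ?case using bounded_linear.continuous_on[OF assms(2)] by auto
next
  case (Suc k)
  show ?case
    by (rule differentiable_times_SucI[OF assms(1)
          bounded_linear.has_derivative[OF assms(2) differentiable_times_SucD(1)[OF Suc.prems(1)]]])
      (auto intro!: Suc.IH differentiable_times_SucD(2)[OF Suc.prems(1)])
qed

lemma differentiable_times_bilinear:
  assumes "open S" "bounded_bilinear B" "differentiable_times k S f" "differentiable_times k S g"
  shows "differentiable_times k S (\<lambda>x. B (f x) (g x))"
  using assms(3,4)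
proof (induction k arbitrary: f g)
  case 0
  then show ?case using bounded_bilinear.continuous_on[OF assms(2)] by auto
next
  case (Suc k)
  show ?case
    by (rule differentiable_times_SucI[OF assms(1)
          bounded_bilinear.FDERIV[OF assms(2) differentiable_times_SucD(1)[OF Suc.prems(1)]
            differentiable_times_SucD(1)[OF Suc.prems(2)]]])
      (auto intro!: differentiable_times_add[OF assms(1)] Suc.IH differentiable_times_SucD(2)[OF Suc.prems(1)]
         differentiable_times_SucD(2)[OF Suc.prems(2)] differentiable_times_Suc_imp[OF Suc.prems(1)]
         differentiable_times_Suc_imp[OF Suc.prems(2)])
qed

text \<open>The derivative of 1/f is -(1/f) f' (1/f), which contains 1/f again but needs it only to
  one order less, so the induction closes.\<close>

lemma differentiable_times_inverse:
  fixes f :: "'a::real_normed_vector \<Rightarrow> 'b::real_normed_field"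
  assumes "open S" "\<And>x. x \<in> S \<Longrightarrow> f x \<noteq> 0" "differentiable_times k S f"
  shows "differentiable_times k S (\<lambda>x. inverse (f x))"
  using assms(3)
proof (induction k)
  case 0
  then show ?case using assms(2) by (auto intro!: continuous_intros)
next
  case (Suc k)
  have IH: "differentiable_times k S (\<lambda>x. inverse (f x))"
    using Suc differentiable_times_Suc_imp by blast
  have m: "differentiable_times k S (\<lambda>x. p x * q x)"
    if "differentiable_times k S p" "differentiable_times k S q" for p q :: "'a \<Rightarrow> 'b"
    by (rule differentiable_times_bilinear[OF assms(1) bounded_bilinear_mult that])
  have "differentiable_times k S (\<lambda>x. - (inverse (f x) * frechet_derivative f (at x) v * inverse (f x)))" for v
    by (intro differentiable_times_bounded_linear[OF assms(1) bounded_linear_minus[OF bounded_linear_ident]]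
      m IH differentiable_times_SucD(2)[OF Suc.prems])
  from this show ?case
    by (rule differentiable_times_SucI[OF assms(1)
        Deriv.has_derivative_inverse[OF assms(2) differentiable_times_SucD(1)[OF Suc.prems]], rotated 2])
qed

lemma smooth_on_cong:
  "open S \<Longrightarrow> (\<And>x. x \<in> S \<Longrightarrow> f x = g x) \<Longrightarrow> smooth_on S f \<longleftrightarrow> smooth_on S g"
  unfolding smooth_on_def using differentiable_times_cong by blast

lemma smooth_on_subset:
  assumes "smooth_on S f" "S' \<subseteq> S"
  shows "smooth_on S' f"
proof -
  have "differentiable_times k S g \<Longrightarrow> differentiable_times k S' g" for k and g :: "'a \<Rightarrow> 'b"
    by (induction k arbitrary: g) (use assms(2) in \<open>auto intro: continuous_on_subset\<close>)
  then show ?thesis using assms(1) unfolding smooth_on_def by blast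
qed

lemma smooth_on_imp_continuous_on: "smooth_on S f \<Longrightarrow> continuous_on S f"
  unfolding smooth_on_def by (drule spec[of _ 0]) simp

lemma smooth_on_frechet:
  assumes "smooth_on S f"
  shows "x \<in> S \<Longrightarrow> (f has_derivative frechet_derivative f (at x)) (at x)"
    and "smooth_on S (\<lambda>x. frechet_derivative f (at x) v)"
proof -
  have "differentiable_times (Suc k) S f" for k
    using assms smooth_on_def by blast
  note * = differentiable_times_SucD[OF this]
  show "x \<in> S \<Longrightarrow> (f has_derivative frechet_derivative f (at x)) (at x)"
    "smooth_on S (\<lambda>x. frechet_derivative f (at x) v)"
    using * unfolding smooth_on_def by blast+
qed

lemma smooth_on_const: "smooth_on S (\<lambda>_. c)"
  unfolding smooth_on_def by (simp add: differentiable_times_const)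

lemma smooth_on_add:
  "open S \<Longrightarrow> smooth_on S f \<Longrightarrow> smooth_on S g \<Longrightarrow> smooth_on S (\<lambda>x. f x + g x)"
  unfolding smooth_on_def using differentiable_times_add by blast

lemma smooth_on_bounded_linear:
  "open S \<Longrightarrow> bounded_linear B \<Longrightarrow> smooth_on S f \<Longrightarrow> smooth_on S (\<lambda>x. B (f x))"
  unfolding smooth_on_def using differentiable_times_bounded_linear by blast

lemma smooth_on_uminus: "open S \<Longrightarrow> smooth_on S f \<Longrightarrow> smooth_on S (\<lambda>x. - f x)"
  by (rule smooth_on_bounded_linear[OF _ bounded_linear_minus[OF bounded_linear_ident]])

lemma smooth_on_mult:
  fixes f g :: "'a::real_normed_vector \<Rightarrow> 'b::real_normed_algebra"
  shows "open S \<Longrightarrow> smooth_on S f \<Longrightarrow> smooth_on S g \<Longrightarrow> smooth_on S (\<lambda>x. f x * g x)"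
  unfolding smooth_on_def using differentiable_times_bilinear[OF _ bounded_bilinear_mult] by blast

lemma smooth_on_inverse:
  fixes f :: "'a::real_normed_vector \<Rightarrow> 'b::real_normed_field"
  shows "open S \<Longrightarrow> (\<And>x. x \<in> S \<Longrightarrow> f x \<noteq> 0) \<Longrightarrow> smooth_on S f \<Longrightarrow> smooth_on S (\<lambda>x. inverse (f x))"
  unfolding smooth_on_def using differentiable_times_inverse by blast

lemma smooth_on_divide:
  fixes f g :: "'a::real_normed_vector \<Rightarrow> 'b::real_normed_field"
  assumes "open S" "\<And>x. x \<in> S \<Longrightarrow> g x \<noteq> 0" "smooth_on S f" "smooth_on S g"
  shows "smooth_on S (\<lambda>x. f x / g x)"
  using smooth_on_mult[OF assms(1,3) smooth_on_inverse[OF assms(1,2,4)]] by (simp add: divide_inverse)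

lemma has_derivative_partials:
  fixes f :: "real \<times> real \<Rightarrow> 'b::real_normed_vector"
  assumes "(f has_derivative f') (at p)"
  shows "((\<lambda>s. f (s, snd p)) has_vector_derivative f' (1, 0)) (at (fst p))"
    and "((\<lambda>s. f (fst p, s)) has_vector_derivative f' (0, 1)) (at (snd p))"
proof -
  have sc: "f' (r *\<^sub>R v) = r *\<^sub>R f' v" for r v
    by (rule linear_cmul[OF has_derivative_linear[OF assms]])
  have "((\<lambda>s. f (s, snd p)) has_derivative (\<lambda>s. f' (s, 0))) (at (fst p))"
    by (rule has_derivative_compose[of "\<lambda>s. (s, snd p)", where g = f])
      (use assms in \<open>auto intro!: derivative_eq_intros\<close>)
  also have "(\<lambda>s. f' (s, 0)) = (\<lambda>s. s *\<^sub>R f' (1, 0))"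
    by (rule ext, subst sc[symmetric]) simp
  finally show "((\<lambda>s. f (s, snd p)) has_vector_derivative f' (1, 0)) (at (fst p))"
    unfolding has_vector_derivative_def .
  have "((\<lambda>s. f (fst p, s)) has_derivative (\<lambda>s. f' (0, s))) (at (snd p))"
    by (rule has_derivative_compose[of "\<lambda>s. (fst p, s)", where g = f])
      (use assms in \<open>auto intro!: derivative_eq_intros\<close>)
  also have "(\<lambda>s. f' (0, s)) = (\<lambda>s. s *\<^sub>R f' (0, 1))"
    by (rule ext, subst sc[symmetric]) simp
  finally show "((\<lambda>s. f (fst p, s)) has_vector_derivative f' (0, 1)) (at (snd p))"
    unfolding has_vector_derivative_def .
qed

lemma smooth_on_partials:
  fixes f :: "real \<times> real \<Rightarrow> 'b::real_normed_vector"
  assumes "smooth_on S f" "p \<in> S"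
  shows "((\<lambda>s. f (s, snd p)) has_vector_derivative Dx f p) (at (fst p))"
    and "((\<lambda>s. f (fst p, s)) has_vector_derivative Dt f p) (at (snd p))"
    and "Dx f p = frechet_derivative f (at p) (1, 0)"
    and "Dt f p = frechet_derivative f (at p) (0, 1)"
proof -
  note d = has_derivative_partials[OF smooth_on_frechet(1)[OF assms]]
  show x: "Dx f p = frechet_derivative f (at p) (1, 0)" and t: "Dt f p = frechet_derivative f (at p) (0, 1)"
    unfolding Dx_def Dt_def using vector_derivative_at[OF d(1)] vector_derivative_at[OF d(2)] by auto
  show "((\<lambda>s. f (s, snd p)) has_vector_derivative Dx f p) (at (fst p))"
     "((\<lambda>s. f (fst p, s)) has_vector_derivative Dt f p) (at (snd p))"
    unfolding x t by (rule d)+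
qed

lemma smooth_on_Dx: "open S \<Longrightarrow> smooth_on S f \<Longrightarrow> smooth_on S (Dx f)"
  by (subst smooth_on_cong[OF _ smooth_on_partials(3)[of S f]]) (auto intro: smooth_on_frechet(2))

lemma smooth_on_Dt: "open S \<Longrightarrow> smooth_on S f \<Longrightarrow> smooth_on S (Dt f)"
  by (subst smooth_on_cong[OF _ smooth_on_partials(4)[of S f]]) (auto intro: smooth_on_frechet(2))

text \<open>\<open>Dx\<close> and \<open>Dt\<close> see a function on one line only, so an open box
  around the point is enough to replace the function by one that agrees with it on S.\<close>

lemma open_nbhd_lines:
  fixes S :: "(real \<times> real) set"
  assumes "open S" "p \<in> S"
  shows "\<exists>e>0. \<forall>a b. \<bar>a - fst p\<bar> < e \<longrightarrow> \<bar>b - snd p\<bar> < e \<longrightarrow> (a, b) \<in> S"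
proof -
  obtain A B where AB: "open A" "open B" "p \<in> A \<times> B" "A \<times> B \<subseteq> S"
    using assms open_prod_elim by metis
  then obtain e1 e2 where e: "e1 > 0" "ball (fst p) e1 \<subseteq> A" "e2 > 0" "ball (snd p) e2 \<subseteq> B"
    by (metis mem_Times_iff openE)
  then have "(a, b) \<in> S" if "\<bar>a - fst p\<bar> < min e1 e2" "\<bar>b - snd p\<bar> < min e1 e2" for a b
    using AB(4) that by (auto simp: dist_real_def abs_minus_commute subset_iff)
  then show ?thesis using e by (intro exI[of _ "min e1 e2"]) auto
qed

lemma Dx_cong_open:
  assumes "open S" "p \<in> S" "\<And>q. q \<in> S \<Longrightarrow> f q = g q"
  shows "Dx f p = Dx g p"
proof -
  obtain e where e: "e > 0" "\<And>a b. \<bar>a - fst p\<bar> < e \<Longrightarrow> \<bar>b - snd p\<bar> < e \<Longrightarrow> (a, b) \<in> S"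
    using open_nbhd_lines[OF assms(1,2)] by blast
  have "\<forall>\<^sub>F s in nhds (fst p). f (s, snd p) = g (s, snd p)"
    unfolding eventually_nhds_metric
    by (rule exI[of _ e]) (use e assms(3) in \<open>auto simp: dist_real_def\<close>)
  then show ?thesis unfolding Dx_def by (intro vector_derivative_cong_eq) auto
qed

lemma Dt_cong_open:
  assumes "open S" "p \<in> S" "\<And>q. q \<in> S \<Longrightarrow> f q = g q"
  shows "Dt f p = Dt g p"
proof -
  obtain e where e: "e > 0" "\<And>a b. \<bar>a - fst p\<bar> < e \<Longrightarrow> \<bar>b - snd p\<bar> < e \<Longrightarrow> (a, b) \<in> S"
    using open_nbhd_lines[OF assms(1,2)] by blast
  have "\<forall>\<^sub>F s in nhds (snd p). f (fst p, s) = g (fst p, s)"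
    unfolding eventually_nhds_metric
    by (rule exI[of _ e]) (use e assms(3) in \<open>auto simp: dist_real_def\<close>)
  then show ?thesis unfolding Dt_def by (intro vector_derivative_cong_eq) auto
qed

text \<open>Existence of the x-partial together with continuity of the t-partial already gives the
  total derivative; all higher orders then come from the two partials, which are smooth by
  hypothesis. This serves the \<lambda>-derivative of the frame, whose partials are found line by
  line before any regularity in the plane is known.\<close>

lemma smooth_on_if_partials:
  fixes f :: "real \<times> real \<Rightarrow> 'b::real_normed_vector"
  assumes "open S"
    and fx: "\<And>p. p \<in> S \<Longrightarrow> ((\<lambda>s. f (s, snd p)) has_vector_derivative fx p) (at (fst p))"
    and ft: "\<And>p. p \<in> S \<Longrightarrow> ((\<lambda>s. f (fst p, s)) has_vector_derivative ft p) (at (snd p))"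
    and "smooth_on S fx" "smooth_on S ft"
  shows "smooth_on S f"
proof -
  have d: "(f has_derivative (\<lambda>v. fst v *\<^sub>R fx p + snd v *\<^sub>R ft p)) (at p)" if p: "p \<in> S" for p
  proof -
    obtain e where e: "e > 0" "\<And>a b. \<bar>a - fst p\<bar> < e \<Longrightarrow> \<bar>b - snd p\<bar> < e \<Longrightarrow> (a, b) \<in> S"
      using open_nbhd_lines[OF assms(1) p] by blast
    define X where "X = ball (fst p) e"
    define Y where "Y = ball (snd p) e"
    have XY: "X \<times> Y \<subseteq> S" "p \<in> X \<times> Y" "open (X \<times> Y)"
      using e by (auto simp: X_def Y_def dist_real_def abs_minus_commute mem_Times_iff intro: open_Times)
    have "((\<lambda>(x, y). f (x, y)) has_derivative (\<lambda>(tx, ty). tx *\<^sub>R fx p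
        + blinfun_scaleR_left (ft (fst p, snd p)) ty)) (at (fst p, snd p) within X \<times> Y)"
    proof (rule has_derivative_partialsI)
      show "((\<lambda>x. f (x, snd p)) has_derivative (\<lambda>tx. tx *\<^sub>R fx p)) (at (fst p) within X)"
        using fx[OF p] by (auto simp: has_vector_derivative_def intro: has_derivative_at_withinI)
      show "((\<lambda>y. f (x, y)) has_derivative blinfun_apply (blinfun_scaleR_left (ft (x, y)))) (at y within Y)"
        if "x \<in> X" "y \<in> Y" for x y
      proof -
        have "(x, y) \<in> S" using that XY(1) by blast
        from ft[OF this] show ?thesis
          by (simp add: has_vector_derivative_def has_derivative_at_withinI)
      qed
      have "isCont ft p"
        using smooth_on_imp_continuous_on[OF assms(5)] assms(1) p continuous_on_eq_continuous_at by blast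
      then have "isCont (\<lambda>q. blinfun_scaleR_left (ft q)) p"
        by (intro bounded_linear.isCont[OF bounded_linear_blinfun_scaleR_left])
      then show "continuous (at (fst p, snd p) within X \<times> Y) (\<lambda>(x, y). blinfun_scaleR_left (ft (x, y)))"
        by (simp add: case_prod_unfold continuous_at_imp_continuous_at_within)
    qed (use XY in \<open>auto simp: Y_def mem_Times_iff\<close>)
    then show ?thesis using at_within_open[OF XY(2,3)] by (simp add: case_prod_unfold)
  qed
  have "differentiable_times k S f" for k
  proof (cases k)
    case 0
    then show ?thesis using d
      by (auto intro!: continuous_at_imp_continuous_on has_derivative_continuous)
  next
    case (Suc m)
    have "differentiable_times m S (\<lambda>x. fst v *\<^sub>R fx x + snd v *\<^sub>R ft x)" for v
      using assms(4,5) unfolding smooth_on_def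
      by (auto intro!: differentiable_times_add[OF assms(1)]
        differentiable_times_bounded_linear[OF assms(1) bounded_linear_scaleR_right])
    then show ?thesis unfolding Suc by (intro differentiable_times_SucI[OF assms(1) d])
  qed
  then show ?thesis by (simp add: smooth_on_def)
qed

text \<open>By the mean value theorem, applied in the two possible orders, the second difference
  over a small square of side k is k^2 times one mixed derivative at some interior point and k^2
  times the other at another. Continuity keeps both values close to those at p, so the latter cannot
  differ.\<close>

lemma Dx_Dt_commute:
  fixes f :: "real \<times> real \<Rightarrow> real"
  assumes S: "open S" and f: "smooth_on S f" and p: "p \<in> S"
  shows "Dx (Dt f) p = Dt (Dx f) p"
proof (rule ccontr)
  define A where "A = Dx (Dt f)"
  define B where "B = Dt (Dx f)"
  assume "Dx (Dt f) p \<noteq> Dt (Dx f) p"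
  \<comment> \<open>Half the supposed gap: numbers within distance less than e of \<open>A p\<close>
    and of \<open>B p\<close> cannot coincide.\<close>
  define e where "e = \<bar>A p - B p\<bar> / 2"
  have e: "e > 0" using \<open>Dx (Dt f) p \<noteq> _\<close> by (simp add: e_def A_def B_def)
  have fx: "smooth_on S (Dx f)" and ft: "smooth_on S (Dt f)"
    using f S by (auto intro: smooth_on_Dx smooth_on_Dt)
  have cA: "continuous_on S A" and cB: "continuous_on S B"
    unfolding A_def B_def using S fx ft
    by (auto intro!: smooth_on_imp_continuous_on smooth_on_Dx smooth_on_Dt)
  define S' where "S' = S \<inter> (A -` ball (A p) e) \<inter> (S \<inter> (B -` ball (B p) e))"
  have "open S'" unfolding S'_def
    by (intro open_Int continuous_open_preimage cA cB S open_ball)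
  moreover have "p \<in> S'" using p e by (auto simp: S'_def)
  ultimately obtain d where d: "d > 0" "\<And>a b. \<bar>a - fst p\<bar> < d \<Longrightarrow> \<bar>b - snd p\<bar> < d \<Longrightarrow> (a, b) \<in> S'"
    using open_nbhd_lines by blast
  define x t k where "x = fst p" and "t = snd p" and "k = d / 2"
  have k: "0 < k" "k < d" using d(1) by (auto simp: k_def)
  have in_S': "(a, b) \<in> S'" if "x \<le> a" "a \<le> x + k" "t \<le> b" "b \<le> t + k" for a b
    using d(2)[of a b] that k by (auto simp: x_def t_def)
  have in_S: "(a, b) \<in> S" if "x \<le> a" "a \<le> x + k" "t \<le> b" "b \<le> t + k" for a b
    using in_S'[OF that] by (simp add: S'_def)
  have dx: "((\<lambda>s. g (s, b)) has_real_derivative Dx g (a, b)) (at a)"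
    and dt: "((\<lambda>s. g (a, s)) has_real_derivative Dt g (a, b)) (at b)"
    if "smooth_on S g" "x \<le> a" "a \<le> x + k" "t \<le> b" "b \<le> t + k" for a b and g :: "real \<times> real \<Rightarrow> real"
    using smooth_on_partials(1,2)[OF that(1) in_S[OF that(2-)]]
    by (simp_all add: has_real_derivative_iff_has_vector_derivative)
  let ?\<Delta> = "f (x + k, t + k) - f (x + k, t) - (f (x, t + k) - f (x, t))"
  have "\<exists>z>x. z < x + k \<and> (f (x + k, t + k) - f (x + k, t)) - (f (x, t + k) - f (x, t))
      = (x + k - x) * (Dx f (z, t + k) - Dx f (z, t))"
    by (rule MVT2) (use k in \<open>auto intro!: DERIV_diff dx[OF f]\<close>)
  then obtain a where a: "x < a" "a < x + k" "?\<Delta> = k * (Dx f (a, t + k) - Dx f (a, t))" by auto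
  have "\<exists>z>t. z < t + k \<and> Dx f (a, t + k) - Dx f (a, t) = (t + k - t) * B (a, z)"
    unfolding B_def by (rule MVT2) (use k a in \<open>auto intro!: dt[OF fx]\<close>)
  then obtain b where b: "t < b" "b < t + k" "?\<Delta> = k * (k * B (a, b))" using a by auto
  have "\<exists>z>t. z < t + k \<and> (f (x + k, t + k) - f (x, t + k)) - (f (x + k, t) - f (x, t))
      = (t + k - t) * (Dt f (x + k, z) - Dt f (x, z))"
    by (rule MVT2) (use k in \<open>auto intro!: DERIV_diff dt[OF f]\<close>)
  then obtain b' where b': "t < b'" "b' < t + k" "?\<Delta> = k * (Dt f (x + k, b') - Dt f (x, b'))"
    by (auto simp: algebra_simps)
  have "\<exists>z>x. z < x + k \<and> Dt f (x + k, b') - Dt f (x, b') = (x + k - x) * A (z, b')"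
    unfolding A_def by (rule MVT2) (use k b' in \<open>auto intro!: dx[OF ft]\<close>)
  then obtain a' where a': "x < a'" "a' < x + k" "?\<Delta> = k * (k * A (a', b'))" using b' by auto
  have "A (a', b') = B (a, b)" using a'(3) b(3) k by simp
  moreover have "\<bar>A p - A (a', b')\<bar> < e"
    using in_S'[of a' b'] a' b' by (auto simp: S'_def dist_real_def)
  moreover have "\<bar>B p - B (a, b)\<bar> < e"
    using in_S'[of a b] a b by (auto simp: S'_def dist_real_def)
  ultimately show False unfolding e_def by argo
qed

section \<open>Derivations of function algebras and their entrywise extension to matrices\<close>

definition mat_D :: "((real \<times> real \<Rightarrow> 'a) \<Rightarrow> real \<times> real \<Rightarrow> 'a) \<Rightarrow> (real \<times> real \<Rightarrow> 'a mat) \<Rightarrow> real \<times> real \<Rightarrow> 'a mat"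
  where "mat_D D M p = mat (dim_row (M p)) (dim_col (M p)) (\<lambda>rc. D (\<lambda>q. M q $$ rc) p)"

lemma mat_Dx_eq: "mat_Dx = mat_D Dx" and mat_Dt_eq: "mat_Dt = mat_D Dt"
  by (intro ext, simp add: mat_Dx_def mat_Dt_def mat_D_def)+

lemma mat_mult_index:
  "A \<in> carrier_mat n n \<Longrightarrow> B \<in> carrier_mat n n \<Longrightarrow> r < n \<Longrightarrow> c < n \<Longrightarrow>
    (A * B) $$ (r, c) = (\<Sum>k<n. A $$ (r, k) * B $$ (k, c))"
  by (auto simp: scalar_prod_def atLeast0LessThan)

lemma mat_add_index:
  "B \<in> carrier_mat n n \<Longrightarrow> r < n \<Longrightarrow> c < n \<Longrightarrow> (A + B) $$ (r, c) = A $$ (r, c) + B $$ (r, c)"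
  by auto

lemma mat_diff_index:
  "B \<in> carrier_mat n n \<Longrightarrow> r < n \<Longrightarrow> c < n \<Longrightarrow> (A - B) $$ (r, c) = A $$ (r, c) - B $$ (r, c)"
  by auto

text \<open>One set of rules for six derivations: x and t, each on real functions, on complex
  functions and on Laurent series with smooth coefficients. \<open>C\<close> is the class of
  admissible functions. Equality on S suffices throughout, since objects such as the series
  \<open>Y\<close> are determined nowhere else.\<close>

locale function_derivation =
  fixes S :: "(real \<times> real) set" and C :: "(real \<times> real \<Rightarrow> 'a::comm_ring_1) \<Rightarrow> bool"
    and D :: "(real \<times> real \<Rightarrow> 'a) \<Rightarrow> real \<times> real \<Rightarrow> 'a"
  assumes C_const: "C (\<lambda>_. k)"
    and C_add: "C f \<Longrightarrow> C g \<Longrightarrow> C (\<lambda>p. f p + g p)"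
    and C_uminus: "C f \<Longrightarrow> C (\<lambda>p. - f p)"
    and C_mult: "C f \<Longrightarrow> C g \<Longrightarrow> C (\<lambda>p. f p * g p)"
    and C_D: "C f \<Longrightarrow> C (D f)"
    and C_cong: "(\<And>p. p \<in> S \<Longrightarrow> f p = g p) \<Longrightarrow> C f \<Longrightarrow> C g"
    and D_cong: "(\<And>p. p \<in> S \<Longrightarrow> f p = g p) \<Longrightarrow> p \<in> S \<Longrightarrow> D f p = D g p"
    and D_const: "p \<in> S \<Longrightarrow> D (\<lambda>_. k) p = 0"
    and D_add: "p \<in> S \<Longrightarrow> C f \<Longrightarrow> C g \<Longrightarrow> D (\<lambda>p. f p + g p) p = D f p + D g p"
    and D_mult: "p \<in> S \<Longrightarrow> C f \<Longrightarrow> C g \<Longrightarrow> D (\<lambda>p. f p * g p) p = D f p * g p + f p * D g p"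
begin

lemma C_diff: "C f \<Longrightarrow> C g \<Longrightarrow> C (\<lambda>p. f p - g p)"
  using C_add[of f "\<lambda>p. - g p"] C_uminus[of g] by simp

lemma C_sum: "(\<And>i. i \<in> I \<Longrightarrow> C (f i)) \<Longrightarrow> C (\<lambda>p. \<Sum>i\<in>I. f i p)"
  by (induction I rule: infinite_finite_induct) (auto intro: C_const C_add)

lemma C_prod: "(\<And>i. i \<in> I \<Longrightarrow> C (f i)) \<Longrightarrow> C (\<lambda>p. \<Prod>i\<in>I. f i p)"
  by (induction I rule: infinite_finite_induct) (auto intro: C_const C_mult)

lemma D_uminus: "p \<in> S \<Longrightarrow> C f \<Longrightarrow> D (\<lambda>p. - f p) p = - D f p"
  using D_mult[of p "\<lambda>_. -1" f] C_const[of "-1"] D_const[of p "-1"] by simp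

lemma D_diff: "p \<in> S \<Longrightarrow> C f \<Longrightarrow> C g \<Longrightarrow> D (\<lambda>p. f p - g p) p = D f p - D g p"
  using D_add[of p f "\<lambda>p. - g p"] C_uminus[of g] D_uminus[of p g] by simp

lemma D_sum: "p \<in> S \<Longrightarrow> (\<And>i. i \<in> I \<Longrightarrow> C (f i)) \<Longrightarrow> D (\<lambda>p. \<Sum>i\<in>I. f i p) p = (\<Sum>i\<in>I. D (f i) p)"
  by (induction I rule: infinite_finite_induct) (auto simp: D_const D_add C_sum)

definition C_mat :: "nat \<Rightarrow> (real \<times> real \<Rightarrow> 'a mat) \<Rightarrow> bool"
  where "C_mat n M \<longleftrightarrow> (\<forall>p\<in>S. M p \<in> carrier_mat n n) \<and> (\<forall>r<n. \<forall>c<n. C (\<lambda>p. M p $$ (r, c)))"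

lemma C_matD: "C_mat n M \<Longrightarrow> p \<in> S \<Longrightarrow> M p \<in> carrier_mat n n"
  "C_mat n M \<Longrightarrow> r < n \<Longrightarrow> c < n \<Longrightarrow> C (\<lambda>p. M p $$ (r, c))"
  by (auto simp: C_mat_def)

lemma C_matI:
  "(\<And>p. p \<in> S \<Longrightarrow> M p \<in> carrier_mat n n) \<Longrightarrow> (\<And>r c. r < n \<Longrightarrow> c < n \<Longrightarrow> C (\<lambda>p. M p $$ (r, c))) \<Longrightarrow> C_mat n M"
  by (auto simp: C_mat_def)

lemma C_mat_cong:
  assumes "\<And>p. p \<in> S \<Longrightarrow> M p = N p" "C_mat n M"
  shows "C_mat n N"
  unfolding C_mat_def
proof safe
  fix r c assume "r < n" "c < n"
  with assms(2) have "C (\<lambda>p. M p $$ (r, c))" by (simp add: C_mat_def)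
  then show "C (\<lambda>p. N p $$ (r, c))" by (rule C_cong[rotated]) (simp add: assms(1))
qed (use assms in \<open>auto simp: C_mat_def simp flip: assms(1)\<close>)

lemma C_mat_const: "K \<in> carrier_mat n n \<Longrightarrow> C_mat n (\<lambda>_. K)"
  by (auto simp: C_mat_def intro: C_const)

lemma C_mat_add:
  assumes M: "C_mat n M" and N: "C_mat n N"
  shows "C_mat n (\<lambda>p. M p + N p)"
proof (rule C_matI)
  fix r c assume rc: "r < n" "c < n"
  show "C (\<lambda>p. (M p + N p) $$ (r, c))"
    by (rule C_cong[OF _ C_add[OF C_matD(2)[OF M rc] C_matD(2)[OF N rc]]])
      (simp add: mat_add_index[OF C_matD(1)[OF N] rc])
qed (use assms in \<open>auto simp: C_mat_def\<close>)

lemma C_mat_diff: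
  assumes M: "C_mat n M" and N: "C_mat n N"
  shows "C_mat n (\<lambda>p. M p - N p)"
proof (rule C_matI)
  fix r c assume rc: "r < n" "c < n"
  show "C (\<lambda>p. (M p - N p) $$ (r, c))"
    by (rule C_cong[OF _ C_diff[OF C_matD(2)[OF M rc] C_matD(2)[OF N rc]]])
      (simp add: mat_diff_index[OF C_matD(1)[OF N] rc])
qed (use assms in \<open>auto simp: C_mat_def intro: minus_carrier_mat\<close>)

lemma C_mat_mult:
  assumes M: "C_mat n M" and N: "C_mat n N"
  shows "C_mat n (\<lambda>p. M p * N p)"
proof (rule C_matI)
  fix r c assume rc: "r < n" "c < n"
  have "C (\<lambda>p. \<Sum>k<n. M p $$ (r, k) * N p $$ (k, c))"
    by (intro C_sum C_mult C_matD(2)[OF M] C_matD(2)[OF N] rc) auto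
  then show "C (\<lambda>p. (M p * N p) $$ (r, c))"
    by (rule C_cong[rotated]) (simp add: mat_mult_index[OF C_matD(1)[OF M] C_matD(1)[OF N] rc])
qed (use assms in \<open>auto simp: C_mat_def\<close>)

lemma C_mat_pow: "C_mat n M \<Longrightarrow> C_mat n (\<lambda>p. M p ^\<^sub>m k)"
proof (induction k)
  case 0
  have "C_mat n (\<lambda>p. 1\<^sub>m n)" by (rule C_mat_const) simp
  then show ?case by (rule C_mat_cong[rotated]) (use C_matD(1)[OF 0] in auto)
next
  case (Suc k)
  then show ?case using C_mat_mult[of n "\<lambda>p. M p ^\<^sub>m k" M] by simp
qed

lemma mat_D_index:
  "M p \<in> carrier_mat n n \<Longrightarrow> r < n \<Longrightarrow> c < n \<Longrightarrow> mat_D D M p $$ (r, c) = D (\<lambda>q. M q $$ (r, c)) p"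
  by (auto simp: mat_D_def)

lemma C_mat_D:
  assumes "C_mat n M"
  shows "C_mat n (mat_D D M)"
proof (rule C_matI)
  fix r c assume rc: "r < n" "c < n"
  show "C (\<lambda>p. mat_D D M p $$ (r, c))"
    by (rule C_cong[OF _ C_D[OF C_matD(2)[OF assms rc]]])
      (simp add: mat_D_index[OF C_matD(1)[OF assms] rc])
qed (use assms in \<open>auto simp: C_mat_def mat_D_def\<close>)

lemma mat_D_carrier [simp]: "M p \<in> carrier_mat n n \<Longrightarrow> mat_D D M p \<in> carrier_mat n n"
  by (auto simp: mat_D_def)

lemma mat_D_cong:
  assumes "p \<in> S" "\<And>q. q \<in> S \<Longrightarrow> M q = N q"
  shows "mat_D D M p = mat_D D N p"
  unfolding mat_D_def using assms(2)[OF assms(1)]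
  by (auto intro!: eq_matI D_cong assms(1) simp: assms(2))

lemma mat_D_const: "p \<in> S \<Longrightarrow> K \<in> carrier_mat n n \<Longrightarrow> mat_D D (\<lambda>_. K) p = 0\<^sub>m n n"
  by (auto simp: mat_D_def D_const)

lemma mat_D_add:
  assumes p: "p \<in> S" and M: "C_mat n M" and N: "C_mat n N"
  shows "mat_D D (\<lambda>q. M q + N q) p = mat_D D M p + mat_D D N p"
proof (rule eq_matI)
  note c = C_matD(1)[OF M] C_matD(1)[OF N]
  note [simp] = c[OF p]
  fix r c assume "r < dim_row (mat_D D M p + mat_D D N p)" "c < dim_col (mat_D D M p + mat_D D N p)"
  then have rc: "r < n" "c < n" using c[OF p] by (auto simp: mat_D_def)
  have "mat_D D (\<lambda>q. M q + N q) p $$ (r, c) = D (\<lambda>q. (M q + N q) $$ (r, c)) p"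
    using rc by (intro mat_D_index[of _ _ n]) auto
  also have "\<dots> = D (\<lambda>q. M q $$ (r, c) + N q $$ (r, c)) p"
    by (rule D_cong[OF _ p]) (rule mat_add_index[OF C_matD(1)[OF N] rc])
  also have "\<dots> = D (\<lambda>q. M q $$ (r, c)) p + D (\<lambda>q. N q $$ (r, c)) p"
    by (intro D_add p C_matD(2)[OF M] C_matD(2)[OF N] rc)
  finally show "mat_D D (\<lambda>q. M q + N q) p $$ (r, c) = (mat_D D M p + mat_D D N p) $$ (r, c)"
    using rc c[OF p] mat_add_index[of "mat_D D N p" n r c "mat_D D M p"] by (simp add: mat_D_index[of _ _ n])
qed (use C_matD(1)[OF M p] C_matD(1)[OF N p] in \<open>auto simp: mat_D_def\<close>)

lemma mat_D_mult:
  assumes p: "p \<in> S" and M: "C_mat n M" and N: "C_mat n N"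
  shows "mat_D D (\<lambda>q. M q * N q) p = mat_D D M p * N p + M p * mat_D D N p"
proof (rule eq_matI)
  note cM = C_matD(1)[OF M p] and cN = C_matD(1)[OF N p]
  note [simp] = cM cN
  fix r c assume "r < dim_row (mat_D D M p * N p + M p * mat_D D N p)"
    "c < dim_col (mat_D D M p * N p + M p * mat_D D N p)"
  then have rc: "r < n" "c < n" using cM cN by (auto simp: mat_D_def)
  have "mat_D D (\<lambda>q. M q * N q) p $$ (r, c) = D (\<lambda>q. (M q * N q) $$ (r, c)) p"
    by (rule mat_D_index[where n = n]) (use rc mult_carrier_mat[OF cM cN] in auto)
  also have "\<dots> = D (\<lambda>q. \<Sum>k<n. M q $$ (r, k) * N q $$ (k, c)) p"
    by (rule D_cong[OF _ p]) (rule mat_mult_index[OF C_matD(1)[OF M] C_matD(1)[OF N] rc])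
  also have "\<dots> = (\<Sum>k<n. D (\<lambda>q. M q $$ (r, k) * N q $$ (k, c)) p)"
    by (intro D_sum p C_mult C_matD(2)[OF M] C_matD(2)[OF N] rc) auto
  also have "\<dots> = (\<Sum>k<n. mat_D D M p $$ (r, k) * N p $$ (k, c) + M p $$ (r, k) * mat_D D N p $$ (k, c))"
    using rc by (intro sum.cong refl, subst D_mult)
      (auto simp: p mat_D_index[where M = M and n = n] mat_D_index[where M = N and n = n] intro: C_matD(2)[OF M] C_matD(2)[OF N])
  also have "\<dots> = (mat_D D M p * N p + M p * mat_D D N p) $$ (r, c)"
    using rc mat_mult_index[of "mat_D D M p" n "N p" r c] mat_mult_index[of "M p" n "mat_D D N p" r c]
      mat_add_index[OF mult_carrier_mat[OF cM mat_D_carrier[of N p n, OF cN]] rc, of "mat_D D M p * N p"]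
    by (simp add: sum.distrib del: index_mult_mat index_add_mat)
  finally show "mat_D D (\<lambda>q. M q * N q) p $$ (r, c) = \<dots>" .
qed (use C_matD(1)[OF M p] C_matD(1)[OF N p] in \<open>auto simp: mat_D_def\<close>)

end

lemma smooth_on_locale:
  assumes "open S"
  shows "function_derivation S (smooth_on S :: (real \<times> real \<Rightarrow> 'a::real_normed_field) \<Rightarrow> bool) Dx"
    and "function_derivation S (smooth_on S :: (real \<times> real \<Rightarrow> 'a::real_normed_field) \<Rightarrow> bool) Dt"
proof -
  note c = smooth_on_const smooth_on_add[OF assms] smooth_on_uminus[OF assms] smooth_on_mult[OF assms]
    smooth_on_Dx[OF assms] smooth_on_Dt[OF assms] Dx_cong_open[OF assms] Dt_cong_open[OF assms]
  have cong: "smooth_on S f \<Longrightarrow> smooth_on S g" if "\<And>p. p \<in> S \<Longrightarrow> f p = g p" for f g :: "real \<times> real \<Rightarrow> 'a"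
    using smooth_on_cong[OF assms, of f g] that by blast
  have d: "Dx f p = x" if "((\<lambda>s. f (s, snd p)) has_vector_derivative x) (at (fst p))"
    for f :: "real \<times> real \<Rightarrow> 'a" and p x
    unfolding Dx_def by (rule vector_derivative_at[OF that])
  have d': "Dt f p = x" if "((\<lambda>s. f (fst p, s)) has_vector_derivative x) (at (snd p))"
    for f :: "real \<times> real \<Rightarrow> 'a" and p x
    unfolding Dt_def by (rule vector_derivative_at[OF that])
  note p = smooth_on_partials(1) smooth_on_partials(2)
  show "function_derivation S (smooth_on S :: (real \<times> real \<Rightarrow> 'a) \<Rightarrow> bool) Dx"
  proof (unfold_locales, goal_cases)
    case (6 f g)
    then show ?case using cong by blast
  next
    case (7 f g p)
    show ?case by (rule Dx_cong_open[OF assms 7(2,1)])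
  next
    case (9 p f g)
    then show ?case by (intro d has_vector_derivative_add) (auto dest: p)
  next
    case (10 p f g)
    then show ?case
      using has_vector_derivative_mult[OF p(1)[OF 10(2,1)] p(1)[OF 10(3,1)]]
      by (intro d) (simp add: add.commute)
  qed (auto intro: c cong d)
  show "function_derivation S (smooth_on S :: (real \<times> real \<Rightarrow> 'a) \<Rightarrow> bool) Dt"
  proof (unfold_locales, goal_cases)
    case (6 f g)
    then show ?case using cong by blast
  next
    case (7 f g p)
    show ?case by (rule Dt_cong_open[OF assms 7(2,1)])
  next
    case (9 p f g)
    then show ?case by (intro d' has_vector_derivative_add) (auto dest: p)
  next
    case (10 p f g)
    then show ?case
      using has_vector_derivative_mult[OF p(2)[OF 10(2,1)] p(2)[OF 10(3,1)]]
      by (intro d') (simp add: add.commute)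
  qed (auto intro: c cong d')
qed

section \<open>Laurent series with smooth coefficients\<close>

text \<open>The lower bound N is uniform in the point. A coefficient of a product is then a finite
  sum over a range that does not move with the point, hence smooth.\<close>

definition fls_smooth_on :: "(real \<times> real) set \<Rightarrow> (real \<times> real \<Rightarrow> real fls) \<Rightarrow> bool"
  where "fls_smooth_on S f \<longleftrightarrow>
    (\<exists>N. \<forall>p\<in>S. \<forall>i<N. fls_nth (f p) i = 0) \<and> (\<forall>i. smooth_on S (\<lambda>p. fls_nth (f p) i))"

text \<open>The coefficientwise derivative. For series in \<open>fls_smooth_on\<close> the use of
  \<open>Abs_fls\<close> is legitimate: their coefficients vanish below a common index, and so do
  the derivatives.\<close>

definition fls_D :: "((real \<times> real \<Rightarrow> real) \<Rightarrow> real \<times> real \<Rightarrow> real) \<Rightarrow> (real \<times> real \<Rightarrow> real fls) \<Rightarrow> real \<times> real \<Rightarrow> real fls"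
  where "fls_D D f p = Abs_fls (\<lambda>i. D (\<lambda>q. fls_nth (f q) i) p)"

text \<open>Replaces the subdegrees, which may jump from point to point, by arbitrary lower bounds,
  so that one summation range serves all points.\<close>

lemma fls_times_nth_bounded:
  fixes f g :: "'a::comm_ring_1 fls"
  assumes "\<And>i. i < a \<Longrightarrow> fls_nth f i = 0" "\<And>i. i < b \<Longrightarrow> fls_nth g i = 0"
  shows "fls_nth (f * g) m = (\<Sum>i=a..m - b. fls_nth f i * fls_nth g (m - i))"
proof (cases "f = 0 \<or> g = 0")
  case False
  then have ge: "fls_subdegree f \<ge> a" "fls_subdegree g \<ge> b"
    using assms nth_fls_subdegree_nonzero by (meson not_le_imp_less)+
  have "fls_nth (f * g) m = (\<Sum>i=fls_subdegree f..m - fls_subdegree g. fls_nth f i * fls_nth g (m - i))"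
    by (rule fls_times_nth(2))
  also have "\<dots> = (\<Sum>i=a..m - b. fls_nth f i * fls_nth g (m - i))"
    by (rule sum.mono_neutral_left) (use ge in auto)
  finally show ?thesis .
qed auto

lemma fls_locale:
  assumes "function_derivation S (smooth_on S) D"
  shows "function_derivation S (fls_smooth_on S) (fls_D D)"
    and "fls_smooth_on S f \<Longrightarrow> p \<in> S \<Longrightarrow> fls_nth (fls_D D f p) i = D (\<lambda>q. fls_nth (f q) i) p"
proof -
  interpret function_derivation S "smooth_on S :: (real \<times> real \<Rightarrow> real) \<Rightarrow> bool" D by fact
  have nthD: "fls_nth (fls_D D f p) i = D (\<lambda>q. fls_nth (f q) i) p"
    if sm: "fls_smooth_on S f" and p: "p \<in> S" for f p i
  proof -
    obtain N where N: "\<forall>p\<in>S. \<forall>i<N. fls_nth (f p) i = 0"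
      using sm unfolding fls_smooth_on_def by blast
    have "D (\<lambda>q. fls_nth (f q) i) p = 0" if "i < N" for i
      using D_cong[of "\<lambda>q. fls_nth (f q) i" "\<lambda>_. 0", OF _ p] N that D_const[OF p, of 0] by simp
    then show ?thesis unfolding fls_D_def
      using nth_Abs_fls_lower_bound[of N "\<lambda>i. D (\<lambda>q. fls_nth (f q) i) p" i] by simp
  qed
  then show "fls_smooth_on S f \<Longrightarrow> p \<in> S \<Longrightarrow> fls_nth (fls_D D f p) i = D (\<lambda>q. fls_nth (f q) i) p" .
  have cong: "fls_smooth_on S g" if "\<And>p. p \<in> S \<Longrightarrow> f p = g p" "fls_smooth_on S f" for f g
    unfolding fls_smooth_on_def
  proof safe
    show "\<exists>N. \<forall>p\<in>S. \<forall>i<N. fls_nth (g p) i = 0"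
      using that by (simp add: fls_smooth_on_def)
    show "smooth_on S (\<lambda>p. fls_nth (g p) i)" for i
      by (rule C_cong[of "\<lambda>p. fls_nth (f p) i"]) (use that in \<open>auto simp: fls_smooth_on_def\<close>)
  qed
  have add: "fls_smooth_on S (\<lambda>p. f p + g p)" if f: "fls_smooth_on S f" and g: "fls_smooth_on S g" for f g
  proof -
    obtain a where a: "\<forall>p\<in>S. \<forall>i<a. fls_nth (f p) i = 0" using f by (auto simp: fls_smooth_on_def)
    obtain b where b: "\<forall>p\<in>S. \<forall>i<b. fls_nth (g p) i = 0" using g by (auto simp: fls_smooth_on_def)
    have "\<exists>N. \<forall>p\<in>S. \<forall>i<N. fls_nth (f p + g p) i = 0"
      using a b by (intro exI[of _ "min a b"]) simp
    then show ?thesis using f g unfolding fls_smooth_on_def by (simp add: C_add)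
  qed
  \<comment> \<open>The bounds a and b are part of the conclusion because the product rule expands
    three products, of f and g and of each with the derivative of the other, over the same
    range.\<close>
  have mult: "\<exists>a b. (\<forall>p\<in>S. \<forall>i<a. fls_nth (f p) i = 0) \<and> (\<forall>p\<in>S. \<forall>i<b. fls_nth (g p) i = 0) \<and>
      (\<forall>p\<in>S. \<forall>m. fls_nth (f p * g p) m = (\<Sum>i=a..m - b. fls_nth (f p) i * fls_nth (g p) (m - i)))"
    if f: "fls_smooth_on S f" and g: "fls_smooth_on S g" for f g
  proof -
    obtain a where a: "\<forall>p\<in>S. \<forall>i<a. fls_nth (f p) i = 0" using f by (auto simp: fls_smooth_on_def)
    obtain b where b: "\<forall>p\<in>S. \<forall>i<b. fls_nth (g p) i = 0" using g by (auto simp: fls_smooth_on_def)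
    have "\<forall>p\<in>S. \<forall>m. fls_nth (f p * g p) m = (\<Sum>i=a..m - b. fls_nth (f p) i * fls_nth (g p) (m - i))"
      using a b by (auto intro: fls_times_nth_bounded)
    with a b show ?thesis by blast
  qed
  show "function_derivation S (fls_smooth_on S) (fls_D D)"
  proof (unfold_locales, goal_cases)
    case (1 k)
    then show ?case unfolding fls_smooth_on_def
      by (auto intro: C_const exI[of _ "fls_subdegree k"])
  next
    case (2 f g)
    then show ?case by (rule add)
  next
    case (3 f)
    then show ?case unfolding fls_smooth_on_def by (auto intro: C_uminus)
  next
    case (4 f g)
    obtain a b where ab: "\<forall>p\<in>S. \<forall>i<a. fls_nth (f p) i = 0" "\<forall>p\<in>S. \<forall>i<b. fls_nth (g p) i = 0"
      "\<forall>p\<in>S. \<forall>m. fls_nth (f p * g p) m = (\<Sum>i=a..m - b. fls_nth (f p) i * fls_nth (g p) (m - i))"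
      using mult[OF 4] by blast
    show ?case unfolding fls_smooth_on_def
    proof safe
      show "\<exists>N. \<forall>p\<in>S. \<forall>i<N. fls_nth (f p * g p) i = 0"
        using ab(3) by (intro exI[of _ "a + b"]) simp
      fix m
      have "smooth_on S (\<lambda>p. \<Sum>i=a..m - b. fls_nth (f p) i * fls_nth (g p) (m - i))"
        using 4 by (intro C_sum C_mult) (auto simp: fls_smooth_on_def)
      then show "smooth_on S (\<lambda>p. fls_nth (f p * g p) m)"
        by (rule C_cong[rotated]) (simp add: ab(3))
    qed
  next
    case (5 f)
    then obtain N where N: "\<forall>p\<in>S. \<forall>i<N. fls_nth (f p) i = 0"
      unfolding fls_smooth_on_def by blast
    have "fls_nth (fls_D D f p) i = 0" if "p \<in> S" "i < N" for p i
      using nthD[OF 5 that(1), of i] D_cong[of "\<lambda>q. fls_nth (f q) i" "\<lambda>_. 0", OF _ that(1)] N that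
        D_const[OF that(1), of 0] by simp
    moreover have "smooth_on S (\<lambda>p. fls_nth (fls_D D f p) i)" for i
      by (rule C_cong[OF _ C_D[of "\<lambda>q. fls_nth (f q) i"]])
       (use nthD[OF 5] 5 in \<open>auto simp: fls_smooth_on_def\<close>)
    ultimately show ?case unfolding fls_smooth_on_def by blast
  next
    case (6 f g)
    then show ?case using cong by blast
  next
    case (7 f g p)
    have "D (\<lambda>q. fls_nth (f q) i) p = D (\<lambda>q. fls_nth (g q) i) p" for i
      by (rule D_cong) (use 7 in auto)
    then show ?case unfolding fls_D_def by simp
  next
    case (8 p k)
    then show ?case unfolding fls_D_def by (simp add: D_const zero_fls_def)
  next
    case (9 p f g)
    have fg: "fls_smooth_on S (\<lambda>p. f p + g p)"
      by (rule add[OF 9(2,3)])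
    show ?case
      by (rule fls_eqI) (use 9 in \<open>simp add: nthD[OF fg] nthD D_add fls_smooth_on_def\<close>)
  next
    case (10 p f g)
    obtain a b where ab: "\<forall>p\<in>S. \<forall>i<a. fls_nth (f p) i = 0" "\<forall>p\<in>S. \<forall>i<b. fls_nth (g p) i = 0"
      "\<forall>p\<in>S. \<forall>m. fls_nth (f p * g p) m = (\<Sum>i=a..m - b. fls_nth (f p) i * fls_nth (g p) (m - i))"
      using mult[OF 10(2,3)] by blast
    have sm: "smooth_on S (\<lambda>p. fls_nth (f p) i)" "smooth_on S (\<lambda>p. fls_nth (g p) i)" for i
      using 10 by (auto simp: fls_smooth_on_def)
    have fg: "fls_smooth_on S (\<lambda>p. f p * g p)"
      unfolding fls_smooth_on_def
    proof safe
      show "\<exists>N. \<forall>p\<in>S. \<forall>i<N. fls_nth (f p * g p) i = 0"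
        using ab(3) by (intro exI[of _ "a + b"]) simp
      fix m
      have "smooth_on S (\<lambda>p. \<Sum>i=a..m - b. fls_nth (f p) i * fls_nth (g p) (m - i))"
        by (intro C_sum C_mult sm)
      then show "smooth_on S (\<lambda>p. fls_nth (f p * g p) m)"
        by (rule C_cong[rotated]) (simp add: ab(3))
    qed
    have zero: "fls_nth (fls_D D h p) i = 0" if "fls_smooth_on S h" "\<forall>p\<in>S. \<forall>i<N. fls_nth (h p) i = 0" "i < N" for N i h
      using nthD[OF that(1) 10(1), of i] D_cong[of "\<lambda>q. fls_nth (h q) i" "\<lambda>_. 0", OF _ 10(1)] that
        D_const[OF 10(1), of 0] by simp
    show ?case
    proof (rule fls_eqI)
      fix m
      have "fls_nth (fls_D D (\<lambda>p. f p * g p) p) m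
          = D (\<lambda>p. \<Sum>i=a..m - b. fls_nth (f p) i * fls_nth (g p) (m - i)) p"
        unfolding nthD[OF fg 10(1)] by (rule D_cong) (use ab(3) 10(1) in auto)
      also have "\<dots> = (\<Sum>i=a..m - b. D (\<lambda>p. fls_nth (f p) i * fls_nth (g p) (m - i)) p)"
        by (intro D_sum 10(1) C_mult sm)
      also have "\<dots> = (\<Sum>i=a..m - b. fls_nth (fls_D D f p) i * fls_nth (g p) (m - i)
           + fls_nth (f p) i * fls_nth (fls_D D g p) (m - i))"
        by (intro sum.cong refl, subst D_mult) (auto simp: 10 sm nthD)
      also have "\<dots> = fls_nth (fls_D D f p * g p) m + fls_nth (f p * fls_D D g p) m"
        using fls_times_nth_bounded[of a "fls_D D f p" b "g p" m] fls_times_nth_bounded[of a "f p" b "fls_D D g p" m]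
          zero[OF 10(2) ab(1)] zero[OF 10(3) ab(2)] ab(1,2) 10(1) by (simp add: sum.distrib)
      finally show "fls_nth (fls_D D (\<lambda>p. f p * g p) p) m = fls_nth (fls_D D f p * g p + f p * fls_D D g p) m"
        by simp
    qed
  qed
qed

section \<open>Square matrices\<close>

lemma fls_X_inv_times_nth: "fls_nth (fls_X_inv * f) i = fls_nth f (i + 1)" for f :: "'a::comm_ring_1 fls"
  by (simp add: fls_X_inv_times_conv_shift)

lemma fls_X_times_nth': "fls_nth (fls_X * f) i = fls_nth f (i - 1)" for f :: "'a::comm_ring_1 fls"
  by (simp add: fls_X_times_conv_shift)

locale square_mat =
  fixes n :: nat
begin

lemma carrier_closed [simp]:
  fixes A B :: "'a::comm_ring_1 mat"
  shows "A \<in> carrier_mat n n \<Longrightarrow> B \<in> carrier_mat n n \<Longrightarrow> A * B \<in> carrier_mat n n"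
    and "B \<in> carrier_mat n n \<Longrightarrow> A + B \<in> carrier_mat n n"
    and "B \<in> carrier_mat n n \<Longrightarrow> A - B \<in> carrier_mat n n"
    and "A \<in> carrier_mat n n \<Longrightarrow> - A \<in> carrier_mat n n"
    and "A \<in> carrier_mat n n \<Longrightarrow> k \<cdot>\<^sub>m A \<in> carrier_mat n n"
    and "A \<in> carrier_mat n n \<Longrightarrow> map_mat f A \<in> carrier_mat n n"
    and "A \<in> carrier_mat n n \<Longrightarrow> A ^\<^sub>m m \<in> carrier_mat n n"
  by auto

lemma dims [simp]: "A \<in> carrier_mat n n \<Longrightarrow> dim_row A = n" "A \<in> carrier_mat n n \<Longrightarrow> dim_col A = n"
  by auto

lemma assoc: "A \<in> carrier_mat n n \<Longrightarrow> B \<in> carrier_mat n n \<Longrightarrow> C \<in> carrier_mat n n \<Longrightarrow>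
    A * B * C = A * (B * C)" for A B C :: "'a::comm_ring_1 mat"
  by (rule assoc_mult_mat)

lemma ring_distribs:
  fixes A B C :: "'a::comm_ring_1 mat"
  assumes "A \<in> carrier_mat n n" "B \<in> carrier_mat n n" "C \<in> carrier_mat n n"
  shows "(A + B) * C = A * C + B * C" "A * (B + C) = A * B + A * C"
    "(A - B) * C = A * C - B * C" "A * (B - C) = A * B - A * C"
  using assms by (auto intro: add_mult_distrib_mat mult_add_distrib_mat minus_mult_distrib_mat mult_minus_distrib_mat)

lemma smult_mult:
  fixes A B :: "'a::comm_ring_1 mat"
  assumes "A \<in> carrier_mat n n" "B \<in> carrier_mat n n"
  shows "(k \<cdot>\<^sub>m A) * B = k \<cdot>\<^sub>m (A * B)" "A * (k \<cdot>\<^sub>m B) = k \<cdot>\<^sub>m (A * B)"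
  using assms by (auto intro: mult_smult_assoc_mat mult_smult_distrib)

lemma one_zero [simp]:
  fixes A :: "'a::comm_ring_1 mat"
  assumes "A \<in> carrier_mat n n"
  shows "1\<^sub>m n * A = A" "A * 1\<^sub>m n = A" "0\<^sub>m n n * A = 0\<^sub>m n n" "A * 0\<^sub>m n n = 0\<^sub>m n n"
    "A + 0\<^sub>m n n = A" "0\<^sub>m n n + A = A" "A - 0\<^sub>m n n = A" "0\<^sub>m n n - A = - A" "A - A = 0\<^sub>m n n"
        apply (rule left_mult_one_mat[OF assms])
       apply (rule right_mult_one_mat[OF assms])
      apply (rule left_mult_zero_mat[OF assms])
     apply (rule right_mult_zero_mat[OF assms])
    apply (rule right_add_zero_mat[OF assms])
   apply (rule left_add_zero_mat[OF assms])
  using assms by (intro eq_matI; simp)+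

lemma index:
  fixes A B :: "'a::comm_ring_1 mat"
  assumes "B \<in> carrier_mat n n" "r < n" "c < n"
  shows "(A + B) $$ (r, c) = A $$ (r, c) + B $$ (r, c)" "(A - B) $$ (r, c) = A $$ (r, c) - B $$ (r, c)"
    "(- B) $$ (r, c) = - B $$ (r, c)" "(k \<cdot>\<^sub>m B) $$ (r, c) = k * B $$ (r, c)"
    "map_mat f B $$ (r, c) = f (B $$ (r, c))"
  using assms by auto

lemma mult_index:
  fixes A B :: "'a::comm_ring_1 mat"
  assumes "A \<in> carrier_mat n n" "B \<in> carrier_mat n n" "r < n" "c < n"
  shows "(A * B) $$ (r, c) = (\<Sum>k<n. A $$ (r, k) * B $$ (k, c))"
  by (rule mat_mult_index[OF assms])

lemma eqI:
  assumes "A \<in> carrier_mat n n" "B \<in> carrier_mat n n" "\<And>r c. r < n \<Longrightarrow> c < n \<Longrightarrow> A $$ (r, c) = B $$ (r, c)"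
  shows "A = B"
  by (rule eq_matI) (use assms in auto)

lemma right_inverse_imp_left:
  fixes A B :: "'a::field mat"
  shows "A \<in> carrier_mat n n \<Longrightarrow> B \<in> carrier_mat n n \<Longrightarrow> A * B = 1\<^sub>m n \<Longrightarrow> B * A = 1\<^sub>m n"
  by (rule mat_mult_left_right_inverse)

text \<open>Makes the trace invariant under conjugation, which gives the vanishing trace of the
  transformed \<open>Y\<close>.\<close>

lemma trace_mult_comm:
  fixes A B :: "'a::comm_ring_1 mat"
  assumes "A \<in> carrier_mat n n" "B \<in> carrier_mat n n"
  shows "(\<Sum>r<n. (A * B) $$ (r, r)) = (\<Sum>r<n. (B * A) $$ (r, r))"
proof -
  have "(\<Sum>r<n. (A * B) $$ (r, r)) = (\<Sum>r<n. \<Sum>k<n. A $$ (r, k) * B $$ (k, r))"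
    by (intro sum.cong refl mult_index) (use assms in auto)
  also have "\<dots> = (\<Sum>k<n. \<Sum>r<n. B $$ (k, r) * A $$ (r, k))"
    by (subst sum.swap) (simp add: mult.commute)
  also have "\<dots> = (\<Sum>r<n. (B * A) $$ (r, r))"
    by (intro sum.cong refl mult_index[symmetric]) (use assms in auto)
  finally show ?thesis .
qed

lemma conj_pow:
  fixes F K Y :: "'a::comm_ring_1 mat"
  assumes c: "F \<in> carrier_mat n n" "K \<in> carrier_mat n n" "Y \<in> carrier_mat n n"
    and FK: "F * K = 1\<^sub>m n" and KF: "K * F = 1\<^sub>m n"
  shows "(F * Y * K) ^\<^sub>m k = F * Y ^\<^sub>m k * K"
proof (induction k)
  case 0
  then show ?case using c FK by simp
next
  case (Suc k)
  have KF': "K * (F * X) = X" if "X \<in> carrier_mat n n" for X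
    using that c KF assoc[of K F X] by simp
  have "(F * Y * K) ^\<^sub>m Suc k = F * Y ^\<^sub>m k * K * (F * Y * K)" using Suc by simp
  also have "\<dots> = F * (Y ^\<^sub>m k * Y) * K" using c by (simp add: assoc KF')
  finally show ?case by simp
qed

section \<open>Coefficients of matrices of Laurent series\<close>

lemma lam_coeff_carrier [simp]: "M \<in> carrier_mat n n \<Longrightarrow> lam_coeff M i \<in> carrier_mat n n"
  by (simp add: lam_coeff_def)

lemma lam_coeff_index: "M \<in> carrier_mat n n \<Longrightarrow> r < n \<Longrightarrow> c < n \<Longrightarrow> lam_coeff M i $$ (r, c) = fls_nth (M $$ (r, c)) (- i)"
  by (auto simp: lam_coeff_def)

lemma lam_coeff_eqI:
  assumes c: "M \<in> carrier_mat n n" "N \<in> carrier_mat n n" and eq: "\<And>i. lam_coeff M i = lam_coeff N i"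
  shows "M = N"
proof (rule eqI[OF c], rule fls_eqI)
  fix r c i assume "r < n" "c < n"
  then show "fls_nth (M $$ (r, c)) i = fls_nth (N $$ (r, c)) i"
    using arg_cong[OF eq[of "- i"], of "\<lambda>X. X $$ (r, c)"] assms(1,2) by (simp add: lam_coeff_index)
qed

lemma lam_coeff_lin:
  assumes "M \<in> carrier_mat n n" "N \<in> carrier_mat n n"
  shows "lam_coeff (M + N) i = lam_coeff M i + lam_coeff N i"
    "lam_coeff (M - N) i = lam_coeff M i - lam_coeff N i"
    "lam_coeff (- M) i = - lam_coeff M i"
    "lam_coeff (fls_X_inv \<cdot>\<^sub>m M) i = lam_coeff M (i - 1)"
    "lam_coeff (fls_X \<cdot>\<^sub>m M) i = lam_coeff M (i + 1)"
  using assms by (auto intro!: eqI simp: lam_coeff_def fls_X_inv_times_nth fls_X_times_nth')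

lemma lam_coeff_const:
  "A \<in> carrier_mat n n \<Longrightarrow> lam_coeff (map_mat fls_const A) i = (if i = 0 then A else 0\<^sub>m n n)"
  by (auto intro!: eqI simp: lam_coeff_def)

lemma fls_nth_sum: "fls_nth (\<Sum>i\<in>I. f i) m = (\<Sum>i\<in>I. fls_nth (f i) m)"
  by (induction I rule: infinite_finite_induct) auto

lemma lam_coeff_const_mult:
  assumes "A \<in> carrier_mat n n" "M \<in> carrier_mat n n"
  shows "lam_coeff (map_mat fls_const A * M) i = A * lam_coeff M i"
    "lam_coeff (M * map_mat fls_const A) i = lam_coeff M i * A"
  by (rule eqI; use assms in \<open>simp add: lam_coeff_index mult_index fls_nth_sum index del: index_mult_mat\<close>)+

lemma const_add:
  fixes A B :: "real mat"
  assumes "A \<in> carrier_mat n n" "B \<in> carrier_mat n n"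
  shows "map_mat fls_const (A + B) = map_mat fls_const A + map_mat fls_const B"
    "map_mat fls_const (A - B) = map_mat fls_const A - map_mat fls_const B"
  by (rule lam_coeff_eqI; use assms in \<open>simp add: lam_coeff_const lam_coeff_lin\<close>)+

lemma elem_carrier [simp]: "elem_mat n i k \<in> carrier_mat n n" "b_mat n \<in> carrier_mat n n"
  "J_mat n l \<in> carrier_mat n n" "u_mat n a \<in> carrier_mat n n"
  by (auto simp: elem_mat_def b_mat_def J_mat_def u_mat_def)

lemma J_mat_fls: "J_mat n fls_X_inv = fls_X_inv \<cdot>\<^sub>m map_mat fls_const (elem_mat n 1 n) + map_mat fls_const (b_mat n)"
  by (rule eqI) (auto simp: J_mat_def elem_mat_def b_mat_def)

end

locale smooth_fls_mat = square_mat n for n +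
  fixes S :: "(real \<times> real) set"
  assumes open_S: "open S"
begin

sublocale x: function_derivation S "smooth_on S :: (real \<times> real \<Rightarrow> real) \<Rightarrow> bool" Dx
  by (rule smooth_on_locale[OF open_S])
sublocale t: function_derivation S "smooth_on S :: (real \<times> real \<Rightarrow> real) \<Rightarrow> bool" Dt
  by (rule smooth_on_locale[OF open_S])
sublocale fx: function_derivation S "fls_smooth_on S" "fls_D Dx"
  by (rule fls_locale[OF x.function_derivation_axioms])
sublocale ft: function_derivation S "fls_smooth_on S" "fls_D Dt"
  by (rule fls_locale[OF t.function_derivation_axioms])

lemma x_C_mat_iff: "x.C_mat n M \<longleftrightarrow> smooth_mat_on n S M" "t.C_mat n M \<longleftrightarrow> smooth_mat_on n S M"
  unfolding x.C_mat_def t.C_mat_def smooth_mat_on_def by auto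

lemma fls_C_matD: "fx.C_mat n M \<Longrightarrow> smooth_mat_on n S (\<lambda>p. lam_coeff (M p) i)"
  unfolding x_C_mat_iff[symmetric]
proof (rule x.C_matI)
  fix r c assume M: "fx.C_mat n M" and rc: "r < n" "c < n"
  have "smooth_on S (\<lambda>p. fls_nth (M p $$ (r, c)) (- i))"
    using fx.C_matD(2)[OF M rc] by (simp add: fls_smooth_on_def)
  then show "smooth_on S (\<lambda>p. lam_coeff (M p) i $$ (r, c))"
    by (rule x.C_cong[rotated]) (simp add: lam_coeff_index[OF fx.C_matD(1)[OF M] rc])
qed (simp add: fx.C_matD)

lemma fls_C_matI:
  assumes "\<And>i. smooth_mat_on n S (\<lambda>p. lam_coeff (M p) i)"
    and z: "\<And>p i. p \<in> S \<Longrightarrow> i > N \<Longrightarrow> lam_coeff (M p) i = 0\<^sub>m n n"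
    and M: "\<And>p. p \<in> S \<Longrightarrow> M p \<in> carrier_mat n n"
  shows "fx.C_mat n M"
proof (rule fx.C_matI)
  fix r c assume rc: "r < n" "c < n"
  have sm: "smooth_on S (\<lambda>p. fls_nth (M p $$ (r, c)) i)" for i
  proof (rule x.C_cong[of "\<lambda>p. lam_coeff (M p) (- i) $$ (r, c)"])
    show "smooth_on S (\<lambda>p. lam_coeff (M p) (- i) $$ (r, c))"
      using assms(1)[of "- i"] rc by (simp add: smooth_mat_on_def)
  qed (simp add: lam_coeff_index[OF M rc])
  have "fls_nth (M p $$ (r, c)) i = 0" if "p \<in> S" "i < - N" for p i
    using arg_cong[OF z[of p "- i"], of "\<lambda>X. X $$ (r, c)"] that rc by (simp add: lam_coeff_index[OF M rc])
  then show "fls_smooth_on S (\<lambda>p. M p $$ (r, c))"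
    unfolding fls_smooth_on_def using sm by blast
qed (rule M)

lemma const_C_mat:
  assumes "smooth_mat_on n S A"
  shows "fx.C_mat n (\<lambda>p. map_mat fls_const (A p))"
proof (rule fls_C_matI[where N = 0])
  have c: "A p \<in> carrier_mat n n" if "p \<in> S" for p using assms that by (simp add: smooth_mat_on_def)
  then show "map_mat fls_const (A p) \<in> carrier_mat n n" if "p \<in> S" for p using that by simp
  have 0: "smooth_mat_on n S (\<lambda>p. 0\<^sub>m n n)" by (auto simp: smooth_mat_on_def intro: smooth_on_const)
  show "smooth_mat_on n S (\<lambda>p. lam_coeff (map_mat fls_const (A p)) i)" for i
    unfolding x_C_mat_iff[symmetric]
    by (rule x.C_mat_cong[of "\<lambda>p. if i = 0 then A p else 0\<^sub>m n n"])
      (use assms 0 in \<open>cases "i = 0"; simp add: lam_coeff_const c x_C_mat_iff\<close>)+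
  show "lam_coeff (map_mat fls_const (A p)) i = 0\<^sub>m n n" if "p \<in> S" "i > 0" for p i
    using that by (simp add: lam_coeff_const c)
qed

lemma lam_coeff_D:
  assumes "fx.C_mat n M" "p \<in> S"
  shows "lam_coeff (mat_D (fls_D Dx) M p) i = mat_Dx (\<lambda>q. lam_coeff (M q) i) p"
    "lam_coeff (mat_D (fls_D Dt) M p) i = mat_Dt (\<lambda>q. lam_coeff (M q) i) p"
proof -
  note c = fx.C_matD(1)[OF assms(1)]
  show "lam_coeff (mat_D (fls_D Dx) M p) i = mat_Dx (\<lambda>q. lam_coeff (M q) i) p"
  proof (rule eqI)
    fix r k assume rk: "r < n" "k < n"
    have "lam_coeff (mat_D (fls_D Dx) M p) i $$ (r, k) = Dx (\<lambda>q. fls_nth (M q $$ (r, k)) (- i)) p"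
      using rk c[OF assms(2)] fls_locale(2)[OF x.function_derivation_axioms fx.C_matD(2)[OF assms(1) rk] assms(2)]
      by (simp add: lam_coeff_index fx.mat_D_index[where n = n])
    also have "\<dots> = Dx (\<lambda>q. lam_coeff (M q) i $$ (r, k)) p"
      by (rule x.D_cong[OF _ assms(2)]) (simp add: lam_coeff_index[OF c rk])
    also have "\<dots> = mat_Dx (\<lambda>q. lam_coeff (M q) i) p $$ (r, k)"
      using rk c[OF assms(2)] by (simp add: mat_Dx_eq x.mat_D_index[where n = n])
    finally show "lam_coeff (mat_D (fls_D Dx) M p) i $$ (r, k) = \<dots>" .
  qed (use c[OF assms(2)] in \<open>simp_all add: mat_Dx_eq\<close>)
  show "lam_coeff (mat_D (fls_D Dt) M p) i = mat_Dt (\<lambda>q. lam_coeff (M q) i) p"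
  proof (rule eqI)
    fix r k assume rk: "r < n" "k < n"
    have "lam_coeff (mat_D (fls_D Dt) M p) i $$ (r, k) = Dt (\<lambda>q. fls_nth (M q $$ (r, k)) (- i)) p"
      using rk c[OF assms(2)] fls_locale(2)[OF t.function_derivation_axioms fx.C_matD(2)[OF assms(1) rk] assms(2)]
      by (simp add: lam_coeff_index ft.mat_D_index[where n = n])
    also have "\<dots> = Dt (\<lambda>q. lam_coeff (M q) i $$ (r, k)) p"
      by (rule t.D_cong[OF _ assms(2)]) (simp add: lam_coeff_index[OF c rk])
    also have "\<dots> = mat_Dt (\<lambda>q. lam_coeff (M q) i) p $$ (r, k)"
      using rk c[OF assms(2)] by (simp add: mat_Dt_eq t.mat_D_index[where n = n])
    finally show "lam_coeff (mat_D (fls_D Dt) M p) i $$ (r, k) = \<dots>" .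
  qed (use c[OF assms(2)] in \<open>simp_all add: mat_Dt_eq\<close>)
qed

end

section \<open>The principal grading\<close>

text \<open>
  Giving \<open>\<lambda>\<close> weight \<open>n\<close> and the matrix unit at \<open>(r, c)\<close> weight \<open>r - c\<close> makes \<open>e\<^bsub>1n\<^esub>\<lambda> + b\<close> homogeneous of
  weight 1. Substituting \<open>\<lambda> = z\<^sup>n\<close> and conjugating by a diagonal matrix turns this weight into the
  degree in \<open>z\<close>.
\<close>

definition principal :: "nat \<Rightarrow> real fls mat \<Rightarrow> real fls mat"
  where "principal n M = mat n n (\<lambda>(r, c). fls_shift (int r - int c) (fls_compose_power (M $$ (r, c)) n))"

text \<open>The e-th power of the cyclic shift e_{1n} + b, for any integer e. These matrices are the
  possible leading coefficients, in the principal grading, of solutions of Y_x + [J + u, Y] =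
  0.\<close>

definition circulant :: "nat \<Rightarrow> int \<Rightarrow> real mat"
  where "circulant n e = mat n n (\<lambda>(r, c). if int n dvd int r - int c - e then 1 else 0)"

locale principal_grading = square_mat n for n +
  assumes n_pos: "n > 0"
begin

lemma principal_carrier [simp]: "principal n M \<in> carrier_mat n n"
  by (simp add: principal_def)

lemma circulant_carrier [simp]: "circulant n e \<in> carrier_mat n n"
  by (simp add: circulant_def)

lemma circulant_index:
  "r < n \<Longrightarrow> c < n \<Longrightarrow> circulant n e $$ (r, c) = (if int n dvd int r - int c - e then 1 else 0)"
  by (simp add: circulant_def)

lemma principal_index:
  "r < n \<Longrightarrow> c < n \<Longrightarrow> principal n M $$ (r, c) = fls_shift (int r - int c) (fls_compose_power (M $$ (r, c)) n)"
  by (simp add: principal_def)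

text \<open>The monomial \<lambda>^i at the entry (r, c) has weight n i + r - c. Since \<lambda>^i
  sits at index -i of the Laurent series, weight e occurs exactly at index (r - c - e) / n, if this
  is an integer.\<close>

lemma principal_coeff:
  assumes "r < n" "c < n"
  shows "lam_coeff (principal n M) e $$ (r, c)
    = (if int n dvd int r - int c - e then fls_nth (M $$ (r, c)) ((int r - int c - e) div int n) else 0)"
  using assms n_pos
  by (simp add: lam_coeff_index principal_index fls_nth_compose_power)

lemma principal_mult:
  assumes "M \<in> carrier_mat n n" "N \<in> carrier_mat n n"
  shows "principal n (M * N) = principal n M * principal n N"
proof (rule eqI)
  fix r c assume rc: "r < n" "c < n"
  have sum_pow: "fls_compose_power (\<Sum>k\<in>I. f k) n = (\<Sum>k\<in>I. fls_compose_power (f k) n)" for f :: "nat \<Rightarrow> real fls" and I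
    by (induction I rule: infinite_finite_induct) auto
  have sum_shift: "fls_shift m (\<Sum>k\<in>I. f k) = (\<Sum>k\<in>I. fls_shift m (f k))" for f :: "nat \<Rightarrow> real fls" and I m
    by (induction I rule: infinite_finite_induct) auto
  have "principal n (M * N) $$ (r, c)
      = (\<Sum>k<n. fls_shift (int r - int c) (fls_compose_power (M $$ (r, k)) n * fls_compose_power (N $$ (k, c)) n))"
    using assms rc n_pos by (simp add: principal_index mult_index sum_pow sum_shift del: index_mult_mat)
  also have "\<dots> = (\<Sum>k<n. principal n M $$ (r, k) * principal n N $$ (k, c))"
    using rc by (intro sum.cong refl) (simp add: principal_index fls_shifted_times_simps)
  also have "\<dots> = (principal n M * principal n N) $$ (r, c)"
    using rc by (simp add: mult_index del: index_mult_mat)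
  finally show "principal n (M * N) $$ (r, c) = \<dots>" .
qed (use assms in auto)

lemma principal_diff:
  assumes "M \<in> carrier_mat n n" "N \<in> carrier_mat n n"
  shows "principal n (M - N) = principal n M - principal n N"
  using assms by (intro eqI) (auto simp: principal_index)

lemma principal_one: "principal n (1\<^sub>m n) = 1\<^sub>m n"
  using n_pos by (intro eqI) (auto simp: principal_index)

lemma principal_pow: "M \<in> carrier_mat n n \<Longrightarrow> principal n (M ^\<^sub>m k) = principal n M ^\<^sub>m k"
  by (induction k) (simp_all add: principal_one principal_mult)

text \<open>Exponents add, as for powers of a shift: in row r of the first factor the only nonzero
  entry stands in the column \<open>k0\<close> congruent to r - e.\<close>

lemma circulant_mult: "circulant n e * circulant n f = circulant n (e + f)"
proof (rule eqI)
  fix r c assume rc: "r < n" "c < n"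
  define k0 where "k0 = nat ((int r - e) mod int n)"
  have k0: "k0 < n" "int k0 = (int r - e) mod int n" using n_pos by (auto simp: k0_def nat_less_iff)
  have iff: "int n dvd int r - int k - e \<longleftrightarrow> k = k0" if "k < n" for k
  proof
    assume "int n dvd int r - int k - e"
    then have "int n dvd (int r - e) - int k" by (simp add: algebra_simps)
    then have "(int r - e) mod int n = int k mod int n" by (simp add: mod_eq_dvd_iff)
    then show "k = k0" using k0 that by simp
  next
    assume "k = k0"
    then have "(int r - e) mod int n = int k mod int n" using k0 by simp
    then have "int n dvd (int r - e) - int k" by (simp add: mod_eq_dvd_iff)
    then show "int n dvd int r - int k - e" by (simp add: algebra_simps)
  qed
  have "(circulant n e * circulant n f) $$ (r, c)
      = (\<Sum>k<n. if k = k0 then (if int n dvd int k - int c - f then 1 else 0) else 0)"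
    unfolding mult_index[OF circulant_carrier circulant_carrier rc]
    using rc by (intro sum.cong refl) (simp add: circulant_def iff)
  also have "\<dots> = (if int n dvd int k0 - int c - f then 1 else 0)"
    using k0(1) by simp
  also have "int n dvd int k0 - int c - f \<longleftrightarrow> int n dvd int r - int c - (e + f)"
  proof -
    have "int n dvd int r - e - int k0" using k0 by (simp add: mod_eq_dvd_iff[symmetric])
    from dvd_add_right_iff[OF this, of "int k0 - int c - f"] show ?thesis
      by (simp add: algebra_simps)
  qed
  finally show "(circulant n e * circulant n f) $$ (r, c) = circulant n (e + f) $$ (r, c)"
    using rc by (simp add: circulant_def)
qed auto

lemma circulant_0: "circulant n 0 = 1\<^sub>m n"
proof (rule eqI)
  fix r c assume rc: "r < n" "c < n"
  then have "int n dvd int r - int c \<longleftrightarrow> r = c"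
    by (metis mod_eq_dvd_iff mod_less of_nat_eq_iff of_nat_mod)
  then show "circulant n 0 $$ (r, c) = 1\<^sub>m n $$ (r, c)" using rc by (simp add: circulant_def)
qed auto

text \<open>Column 0 has the entry 1 in row e mod n, so no nonzero multiple of a power of the shift
  vanishes.\<close>

lemma circulant_eq_0: "a \<cdot>\<^sub>m circulant n e = 0\<^sub>m n n \<longleftrightarrow> a = 0"
proof
  assume *: "a \<cdot>\<^sub>m circulant n e = 0\<^sub>m n n"
  have "nat (e mod int n) < n" using n_pos by (simp add: nat_less_iff)
  then show "a = 0"
    using arg_cong[OF *, of "\<lambda>X. X $$ (nat (e mod int n), 0)"] n_pos
    by (simp add: circulant_def mod_eq_dvd_iff[symmetric])
next
  assume "a = 0"
  then show "a \<cdot>\<^sub>m circulant n e = 0\<^sub>m n n" by (intro eqI) auto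
qed

text \<open>T may be zero, so d is only an upper bound for the degree. This makes the notion stable
  under sums, differences and products even when leading terms cancel.\<close>

definition has_top :: "real fls mat \<Rightarrow> int \<Rightarrow> real mat \<Rightarrow> bool"
  where "has_top A d T \<longleftrightarrow> A \<in> carrier_mat n n \<and> (\<forall>i>d. lam_coeff A i = 0\<^sub>m n n) \<and> lam_coeff A d = T"

lemma has_top_nth:
  assumes "has_top A d T" "i < - d" "r < n" "k < n"
  shows "fls_nth (A $$ (r, k)) i = 0"
proof -
  have "lam_coeff A (- i) = 0\<^sub>m n n" using assms by (simp add: has_top_def)
  moreover have "A \<in> carrier_mat n n" using assms(1) by (simp add: has_top_def)
  ultimately show ?thesis using lam_coeff_index[of A r k "- i"] assms(3,4) by simp
qed

lemma has_top_mult: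
  assumes "has_top A a T" "has_top B b U"
  shows "has_top (A * B) (a + b) (T * U)"
proof -
  have c: "A \<in> carrier_mat n n" "B \<in> carrier_mat n n" using assms by (auto simp: has_top_def)
  have prod: "fls_nth (A $$ (r, k) * B $$ (k, s)) m
      = (\<Sum>i=-a..m + b. fls_nth (A $$ (r, k)) i * fls_nth (B $$ (k, s)) (m - i))" if "r < n" "k < n" "s < n" for r k s m
    using fls_times_nth_bounded[of "- a" "A $$ (r, k)" "- b" "B $$ (k, s)" m]
      has_top_nth[OF assms(1)] has_top_nth[OF assms(2)] that by simp
  have AB: "lam_coeff (A * B) i = 0\<^sub>m n n" if "i > a + b" for i
    using c that by (intro eqI) (auto simp: lam_coeff_index mult_index fls_nth_sum prod simp del: index_mult_mat)
  have "lam_coeff (A * B) (a + b) = lam_coeff A a * lam_coeff B b"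
    using c by (intro eqI) (auto simp: lam_coeff_index mult_index fls_nth_sum prod simp del: index_mult_mat)
  then show ?thesis using c AB assms by (simp add: has_top_def)
qed

lemma has_top_diff:
  "has_top A a T \<Longrightarrow> has_top B a U \<Longrightarrow> has_top (A - B) a (T - U)"
  by (auto simp: has_top_def lam_coeff_lin)

lemma has_top_add:
  "has_top A a T \<Longrightarrow> has_top B a U \<Longrightarrow> has_top (A + B) a (T + U)"
  by (auto simp: has_top_def lam_coeff_lin)

lemma has_top_pow:
  assumes "has_top A d (a \<cdot>\<^sub>m circulant n d)"
  shows "has_top (A ^\<^sub>m k) (int k * d) (a ^ k \<cdot>\<^sub>m circulant n (int k * d))"
proof (induction k)
  case 0
  have "lam_coeff (1\<^sub>m n :: real fls mat) i = (if i = 0 then 1\<^sub>m n else 0\<^sub>m n n)" for i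
    by (rule eqI) (auto simp: lam_coeff_index)
  moreover have "1 \<cdot>\<^sub>m circulant n 0 = 1\<^sub>m n" unfolding circulant_0 by (rule eqI) auto
  moreover have "A ^\<^sub>m 0 = 1\<^sub>m n" using assms by (simp add: has_top_def)
  ultimately show ?case by (simp add: has_top_def del: pow_mat.simps)
next
  case (Suc k)
  have e: "int k * d + d = int (Suc k) * d" by (simp add: algebra_simps)
  have "a ^ k \<cdot>\<^sub>m circulant n (int k * d) * (a \<cdot>\<^sub>m circulant n d) = a \<cdot>\<^sub>m (a ^ k \<cdot>\<^sub>m circulant n (int (Suc k) * d))"
    by (simp only: smult_mult circulant_carrier carrier_closed circulant_mult e)
  also have "\<dots> = a ^ Suc k \<cdot>\<^sub>m circulant n (int (Suc k) * d)"
    by (rule eqI) (auto simp: index)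
  finally show ?case using has_top_mult[OF Suc assms] unfolding e by simp
qed

text \<open>\<open>A\<^sup>k - B\<^sup>k\<close> telescopes; its leading coefficient is that of \<open>k (A - B) C\<^sup>k\<^sup>-\<^sup>1\<close> since all the leading
  coefficients commute.\<close>

lemma has_top_pow_diff:
  assumes A: "has_top A 1 (circulant n 1)" and B: "has_top B 1 (circulant n 1)"
    and AB: "has_top (A - B) d (a \<cdot>\<^sub>m circulant n d)"
  shows "has_top (A ^\<^sub>m k - B ^\<^sub>m k) (d + int k - 1) ((real k * a) \<cdot>\<^sub>m circulant n (d + int k - 1))"
proof (induction k)
  case 0
  have "A ^\<^sub>m 0 - B ^\<^sub>m 0 = 0\<^sub>m n n" using A B by (auto simp: has_top_def)
  moreover have "lam_coeff (0\<^sub>m n n) i = 0\<^sub>m n n" for i by (rule eqI) (auto simp: lam_coeff_index)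
  moreover have "0 \<cdot>\<^sub>m circulant n (d - 1) = 0\<^sub>m n n" by (subst circulant_eq_0) simp
  ultimately show ?case by (auto simp: has_top_def)
next
  case (Suc k)
  have c: "A \<in> carrier_mat n n" "B \<in> carrier_mat n n" using A B by (auto simp: has_top_def)
  have eq: "A ^\<^sub>m Suc k - B ^\<^sub>m Suc k = A ^\<^sub>m k * (A - B) + (A ^\<^sub>m k - B ^\<^sub>m k) * B"
    using c by (intro eqI) (simp_all add: ring_distribs index del: index_mult_mat index_add_mat index_minus_mat)
  have one: "1 \<cdot>\<^sub>m circulant n 1 = circulant n 1" by (rule eqI) auto
  have Ak: "has_top (A ^\<^sub>m k) (int k) (circulant n (int k))"
    using has_top_pow[of A 1 1 k] A by (simp add: one) (metis (no_types, lifting) circulant_carrier eqI index(4) mult_1 carrier_closed(5))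
  have t1: "has_top (A ^\<^sub>m k * (A - B)) (int k + d) (circulant n (int k) * (a \<cdot>\<^sub>m circulant n d))"
    by (rule has_top_mult[OF Ak AB])
  have t2: "has_top ((A ^\<^sub>m k - B ^\<^sub>m k) * B) (d + int k - 1 + 1) (((real k * a) \<cdot>\<^sub>m circulant n (d + int k - 1)) * circulant n 1)"
    by (rule has_top_mult[OF Suc B])
  have "circulant n (int k) * (a \<cdot>\<^sub>m circulant n d) + ((real k * a) \<cdot>\<^sub>m circulant n (d + int k - 1)) * circulant n 1
     = (real (Suc k) * a) \<cdot>\<^sub>m circulant n (d + int k)"
    by (simp add: smult_mult circulant_mult add.commute[of "int k"]) (intro eqI; simp add: algebra_simps)
  moreover have "has_top (A ^\<^sub>m k * (A - B) + (A ^\<^sub>m k - B ^\<^sub>m k) * B) (d + int k)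
      (circulant n (int k) * (a \<cdot>\<^sub>m circulant n d) + ((real k * a) \<cdot>\<^sub>m circulant n (d + int k - 1)) * circulant n 1)"
    by (rule has_top_add) (use t1 t2 in \<open>simp_all add: add.commute[of "int k"]\<close>)
  moreover have "d + int (Suc k) - 1 = d + int k" by simp
  ultimately show ?case unfolding eq by (simp only:)
qed

text \<open>Commuting with the cyclic shift makes T constant along each cyclic diagonal; the support
  condition \<open>z\<close> leaves a single diagonal, the one on which r - c is congruent to
  d.\<close>

lemma commute_circulant_imp:
  assumes T: "T \<in> carrier_mat n n" and comm: "circulant n 1 * T = T * circulant n 1"
    and z: "\<And>r c. r < n \<Longrightarrow> c < n \<Longrightarrow> \<not> int n dvd int r - int c - d \<Longrightarrow> T $$ (r, c) = 0"
  shows "\<exists>a. T = a \<cdot>\<^sub>m circulant n d"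
proof -
  \<comment> \<open>Both products are compared at the entry ((r + 1) mod n, c): the shift on the
    left reads off row r, the shift on the right reads off column c + 1.\<close>
  have step: "T $$ ((r + 1) mod n, c + 1) = T $$ (r, c)" if "r < n" "c + 1 < n" for r c
  proof -
    have r': "(r + 1) mod n < n" using n_pos by simp
    have cn: "c < n" using that by simp
    have 1: "int n dvd int ((r + 1) mod n) - int k - 1 \<longleftrightarrow> k = r" if "k < n" for k
    proof -
      have "int n dvd int ((r + 1) mod n) - int k - 1 \<longleftrightarrow> int n dvd int ((r + 1) mod n) - int (k + 1)"
        by (simp add: algebra_simps)
      also have "\<dots> \<longleftrightarrow> (r + 1) mod n = (k + 1) mod n"
        by (metis mod_eq_dvd_iff mod_mod_trivial of_nat_eq_iff of_nat_mod)
      also have "\<dots> \<longleftrightarrow> k = r"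
        using \<open>r < n\<close> \<open>k < n\<close> by (auto simp: mod_Suc split: if_splits)
      finally show ?thesis .
    qed
    have 2: "int n dvd int k - int c - 1 \<longleftrightarrow> k = c + 1" if "k < n" for k
    proof -
      have "int n dvd int k - int c - 1 \<longleftrightarrow> int n dvd int k - int (c + 1)"
        by (simp add: algebra_simps)
      also have "\<dots> \<longleftrightarrow> k mod n = (c + 1) mod n"
        by (metis mod_eq_dvd_iff of_nat_eq_iff of_nat_mod)
      finally show ?thesis using \<open>c + 1 < n\<close> \<open>k < n\<close> by simp
    qed
    have "(circulant n 1 * T) $$ ((r + 1) mod n, c) = (\<Sum>k<n. if k = r then T $$ (k, c) else 0)"
      unfolding mult_index[OF circulant_carrier T r' cn]
      by (intro sum.cong refl) (simp only: lessThan_iff circulant_index[OF r'] 1, simp)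
    then have L: "(circulant n 1 * T) $$ ((r + 1) mod n, c) = T $$ (r, c)" using that by simp
    have "(T * circulant n 1) $$ ((r + 1) mod n, c) = (\<Sum>k<n. if k = c + 1 then T $$ ((r + 1) mod n, k) else 0)"
      unfolding mult_index[OF T circulant_carrier r' cn]
      by (intro sum.cong refl) (simp only: lessThan_iff circulant_index[OF _ cn] 2, simp)
    then have R: "(T * circulant n 1) $$ ((r + 1) mod n, c) = T $$ ((r + 1) mod n, c + 1)" using that by simp
    show ?thesis using L R comm by simp
  qed
  define a where "a = T $$ (nat (d mod int n), 0)"
  have val: "T $$ (r, c) = a" if "r < n" "c < n" "int n dvd int r - int c - d" for r c
    using that
  proof (induction c arbitrary: r)
    case 0
    then have "int r mod int n = d mod int n" by (simp only: mod_eq_dvd_iff) simp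
    then have "r = nat (d mod int n)" using 0 by simp
    then show ?case by (simp add: a_def)
  next
    case (Suc c)
    define r' where "r' = (r + n - 1) mod n"
    have r': "r' < n" "(r' + 1) mod n = r"
      using Suc.prems n_pos by (auto simp: r'_def mod_Suc_eq)
    have "int r' mod int n = (int r - 1) mod int n"
    proof -
      have "int (r + n - 1) = int r - 1 + int n" using Suc.prems by simp
      then show ?thesis unfolding r'_def by (simp add: of_nat_mod)
    qed
    then have "int n dvd int r' - (int r - 1)" by (simp add: mod_eq_dvd_iff)
    then have "int n dvd (int r' - (int r - 1)) + (int r - int (Suc c) - d)"
      using Suc.prems(3) by (rule dvd_add)
    then have "int n dvd int r' - int c - d" by (simp add: algebra_simps)
    then have "T $$ (r', c) = a" using Suc.IH[of r'] r' Suc.prems by simp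
    then show ?case using step[of r' c] r' Suc.prems by simp
  qed
  have "T = a \<cdot>\<^sub>m circulant n d"
    using T by (intro eqI) (auto simp: circulant_def val z)
  then show ?thesis by blast
qed

end

section \<open>Uniqueness of the series Y and of \<zeta>_j and Z_j\<close>

locale kdv_domain = smooth_fls_mat n S for n S +
  assumes n_ge: "n \<ge> 2"
begin

sublocale principal_grading n
  by unfold_locales (use n_ge in simp)

definition Lax :: "(nat \<Rightarrow> real \<times> real \<Rightarrow> real) \<Rightarrow> real \<times> real \<Rightarrow> real fls mat"
  where "Lax u p = J_mat n fls_X_inv + map_mat fls_const (u_mat n (\<lambda>i. u i p))"

lemma Lax_carrier [simp]: "Lax u p \<in> carrier_mat n n"
  by (simp add: Lax_def)

lemma Lax_index:
  "r < n \<Longrightarrow> c < n \<Longrightarrow> Lax u p $$ (r, c) = (if r = 0 \<and> c + 1 = n then fls_X_inv else 0)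
    + (if r = c + 1 then 1 else 0) + fls_const (if c + 1 = n \<and> r + 1 < n then u (r + 1) p else 0)"
  by (auto simp: Lax_def J_mat_def elem_mat_def b_mat_def u_mat_def)

text \<open>The entries of \<lambda> e_{1n} and of b have weight 1, while u_i stands at (i, n) and
  has weight i - n < 0. Hence the leading part does not see u.\<close>

lemma principal_Lax: "has_top (principal n (Lax u p)) 1 (circulant n 1)"
proof -
  have nth: "fls_nth (Lax u p $$ (r, c)) k = (if r = 0 \<and> c + 1 = n \<and> k = -1 then 1 else 0)
    + (if r = c + 1 \<and> k = 0 then 1 else 0) + (if c + 1 = n \<and> r + 1 < n \<and> k = 0 then u (r + 1) p else 0)"
    if "r < n" "c < n" for r c k
    using that by (simp add: Lax_index)
  have z: "lam_coeff (principal n (Lax u p)) e $$ (r, c) = (if e = 1 then circulant n 1 $$ (r, c) else 0)"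
    if "e \<ge> 1" and rc: "r < n" "c < n" for e r c
  proof (cases "int n dvd int r - int c - e")
    case False
    then show ?thesis using rc by (auto simp: principal_coeff circulant_index)
  next
    case True
    then obtain k where k: "int r - int c - e = int n * k" by (auto elim: dvdE)
    then have div: "(int r - int c - e) div int n = k" using n_pos by simp
    have a: "r = c + 1 \<and> k = 0 \<longleftrightarrow> e = 1 \<and> k = 0" and "\<not> (c + 1 = n \<and> r + 1 < n \<and> k = 0)"
      using k that by auto
    moreover have "r = 0 \<and> c + 1 = n \<and> k = -1 \<longleftrightarrow> e = 1 \<and> k = -1"
    proof
      assume "e = 1 \<and> k = -1"
      then have "int r + int n = int c + 1" using k by simp
      then have "r + n = c + 1" by linarith
      then show "r = 0 \<and> c + 1 = n \<and> k = -1" using rc \<open>e = 1 \<and> k = -1\<close> by auto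
    qed (use k in auto)
    \<comment> \<open>In weight 1 only the powers \<lambda>^0 and \<lambda>^1 occur, because r - c -
      1 lies between -n and n - 2.\<close>
    moreover have "k = 0 \<or> k = -1" if "e = 1"
    proof (rule ccontr)
      assume "\<not> (k = 0 \<or> k = -1)"
      then consider "k \<ge> 1" | "k \<le> -2" by linarith
      then show False
      proof cases
        case 1
        then have "int n * k \<ge> int n" using mult_left_mono[of 1 k "int n"] by simp
        then show ?thesis using k rc that by linarith
      next
        case 2
        then have "int n * k \<le> - 2 * int n" using mult_left_mono[of k "-2" "int n"] by simp
        then show ?thesis using k rc that by linarith
      qed
    qed
    ultimately show ?thesis
      using True rc by (auto simp: principal_coeff div nth circulant_index)
  qed
  show ?thesis unfolding has_top_def
  proof (intro conjI allI impI)
    show "lam_coeff (principal n (Lax u p)) i = 0\<^sub>m n n" if "i > 1" for i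
      using that by (intro eqI) (simp_all add: z)
    show "lam_coeff (principal n (Lax u p)) 1 = circulant n 1"
      by (intro eqI) (simp_all add: z)
  qed simp
qed

text \<open>The equation Y_x + [J + u, Y] = 0 without the normalisation of Y. Being linear, it
  passes to the difference of two solutions.\<close>

definition flat :: "(nat \<Rightarrow> real \<times> real \<Rightarrow> real) \<Rightarrow> (real \<times> real \<Rightarrow> real fls mat) \<Rightarrow> bool"
  where "flat u Y \<longleftrightarrow> (\<forall>p\<in>S. Y p \<in> carrier_mat n n \<and>
    (\<forall>i. mat_Dx (\<lambda>q. lam_coeff (Y q) i) p + lam_coeff (Lax u p * Y p - Y p * Lax u p) i = 0\<^sub>m n n))"

text \<open>In weight d + 1 the term Y_x is absent, and what is left of the equation says that the
  leading coefficient commutes with the cyclic shift. The bound \<open>z\<close> is required at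
  every point of S because Y_x involves neighbouring points.\<close>

lemma flat_top:
  assumes fl: "flat u Y" and z: "\<And>q i. q \<in> S \<Longrightarrow> i > d \<Longrightarrow> lam_coeff (principal n (Y q)) i = 0\<^sub>m n n"
    and p: "p \<in> S"
  shows "\<exists>a. has_top (principal n (Y p)) d (a \<cdot>\<^sub>m circulant n d)"
proof -
  have c: "Y q \<in> carrier_mat n n" if "q \<in> S" for q using fl that by (simp add: flat_def)
  define T where "T = lam_coeff (principal n (Y p)) d"
  have top: "has_top (principal n (Y p)) d T" using z[OF p] by (simp add: has_top_def T_def)
  have "has_top (principal n (Lax u p * Y p - Y p * Lax u p)) (d + 1) (circulant n 1 * T - T * circulant n 1)"
    using has_top_diff[OF _ has_top_mult[OF top principal_Lax[of u p]]] has_top_mult[OF principal_Lax[of u p] top] c[OF p]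
    by (simp add: principal_diff principal_mult add.commute)
  then have "circulant n 1 * T - T * circulant n 1 = lam_coeff (principal n (Lax u p * Y p - Y p * Lax u p)) (d + 1)"
    by (simp add: has_top_def)
  also have "\<dots> = 0\<^sub>m n n"
  proof (rule eqI)
    fix r k assume rk: "r < n" "k < n"
    define m where "m = (int r - int k - (d + 1)) div int n"
    show "lam_coeff (principal n (Lax u p * Y p - Y p * Lax u p)) (d + 1) $$ (r, k) = 0\<^sub>m n n $$ (r, k)"
    proof (cases "int n dvd int r - int k - (d + 1)")
      case True
      have YY: "lam_coeff (Y q) (- m) $$ (r, k) = 0" if "q \<in> S" for q
        using z[OF that, of "d + 1"] principal_coeff[OF rk, of "Y q" "d + 1"] True rk
          lam_coeff_index[OF c[OF that] rk, of "- m"] by (simp add: m_def)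
      have "Dx (\<lambda>q. lam_coeff (Y q) (- m) $$ (r, k)) p = Dx (\<lambda>q. 0 :: real) p"
        by (rule x.D_cong[OF _ p]) (rule YY)
      also have "\<dots> = 0" by (rule x.D_const[OF p])
      finally have dz: "mat_Dx (\<lambda>q. lam_coeff (Y q) (- m)) p $$ (r, k) = 0"
        using c[OF p] rk by (simp add: mat_Dx_eq x.mat_D_index[where n = n])
      have "mat_Dx (\<lambda>q. lam_coeff (Y q) (- m)) p + lam_coeff (Lax u p * Y p - Y p * Lax u p) (- m) = 0\<^sub>m n n"
        using fl p by (simp add: flat_def)
      from arg_cong[OF this, of "\<lambda>X. X $$ (r, k)"] dz
      have "lam_coeff (Lax u p * Y p - Y p * Lax u p) (- m) $$ (r, k) = 0"
        using rk c[OF p] by (simp add: index del: index_add_mat)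
      then have "fls_nth ((Lax u p * Y p - Y p * Lax u p) $$ (r, k)) m = 0"
        using rk c[OF p] by (simp add: lam_coeff_index del: index_minus_mat)
      then show ?thesis
        unfolding principal_coeff[OF rk] using rk by (simp add: m_def)
    next
      case False
      then show ?thesis using rk by (simp add: principal_coeff)
    qed
  qed auto
  finally have *: "circulant n 1 * T - T * circulant n 1 = 0\<^sub>m n n" .
  have Tc: "T \<in> carrier_mat n n" by (simp add: T_def)
  have "circulant n 1 * T = T * circulant n 1"
  proof (rule eqI)
    fix r k assume rk: "r < n" "k < n"
    have "(circulant n 1 * T - T * circulant n 1) $$ (r, k) = 0" unfolding * using rk by simp
    then show "(circulant n 1 * T) $$ (r, k) = (T * circulant n 1) $$ (r, k)"
      using rk Tc by (simp add: index del: index_minus_mat index_mult_mat)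
  qed (use Tc in auto)
  then have "\<exists>a. T = a \<cdot>\<^sub>m circulant n d"
    by (rule commute_circulant_imp[OF Tc]) (simp add: T_def principal_coeff)
  then show ?thesis using top by auto
qed

text \<open>The degree d is the largest weight that occurs anywhere on S, as \<open>flat_top\<close>
  needs a common bound. The point p where it is attained may therefore differ from
  \<open>p0\<close>.\<close>

lemma top_degree:
  assumes fl: "flat u Y" and b: "\<And>q i. q \<in> S \<Longrightarrow> i > N \<Longrightarrow> lam_coeff (Y q) i = 0\<^sub>m n n"
    and p0: "p0 \<in> S" "lam_coeff (principal n (Y p0)) e0 \<noteq> 0\<^sub>m n n"
  shows "\<exists>d a p. d \<ge> e0 \<and> p \<in> S \<and> a \<noteq> 0 \<and> has_top (principal n (Y p)) d (a \<cdot>\<^sub>m circulant n d)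
    \<and> (\<forall>q\<in>S. \<exists>a. has_top (principal n (Y q)) d (a \<cdot>\<^sub>m circulant n d))"
proof -
  have c: "Y q \<in> carrier_mat n n" if "q \<in> S" for q using fl that by (simp add: flat_def)
  define P where "P d \<longleftrightarrow> (\<exists>p\<in>S. lam_coeff (principal n (Y p)) d \<noteq> 0\<^sub>m n n)" for d
  \<comment> \<open>A coefficient of \<lambda>^i with i at most N has weight at most n N + n -
    1.\<close>
  have bnd: "e \<le> int n * (N + 1)" if "P e" for e
  proof (rule ccontr)
    assume e: "\<not> e \<le> int n * (N + 1)"
    obtain q where q: "q \<in> S" "lam_coeff (principal n (Y q)) e \<noteq> 0\<^sub>m n n" using \<open>P e\<close> by (auto simp: P_def)
    have "lam_coeff (principal n (Y q)) e = 0\<^sub>m n n"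
    proof (rule eqI)
      fix r k assume rk: "r < n" "k < n"
      define m where "m = (int r - int k - e) div int n"
      have "int r - int k - e < int n * (- N)" using e rk by (simp add: algebra_simps)
      moreover have "int n * m \<le> int r - int k - e"
        using mult_div_mod_eq[of "int n" "int r - int k - e"] pos_mod_sign[of "int n" "int r - int k - e"] n_pos
        unfolding m_def by linarith
      ultimately have "int n * m < int n * (- N)" by linarith
      then have "m < - N" using n_pos by (simp only: mult_less_cancel_left_pos of_nat_0_less_iff)
      then have "lam_coeff (Y q) (- m) $$ (r, k) = 0" using b[OF q(1), of "- m"] rk by simp
      then show "lam_coeff (principal n (Y q)) e $$ (r, k) = 0\<^sub>m n n $$ (r, k)"
        unfolding principal_coeff[OF rk] lam_coeff_index[OF c[OF q(1)] rk] using rk by (simp add: m_def)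
    qed auto
    then show False using q by simp
  qed
  have fin: "finite {e. e0 \<le> e \<and> P e}"
    by (rule finite_subset[of _ "{e0..int n * (N + 1)}"]) (use bnd in auto)
  have ne: "{e. e0 \<le> e \<and> P e} \<noteq> {}" using p0 by (auto simp: P_def)
  define d where "d = Max {e. e0 \<le> e \<and> P e}"
  have d: "e0 \<le> d" "P d" using Max_in[OF fin ne] by (auto simp: d_def)
  have "\<not> P i" if "i > d" for i
    using Max_ge[OF fin, of i] that d(1) unfolding d_def[symmetric] by auto
  then have z: "lam_coeff (principal n (Y q)) i = 0\<^sub>m n n" if "q \<in> S" "i > d" for q i
    using that by (auto simp: P_def)
  have ht: "\<exists>a. has_top (principal n (Y q)) d (a \<cdot>\<^sub>m circulant n d)" if "q \<in> S" for q
    by (rule flat_top[OF fl z that])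
  obtain p where p: "p \<in> S" "lam_coeff (principal n (Y p)) d \<noteq> 0\<^sub>m n n" using d(2) by (auto simp: P_def)
  obtain a where a: "has_top (principal n (Y p)) d (a \<cdot>\<^sub>m circulant n d)" using ht[OF p(1)] by blast
  have "a \<noteq> 0" using a p(2) circulant_eq_0[of a d] by (auto simp: has_top_def)
  then show ?thesis using d(1) p(1) a ht by blast
qed

lemma is_Y_carrier:
  assumes "is_Y n S u Y" "p \<in> S"
  shows "Y p \<in> carrier_mat n n"
proof -
  have "lam_coeff (Y p) 0 \<in> carrier_mat n n"
    using assms by (simp add: is_Y_def smooth_mat_on_def)
  then show ?thesis by (auto simp: lam_coeff_def)
qed

lemma is_Y_flat:
  assumes "is_Y n S u Y"
  shows "flat u Y"
  unfolding flat_def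
proof (intro ballI conjI allI)
  fix p i assume p: "p \<in> S"
  show "Y p \<in> carrier_mat n n" by (rule is_Y_carrier[OF assms p])
  show "mat_Dx (\<lambda>q. lam_coeff (Y q) i) p + lam_coeff (Lax u p * Y p - Y p * Lax u p) i = 0\<^sub>m n n"
    using assms p by (simp add: is_Y_def Lax_def Let_def)
qed

lemma is_Y_C_mat:
  assumes "is_Y n S u Y"
  shows "fx.C_mat n Y"
  by (rule fls_C_matI[where N = 1, OF _ _ is_Y_carrier[OF assms]]) (use assms in \<open>simp_all add: is_Y_def\<close>)

text \<open>The series \<lambda> I is homogeneous of weight n, and its leading coefficient, the
  identity, is the n-th power of the cyclic shift.\<close>

lemma is_Y_pow_n:
  assumes "is_Y n S u Y" "p \<in> S"
  shows "has_top (principal n (Y p) ^\<^sub>m n) (int n) (circulant n (int n))"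
proof -
  have c: "Y p \<in> carrier_mat n n" by (rule is_Y_carrier[OF assms])
  have eq: "principal n (Y p) ^\<^sub>m n = principal n (fls_X_inv \<cdot>\<^sub>m 1\<^sub>m n)"
    using assms c by (simp add: principal_pow[symmetric] is_Y_def)
  have "lam_coeff (principal n (fls_X_inv \<cdot>\<^sub>m 1\<^sub>m n)) e = (if e = int n then circulant n (int n) else 0\<^sub>m n n)" for e
  proof (rule eqI)
    fix r k assume rk: "r < n" "k < n"
    have dd: "int n dvd int r - int k - int n \<longleftrightarrow> r = k"
      using arg_cong[OF circulant_0, of "\<lambda>X. X $$ (r, k)"] rk
        dvd_add_triv_right_iff[of "int n" "int r - int k - int n"]
      by (auto simp: circulant_index split: if_splits)
    have "(- e) div int n = -1 \<longleftrightarrow> e = int n" if e: "int n dvd e"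
    proof -
      obtain m where m: "e = int n * m" using e by (auto elim: dvdE)
      have "(- e) div int n = - m"
        using nonzero_mult_div_cancel_left[of "int n" "- m"] n_pos by (simp add: m)
      then show ?thesis using m n_pos by auto
    qed
    then show "lam_coeff (principal n (fls_X_inv \<cdot>\<^sub>m 1\<^sub>m n)) e $$ (r, k)
       = (if e = int n then circulant n (int n) else 0\<^sub>m n n) $$ (r, k)"
      using rk dd n_pos by (auto simp: principal_coeff circulant_index)
  qed auto
  then show ?thesis unfolding eq by (simp add: has_top_def)
qed

text \<open>The prescribed coefficient e_{1n} of \<lambda> contributes a 1 in weight 1, so the top
  degree d is at least 1. If d > 1, the n-th power of Y has the nonzero factor a^n in weight n d >
  n, against Y^n = \<lambda> I. The same corner entry shows that the leading factor is 1.\<close>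

lemma is_Y_top:
  assumes Y: "is_Y n S u Y" and p: "p \<in> S"
  shows "has_top (principal n (Y p)) 1 (circulant n 1)"
proof -
  note fl = is_Y_flat[OF Y]
  have corner: "0 < n" "n - 1 < n" "(int 0 - int (n - 1) - 1) div int n = -1" "int n dvd int 0 - int (n - 1) - 1"
  proof -
    have *: "int 0 - int (n - 1) - 1 = int n * (-1)" using n_ge by simp
    show "(int 0 - int (n - 1) - 1) div int n = -1" "int n dvd int 0 - int (n - 1) - 1"
      unfolding * using n_ge nonzero_mult_div_cancel_left[of "int n" "-1"] by auto
  qed (use n_ge in auto)
  have e1: "lam_coeff (principal n (Y q)) 1 $$ (0, n - 1) = 1" if "q \<in> S" for q
  proof -
    have c: "Y q \<in> carrier_mat n n" by (rule is_Y_carrier[OF Y that])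
    have "fls_nth (Y q $$ (0, n - 1)) (-1) = lam_coeff (Y q) 1 $$ (0, n - 1)"
      using c n_ge by (simp add: lam_coeff_index)
    also have "\<dots> = 1" using Y that n_ge by (simp add: is_Y_def elem_mat_def)
    finally have "fls_nth (Y q $$ (0, n - 1)) (-1) = 1" .
    then show ?thesis unfolding principal_coeff[OF corner(1,2)] corner(3) using corner(4) by simp
  qed
  have "lam_coeff (principal n (Y p)) 1 \<noteq> 0\<^sub>m n n"
  proof
    assume "lam_coeff (principal n (Y p)) 1 = 0\<^sub>m n n"
    then show False using e1[OF p] n_ge by simp
  qed
  from top_degree[OF fl _ p this, of 1]
  obtain d a q where d: "d \<ge> 1" "q \<in> S" "a \<noteq> 0" "has_top (principal n (Y q)) d (a \<cdot>\<^sub>m circulant n d)"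
    and all: "\<forall>q\<in>S. \<exists>a. has_top (principal n (Y q)) d (a \<cdot>\<^sub>m circulant n d)"
    using Y unfolding is_Y_def by blast
  have "d = 1"
  proof (rule ccontr)
    assume "d \<noteq> 1"
    then have "int n * d > int n * 1" using d(1) n_ge by (intro mult_strict_left_mono) auto
    then have "lam_coeff (principal n (Y q) ^\<^sub>m n) (int n * d) = 0\<^sub>m n n"
      using is_Y_pow_n[OF Y d(2)] by (simp add: has_top_def)
    moreover have "lam_coeff (principal n (Y q) ^\<^sub>m n) (int n * d) = a ^ n \<cdot>\<^sub>m circulant n (int n * d)"
      using has_top_pow[OF d(4), of n] by (simp add: has_top_def)
    ultimately show False using d(3) by (simp add: circulant_eq_0)
  qed
  then obtain a where a: "has_top (principal n (Y p)) 1 (a \<cdot>\<^sub>m circulant n 1)" using all p by blast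
  then have "lam_coeff (principal n (Y p)) 1 $$ (0, n - 1) = (a \<cdot>\<^sub>m circulant n 1) $$ (0, n - 1)"
    by (simp add: has_top_def)
  then have "a = 1" unfolding e1[OF p] using corner circulant_index[OF corner(1,2), of 1] by simp
  moreover have "1 \<cdot>\<^sub>m circulant n 1 = circulant n 1" by (rule eqI) auto
  ultimately show ?thesis using a by simp
qed

text \<open>Both series start with the cyclic shift in weight 1. If their difference starts in
  weight d with a factor a \<noteq> 0 at some point, then the difference of the n-th powers starts
  in weight d + n - 1 with the factor n a; but both n-th powers are \<lambda> I.\<close>

lemma is_Y_unique:
  assumes Y: "is_Y n S u Y" and Y': "is_Y n S u Y'" and p: "p \<in> S"
  shows "Y p = Y' p"
proof (rule ccontr)
  assume ne: "Y p \<noteq> Y' p"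
  note c = is_Y_carrier[OF Y] is_Y_carrier[OF Y']
  have fl: "flat u (\<lambda>q. Y q - Y' q)"
    unfolding flat_def
  proof (intro ballI conjI allI)
    fix q i assume q: "q \<in> S"
    show "Y q - Y' q \<in> carrier_mat n n" using c[OF q] by simp
    have sm: "x.C_mat n (\<lambda>q. lam_coeff (Y q) i)" "x.C_mat n (\<lambda>q. lam_coeff (Y' q) i)"
      using Y Y' by (simp_all add: is_Y_def x_C_mat_iff)
    have D: "mat_Dx (\<lambda>q. lam_coeff (Y q - Y' q) i) q
      = mat_Dx (\<lambda>q. lam_coeff (Y q) i) q - mat_Dx (\<lambda>q. lam_coeff (Y' q) i) q"
    proof (rule eqI)
      fix r k assume rk: "r < n" "k < n"
      have "Dx (\<lambda>q. lam_coeff (Y q - Y' q) i $$ (r, k)) q = Dx (\<lambda>q. lam_coeff (Y q) i $$ (r, k) - lam_coeff (Y' q) i $$ (r, k)) q"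
        by (rule x.D_cong[OF _ q]) (use rk c in \<open>simp add: lam_coeff_lin index\<close>)
      also have "\<dots> = Dx (\<lambda>q. lam_coeff (Y q) i $$ (r, k)) q - Dx (\<lambda>q. lam_coeff (Y' q) i $$ (r, k)) q"
        by (intro x.D_diff q x.C_matD(2)[OF sm(1)] x.C_matD(2)[OF sm(2)] rk)
      finally show "mat_Dx (\<lambda>q. lam_coeff (Y q - Y' q) i) q $$ (r, k)
        = (mat_Dx (\<lambda>q. lam_coeff (Y q) i) q - mat_Dx (\<lambda>q. lam_coeff (Y' q) i) q) $$ (r, k)"
        using rk c[OF q] by (simp add: mat_Dx_eq x.mat_D_index[where n = n] index del: index_minus_mat)
    qed (use c[OF q] in \<open>simp_all add: mat_Dx_eq\<close>)
    have e: "mat_Dx (\<lambda>q. lam_coeff (Y q) i) q + lam_coeff (Lax u q * Y q - Y q * Lax u q) i = 0\<^sub>m n n"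
      "mat_Dx (\<lambda>q. lam_coeff (Y' q) i) q + lam_coeff (Lax u q * Y' q - Y' q * Lax u q) i = 0\<^sub>m n n"
      using is_Y_flat[OF Y] is_Y_flat[OF Y'] q by (auto simp: flat_def)
    show "mat_Dx (\<lambda>q. lam_coeff (Y q - Y' q) i) q
       + lam_coeff (Lax u q * (Y q - Y' q) - (Y q - Y' q) * Lax u q) i = 0\<^sub>m n n"
      unfolding D
    proof (rule eqI)
      fix r k assume rk: "r < n" "k < n"
      show "(mat_Dx (\<lambda>q. lam_coeff (Y q) i) q - mat_Dx (\<lambda>q. lam_coeff (Y' q) i) q
         + lam_coeff (Lax u q * (Y q - Y' q) - (Y q - Y' q) * Lax u q) i) $$ (r, k) = 0\<^sub>m n n $$ (r, k)"
        using arg_cong[OF e(1), of "\<lambda>X. X $$ (r, k)"] arg_cong[OF e(2), of "\<lambda>X. X $$ (r, k)"] rk c[OF q]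
        by (simp add: ring_distribs lam_coeff_lin index mat_Dx_eq del: index_minus_mat index_add_mat index_mult_mat)
    qed (use c[OF q] in \<open>simp_all add: mat_Dx_eq\<close>)
  qed
  obtain r k where rk: "r < n" "k < n" "Y p $$ (r, k) \<noteq> Y' p $$ (r, k)"
    using ne eqI[OF c[OF p]] by blast
  then obtain m where m: "fls_nth (Y p $$ (r, k)) m \<noteq> fls_nth (Y' p $$ (r, k)) m"
    using fls_eqI by blast
  \<comment> \<open>The weight of a coefficient in which the two series differ.\<close>
  define e0 where "e0 = int r - int k - int n * m"
  have "lam_coeff (principal n (Y p - Y' p)) e0 \<noteq> 0\<^sub>m n n"
  proof
    assume "lam_coeff (principal n (Y p - Y' p)) e0 = 0\<^sub>m n n"
    then have "lam_coeff (principal n (Y p - Y' p)) e0 $$ (r, k) = 0" using rk by simp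
    then show False using rk m n_pos c[OF p] by (simp add: principal_coeff e0_def)
  qed
  moreover have "lam_coeff (Y q - Y' q) i = 0\<^sub>m n n" if "q \<in> S" "i > 1" for q i
    using Y Y' that c[OF that(1)] by (simp add: is_Y_def lam_coeff_lin)
  ultimately obtain d a q where d: "q \<in> S" "a \<noteq> 0" "has_top (principal n (Y q - Y' q)) d (a \<cdot>\<^sub>m circulant n d)"
    using top_degree[OF fl _ p, of 1] by blast
  have "has_top (principal n (Y q) ^\<^sub>m n - principal n (Y' q) ^\<^sub>m n) (d + int n - 1)
     ((real n * a) \<cdot>\<^sub>m circulant n (d + int n - 1))"
    by (rule has_top_pow_diff[OF is_Y_top[OF Y d(1)] is_Y_top[OF Y' d(1)]])
      (use d c[OF d(1)] in \<open>simp add: principal_diff\<close>)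
  moreover have "principal n (Y q) ^\<^sub>m n - principal n (Y' q) ^\<^sub>m n = 0\<^sub>m n n"
    using c[OF d(1)] Y Y' d(1) by (simp add: principal_pow[symmetric] is_Y_def)
  moreover have "lam_coeff (0\<^sub>m n n) i = 0\<^sub>m n n" for i by (rule eqI) (auto simp: lam_coeff_index)
  ultimately have "(real n * a) \<cdot>\<^sub>m circulant n (d + int n - 1) = 0\<^sub>m n n" by (simp add: has_top_def)
  then show False using d(2) n_ge by (simp add: circulant_eq_0)
qed

text \<open>Membership of the bracket in V_n makes its first n - 1 columns vanish. Right
  multiplication by b moves columns one place to the left, so the vanishing of column c expresses
  column c + 1 of M through column c and its x-derivative. Agreement of the first columns is needed
  on all of S, since each step differentiates.\<close>

lemma first_column_unique:
  assumes A: "\<And>p. p \<in> S \<Longrightarrow> A p = b_mat n + u_mat n (\<lambda>i. u i p)"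
    and M: "\<And>p. p \<in> S \<Longrightarrow> M p \<in> carrier_mat n n" "\<And>p. p \<in> S \<Longrightarrow> bracket_Dx A M p \<in> V_space n"
    and M': "\<And>p. p \<in> S \<Longrightarrow> M' p \<in> carrier_mat n n" "\<And>p. p \<in> S \<Longrightarrow> bracket_Dx A M' p \<in> V_space n"
    and first: "\<And>p r. p \<in> S \<Longrightarrow> r < n \<Longrightarrow> M p $$ (r, 0) = M' p $$ (r, 0)"
    and p: "p \<in> S"
  shows "M p = M' p"
proof -
  have Ac: "A p \<in> carrier_mat n n" if "p \<in> S" for p using A[OF that] by simp
  have next_col: "N p $$ (r, c + 1) = Dx (\<lambda>q. N q $$ (r, c)) p + (\<Sum>k<n. A p $$ (r, k) * N p $$ (k, c))"
    if "p \<in> S" "N p \<in> carrier_mat n n" "bracket_Dx A N p \<in> V_space n" "r < n" "c + 1 < n" for N p r c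
  proof -
    have c: "c < n" using that by simp
    have "bracket_Dx A N p $$ (r, c) = 0"
      using that by (auto simp: V_space_def u_mat_def)
    moreover have "(N p * A p) $$ (r, c) = (\<Sum>k<n. if k = c + 1 then N p $$ (r, k) else 0)"
      unfolding mult_index[OF that(2) Ac[OF that(1)] that(4) c]
      using c that by (intro sum.cong refl) (simp add: A[OF that(1)] b_mat_def u_mat_def)
    ultimately show ?thesis
      using that c Ac[OF that(1)] mult_index[OF Ac[OF that(1)] that(2,4) c]
      by (simp add: bracket_Dx_def index mat_Dx_eq x.mat_D_index[where n = n] del: index_add_mat index_minus_mat index_mult_mat)
  qed
  have "\<forall>p\<in>S. \<forall>r<n. M p $$ (r, c) = M' p $$ (r, c)" if "c < n" for c
    using that
  proof (induction c)
    case 0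
    then show ?case using first by simp
  next
    case (Suc c)
    then have IH: "M p $$ (r, c) = M' p $$ (r, c)" if "p \<in> S" "r < n" for p r using that by simp
    show ?case
    proof (intro ballI allI impI)
      fix p r assume p: "p \<in> S" and r: "r < n"
      have "Dx (\<lambda>q. M q $$ (r, c)) p = Dx (\<lambda>q. M' q $$ (r, c)) p"
        by (rule x.D_cong[OF _ p]) (rule IH[OF _ r])
      then show "M p $$ (r, Suc c) = M' p $$ (r, Suc c)"
        using next_col[OF p M(1)[OF p] M(2)[OF p] r, of c] next_col[OF p M'(1)[OF p] M'(2)[OF p] r, of c] Suc.prems
        by (simp add: IH[OF p])
    qed
  qed
  then show ?thesis using M(1)[OF p] M'(1)[OF p] p by (intro eqI) auto
qed

text \<open>A strictly upper triangular matrix has zero first column, so two candidates give the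
  same first column of Y_{j,0} - \<zeta>.\<close>

lemma is_zeta_unique:
  assumes Y: "is_Y n S u Y" and z: "is_zeta n j S u Y \<zeta>" "is_zeta n j S u Y \<zeta>'" and p: "p \<in> S"
  shows "\<zeta> p = \<zeta>' p"
proof -
  have Yc: "lam_coeff (Y q ^\<^sub>m j) 0 \<in> carrier_mat n n" if "q \<in> S" for q
    using is_Y_carrier[OF Y that] by simp
  have zc: "\<zeta> q \<in> carrier_mat n n" "\<zeta>' q \<in> carrier_mat n n" if "q \<in> S" for q
    using z that by (auto simp: is_zeta_def smooth_mat_on_def)
  have "lam_coeff (Y p ^\<^sub>m j) 0 - \<zeta> p = lam_coeff (Y p ^\<^sub>m j) 0 - \<zeta>' p"
    by (rule first_column_unique[where A = "\<lambda>q. b_mat n + u_mat n (\<lambda>i. u i q)" and u = u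
          and M = "\<lambda>q. lam_coeff (Y q ^\<^sub>m j) 0 - \<zeta> q" and M' = "\<lambda>q. lam_coeff (Y q ^\<^sub>m j) 0 - \<zeta>' q"])
      (use z zc Yc p n_ge in \<open>auto simp: is_zeta_def index simp del: index_minus_mat\<close>)
  note eq = this
  show ?thesis
  proof (rule eqI)
    fix r k assume "r < n" "k < n"
    then show "\<zeta> p $$ (r, k) = \<zeta>' p $$ (r, k)"
      using arg_cong[OF eq, of "\<lambda>X. X $$ (r, k)"] zc[OF p] Yc[OF p]
      by (simp add: index del: index_minus_mat)
  qed (use zc[OF p] in auto)
qed

text \<open>The curve flow and the frame each speak of some Z; uniqueness allows the two to be
  identified.\<close>

lemma is_Z_unique:
  assumes "is_Z n j S u Z" "is_Z n j S u Z'" "p \<in> S"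
  shows "Z p = Z' p"
proof -
  obtain Y \<zeta> where Y: "is_Y n S u Y" "is_zeta n j S u Y \<zeta>"
    "\<And>p. p \<in> S \<Longrightarrow> Z p = map_mat lam_poly_part (Y p ^\<^sub>m j) - map_mat (\<lambda>a. [: a :]) (\<zeta> p)"
    using assms(1) by (auto simp: is_Z_def)
  obtain Y' \<zeta>' where Y': "is_Y n S u Y'" "is_zeta n j S u Y' \<zeta>'"
    "\<And>p. p \<in> S \<Longrightarrow> Z' p = map_mat lam_poly_part (Y' p ^\<^sub>m j) - map_mat (\<lambda>a. [: a :]) (\<zeta>' p)"
    using assms(2) by (auto simp: is_Z_def)
  have eq: "Y q = Y' q" if "q \<in> S" for q by (rule is_Y_unique[OF Y(1) Y'(1) that])
  have "is_zeta n j S u Y \<zeta>'"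
    unfolding is_zeta_def
  proof (intro conjI ballI)
    show "smooth_mat_on n S \<zeta>'" using Y'(2) by (simp add: is_zeta_def)
    fix p assume p: "p \<in> S"
    show "\<forall>r<n. \<forall>c\<le>r. \<zeta>' p $$ (r, c) = 0" using Y'(2) p by (simp add: is_zeta_def)
    have "bracket_Dx (\<lambda>q. b_mat n + u_mat n (\<lambda>i. u i q)) (\<lambda>q. lam_coeff (Y q ^\<^sub>m j) 0 - \<zeta>' q) p
      = bracket_Dx (\<lambda>q. b_mat n + u_mat n (\<lambda>i. u i q)) (\<lambda>q. lam_coeff (Y' q ^\<^sub>m j) 0 - \<zeta>' q) p"
      using x.mat_D_cong[OF p, of "\<lambda>q. lam_coeff (Y q ^\<^sub>m j) 0 - \<zeta>' q" "\<lambda>q. lam_coeff (Y' q ^\<^sub>m j) 0 - \<zeta>' q"]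
      unfolding bracket_Dx_def mat_Dx_eq by (simp add: eq p)
    then show "bracket_Dx (\<lambda>q. b_mat n + u_mat n (\<lambda>i. u i q)) (\<lambda>q. lam_coeff (Y q ^\<^sub>m j) 0 - \<zeta>' q) p \<in> V_space n"
      using Y'(2) p by (simp add: is_zeta_def)
  qed
  then have "\<zeta> p = \<zeta>' p" by (intro is_zeta_unique[OF Y(1,2) _ assms(3)])
  then show ?thesis using Y(3)[OF assms(3)] Y'(3)[OF assms(3)] eq[OF assms(3)] by simp
qed

end

section \<open>Differentiating a linear system in the spectral parameter\<close>

lemma vector_derivative_bound:
  fixes f :: "real \<Rightarrow> 'a::real_normed_vector"
  assumes "\<And>s. s \<in> {a..b} \<Longrightarrow> (f has_vector_derivative f' s) (at s)"
    and "\<And>s. s \<in> {a..b} \<Longrightarrow> norm (f' s) \<le> B"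
    and "x \<in> {a..b}" "y \<in> {a..b}"
  shows "norm (f x - f y) \<le> B * \<bar>x - y\<bar>"
proof -
  have "norm (f x - f y) \<le> B * norm (x - y)"
  proof (rule differentiable_bound[of "{a..b}" f "\<lambda>s h. h *\<^sub>R f' s"])
    show "(f has_derivative (\<lambda>h. h *\<^sub>R f' s)) (at s within {a..b})" if "s \<in> {a..b}" for s
      using assms(1)[OF that] by (simp add: has_vector_derivative_def has_derivative_at_withinI)
    show "onorm (\<lambda>h. h *\<^sub>R f' s) \<le> B" if "s \<in> {a..b}" for s
      using assms(2)[OF that] by (intro onorm_le) (simp add: mult.commute[of B] mult_left_mono)
  qed (use assms in auto)
  then show ?thesis by simp
qed

lemma eventually_nhds_box:
  fixes s0 :: real
  assumes "eventually P (nhds (s0, 0::complex))"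
  shows "\<exists>d>0. \<forall>s l. \<bar>s - s0\<bar> < d \<longrightarrow> norm l < d \<longrightarrow> P (s, l)"
proof -
  obtain e where e: "e > 0" "\<And>q. dist q (s0, 0) < e \<Longrightarrow> P q"
    using assms unfolding eventually_nhds_metric by auto
  have "P (s, l)" if "\<bar>s - s0\<bar> < e / 2" "norm l < e / 2" for s l
  proof (rule e(2))
    have "dist (s, l) (s0, 0) \<le> \<bar>s - s0\<bar> + norm l"
      using sqrt_sum_squares_le_sum_abs[of "\<bar>s - s0\<bar>" "norm l"] by (simp add: dist_prod_def dist_real_def)
    then show "dist (s, l) (s0, 0) < e" using that by linarith
  qed
  then show ?thesis using e(1) by (intro exI[of _ "e / 2"]) auto
qed

text \<open>Exchanges the \<lambda>-derivative at 0 with d/ds without joint differentiability of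
  \<phi>. The quotient Q = (\<phi>(s, \<lambda>) - \<phi>(s, 0)) / \<lambda> has s-derivative
  \<psi>, which is close to c for all small \<lambda> at once; the mean value inequality for Q - s c
  survives the limit \<lambda> \<rightarrow> 0.\<close>

lemma lam_derivative_line:
  fixes \<phi> \<psi> :: "real \<Rightarrow> complex \<Rightarrow> complex"
  assumes d: "\<delta> > 0" "\<rho> > 0"
    and der: "\<And>s l. \<bar>s - s0\<bar> < \<delta> \<Longrightarrow> norm l < \<rho> \<Longrightarrow> ((\<lambda>s. \<phi> s l) has_vector_derivative l * \<psi> s l) (at s)"
    and hol: "\<And>s. \<bar>s - s0\<bar> < \<delta> \<Longrightarrow> ((\<lambda>l. \<phi> s l) has_field_derivative \<phi>' s) (at 0)"
    and lim: "((\<lambda>(s, l). \<psi> s l) \<longlongrightarrow> c) (nhds (s0, 0))"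
  shows "(\<phi>' has_vector_derivative c) (at s0)"
  unfolding has_vector_derivative_def has_derivative_at_alt
proof (intro conjI allI impI)
  show "bounded_linear (\<lambda>h. h *\<^sub>R c)" by (rule bounded_linear_scaleR_left)
  fix e :: real assume e: "e > 0"
  have "eventually (\<lambda>q. dist (case q of (s, l) \<Rightarrow> \<psi> s l) c < e) (nhds (s0, 0))"
    by (rule tendstoD[OF lim e])
  from eventually_nhds_box[OF this] obtain d' where d': "d' > 0"
    "\<And>s l. \<bar>s - s0\<bar> < d' \<Longrightarrow> norm l < d' \<Longrightarrow> norm (\<psi> s l - c) < e"
    by (auto simp: dist_norm)
  define b where "b = min d' \<delta> / 2"
  have b: "b > 0" "b < d'" "b < \<delta>" using d' d by (auto simp: b_def)
  show "\<exists>d>0. \<forall>y. norm (y - s0) < d \<longrightarrow> norm (\<phi>' y - \<phi>' s0 - (y - s0) *\<^sub>R c) \<le> e * norm (y - s0)"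
  proof (intro exI[of _ b] conjI allI impI b(1))
    fix y assume y: "norm (y - s0) < b"
    define Q where "Q l s = (\<phi> s l - \<phi> s 0) / l" for l s
    have bound: "norm (Q l y - Q l s0 - (y - s0) *\<^sub>R c) \<le> e * norm (y - s0)"
      if l: "l \<noteq> 0" "norm l < min d' \<rho>" for l
    proof -
      have "norm ((Q l y - y *\<^sub>R c) - (Q l s0 - s0 *\<^sub>R c)) \<le> e * \<bar>y - s0\<bar>"
      proof (rule vector_derivative_bound[where a = "s0 - b" and b = "s0 + b" and f' = "\<lambda>s. \<psi> s l - c"])
        fix s assume s: "s \<in> {s0 - b..s0 + b}"
        then have s': "\<bar>s - s0\<bar> < \<delta>" "\<bar>s - s0\<bar> < d'" using b by auto
        have 1: "((\<lambda>s. \<phi> s l) has_vector_derivative l * \<psi> s l) (at s)" by (rule der) (use s' l in auto)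
        \<comment> \<open>At \<lambda> = 0 the hypothesis says that \<phi>(s, 0) is stationary in s,
          so the subtracted term does not contribute.\<close>
        have 2: "((\<lambda>s. \<phi> s 0) has_vector_derivative 0 * \<psi> s 0) (at s)" by (rule der) (use s' d in auto)
        have "((\<lambda>s. (\<phi> s l - \<phi> s 0) * inverse l) has_vector_derivative (l * \<psi> s l - 0 * \<psi> s 0) * inverse l) (at s)"
          by (intro has_vector_derivative_mult_left has_vector_derivative_diff 1 2)
        moreover have "(\<lambda>s. (\<phi> s l - \<phi> s 0) * inverse l) = (\<lambda>s. Q l s)"
          by (rule ext) (simp add: Q_def divide_inverse)
        moreover have "(l * \<psi> s l - 0 * \<psi> s 0) * inverse l = \<psi> s l" using l by simp
        ultimately have "((\<lambda>s. Q l s) has_vector_derivative \<psi> s l) (at s)" by (simp only:)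
        moreover have "((\<lambda>s. s *\<^sub>R c) has_vector_derivative c) (at s)"
          by (auto intro!: derivative_eq_intros simp: has_vector_derivative_def)
        ultimately show "((\<lambda>s. Q l s - s *\<^sub>R c) has_vector_derivative \<psi> s l - c) (at s)"
          by (rule has_vector_derivative_diff)
        show "norm (\<psi> s l - c) \<le> e" using d'(2)[OF s'(2)] l by (simp add: less_imp_le)
      qed (use y b in auto)
      then show ?thesis by (simp add: algebra_simps)
    qed
    have lim': "((\<lambda>l. Q l s) \<longlongrightarrow> \<phi>' s) (at 0)" if "\<bar>s - s0\<bar> < \<delta>" for s
      using hol[OF that] unfolding has_field_derivative_iff Q_def by simp
    have "((\<lambda>l. norm (Q l y - Q l s0 - (y - s0) *\<^sub>R c)) \<longlongrightarrow> norm (\<phi>' y - \<phi>' s0 - (y - s0) *\<^sub>R c)) (at 0)"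
      by (intro tendsto_intros lim') (use y b in auto)
    moreover have "eventually (\<lambda>l. norm (Q l y - Q l s0 - (y - s0) *\<^sub>R c) \<le> e * norm (y - s0)) (at 0)"
      unfolding eventually_at
      by (intro exI[of _ "min d' \<rho>"]) (use d d' bound in \<open>auto simp: dist_norm\<close>)
    ultimately show "norm (\<phi>' y - \<phi>' s0 - (y - s0) *\<^sub>R c) \<le> e * norm (y - s0)"
      by (intro tendsto_upperbound) auto
  qed
qed

text \<open>
  For a linear system \<open>R\<^sub>s = \<lambda> R B\<close> the supremum of \<open>R\<close> on a short interval is controlled by the value
  at the centre, so \<open>R\<close> is jointly continuous at \<open>\<lambda> = 0\<close>.
\<close>

lemma lam_derivative_linear_system:
  fixes R :: "real \<Rightarrow> complex \<Rightarrow> nat \<Rightarrow> complex" and B :: "real \<Rightarrow> complex \<Rightarrow> nat \<Rightarrow> nat \<Rightarrow> complex"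
  assumes d: "\<delta> > 0" "\<rho> > 0"
    and der: "\<And>s l k. \<bar>s - s0\<bar> < \<delta> \<Longrightarrow> norm l < \<rho> \<Longrightarrow> k < n \<Longrightarrow>
      ((\<lambda>s. R s l k) has_vector_derivative l * (\<Sum>m<n. R s l m * B s l m k)) (at s)"
    and B: "\<And>m k. m < n \<Longrightarrow> k < n \<Longrightarrow> ((\<lambda>(s, l). B s l m k) \<longlongrightarrow> B' m k) (nhds (s0, 0))"
    and hol: "\<And>s k. \<bar>s - s0\<bar> < \<delta> \<Longrightarrow> k < n \<Longrightarrow> ((\<lambda>l. R s l k) has_field_derivative R' s k) (at 0)"
    and k: "k < n"
  shows "((\<lambda>s. R' s k) has_vector_derivative (\<Sum>m<n. R s0 0 m * B' m k)) (at s0)"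
proof -
  \<comment> \<open>The summand 1 makes K a strict bound at (s0, 0), which then persists in a
    neighbourhood.\<close>
  define K where "K = (\<Sum>m<n. \<Sum>k<n. norm (B' m k)) + 1"
  have K: "K > 0" unfolding K_def by (intro add_nonneg_pos sum_nonneg) auto
  have B0K: "norm (B' m k) < K" if "m < n" "k < n" for m k
  proof -
    have "norm (B' m k) \<le> (\<Sum>k<n. norm (B' m k))" using that by (intro member_le_sum) auto
    also have "\<dots> \<le> (\<Sum>m<n. \<Sum>k<n. norm (B' m k))"
      using that(1) by (intro member_le_sum[of m "{..<n}" "\<lambda>m. \<Sum>k<n. norm (B' m k)"] sum_nonneg) auto
    finally show ?thesis by (simp add: K_def)
  qed
  have "eventually (\<lambda>q. \<forall>m\<in>{..<n}. \<forall>k\<in>{..<n}. norm (case q of (s, l) \<Rightarrow> B s l m k) < K) (nhds (s0, 0))"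
    using order_tendstoD(2)[OF tendsto_norm[OF B] B0K] by (intro eventually_ball_finite ballI) auto
  from eventually_nhds_box[OF this] obtain d' where d': "d' > 0"
    "\<And>s l m k. \<bar>s - s0\<bar> < d' \<Longrightarrow> norm l < d' \<Longrightarrow> m < n \<Longrightarrow> k < n \<Longrightarrow> norm (B s l m k) < K"
    by auto
  define N where "N s l = (\<Sum>k<n. norm (R s l k))" for s l
  have N0: "N s l \<ge> 0" for s l unfolding N_def by (intro sum_nonneg) auto
  define b where "b = min d' \<delta> / 2"
  have b: "b > 0" "b < d'" "b < \<delta>" using d' d by (auto simp: b_def)
  \<comment> \<open>The last term of the minimum makes |\<lambda>| n b K at most 1/2, so that the
    contribution of the supremum can be absorbed on the left.\<close>
  define e where "e = min (min d' \<rho>) (1 / (2 * (real n * b * K + 1)))"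
  have den: "real n * b * K + 1 > 0" using K b by (intro add_nonneg_pos mult_nonneg_nonneg) auto
  then have e: "e > 0" "e \<le> d'" "e \<le> \<rho>" using d' d by (auto simp: e_def)
  have key: "norm (R s l k - R s0 l k) \<le> norm l * K * (2 * N s0 l) * b"
    if s: "s \<in> {s0 - b..s0 + b}" and l: "norm l < e" and k: "k < n" for s l k
  proof -
    have dist: "\<bar>s - s0\<bar> < \<delta>" "\<bar>s - s0\<bar> < d'" if "s \<in> {s0 - b..s0 + b}" for s using that b by auto
    have lr: "norm l < \<rho>" "norm l < d'" using l e by auto
    have cont: "continuous_on {s0 - b..s0 + b} (\<lambda>s. N s l)"
      unfolding N_def
    proof (intro continuous_on_sum continuous_on_norm)
      fix k assume "k \<in> {..<n}"
      then show "continuous_on {s0 - b..s0 + b} (\<lambda>s. R s l k)"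
        by (intro continuous_at_imp_continuous_on ballI)
          (rule has_vector_derivative_continuous[OF der[OF dist(1) lr(1)]], auto)
    qed
    \<comment> \<open>The point of the closed interval where the norm of R is largest. Bounding the
      derivative by the value there gives N(s1) \<le> N(s0) + N(s1) / 2.\<close>
    obtain s1 where s1: "s1 \<in> {s0 - b..s0 + b}" "\<And>s. s \<in> {s0 - b..s0 + b} \<Longrightarrow> N s l \<le> N s1 l"
      using continuous_attains_sup[OF compact_Icc _ cont] b by auto
    have der_bound: "norm (l * (\<Sum>m<n. R s l m * B s l m k)) \<le> norm l * K * N s1 l"
      if "s \<in> {s0 - b..s0 + b}" "k < n" for s k
    proof -
      have "norm (\<Sum>m<n. R s l m * B s l m k) \<le> (\<Sum>m<n. norm (R s l m) * K)"
        using that d'(2)[OF dist(2)[OF that(1)] lr(2)]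
        by (intro sum_norm_le) (simp add: norm_mult mult_left_mono less_imp_le)
      also have "\<dots> = K * N s l" by (simp add: N_def sum_distrib_left mult.commute)
      also have "\<dots> \<le> K * N s1 l" using s1(2)[OF that(1)] K by simp
      finally show ?thesis by (simp add: norm_mult mult_left_mono mult.assoc)
    qed
    have diff: "norm (R s l k - R s0 l k) \<le> norm l * K * N s1 l * b" if "s \<in> {s0 - b..s0 + b}" "k < n" for s k
    proof -
      have "norm (R s l k - R s0 l k) \<le> norm l * K * N s1 l * \<bar>s - s0\<bar>"
        by (rule vector_derivative_bound[where a = "s0 - b" and b = "s0 + b"
              and f = "\<lambda>s. R s l k" and f' = "\<lambda>s. l * (\<Sum>m<n. R s l m * B s l m k)"])
          (use that b der[OF dist(1) lr(1)] der_bound in auto)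
      also have "\<dots> \<le> norm l * K * N s1 l * b"
        using that K N0[of s1 l] by (intro mult_left_mono) (auto intro!: mult_nonneg_nonneg)
      finally show ?thesis .
    qed
    have "N s1 l \<le> (\<Sum>k<n. norm (R s0 l k) + norm l * K * N s1 l * b)"
      unfolding N_def[of s1]
    proof (rule sum_mono)
      fix k assume "k \<in> {..<n}"
      then show "norm (R s1 l k) \<le> norm (R s0 l k) + norm l * K * (\<Sum>k<n. norm (R s1 l k)) * b"
        using diff[OF s1(1), of k] norm_triangle_ineq2[of "R s1 l k" "R s0 l k"] by (simp add: N_def)
    qed
    also have "\<dots> = N s0 l + norm l * (real n * b * K) * N s1 l"
      by (simp add: N_def sum.distrib mult_ac)
    finally have "N s1 l \<le> N s0 l + norm l * (real n * b * K) * N s1 l" .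
    moreover have "norm l * (real n * b * K) \<le> 1 / 2"
    proof -
      have "norm l * (real n * b * K) \<le> 1 / (2 * (real n * b * K + 1)) * (real n * b * K)"
        using l K b by (intro mult_right_mono) (auto simp: e_def)
      also have "\<dots> \<le> 1 / 2" using den K b by (simp add: field_simps)
      finally show ?thesis .
    qed
    then have "norm l * (real n * b * K) * N s1 l \<le> 1 / 2 * N s1 l"
      by (intro mult_right_mono N0)
    ultimately have "N s1 l \<le> 2 * N s0 l" by linarith
    then have "norm l * K * N s1 l * b \<le> norm l * K * (2 * N s0 l) * b"
      using K b by (intro mult_right_mono mult_left_mono) auto
    then show ?thesis using diff[OF s k] by linarith
  qed
  have lim0: "((\<lambda>l. R s0 l k) \<longlongrightarrow> R s0 0 k) (nhds 0)" if "k < n" for k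
  proof -
    have "isCont (\<lambda>l. R s0 l k) 0" using hol[of s0 k] d that by (auto intro: DERIV_isCont)
    then show ?thesis
      using tendsto_at_iff_tendsto_nhds[of "\<lambda>l. R s0 l k" 0] by (simp add: isCont_def)
  qed
  have snd: "((\<lambda>q. f (snd q)) \<longlongrightarrow> x) (nhds (s0, 0))" if "(f \<longlongrightarrow> x) (nhds 0)" for f :: "complex \<Rightarrow> 'b::topological_space" and x
  proof (rule filterlim_compose[OF that])
    show "filterlim snd (nhds 0) (nhds (s0, 0::complex))"
      using tendsto_snd[of "\<lambda>q. q" "(s0, 0::complex)" "nhds (s0, 0)"] by (simp add: filterlim_ident)
  qed
  have limR: "((\<lambda>(s, l). R s l k) \<longlongrightarrow> R s0 0 k) (nhds (s0, 0))" if k: "k < n" for k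
  proof -
    \<comment> \<open>Splits R(s, \<lambda>) - R(s0, 0) into the change in s at fixed \<lambda>,
      which carries a factor |\<lambda>|, and the change in \<lambda> at s0, where R is
      continuous.\<close>
    define G where "G l = norm l * K * (2 * N s0 l) * b + norm (R s0 l k - R s0 0 k)" for l
    have "(G \<longlongrightarrow> norm (0::complex) * K * (2 * (\<Sum>k<n. norm (R s0 0 k))) * b + norm (R s0 0 k - R s0 0 k)) (nhds 0)"
      unfolding G_def N_def by (intro tendsto_intros lim0 k filterlim_ident) auto
    then have G: "((\<lambda>q. G (snd q)) \<longlongrightarrow> 0) (nhds (s0, 0))" by (intro snd) simp
    have "eventually (\<lambda>q::real \<times> complex. dist q (s0, 0) < min b e) (nhds (s0, 0))"
      unfolding eventually_nhds_metric using b e by (intro exI[of _ "min b e"]) simp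
    then have "eventually (\<lambda>q. norm ((case q of (s, l) \<Rightarrow> R s l k) - R s0 0 k) \<le> G (snd q)) (nhds (s0, 0))"
    proof eventually_elim
      case (elim q)
      obtain s l where q: "q = (s, l)" by (cases q)
      have "dist s s0 \<le> dist q (s0, 0)" "dist l 0 \<le> dist q (s0, 0)"
        using dist_fst_le[of q "(s0, 0)"] dist_snd_le[of q "(s0, 0)"] by (simp_all add: q)
      then have sl: "s \<in> {s0 - b..s0 + b}" "norm l < e" using elim by (auto simp: dist_real_def)
      have "norm (R s l k - R s0 0 k) \<le> norm (R s l k - R s0 l k) + norm (R s0 l k - R s0 0 k)"
        using norm_triangle_ineq[of "R s l k - R s0 l k" "R s0 l k - R s0 0 k"] by simp
      then show ?case using key[OF sl k] by (simp add: q G_def)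
    qed
    then have "((\<lambda>q. (case q of (s, l) \<Rightarrow> R s l k) - R s0 0 k) \<longlongrightarrow> 0) (nhds (s0, 0))"
      using G by (rule Lim_null_comparison)
    then show ?thesis by (simp add: LIM_zero_iff)
  qed
  show ?thesis
  proof (rule lam_derivative_line[OF d, where \<phi> = "\<lambda>s l. R s l k" and \<psi> = "\<lambda>s l. \<Sum>m<n. R s l m * B s l m k"])
    show "((\<lambda>(s, l). \<Sum>m<n. R s l m * B s l m k) \<longlongrightarrow> (\<Sum>m<n. R s0 0 m * B' m k)) (nhds (s0, 0))"
      using limR B k unfolding case_prod_unfold by (intro tendsto_intros) auto
  qed (use der hol k in auto)
qed

section \<open>Determinants, adjugates and inverses with smooth entries\<close>

context function_derivation begin

lemma C_det: "C_mat m M \<Longrightarrow> C (\<lambda>p. det (M p))"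
proof -
  assume M: "C_mat m M"
  have "C (\<lambda>q. \<Sum>\<pi> \<in> {\<pi>. \<pi> permutes {0..<m}}. signof \<pi> * (\<Prod>i = 0..<m. M q $$ (i, \<pi> i)))"
    by (intro C_sum C_mult C_const C_prod C_matD(2)[OF M]) (auto dest: permutes_in_image)
  then show ?thesis
    by (rule C_cong[rotated]) (simp only: det_def'[OF C_matD(1)[OF M]])
qed

lemma C_mat_adj:
  assumes M: "C_mat m M"
  shows "C_mat m (\<lambda>p. adj_mat (M p))"
proof (rule C_matI)
  show "adj_mat (M p) \<in> carrier_mat m m" if "p \<in> S" for p
    by (rule adj_mat(1)[OF C_matD(1)[OF M that]])
  fix r c assume rc: "r < m" "c < m"
  have "C_mat (m - 1) (\<lambda>p. mat_delete (M p) c r)"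
  proof (rule C_matI)
    show "mat_delete (M p) c r \<in> carrier_mat (m - 1) (m - 1)" if "p \<in> S" for p
      by (rule mat_delete_carrier[OF C_matD(1)[OF M that]])
    fix i k assume ik: "i < m - 1" "k < m - 1"
    have "C (\<lambda>p. M p $$ (if i < c then i else Suc i, if k < r then k else Suc k))"
      by (rule C_matD(2)[OF M]) (use ik in auto)
    then show "C (\<lambda>p. mat_delete (M p) c r $$ (i, k))"
    proof (rule C_cong[rotated])
      fix p assume p: "p \<in> S"
      have "dim_row (M p) = m" "dim_col (M p) = m" using C_matD(1)[OF M p] by auto
      then show "M p $$ (if i < c then i else Suc i, if k < r then k else Suc k) = mat_delete (M p) c r $$ (i, k)"
        using ik by (simp add: mat_delete_def)
    qed
  qed
  then have "C (\<lambda>p. (-1) ^ (c + r) * det (mat_delete (M p) c r))"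
    by (intro C_mult C_const C_det)
  then show "C (\<lambda>p. adj_mat (M p) $$ (r, c))"
  proof (rule C_cong[rotated])
    fix p assume p: "p \<in> S"
    have "dim_row (M p) = m" "dim_col (M p) = m" using C_matD(1)[OF M p] by auto
    then show "(-1) ^ (c + r) * det (mat_delete (M p) c r) = adj_mat (M p) $$ (r, c)"
      using rc by (simp add: adj_mat_def cofactor_def)
  qed
qed

end

context square_mat begin

text \<open>For determinant 1 the adjugate is the inverse. Its entries are polynomials in those of
  G, so its smoothness is evident, unlike that of \<open>inv_mat\<close>, which is defined through
  elimination.\<close>

lemma det_one_inverse:
  fixes G :: "'a::field mat"
  assumes G: "G \<in> carrier_mat n n" and d: "det G = 1"
  shows "adj_mat G \<in> carrier_mat n n" "G * adj_mat G = 1\<^sub>m n" "adj_mat G * G = 1\<^sub>m n"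
proof -
  have "1 \<cdot>\<^sub>m 1\<^sub>m n = (1\<^sub>m n :: 'a mat)" by (rule eqI) auto
  then show "adj_mat G \<in> carrier_mat n n" "G * adj_mat G = 1\<^sub>m n" "adj_mat G * G = 1\<^sub>m n"
    using adj_mat[OF G] d by simp_all
qed

text \<open>\<open>inv_mat\<close> takes \<open>the\<close> of an option; an explicit inverse shows
  that the elimination succeeds, and uniqueness of inverses identifies its result.\<close>

lemma inv_mat_eq:
  fixes G H :: "'a::field mat"
  assumes G: "G \<in> carrier_mat n n" and H: "H \<in> carrier_mat n n" and GH: "G * H = 1\<^sub>m n"
  shows "inv_mat G = H"
proof -
  have HG: "H * G = 1\<^sub>m n" by (rule right_inverse_imp_left[OF G H GH])
  have "G \<in> Units (ring_mat TYPE('a) n ())"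
    using G H GH HG by (auto simp: Units_def ring_mat_def)
  then obtain B where B: "mat_inverse G = Some B"
    using mat_inverse(1)[OF G, of "()"] by (cases "mat_inverse G") auto
  note B' = mat_inverse(2)[OF G B]
  have "B = B * (G * H)" using GH B' by simp
  also have "\<dots> = H" using B' G H assoc[of B G H] by simp
  finally show ?thesis using B by (simp add: inv_mat_def)
qed

lemma cmat_mult:
  assumes "A \<in> carrier_mat n n" "B \<in> carrier_mat n n"
  shows "map_mat complex_of_real (A * B) = map_mat complex_of_real A * map_mat complex_of_real B"
  using assms by (intro eqI) (auto simp: mult_index simp del: index_mult_mat)

lemma cmat_lin:
  assumes "A \<in> carrier_mat n n" "B \<in> carrier_mat n n"
  shows "map_mat complex_of_real (A + B) = map_mat complex_of_real A + map_mat complex_of_real B"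
    "map_mat complex_of_real (A - B) = map_mat complex_of_real A - map_mat complex_of_real B"
    "map_mat complex_of_real (- A) = - map_mat complex_of_real A"
    "map_mat complex_of_real (k \<cdot>\<^sub>m A) = complex_of_real k \<cdot>\<^sub>m map_mat complex_of_real A"
  by (rule eqI; use assms in simp)+

lemma cmat_one: "map_mat complex_of_real (1\<^sub>m n) = 1\<^sub>m n" "map_mat complex_of_real (0\<^sub>m n n) = 0\<^sub>m n n"
  by (rule eqI; simp)+

lemma cmat_elem: "map_mat complex_of_real (elem_mat n i k) = elem_mat n i k"
  "map_mat complex_of_real (b_mat n) = b_mat n"
  by (rule eqI; simp add: elem_mat_def b_mat_def)+

lemma minus_eq_zero:
  fixes A B :: "'a::comm_ring_1 mat"
  assumes "A \<in> carrier_mat n n" "B \<in> carrier_mat n n" "A - B = 0\<^sub>m n n"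
  shows "A = B"
proof (rule eqI[OF assms(1,2)])
  fix r c assume "r < n" "c < n"
  then show "A $$ (r, c) = B $$ (r, c)"
    using arg_cong[OF assms(3), of "\<lambda>X. X $$ (r, c)"] assms(1,2) by (simp add: index del: index_minus_mat)
qed

lemma mult_cancel_left:
  fixes H G A B :: "'a::comm_ring_1 mat"
  assumes "H \<in> carrier_mat n n" "G \<in> carrier_mat n n" "A \<in> carrier_mat n n" "B \<in> carrier_mat n n"
    and "H * G = 1\<^sub>m n" "G * A = G * B"
  shows "A = B"
proof -
  have "H * (G * A) = H * (G * B)" using assms(6) by simp
  then show ?thesis using assms assoc[of H G A] assoc[of H G B] by simp
qed

end

lemma Dx_of_real:
  assumes "smooth_on S f" "p \<in> S"
  shows "Dx (\<lambda>q. complex_of_real (f q)) p = complex_of_real (Dx f p)"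
    "Dt (\<lambda>q. complex_of_real (f q)) p = complex_of_real (Dt f p)"
  unfolding Dx_def[of "\<lambda>q. complex_of_real (f q)"] Dt_def[of "\<lambda>q. complex_of_real (f q)"]
  using smooth_on_partials(1,2)[OF assms]
  by (auto intro!: vector_derivative_at bounded_linear.has_vector_derivative[OF bounded_linear_of_real])

context kdv_domain begin

sublocale cx: function_derivation S "smooth_on S :: (real \<times> real \<Rightarrow> complex) \<Rightarrow> bool" Dx
  by (rule smooth_on_locale[OF open_S])
sublocale ct: function_derivation S "smooth_on S :: (real \<times> real \<Rightarrow> complex) \<Rightarrow> bool" Dt
  by (rule smooth_on_locale[OF open_S])

lemma c_C_mat_iff: "cx.C_mat n M \<longleftrightarrow> smooth_mat_on n S M" "ct.C_mat n M \<longleftrightarrow> smooth_mat_on n S M"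
  unfolding cx.C_mat_def ct.C_mat_def smooth_mat_on_def by auto

lemma smooth_matD: "smooth_mat_on n S M \<Longrightarrow> p \<in> S \<Longrightarrow> M p \<in> carrier_mat n n"
  by (simp add: smooth_mat_on_def)

lemma cmat_smooth:
  assumes "smooth_mat_on n S M"
  shows "smooth_mat_on n S (\<lambda>p. map_mat complex_of_real (M p))"
  unfolding c_C_mat_iff[symmetric]
proof (rule cx.C_matI)
  fix r c assume rc: "r < n" "c < n"
  have "smooth_on S (\<lambda>p. complex_of_real (M p $$ (r, c)))"
    using assms rc by (intro smooth_on_bounded_linear[OF open_S bounded_linear_of_real]) (simp add: smooth_mat_on_def)
  then show "smooth_on S (\<lambda>p. map_mat complex_of_real (M p) $$ (r, c))"
    by (rule cx.C_cong[rotated]) (use rc smooth_matD[OF assms] in \<open>simp add: index\<close>)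
qed (use smooth_matD[OF assms] in simp)

lemma cmat_D:
  assumes M: "smooth_mat_on n S M" and p: "p \<in> S"
  shows "mat_Dx (\<lambda>q. map_mat complex_of_real (M q)) p = map_mat complex_of_real (mat_Dx M p)"
    "mat_Dt (\<lambda>q. map_mat complex_of_real (M q)) p = map_mat complex_of_real (mat_Dt M p)"
proof -
  note c = smooth_matD[OF M]
  have sm: "smooth_on S (\<lambda>q. M q $$ (r, k))" if "r < n" "k < n" for r k
    using M that by (simp add: smooth_mat_on_def)
  show "mat_Dx (\<lambda>q. map_mat complex_of_real (M q)) p = map_mat complex_of_real (mat_Dx M p)"
  proof (rule eqI)
    fix r k assume rk: "r < n" "k < n"
    have "Dx (\<lambda>q. map_mat complex_of_real (M q) $$ (r, k)) p = Dx (\<lambda>q. complex_of_real (M q $$ (r, k))) p"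
      by (rule cx.D_cong[OF _ p]) (use c rk in \<open>simp add: index\<close>)
    then show "mat_Dx (\<lambda>q. map_mat complex_of_real (M q)) p $$ (r, k) = map_mat complex_of_real (mat_Dx M p) $$ (r, k)"
      using rk c[OF p] Dx_of_real(1)[OF sm[OF rk] p]
      by (simp add: mat_Dx_eq cx.mat_D_index[where n = n] x.mat_D_index[where n = n] index[of "mat_D Dx M p"])
  qed (use c[OF p] in \<open>simp_all add: mat_Dx_eq\<close>)
  show "mat_Dt (\<lambda>q. map_mat complex_of_real (M q)) p = map_mat complex_of_real (mat_Dt M p)"
  proof (rule eqI)
    fix r k assume rk: "r < n" "k < n"
    have "Dt (\<lambda>q. map_mat complex_of_real (M q) $$ (r, k)) p = Dt (\<lambda>q. complex_of_real (M q $$ (r, k))) p"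
      by (rule ct.D_cong[OF _ p]) (use c rk in \<open>simp add: index\<close>)
    then show "mat_Dt (\<lambda>q. map_mat complex_of_real (M q)) p $$ (r, k) = map_mat complex_of_real (mat_Dt M p) $$ (r, k)"
      using rk c[OF p] Dx_of_real(2)[OF sm[OF rk] p]
      by (simp add: mat_Dt_eq ct.mat_D_index[where n = n] t.mat_D_index[where n = n] index[of "mat_D Dt M p"])
  qed (use c[OF p] in \<open>simp_all add: mat_Dt_eq\<close>)
qed

section \<open>Zero curvature and the moving frame\<close>

lemma mat_Dt_Dx_commute:
  fixes G :: "real \<times> real \<Rightarrow> real mat"
  assumes G: "smooth_mat_on n S G" and p: "p \<in> S"
  shows "mat_Dt (mat_Dx G) p = mat_Dx (mat_Dt G) p"
proof (rule eqI)
  note c = smooth_matD[OF G]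
  fix r k assume rk: "r < n" "k < n"
  have sm: "smooth_on S (\<lambda>q. G q $$ (r, k))" using G rk by (simp add: smooth_mat_on_def)
  have "mat_Dt (mat_Dx G) p $$ (r, k) = Dt (\<lambda>q. mat_Dx G q $$ (r, k)) p"
    using rk c[OF p] t.mat_D_index[of "mat_D Dx G" p n r k] by (simp add: mat_Dt_eq mat_Dx_eq)
  also have "\<dots> = Dt (Dx (\<lambda>q. G q $$ (r, k))) p"
    by (rule t.D_cong[OF _ p]) (use rk c in \<open>simp add: mat_Dx_eq x.mat_D_index[where n = n]\<close>)
  also have "\<dots> = Dx (Dt (\<lambda>q. G q $$ (r, k))) p"
    by (rule Dx_Dt_commute[OF open_S sm p, symmetric])
  also have "\<dots> = Dx (\<lambda>q. mat_Dt G q $$ (r, k)) p"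
    by (rule x.D_cong[OF _ p]) (use rk c in \<open>simp add: mat_Dt_eq t.mat_D_index[where n = n]\<close>)
  also have "\<dots> = mat_Dx (mat_Dt G) p $$ (r, k)"
    using rk c[OF p] x.mat_D_index[of "mat_D Dt G" p n r k] by (simp add: mat_Dt_eq mat_Dx_eq)
  finally show "mat_Dt (mat_Dx G) p $$ (r, k) = mat_Dx (mat_Dt G) p $$ (r, k)" .
qed (use smooth_matD[OF G p] in \<open>simp_all add: mat_Dt_eq mat_Dx_eq\<close>)

text \<open>The identity G_xt = G_tx, computed from G_x = G A and G_t = G M, reads G (M A + A_t) = G
  (A M + M_x), and the invertible G cancels.\<close>

lemma zero_curvature:
  assumes G: "smooth_mat_on n S G" and A: "smooth_mat_on n S A" and M: "smooth_mat_on n S M"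
    and Gx: "\<And>p. p \<in> S \<Longrightarrow> mat_Dx G p = G p * A p" and Gt: "\<And>p. p \<in> S \<Longrightarrow> mat_Dt G p = G p * M p"
    and p: "p \<in> S" and H: "H \<in> carrier_mat n n" "H * G p = 1\<^sub>m n"
  shows "bracket_Dx A M p = mat_Dt A p"
proof -
  note c = smooth_matD[OF G p] smooth_matD[OF A p] smooth_matD[OF M p]
  have c': "mat_Dt A p \<in> carrier_mat n n" "mat_Dx M p \<in> carrier_mat n n"
    using c by (simp_all add: mat_Dt_eq mat_Dx_eq)
  have "mat_Dt (mat_Dx G) p = mat_Dt (\<lambda>q. G q * A q) p"
    unfolding mat_Dt_eq by (rule t.mat_D_cong[OF p]) (rule Gx)
  also have "\<dots> = G p * M p * A p + G p * mat_Dt A p"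
    using t.mat_D_mult[OF p, of n G A] G A by (simp add: x_C_mat_iff mat_Dt_eq[symmetric] Gt[OF p])
  finally have 1: "mat_Dt (mat_Dx G) p = G p * (M p * A p + mat_Dt A p)"
    using c c' by (simp add: assoc ring_distribs)
  have "mat_Dx (mat_Dt G) p = mat_Dx (\<lambda>q. G q * M q) p"
    unfolding mat_Dx_eq by (rule x.mat_D_cong[OF p]) (rule Gt)
  also have "\<dots> = G p * A p * M p + G p * mat_Dx M p"
    using x.mat_D_mult[OF p, of n G M] G M by (simp add: x_C_mat_iff mat_Dx_eq[symmetric] Gx[OF p])
  finally have 2: "mat_Dx (mat_Dt G) p = G p * (A p * M p + mat_Dx M p)"
    using c c' by (simp add: assoc ring_distribs)
  have eq: "M p * A p + mat_Dt A p = A p * M p + mat_Dx M p"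
    by (rule mult_cancel_left[OF H(1) c(1) _ _ H(2)])
      (use c c' 1 2 mat_Dt_Dx_commute[OF G p] in simp_all)
  show ?thesis unfolding bracket_Dx_def
  proof (rule eqI)
    fix r k assume rk: "r < n" "k < n"
    show "(mat_Dx M p + (A p * M p - M p * A p)) $$ (r, k) = mat_Dt A p $$ (r, k)"
      using arg_cong[OF eq, of "\<lambda>X. X $$ (r, k)"] rk c c'
      by (simp add: index del: index_add_mat index_minus_mat index_mult_mat)
  qed (use c c' in simp_all)
qed

definition connection :: "(nat \<Rightarrow> real \<times> real \<Rightarrow> real) \<Rightarrow> real \<times> real \<Rightarrow> real mat"
  where "connection u p = b_mat n + u_mat n (\<lambda>i. u i p)"

lemma connection_carrier [simp]: "connection u p \<in> carrier_mat n n"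
  by (simp add: connection_def)

lemma connection_index:
  "r < n \<Longrightarrow> c < n \<Longrightarrow> connection u p $$ (r, c)
    = (if r = c + 1 then 1 else 0) + (if c + 1 = n \<and> r + 1 < n then u (r + 1) p else 0)"
  by (auto simp: connection_def b_mat_def u_mat_def)

lemma connection_smooth:
  assumes "\<And>i. i \<in> {1..n - 1} \<Longrightarrow> smooth_on S (u i)"
  shows "smooth_mat_on n S (connection u)"
  unfolding x_C_mat_iff[symmetric]
proof (rule x.C_matI)
  fix r c assume rc: "r < n" "c < n"
  have "smooth_on S (\<lambda>p. (if r = c + 1 then 1 else 0) + (if c + 1 = n \<and> r + 1 < n then u (r + 1) p else 0))"
  proof (cases "c + 1 = n \<and> r + 1 < n")
    case True
    then have "smooth_on S (u (r + 1))" by (intro assms) auto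
    with True show ?thesis by (simp add: x.C_add x.C_const)
  qed (auto simp: x.C_const)
  then show "smooth_on S (\<lambda>p. connection u p $$ (r, c))" using rc by (simp add: connection_index)
qed simp

lemma connection_Dt:
  assumes "\<And>i. i \<in> {1..n - 1} \<Longrightarrow> smooth_on S (u i)" "p \<in> S"
  shows "mat_Dt (connection u) p = u_mat n (\<lambda>i. Dt (u i) p)"
proof (rule eqI)
  fix r c assume rc: "r < n" "c < n"
  have "mat_Dt (connection u) p $$ (r, c)
      = Dt (\<lambda>p. (if r = c + 1 then 1 else 0) + (if c + 1 = n \<and> r + 1 < n then u (r + 1) p else 0)) p"
    using rc by (simp add: mat_Dt_eq t.mat_D_index[where n = n] connection_index)
  also have "\<dots> = (if c + 1 = n \<and> r + 1 < n then Dt (u (r + 1)) p else 0)"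
  proof (cases "c + 1 = n \<and> r + 1 < n")
    case True
    then have "smooth_on S (u (r + 1))" by (intro assms) auto
    with True show ?thesis using t.D_add[OF assms(2), of "\<lambda>_. if r = c + 1 then 1 else 0" "u (r + 1)"] t.C_const t.D_const[OF assms(2)]
      by simp
  next
    case False
    then show ?thesis by (simp only: if_False) (rule t.D_const[OF assms(2)])
  qed
  finally show "mat_Dt (connection u) p $$ (r, c) = u_mat n (\<lambda>i. Dt (u i) p) $$ (r, c)"
    using rc by (simp add: u_mat_def)
qed (simp_all add: mat_Dt_eq)

text \<open>The x-connection is b + u with b constant, so its t-derivative lies in V_n; zero
  curvature transfers this to the bracket. Thus the existence of a frame alone yields the bracket
  condition by which \<zeta>_j is defined.\<close>

lemma bracket_V:
  assumes G: "smooth_mat_on n S G" and u: "\<And>i. i \<in> {1..n - 1} \<Longrightarrow> smooth_on S (u i)" and M: "smooth_mat_on n S M"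
    and Gx: "\<And>p. p \<in> S \<Longrightarrow> mat_Dx G p = G p * connection u p" and Gt: "\<And>p. p \<in> S \<Longrightarrow> mat_Dt G p = G p * M p"
    and p: "p \<in> S" and H: "H \<in> carrier_mat n n" "H * G p = 1\<^sub>m n"
  shows "bracket_Dx (connection u) M p \<in> V_space n"
proof -
  have "bracket_Dx (connection u) M p = mat_Dt (connection u) p"
    by (rule zero_curvature[OF G connection_smooth[OF u] M Gx Gt p H])
  also have "\<dots> = u_mat n (\<lambda>i. Dt (u i) p)" by (rule connection_Dt[OF u p])
  finally show ?thesis by (simp add: V_space_def)
qed

lemma ca_frame_carrier [simp]: "ca_frame n \<gamma> p \<in> carrier_mat n n"
  by (simp add: ca_frame_def)

lemma ca_frame_index: "r < n \<Longrightarrow> c < n \<Longrightarrow> ca_frame n \<gamma> p $$ (r, c) = (Dx ^^ c) (\<lambda>q. \<gamma> q $ r) p"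
  by (simp add: ca_frame_def)

lemma iterated_Dx_smooth: "smooth_on S f \<Longrightarrow> smooth_on S ((Dx ^^ c) f)"
  by (induction c) (auto intro: smooth_on_Dx open_S)

lemma ca_frame_smooth:
  assumes "\<And>r. r < n \<Longrightarrow> smooth_on S (\<lambda>p. \<gamma> p $ r)"
  shows "smooth_mat_on n S (ca_frame n \<gamma>)"
  unfolding smooth_mat_on_def using assms
  by (auto simp: ca_frame_index iterated_Dx_smooth)

lemma ca_frame_Dx:
  assumes "is_ca_curvature n S \<gamma> u" "p \<in> S"
  shows "mat_Dx (ca_frame n \<gamma>) p = ca_frame n \<gamma> p * connection u p"
proof (rule eqI)
  fix r c assume rc: "r < n" "c < n"
  have L: "mat_Dx (ca_frame n \<gamma>) p $$ (r, c) = (Dx ^^ Suc c) (\<lambda>q. \<gamma> q $ r) p"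
    using rc by (simp add: mat_Dx_eq x.mat_D_index[where n = n] ca_frame_index)
  have R: "(ca_frame n \<gamma> p * connection u p) $$ (r, c) = (\<Sum>k<n. ca_frame n \<gamma> p $$ (r, k) * connection u p $$ (k, c))"
    using rc by (intro mult_index) auto
  show "mat_Dx (ca_frame n \<gamma>) p $$ (r, c) = (ca_frame n \<gamma> p * connection u p) $$ (r, c)"
  proof (cases "c + 1 = n")
    case False
    then have "(\<Sum>k<n. ca_frame n \<gamma> p $$ (r, k) * connection u p $$ (k, c))
        = (\<Sum>k<n. if k = c + 1 then ca_frame n \<gamma> p $$ (r, k) else 0)"
      using rc by (intro sum.cong refl) (simp add: connection_index)
    also have "\<dots> = ca_frame n \<gamma> p $$ (r, c + 1)" using rc False by simp
    finally show ?thesis unfolding L R using rc False by (simp add: ca_frame_index)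
  next
    case True
    have "(\<Sum>k<n. ca_frame n \<gamma> p $$ (r, k) * connection u p $$ (k, c))
        = (\<Sum>k<n. if k + 1 < n then ca_frame n \<gamma> p $$ (r, k) * u (k + 1) p else 0)"
      using rc True by (intro sum.cong refl) (simp add: connection_index)
    also have "\<dots> = (\<Sum>k<n - 1. ca_frame n \<gamma> p $$ (r, k) * u (k + 1) p)"
      by (rule sum.mono_neutral_cong_right) auto
    also have "\<dots> = (\<Sum>i = 1..n - 1. u i p * (Dx ^^ (i - 1)) (\<lambda>q. \<gamma> q $ r) p)"
      by (rule sum.reindex_bij_witness[of _ "\<lambda>i. i - 1" "\<lambda>k. k + 1"])
        (use rc in \<open>auto simp: ca_frame_index\<close>)
    also have "\<dots> = (Dx ^^ Suc c) (\<lambda>q. \<gamma> q $ r) p"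
      using assms rc True unfolding is_ca_curvature_def by simp
    finally show ?thesis unfolding L R by simp
  qed
qed (simp_all add: mat_Dx_eq)

text \<open>The curve flow prescribes only the first column of g_t = g Z. The matrix M = g^{-1} g_t
  has its bracket in V_n by compatibility, Z has it by hypothesis, and their first columns agree, so
  M = Z.\<close>

lemma frame_Dt:
  assumes G: "smooth_mat_on n S G" and u: "\<And>i. i \<in> {1..n - 1} \<Longrightarrow> smooth_on S (u i)"
    and d: "\<And>p. p \<in> S \<Longrightarrow> det (G p) = 1"
    and Gx: "\<And>p. p \<in> S \<Longrightarrow> mat_Dx G p = G p * connection u p"
    and Z: "\<And>p. p \<in> S \<Longrightarrow> Z p \<in> carrier_mat n n" "\<And>p. p \<in> S \<Longrightarrow> bracket_Dx (connection u) Z p \<in> V_space n"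
    and first: "\<And>p r. p \<in> S \<Longrightarrow> r < n \<Longrightarrow> Dt (\<lambda>q. G q $$ (r, 0)) p = (G p * Z p) $$ (r, 0)"
    and p: "p \<in> S"
  shows "mat_Dt G p = G p * Z p"
proof -
  define H where "H q = adj_mat (G q)" for q
  note H = det_one_inverse[OF smooth_matD[OF G] d, folded H_def]
  have Hs: "smooth_mat_on n S H"
    using x.C_mat_adj[of n G] G unfolding x_C_mat_iff H_def by simp
  define M where "M q = H q * mat_Dt G q" for q
  have Gtc: "mat_Dt G q \<in> carrier_mat n n" if "q \<in> S" for q
    using smooth_matD[OF G that] by (simp add: mat_Dt_eq)
  have Mc: "M q \<in> carrier_mat n n" if "q \<in> S" for q using H(1)[OF that that] Gtc[OF that] by (simp add: M_def)
  have Gt: "mat_Dt G q = G q * M q" if "q \<in> S" for q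
    using H(1,2)[OF that that] smooth_matD[OF G that] Gtc[OF that] by (simp add: M_def flip: assoc)
  have Ms: "smooth_mat_on n S M"
    using x.C_mat_mult[of n H "mat_Dt G"] t.C_mat_D[of n G] Hs G
    unfolding x_C_mat_iff M_def mat_Dt_eq by simp
  have "M p = Z p"
  proof (rule first_column_unique[where A = "connection u" and u = u])
    show "bracket_Dx (connection u) M q \<in> V_space n" if "q \<in> S" for q
      by (rule bracket_V[OF G u Ms Gx Gt that H(1)[OF that that] H(3)[OF that that]])
    show "M q $$ (r, 0) = Z q $$ (r, 0)" if q: "q \<in> S" and r: "r < n" for q r
    proof -
      have 0: "0 < n" using n_ge by simp
      have "mat_Dt G q $$ (k, 0) = (G q * Z q) $$ (k, 0)" if "k < n" for k
        using first[OF q that] smooth_matD[OF G q] that 0 by (simp add: mat_Dt_eq t.mat_D_index[where n = n])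
      then have "M q $$ (r, 0) = (H q * (G q * Z q)) $$ (r, 0)"
        unfolding M_def using mult_index[OF H(1)[OF q q] Gtc[OF q] r 0]
          mult_index[OF H(1)[OF q q] _ r 0, of "G q * Z q"] smooth_matD[OF G q] Z(1)[OF q] by simp
      also have "H q * (G q * Z q) = Z q"
        using H[OF q q] smooth_matD[OF G q] Z(1)[OF q] by (simp flip: assoc)
      finally show ?thesis .
    qed
  qed (use Mc Z p in \<open>auto simp: connection_def\<close>)
  then show ?thesis using Gt[OF p] by simp
qed

end

context function_derivation begin

lemma mat_D_inverse:
  assumes p: "p \<in> S" and G: "C_mat n G" and H: "C_mat n H"
    and inv: "\<And>q. q \<in> S \<Longrightarrow> H q * G q = 1\<^sub>m n" "\<And>q. q \<in> S \<Longrightarrow> G q * H q = 1\<^sub>m n"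
    and A: "A \<in> carrier_mat n n" and GA: "mat_D D G p = G p * A"
  shows "mat_D D H p = - (A * H p)"
proof -
  interpret square_mat n .
  note c = C_matD(1)[OF G p] C_matD(1)[OF H p] A
  have c': "mat_D D H p \<in> carrier_mat n n" using c by simp
  have "mat_D D (\<lambda>q. H q * G q) p = mat_D D (\<lambda>_. 1\<^sub>m n) p"
    by (rule mat_D_cong[OF p inv(1)])
  also have "\<dots> = 0\<^sub>m n n" by (rule mat_D_const[OF p]) simp
  finally have z: "mat_D D H p * G p + H p * (G p * A) = 0\<^sub>m n n"
    unfolding mat_D_mult[OF p H G] GA .
  have "H p * (G p * A) = A" using c inv(1)[OF p] assoc[of "H p" "G p" A] by simp
  then have z: "mat_D D H p * G p + A = 0\<^sub>m n n" using z by simp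
  have "mat_D D H p * G p = - A"
  proof (rule eqI)
    fix r k assume "r < n" "k < n"
    then show "(mat_D D H p * G p) $$ (r, k) = (- A) $$ (r, k)"
      using arg_cong[OF z, of "\<lambda>X. X $$ (r, k)"] c c'
      by (simp add: index eq_neg_iff_add_eq_0 del: index_add_mat index_mult_mat index_uminus_mat)
  qed (use c c' in simp_all)
  then have "mat_D D H p * G p * H p = - A * H p" by simp
  then show ?thesis using c c' inv(2)[OF p] by (simp add: assoc)
qed

end

lemma (in square_mat) add_neg: "A \<in> carrier_mat n n \<Longrightarrow> A + - A = 0\<^sub>m n n" for A :: "'a::comm_ring_1 mat"
  by (rule eqI) simp_all

section \<open>The coefficients of Z_j in \<lambda>, and the frame at \<lambda> = 0\<close>

context kdv_domain begin

definition Z_coeff :: "(real \<times> real \<Rightarrow> real poly mat) \<Rightarrow> nat \<Rightarrow> real \<times> real \<Rightarrow> real mat"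
  where "Z_coeff Z i p = map_mat (\<lambda>q. coeff q i) (Z p)"

lemma Z_zero_eq: "Z_zero (Z p) = Z_coeff Z 0 p"
  by (simp add: Z_zero_def Z_coeff_def poly_0_coeff_0)

lemma pow_top:
  assumes "is_Y n S u Y" "p \<in> S" "i > int j"
  shows "lam_coeff (Y p ^\<^sub>m j) i = 0\<^sub>m n n"
proof -
  have Y: "has_top (Y p) 1 (lam_coeff (Y p) 1)"
    using assms is_Y_carrier[OF assms(1,2)] by (simp add: has_top_def is_Y_def)
  have "\<exists>T. has_top (Y p ^\<^sub>m j) (int j) T"
  proof (induction j)
    case 0
    have "lam_coeff (1\<^sub>m n :: real fls mat) i = (if i = 0 then 1\<^sub>m n else 0\<^sub>m n n)" for i
      by (rule eqI) (auto simp: lam_coeff_index)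
    then show ?case using is_Y_carrier[OF assms(1,2)] by (simp add: has_top_def)
  next
    case (Suc j)
    then obtain T where "has_top (Y p ^\<^sub>m j) (int j) T" by blast
    from has_top_mult[OF this Y] show ?case by (auto simp: add.commute)
  qed
  then show ?thesis using assms(3) by (auto simp: has_top_def)
qed

lemma is_Z_coeff:
  assumes Y: "is_Y n S u Y" and z: "is_zeta n j S u Y \<zeta>"
    and Z: "\<And>p. p \<in> S \<Longrightarrow> Z p = map_mat lam_poly_part (Y p ^\<^sub>m j) - map_mat (\<lambda>a. [: a :]) (\<zeta> p)"
    and p: "p \<in> S"
  shows "Z p \<in> carrier_mat n n" "Z_coeff Z 0 p = lam_coeff (Y p ^\<^sub>m j) 0 - \<zeta> p"
    "Z_coeff Z (Suc i) p = lam_coeff (Y p ^\<^sub>m j) (int (Suc i))"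
proof -
  define X where "X = Y p ^\<^sub>m j"
  have c: "X \<in> carrier_mat n n" "\<zeta> p \<in> carrier_mat n n"
    using is_Y_carrier[OF Y p] z p by (auto simp: X_def is_zeta_def smooth_mat_on_def)
  have ZX: "Z p = map_mat lam_poly_part X - map_mat (\<lambda>a. [: a :]) (\<zeta> p)" using Z[OF p] by (simp add: X_def)
  show "Z p \<in> carrier_mat n n" using c by (simp add: ZX)
  show "Z_coeff Z 0 p = lam_coeff (Y p ^\<^sub>m j) 0 - \<zeta> p"
    unfolding X_def[symmetric]
    by (rule eqI) (use c in \<open>simp_all add: Z_coeff_def ZX lam_coeff_def lam_poly_part_def\<close>)
  show "Z_coeff Z (Suc i) p = lam_coeff (Y p ^\<^sub>m j) (int (Suc i))"
    unfolding X_def[symmetric]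
    by (rule eqI) (use c in \<open>simp_all add: Z_coeff_def ZX lam_coeff_def lam_poly_part_def\<close>)
qed

lemma is_ZE:
  assumes "is_Z n j S u Z"
  obtains Y \<zeta> where "is_Y n S u Y" "is_zeta n j S u Y \<zeta>"
    "\<And>p. p \<in> S \<Longrightarrow> Z p = map_mat lam_poly_part (Y p ^\<^sub>m j) - map_mat (\<lambda>a. [: a :]) (\<zeta> p)"
  using assms unfolding is_Z_def by blast

lemma Z_coeff_smooth:
  assumes "is_Z n j S u Z"
  shows "smooth_mat_on n S (Z_coeff Z i)"
proof -
  obtain Y \<zeta> where Y: "is_Y n S u Y" and z: "is_zeta n j S u Y \<zeta>"
    and Z: "\<And>p. p \<in> S \<Longrightarrow> Z p = map_mat lam_poly_part (Y p ^\<^sub>m j) - map_mat (\<lambda>a. [: a :]) (\<zeta> p)"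
    using is_ZE[OF assms] by metis
  have coeff: "Z_coeff Z 0 q = lam_coeff (Y q ^\<^sub>m j) 0 - \<zeta> q" if "q \<in> S" for q
    by (rule is_Z_coeff(2)[OF Y z Z that])
  have coeff': "Z_coeff Z (Suc k) q = lam_coeff (Y q ^\<^sub>m j) (int (Suc k))" if "q \<in> S" for q k
    by (rule is_Z_coeff(3)[OF Y z Z that])
  have P: "x.C_mat n (\<lambda>p. lam_coeff (Y p ^\<^sub>m j) k)" for k
    unfolding x_C_mat_iff by (rule fls_C_matD[OF fx.C_mat_pow[OF is_Y_C_mat[OF Y]]])
  have zs: "x.C_mat n \<zeta>" using z by (simp add: is_zeta_def x_C_mat_iff)
  show ?thesis unfolding x_C_mat_iff[symmetric]
  proof (cases i)
    case 0
    show "x.C_mat n (Z_coeff Z i)"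
      by (rule x.C_mat_cong[OF _ x.C_mat_diff[OF P[of 0] zs]]) (simp add: 0 coeff)
  next
    case (Suc k)
    show "x.C_mat n (Z_coeff Z i)"
      by (rule x.C_mat_cong[OF _ P[of "int (Suc k)"]]) (simp only: Suc coeff')
  qed
qed

lemma Z_coeff_bound:
  assumes "is_Z n j S u Z" "p \<in> S" "i > j"
  shows "Z_coeff Z i p = 0\<^sub>m n n"
proof -
  obtain Y \<zeta> where Y: "is_Y n S u Y" and z: "is_zeta n j S u Y \<zeta>"
    and Z: "\<And>p. p \<in> S \<Longrightarrow> Z p = map_mat lam_poly_part (Y p ^\<^sub>m j) - map_mat (\<lambda>a. [: a :]) (\<zeta> p)"
    using is_ZE[OF assms(1)] by metis
  obtain k where i: "i = Suc k" using assms(3) by (cases i) auto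
  have "Z_coeff Z i p = lam_coeff (Y p ^\<^sub>m j) (int i)"
    unfolding i by (rule is_Z_coeff(3)[OF Y z Z assms(2)])
  also have "\<dots> = 0\<^sub>m n n"
    by (rule pow_top[OF Y assms(2)]) (use assms(3) in simp)
  finally show ?thesis .
qed

lemma is_Z_carrier: "is_Z n j S u Z \<Longrightarrow> p \<in> S \<Longrightarrow> Z p \<in> carrier_mat n n"
  using is_ZE is_Z_coeff(1) by metis

lemma is_Z_bracket:
  assumes "is_Z n j S u Z" "p \<in> S"
  shows "bracket_Dx (connection u) (Z_coeff Z 0) p \<in> V_space n"
proof -
  obtain Y \<zeta> where Y: "is_Y n S u Y" and z: "is_zeta n j S u Y \<zeta>"
    and Z: "\<And>p. p \<in> S \<Longrightarrow> Z p = map_mat lam_poly_part (Y p ^\<^sub>m j) - map_mat (\<lambda>a. [: a :]) (\<zeta> p)"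
    using is_ZE[OF assms(1)] by metis
  have coeff: "Z_coeff Z 0 q = lam_coeff (Y q ^\<^sub>m j) 0 - \<zeta> q" if "q \<in> S" for q
    by (rule is_Z_coeff(2)[OF Y z Z that])
  have "mat_D Dx (Z_coeff Z 0) p = mat_D Dx (\<lambda>q. lam_coeff (Y q ^\<^sub>m j) 0 - \<zeta> q) p"
    by (rule x.mat_D_cong[OF assms(2) coeff])
  moreover have "bracket_Dx (\<lambda>q. b_mat n + u_mat n (\<lambda>i. u i q)) (\<lambda>q. lam_coeff (Y q ^\<^sub>m j) 0 - \<zeta> q) p \<in> V_space n"
    using z assms(2) by (simp add: is_zeta_def)
  ultimately show ?thesis
    by (simp add: bracket_Dx_def mat_Dx_eq coeff[OF assms(2)] connection_def)
qed

text \<open>Separates the constant term from an explicit factor \<lambda>. After cancellation of the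
  constant term, this is the factor \<lambda> in the t-equation of E g^{-1}.\<close>

lemma Z_eval_index:
  assumes Z: "is_Z n j S u Z" and p: "p \<in> S" and rc: "r < n" "c < n"
  shows "Z_eval (Z p) l $$ (r, c) = complex_of_real (Z_coeff Z 0 p $$ (r, c))
    + l * (\<Sum>i<j. complex_of_real (Z_coeff Z (Suc i) p $$ (r, c)) * l ^ i)"
proof -
  note zc = is_Z_carrier[OF Z p]
  define q where "q = Z p $$ (r, c)"
  have cz: "coeff q i = Z_coeff Z i p $$ (r, c)" for i using zc rc by (simp add: q_def Z_coeff_def)
  have "degree q \<le> j"
    by (rule degree_le) (use Z_coeff_bound[OF Z p] rc in \<open>simp add: cz\<close>)
  then have "poly (map_poly complex_of_real q) l = (\<Sum>i\<le>j. complex_of_real (coeff q i) * l ^ i)"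
    unfolding poly_altdef
    by (intro sum.mono_neutral_cong_left)
      (auto simp: coeff_map_poly coeff_eq_0 degree_map_poly)
  also have "\<dots> = (\<Sum>i<Suc j. complex_of_real (coeff q i) * l ^ i)"
    by (simp add: lessThan_Suc_atMost)
  also have "\<dots> = complex_of_real (coeff q 0) + l * (\<Sum>i<j. complex_of_real (coeff q (Suc i)) * l ^ i)"
    by (simp add: sum.lessThan_Suc_shift sum_distrib_left mult_ac del: sum.lessThan_Suc)
  finally show ?thesis using zc rc by (simp add: Z_eval_def q_def[symmetric] cz)
qed

lemma inv_mat_mult_eq:
  fixes E X M :: "complex mat"
  assumes E: "E \<in> carrier_mat n n" and "invertible_mat E" and M: "M \<in> carrier_mat n n" and X: "X \<in> carrier_mat n n"
    and "inv_mat E * X = M"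
  shows "X = E * M"
proof -
  obtain B where B: "E * B = 1\<^sub>m (dim_row E)" "B * E = 1\<^sub>m (dim_row B)"
    using assms(2) by (auto simp: invertible_mat_def inverts_mat_def)
  \<comment> \<open>\<open>invertible_mat\<close> does not state the size of the inverse; it is read
    off from the two products.\<close>
  have "dim_col B = dim_col (E * B)" by simp
  also have "\<dots> = n" unfolding B(1) using E by simp
  finally have col: "dim_col B = n" .
  have "dim_row B = dim_col (B * E)" unfolding B(2) by simp
  also have "\<dots> = n" using E by simp
  finally have Bc: "B \<in> carrier_mat n n" using col by (intro carrier_matI)
  have EB: "E * B = 1\<^sub>m n" unfolding B(1) using E by simp
  have "E * M = E * (B * X)" using assms(5) inv_mat_eq[OF E Bc EB] by simp
  then show ?thesis using E X Bc EB assoc[of E B X] by simp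
qed

lemma J_mat_split: "J_mat n l + map_mat complex_of_real (u_mat n a)
   = l \<cdot>\<^sub>m elem_mat n 1 n + map_mat complex_of_real (b_mat n + u_mat n a)"
  by (rule eqI) (auto simp: J_mat_def elem_mat_def b_mat_def u_mat_def)

text \<open>The quotient of the two frames, E0 g^{-1}, has vanishing x- and t-derivatives because
  both solve the same linear equations. On the convex set S it is therefore constant, and at the
  origin it is the identity.\<close>

lemma frame_at_zero:
  assumes S: "S = UNIV \<times> T" "is_interval T" "0 \<in> T"
    and g: "smooth_mat_on n S g" "\<And>p. p \<in> S \<Longrightarrow> det (g p) = 1"
    and A: "\<And>p. p \<in> S \<Longrightarrow> A p \<in> carrier_mat n n" and M: "\<And>p. p \<in> S \<Longrightarrow> M p \<in> carrier_mat n n"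
    and gx: "\<And>p. p \<in> S \<Longrightarrow> mat_Dx g p = g p * A p" and gt: "\<And>p. p \<in> S \<Longrightarrow> mat_Dt g p = g p * M p"
    and E0: "smooth_mat_on n S E0"
    and Ex: "\<And>p. p \<in> S \<Longrightarrow> mat_Dx E0 p = E0 p * map_mat complex_of_real (A p)"
    and Et: "\<And>p. p \<in> S \<Longrightarrow> mat_Dt E0 p = E0 p * map_mat complex_of_real (M p)"
    and init: "E0 (0, 0) = map_mat complex_of_real (g (0, 0))" and p: "p \<in> S"
  shows "E0 p = map_mat complex_of_real (g p)"
proof -
  define H where "H q = adj_mat (g q)" for q
  note H = det_one_inverse[OF smooth_matD[OF g(1)] g(2), folded H_def]
  have Hs: "smooth_mat_on n S H" using x.C_mat_adj[of n g] g(1) unfolding x_C_mat_iff H_def by simp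
  have Hx: "mat_Dx H q = - (A q * H q)" if "q \<in> S" for q
    unfolding mat_Dx_eq by (rule x.mat_D_inverse[OF that, of n g])
      (use g Hs H A gx that in \<open>auto simp: x_C_mat_iff mat_Dx_eq\<close>)
  have Ht: "mat_Dt H q = - (M q * H q)" if "q \<in> S" for q
    unfolding mat_Dt_eq by (rule t.mat_D_inverse[OF that, of n g])
      (use g Hs H M gt that in \<open>auto simp: x_C_mat_iff mat_Dt_eq\<close>)
  define R where "R q = E0 q * map_mat complex_of_real (H q)" for q
  note cH = cmat_smooth[OF Hs]
  have Rs: "smooth_mat_on n S R"
    using cx.C_mat_mult[of n E0 "\<lambda>q. map_mat complex_of_real (H q)"] E0 cH unfolding c_C_mat_iff R_def by simp
  have Rx: "mat_Dx R q = 0\<^sub>m n n" and Rt: "mat_Dt R q = 0\<^sub>m n n" if q: "q \<in> S" for q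
  proof -
    note c = smooth_matD[OF E0 q] A[OF q] M[OF q] H(1)[OF q q]
    have "mat_Dx R q = mat_Dx E0 q * map_mat complex_of_real (H q) + E0 q * map_mat complex_of_real (mat_Dx H q)"
      using cx.mat_D_mult[OF q, of n E0 "\<lambda>q. map_mat complex_of_real (H q)"] E0 cH cmat_D[OF Hs q]
      by (simp add: c_C_mat_iff R_def[abs_def] mat_Dx_eq)
    also have "\<dots> = 0\<^sub>m n n"
      using c unfolding Ex[OF q] Hx[OF q] by (simp add: cmat_lin cmat_mult assoc add_neg)
    finally show "mat_Dx R q = 0\<^sub>m n n" .
    have "mat_Dt R q = mat_Dt E0 q * map_mat complex_of_real (H q) + E0 q * map_mat complex_of_real (mat_Dt H q)"
      using ct.mat_D_mult[OF q, of n E0 "\<lambda>q. map_mat complex_of_real (H q)"] E0 cH cmat_D[OF Hs q]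
      by (simp add: c_C_mat_iff R_def[abs_def] mat_Dt_eq)
    also have "\<dots> = 0\<^sub>m n n"
      using c unfolding Et[OF q] Ht[OF q] by (simp add: cmat_lin cmat_mult assoc add_neg)
    finally show "mat_Dt R q = 0\<^sub>m n n" .
  qed
  have conv: "convex S" using S by (auto intro: convex_Times is_interval_convex)
  have o: "(0, 0) \<in> S" using S by simp
  have const: "R q $$ (r, k) = R (0, 0) $$ (r, k)" if q: "q \<in> S" and rk: "r < n" "k < n" for q r k
  proof -
    have sm: "smooth_on S (\<lambda>q. R q $$ (r, k))" using Rs rk by (simp add: smooth_mat_on_def)
    have "((\<lambda>q. R q $$ (r, k)) has_derivative (\<lambda>h. 0)) (at y within S)" if y: "y \<in> S" for y
    proof -
      have d: "((\<lambda>q. R q $$ (r, k)) has_derivative frechet_derivative (\<lambda>q. R q $$ (r, k)) (at y)) (at y)"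
        by (rule smooth_on_frechet(1)[OF sm y])
      note lin = has_derivative_linear[OF d]
      have "Dx (\<lambda>q. R q $$ (r, k)) y = mat_Dx R y $$ (r, k)" "Dt (\<lambda>q. R q $$ (r, k)) y = mat_Dt R y $$ (r, k)"
        using rk smooth_matD[OF Rs y] by (simp_all add: mat_Dx_eq mat_Dt_eq cx.mat_D_index[where n = n] ct.mat_D_index[where n = n])
      then have z: "frechet_derivative (\<lambda>q. R q $$ (r, k)) (at y) (1, 0) = 0"
        "frechet_derivative (\<lambda>q. R q $$ (r, k)) (at y) (0, 1) = 0"
        using rk Rx[OF y] Rt[OF y] smooth_on_partials(3,4)[OF sm y] by simp_all
      have "frechet_derivative (\<lambda>q. R q $$ (r, k)) (at y) h = 0" for h
      proof -
        have h: "h = fst h *\<^sub>R (1, 0) + snd h *\<^sub>R (0, 1)" by (simp add: prod_eq_iff)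
        show ?thesis by (subst h) (simp only: linear_add[OF lin] linear_cmul[OF lin] z, simp)
      qed
      then have "frechet_derivative (\<lambda>q. R q $$ (r, k)) (at y) = (\<lambda>h. 0)" by (rule ext)
      then show ?thesis using d by (simp add: has_derivative_at_withinI)
    qed
    from has_derivative_zero_constant[OF conv this] obtain x where "\<forall>q\<in>S. R q $$ (r, k) = x" by blast
    then show ?thesis using q o by simp
  qed
  have "R (0, 0) = map_mat complex_of_real (g (0, 0)) * map_mat complex_of_real (H (0, 0))"
    by (simp add: R_def init)
  also have "\<dots> = 1\<^sub>m n"
    using H[OF o o] smooth_matD[OF g(1) o] by (simp add: cmat_one flip: cmat_mult)
  finally have "R (0, 0) = 1\<^sub>m n" .
  then have "R p = 1\<^sub>m n" using const[OF p] smooth_matD[OF Rs p] by (intro eqI) auto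
  then have "E0 p * map_mat complex_of_real (H p) * map_mat complex_of_real (g p) = map_mat complex_of_real (g p)"
    using smooth_matD[OF g(1) p] by (simp add: R_def)
  moreover have "map_mat complex_of_real (H p) * map_mat complex_of_real (g p) = 1\<^sub>m n"
    using H[OF p p] smooth_matD[OF g(1) p] by (simp add: cmat_one flip: cmat_mult)
  ultimately show ?thesis
    using smooth_matD[OF E0 p] H(1)[OF p p] smooth_matD[OF g(1) p] by (simp add: assoc)
qed

end

section \<open>The \<lambda>-derivative of the frame\<close>

lemma tendsto_along_curve:
  fixes f :: "real \<times> real \<Rightarrow> complex" and \<kappa> :: "real \<Rightarrow> real \<times> real"
  assumes "isCont f (\<kappa> x)" "isCont \<kappa> x"
  shows "((\<lambda>(s, l). f (\<kappa> s)) \<longlongrightarrow> f (\<kappa> x)) (nhds (x, 0::complex))"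
proof -
  have "isCont (\<lambda>q::real \<times> complex. f (\<kappa> (fst q))) (x, 0)"
    using assms by (intro isCont_o2[of "(x, 0)" "\<lambda>q. \<kappa> (fst q)" f] isCont_o2[of "(x, 0)" fst \<kappa>]) (auto intro: continuous_intros)
  then show ?thesis
    using tendsto_at_iff_tendsto_nhds[of "\<lambda>q::real \<times> complex. f (\<kappa> (fst q))" "(x, 0)"]
    by (simp add: isCont_def case_prod_unfold)
qed

text \<open>The symmetry makes f equal to \<open>cnj \<circ> f \<circ> cnj\<close> near 0, and the
  derivative of the latter at 0 is the conjugate of that of f.\<close>

lemma deriv_real_on_reals:
  assumes f: "f holomorphic_on ball 0 \<rho>" and "\<rho> > 0" and sym: "\<And>l. l \<in> ball 0 \<rho> \<Longrightarrow> cnj (f (cnj l)) = f l"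
  shows "Im (deriv f 0) = 0"
proof -
  have d: "(f has_field_derivative deriv f 0) (at 0)"
    using f assms(2) by (auto intro: holomorphic_derivI)
  have "((cnj \<circ> f \<circ> cnj) has_field_derivative cnj (deriv f 0)) (at 0)"
    by (rule has_field_derivative_cnj_cnj) (use d in simp)
  then have "(f has_field_derivative cnj (deriv f 0)) (at 0)"
    by (rule has_field_derivative_transform_within_open[of _ _ _ "ball 0 \<rho>"]) (use assms sym in auto)
  from DERIV_unique[OF this d] show ?thesis by (simp add: complex_eq_iff)
qed

context kdv_domain begin

text \<open>For R = E g^{-1} the \<lambda>-free parts of the connections cancel, so that R_x and R_t
  are \<lambda> times R times a bounded matrix near \<lambda> = 0, and R = I at \<lambda> = 0. Hence
  R_1 = E_1 g^{-1} has the partial derivatives g e_{1n} g^{-1} and g Z_1 g^{-1}, which are smooth,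
  and E_1 = R_1 g is smooth as well. The reality condition ensures that nothing is lost by taking
  real parts.\<close>

lemma frame_lam_derivative:
  assumes g: "smooth_mat_on n S g" and det: "\<And>p. p \<in> S \<Longrightarrow> det (g p) = 1"
    and gx: "\<And>p. p \<in> S \<Longrightarrow> mat_Dx g p = g p * connection u p"
    and gt: "\<And>p. p \<in> S \<Longrightarrow> mat_Dt g p = g p * Z_coeff Z 0 p"
    and Z: "is_Z n j S u Z" and j: "j \<ge> 1" and \<rho>: "\<rho> > 0"
    and Es: "\<And>l. l \<in> ball 0 \<rho> \<Longrightarrow> smooth_mat_on n S (\<lambda>p. E p l)"
    and Ex: "\<And>l p. l \<in> ball 0 \<rho> \<Longrightarrow> p \<in> S \<Longrightarrow>
      mat_Dx (\<lambda>q. E q l) p = E p l * (J_mat n l + map_mat complex_of_real (u_mat n (\<lambda>i. u i p)))"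
    and Et: "\<And>l p. l \<in> ball 0 \<rho> \<Longrightarrow> p \<in> S \<Longrightarrow> mat_Dt (\<lambda>q. E q l) p = E p l * Z_eval (Z p) l"
    and E0: "\<And>p. p \<in> S \<Longrightarrow> E p 0 = map_mat complex_of_real (g p)"
    and hol: "\<And>p r k. p \<in> S \<Longrightarrow> r < n \<Longrightarrow> k < n \<Longrightarrow> (\<lambda>l. E p l $$ (r, k)) holomorphic_on ball 0 \<rho>"
    and real: "\<And>l p. l \<in> ball 0 \<rho> \<Longrightarrow> p \<in> S \<Longrightarrow> map_mat cnj (E p (cnj l)) = E p l"
  defines "E1 \<equiv> \<lambda>p. map_mat Re (lam_deriv_mat n E p)"
  shows "\<And>p. p \<in> S \<Longrightarrow> map_mat complex_of_real (E1 p) = lam_deriv_mat n E p"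
    and "smooth_mat_on n S E1"
    and "\<And>p. p \<in> S \<Longrightarrow> mat_Dx E1 p = E1 p * connection u p + g p * elem_mat n 1 n"
    and "\<And>p. p \<in> S \<Longrightarrow> mat_Dt E1 p = E1 p * Z_coeff Z 0 p + g p * Z_coeff Z 1 p"
proof -
  define A where "A = connection u"
  define e where "e = (elem_mat n 1 n :: complex mat)"
  define H where "H q = adj_mat (g q)" for q
  note H = det_one_inverse[OF smooth_matD[OF g] det, folded H_def]
  have Hs: "smooth_mat_on n S H" using x.C_mat_adj[of n g] g unfolding x_C_mat_iff H_def by simp
  have Zc: "Z_coeff Z i q \<in> carrier_mat n n" if "q \<in> S" for q i
    using smooth_matD[OF Z_coeff_smooth[OF Z] that] .
  have gc: "g q \<in> carrier_mat n n" if "q \<in> S" for q using smooth_matD[OF g that] .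
  have Hx: "mat_Dx H q = - (A q * H q)" if "q \<in> S" for q
    unfolding mat_Dx_eq by (rule x.mat_D_inverse[OF that, of n g])
      (use g Hs H gx that in \<open>auto simp: x_C_mat_iff mat_Dx_eq A_def\<close>)
  have Ht: "mat_Dt H q = - (Z_coeff Z 0 q * H q)" if "q \<in> S" for q
    unfolding mat_Dt_eq by (rule t.mat_D_inverse[OF that, of n g])
      (use g Hs H gt that Zc in \<open>auto simp: x_C_mat_iff mat_Dt_eq\<close>)
  define cg where "cg q = map_mat complex_of_real (g q)" for q
  define cH where "cH q = map_mat complex_of_real (H q)" for q
  have cc: "cg q \<in> carrier_mat n n" "cH q \<in> carrier_mat n n" if "q \<in> S" for q
    using gc[OF that] H(1)[OF that that] by (simp_all add: cg_def cH_def)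
  have ec: "e \<in> carrier_mat n n" by (simp add: e_def)
  have cHg: "cH q * cg q = 1\<^sub>m n" "cg q * cH q = 1\<^sub>m n" if "q \<in> S" for q
    using gc[OF that] H[OF that that] by (simp_all add: cg_def cH_def cmat_one flip: cmat_mult)
  have cancel: "cH q * (cg q * X) = X" "cg q * (cH q * X) = X" if "q \<in> S" "X \<in> carrier_mat n n" for q X
    using cc[OF that(1)] cHg[OF that(1)] that(2) by (simp_all flip: assoc)
  \<comment> \<open>The polynomial (Z(\<lambda>) - Z(0)) / \<lambda>.\<close>
  define ZZ where "ZZ q l = mat n n (\<lambda>rc. \<Sum>i<j. complex_of_real (Z_coeff Z (Suc i) q $$ rc) * l ^ i)" for q l
  have ZZc [simp]: "ZZ q l \<in> carrier_mat n n" for q l by (simp add: ZZ_def)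
  have Zev: "Z_eval (Z q) l = map_mat complex_of_real (Z_coeff Z 0 q) + l \<cdot>\<^sub>m ZZ q l" if "q \<in> S" for q l
  proof (rule eqI)
    fix r k assume rk: "r < n" "k < n"
    show "Z_eval (Z q) l $$ (r, k) = (map_mat complex_of_real (Z_coeff Z 0 q) + l \<cdot>\<^sub>m ZZ q l) $$ (r, k)"
      using rk Zc[OF that, of 0] Z_eval_index[OF Z that rk, of l] by (simp add: ZZ_def)
  next
    show "Z_eval (Z q) l \<in> carrier_mat n n" using is_Z_carrier[OF Z that] by (simp add: Z_eval_def)
  qed simp
  define RR where "RR q l = E q l * cH q" for q l
  define Bx where "Bx q = cg q * (e * cH q)" for q
  define Bt where "Bt q l = cg q * (ZZ q l * cH q)" for q l
  have Ec: "E q l \<in> carrier_mat n n" if "l \<in> ball 0 \<rho>" "q \<in> S" for q l using smooth_matD[OF Es[OF that(1)] that(2)] .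
  have Bc: "Bx q \<in> carrier_mat n n" "Bt q l \<in> carrier_mat n n" if "q \<in> S" for q l
    using cc[OF that] ec by (simp_all add: Bx_def Bt_def)
  have cHs: "smooth_mat_on n S cH" unfolding cH_def using cmat_smooth[OF Hs] by simp
  have cgs: "smooth_mat_on n S cg" unfolding cg_def using cmat_smooth[OF g] by simp
  have RRs: "smooth_mat_on n S (\<lambda>q. RR q l)" if "l \<in> ball 0 \<rho>" for l
    using cx.C_mat_mult[of n "\<lambda>q. E q l" cH] Es[OF that] cHs unfolding c_C_mat_iff RR_def by simp
  have RRx: "mat_Dx (\<lambda>q. RR q l) q = l \<cdot>\<^sub>m (RR q l * Bx q)"
    and RRt: "mat_Dt (\<lambda>q. RR q l) q = l \<cdot>\<^sub>m (RR q l * Bt q l)" if l: "l \<in> ball 0 \<rho>" and q: "q \<in> S" for l q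
  proof -
    note c = Ec[OF l q] cc[OF q] ec Zc[OF q, of 0] H(1)[OF q q]
    have Ac: "map_mat complex_of_real (A q) \<in> carrier_mat n n" by (simp add: A_def)
    have Exq: "mat_Dx (\<lambda>q. E q l) q = E q l * (l \<cdot>\<^sub>m e + map_mat complex_of_real (A q))"
      unfolding Ex[OF l q] J_mat_split by (simp add: A_def connection_def e_def)
    have s1: "X + Y + - Y = X" if "X \<in> carrier_mat n n" "Y \<in> carrier_mat n n" for X Y :: "complex mat"
      using that by (intro eqI) simp_all
    have "mat_Dx (\<lambda>q. RR q l) q = mat_Dx (\<lambda>q. E q l) q * cH q + E q l * map_mat complex_of_real (mat_Dx H q)"
      using cx.mat_D_mult[OF q, of n "\<lambda>q. E q l" cH] Es[OF l] cHs cmat_D(1)[OF Hs q]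
      by (simp add: c_C_mat_iff RR_def[abs_def] cH_def[abs_def] mat_Dx_eq)
    also have "\<dots> = l \<cdot>\<^sub>m (E q l * (e * cH q))"
      unfolding Exq Hx[OF q] using c Ac
      by (simp add: cmat_lin cmat_mult A_def cH_def[symmetric] assoc ring_distribs smult_mult s1)
    also have "E q l * (e * cH q) = RR q l * Bx q"
      using c by (simp add: RR_def Bx_def assoc cancel[OF q])
    finally show "mat_Dx (\<lambda>q. RR q l) q = l \<cdot>\<^sub>m (RR q l * Bx q)" .
    have s2: "Y + X + - Y = X" if "X \<in> carrier_mat n n" "Y \<in> carrier_mat n n" for X Y :: "complex mat"
      using that by (intro eqI) simp_all
    have "mat_Dt (\<lambda>q. RR q l) q = mat_Dt (\<lambda>q. E q l) q * cH q + E q l * map_mat complex_of_real (mat_Dt H q)"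
      using ct.mat_D_mult[OF q, of n "\<lambda>q. E q l" cH] Es[OF l] cHs cmat_D(2)[OF Hs q]
      by (simp add: c_C_mat_iff RR_def[abs_def] cH_def[abs_def] mat_Dt_eq)
    also have "\<dots> = l \<cdot>\<^sub>m (E q l * (ZZ q l * cH q))"
      unfolding Et[OF l q] Zev[OF q] Ht[OF q] using c
      by (simp add: cmat_lin cmat_mult cH_def[symmetric] assoc ring_distribs smult_mult s2)
    also have "E q l * (ZZ q l * cH q) = RR q l * Bt q l"
      using c by (simp add: RR_def Bt_def assoc cancel[OF q])
    finally show "mat_Dt (\<lambda>q. RR q l) q = l \<cdot>\<^sub>m (RR q l * Bt q l)" .
  qed
  define D1 where "D1 = lam_deriv_mat n E"
  have D1c: "D1 q \<in> carrier_mat n n" for q by (simp add: D1_def lam_deriv_mat_def)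
  have D1: "((\<lambda>l. E q l $$ (r, k)) has_field_derivative D1 q $$ (r, k)) (at 0)" if "q \<in> S" "r < n" "k < n" for q r k
    using holomorphic_derivI[OF hol[OF that], of 0] \<rho> that by (simp add: D1_def lam_deriv_mat_def)
  define R1 where "R1 q = D1 q * cH q" for q
  have R1c: "R1 q \<in> carrier_mat n n" if "q \<in> S" for q using D1c cc[OF that] by (simp add: R1_def)
  have R1: "((\<lambda>l. RR q l $$ (r, k)) has_field_derivative R1 q $$ (r, k)) (at 0)" if q: "q \<in> S" and rk: "r < n" "k < n" for q r k
  proof -
    have "((\<lambda>l. \<Sum>m<n. E q l $$ (r, m) * cH q $$ (m, k)) has_field_derivative (\<Sum>m<n. D1 q $$ (r, m) * cH q $$ (m, k))) (at 0)"
      by (intro DERIV_sum DERIV_cmult_right D1 q rk) auto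
    then have "((\<lambda>l. RR q l $$ (r, k)) has_field_derivative (\<Sum>m<n. D1 q $$ (r, m) * cH q $$ (m, k))) (at 0)"
      by (rule has_field_derivative_transform_within_open[of _ _ _ "ball 0 \<rho>"])
        (use \<rho> Ec[OF _ q] cc[OF q] rk in \<open>simp_all add: RR_def mult_index del: index_mult_mat\<close>)
    then show ?thesis using D1c cc[OF q] rk by (simp add: R1_def mult_index del: index_mult_mat)
  qed
  have RR0: "RR q 0 = 1\<^sub>m n" if "q \<in> S" for q
    using E0[OF that] cHg[OF that] by (simp add: RR_def cg_def)
  \<comment> \<open>Stated along an arbitrary path \<kappa>, so that it serves horizontal and
    vertical lines alike. Each row of R is a linear system of its own.\<close>
  have line: "((\<lambda>s. R1 (\<kappa> s) $$ (r, k)) has_vector_derivative B (\<kappa> s0) 0 $$ (r, k)) (at s0)"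
    if d: "\<delta> > 0" and \<kappa>S: "\<And>s. \<bar>s - s0\<bar> < \<delta> \<Longrightarrow> \<kappa> s \<in> S"
      and Bcar: "\<And>q l. q \<in> S \<Longrightarrow> B q l \<in> carrier_mat n n"
      and der: "\<And>s l r k. \<bar>s - s0\<bar> < \<delta> \<Longrightarrow> l \<in> ball 0 \<rho> \<Longrightarrow> r < n \<Longrightarrow> k < n \<Longrightarrow>
        ((\<lambda>s. RR (\<kappa> s) l $$ (r, k)) has_vector_derivative (l \<cdot>\<^sub>m (RR (\<kappa> s) l * B (\<kappa> s) l)) $$ (r, k)) (at s)"
      and lim: "\<And>m k. m < n \<Longrightarrow> k < n \<Longrightarrow> ((\<lambda>(s, l). B (\<kappa> s) l $$ (m, k)) \<longlongrightarrow> B (\<kappa> s0) 0 $$ (m, k)) (nhds (s0, 0))"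
      and rk: "r < n" "k < n"
    for \<delta> s0 :: real and \<kappa> :: "real \<Rightarrow> real \<times> real" and B and r k :: nat
  proof -
    have \<kappa>S0: "\<kappa> s0 \<in> S" using \<kappa>S[of s0] d by simp
    have RRc: "RR q l \<in> carrier_mat n n" if "q \<in> S" "l \<in> ball 0 \<rho>" for q l
      using Ec[OF that(2,1)] cc[OF that(1)] by (simp add: RR_def)
    have "((\<lambda>s. R1 (\<kappa> s) $$ (r, k)) has_vector_derivative (\<Sum>m<n. RR (\<kappa> s0) 0 $$ (r, m) * B (\<kappa> s0) 0 $$ (m, k))) (at s0)"
    proof (rule lam_derivative_linear_system[OF d \<rho>, where R = "\<lambda>s l k. RR (\<kappa> s) l $$ (r, k)"
          and R' = "\<lambda>s k. R1 (\<kappa> s) $$ (r, k)" and B = "\<lambda>s l m k. B (\<kappa> s) l $$ (m, k)" and B' = "\<lambda>m k. B (\<kappa> s0) 0 $$ (m, k)"])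
      fix s :: real and l :: complex and k :: nat assume s: "\<bar>s - s0\<bar> < \<delta>" and l: "norm l < \<rho>" and k: "k < n"
      then have l': "l \<in> ball 0 \<rho>" by simp
      show "((\<lambda>s. RR (\<kappa> s) l $$ (r, k)) has_vector_derivative l * (\<Sum>m<n. RR (\<kappa> s) l $$ (r, m) * B (\<kappa> s) l $$ (m, k))) (at s)"
        using der[OF s l' rk(1) k] rk k RRc[OF \<kappa>S[OF s] l'] Bcar[OF \<kappa>S[OF s], of l]
        by (simp add: index mult_index del: index_mult_mat index_smult_mat)
    next
      fix s :: real and k :: nat assume "\<bar>s - s0\<bar> < \<delta>" "k < n"
      then show "((\<lambda>l. RR (\<kappa> s) l $$ (r, k)) has_field_derivative R1 (\<kappa> s) $$ (r, k)) (at 0)"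
        by (intro R1 \<kappa>S rk)
    qed (use lim rk in auto)
    also have "(\<Sum>m<n. RR (\<kappa> s0) 0 $$ (r, m) * B (\<kappa> s0) 0 $$ (m, k)) = (1\<^sub>m n * B (\<kappa> s0) 0) $$ (r, k)"
      unfolding RR0[OF \<kappa>S0] by (rule mult_index[symmetric]) (use Bcar[OF \<kappa>S0] rk in simp_all)
    also have "1\<^sub>m n * B (\<kappa> s0) 0 = B (\<kappa> s0) 0"
      using Bcar[OF \<kappa>S[of s0], of 0] d by simp
    finally show ?thesis .
  qed
  have cont: "isCont (\<lambda>q. M q $$ (r, k)) p" if "smooth_mat_on n S M" "p \<in> S" "r < n" "k < n"
    for M :: "real \<times> real \<Rightarrow> complex mat" and p r k
    using smooth_on_imp_continuous_on[of S "\<lambda>q. M q $$ (r, k)"] that open_S continuous_on_eq_continuous_at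
    by (auto simp: smooth_mat_on_def)
  have Bxs: "smooth_mat_on n S Bx"
    unfolding c_C_mat_iff(1)[symmetric] Bx_def
    by (intro cx.C_mat_mult cx.C_mat_const ec) (use cgs cHs in \<open>simp_all add: c_C_mat_iff\<close>)
  have Zi: "smooth_mat_on n S (\<lambda>q. map_mat complex_of_real (Z_coeff Z i q))" for i
    by (rule cmat_smooth[OF Z_coeff_smooth[OF Z]])
  have lim_Bt: "((\<lambda>(s, l). Bt (\<kappa> s) l $$ (m, k)) \<longlongrightarrow> Bt (\<kappa> s0) 0 $$ (m, k)) (nhds (s0, 0))"
    if \<kappa>: "isCont \<kappa> s0" "\<kappa> s0 \<in> S" and mk: "m < n" "k < n" and d: "\<delta> > 0" "\<And>s. \<bar>s - s0\<bar> < \<delta> \<Longrightarrow> \<kappa> s \<in> S"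
    for \<kappa> :: "real \<Rightarrow> real \<times> real" and s0 \<delta> :: real and m k :: nat
  proof -
    have B: "Bt q l $$ (m, k) = (\<Sum>a<n. cg q $$ (m, a) * (\<Sum>b<n. (\<Sum>i<j. map_mat complex_of_real (Z_coeff Z (Suc i) q) $$ (a, b) * l ^ i) * cH q $$ (b, k)))"
      if "q \<in> S" for q l
      unfolding Bt_def using mk cc[OF that] Zc[OF that]
      by (simp add: mult_index ZZ_def index del: index_mult_mat)
    have tc: "((\<lambda>q. M (\<kappa> (fst q)) $$ (a, b)) \<longlongrightarrow> M (\<kappa> s0) $$ (a, b)) (nhds (s0, 0::complex))"
      if "smooth_mat_on n S M" "a < n" "b < n" for M :: "real \<times> real \<Rightarrow> complex mat" and a b
      using tendsto_along_curve[where f = "\<lambda>q. M q $$ (a, b)" and \<kappa> = \<kappa> and x = s0, OF cont[OF that(1) \<kappa>(2) that(2,3)] \<kappa>(1)] by (simp add: case_prod_unfold)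
    have s: "((\<lambda>q. snd q) \<longlongrightarrow> (0::complex)) (nhds (s0, 0))"
      using tendsto_snd[of "\<lambda>q. q" "(s0, 0::complex)" "nhds (s0, 0)"] by (simp add: filterlim_ident)
    have "((\<lambda>q. \<Sum>a<n. cg (\<kappa> (fst q)) $$ (m, a) * (\<Sum>b<n. (\<Sum>i<j. map_mat complex_of_real (Z_coeff Z (Suc i) (\<kappa> (fst q))) $$ (a, b) * snd q ^ i) * cH (\<kappa> (fst q)) $$ (b, k)))
      \<longlongrightarrow> (\<Sum>a<n. cg (\<kappa> s0) $$ (m, a) * (\<Sum>b<n. (\<Sum>i<j. map_mat complex_of_real (Z_coeff Z (Suc i) (\<kappa> s0)) $$ (a, b) * 0 ^ i) * cH (\<kappa> s0) $$ (b, k)))) (nhds (s0, 0))"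
      by (intro tendsto_sum tendsto_mult tendsto_power s tc[OF cgs] tc[OF Zi] tc[OF cHs]) (use mk in auto)
    then show ?thesis unfolding B[OF \<kappa>(2), symmetric]
    proof (rule Lim_transform_eventually)
      have "eventually (\<lambda>q::real \<times> complex. dist q (s0, 0) < \<delta>) (nhds (s0, 0))"
        unfolding eventually_nhds_metric using d(1) by (intro exI[of _ \<delta>]) simp
      then show "eventually (\<lambda>q. (\<Sum>a<n. cg (\<kappa> (fst q)) $$ (m, a) * (\<Sum>b<n. (\<Sum>i<j. map_mat complex_of_real (Z_coeff Z (Suc i) (\<kappa> (fst q))) $$ (a, b) * snd q ^ i) * cH (\<kappa> (fst q)) $$ (b, k)))
         = (case q of (s, l) \<Rightarrow> Bt (\<kappa> s) l $$ (m, k))) (nhds (s0, 0))"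
      proof eventually_elim
        case (elim q)
        have "dist (fst q) s0 \<le> dist q (s0, 0)" using dist_fst_le[of q "(s0, 0)"] by simp
        then have "\<kappa> (fst q) \<in> S" using elim by (intro d(2)) (simp add: dist_real_def)
        then show ?case by (simp add: case_prod_unfold B)
      qed
    qed
  qed
  have par: "((\<lambda>s. R1 (s, snd p) $$ (r, k)) has_vector_derivative Bx p $$ (r, k)) (at (fst p))"
      "((\<lambda>s. R1 (fst p, s) $$ (r, k)) has_vector_derivative Bt p 0 $$ (r, k)) (at (snd p))"
    if p: "p \<in> S" and rk: "r < n" "k < n" for p r k
  proof -
    obtain \<delta> where d: "\<delta> > 0" "\<And>a b. \<bar>a - fst p\<bar> < \<delta> \<Longrightarrow> \<bar>b - snd p\<bar> < \<delta> \<Longrightarrow> (a, b) \<in> S"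
      using open_nbhd_lines[OF open_S p] by blast
    have RRd: "((\<lambda>s. RR (s, snd q) l $$ (r, k)) has_vector_derivative mat_Dx (\<lambda>q. RR q l) q $$ (r, k)) (at (fst q))"
      "((\<lambda>s. RR (fst q, s) l $$ (r, k)) has_vector_derivative mat_Dt (\<lambda>q. RR q l) q $$ (r, k)) (at (snd q))"
      if "q \<in> S" "l \<in> ball 0 \<rho>" "r < n" "k < n" for q l r k
      using smooth_on_partials(1,2)[of S "\<lambda>q. RR q l $$ (r, k)" q] RRs[OF that(2)] that
        cx.mat_D_index[of "\<lambda>q. RR q l" q n r k] ct.mat_D_index[of "\<lambda>q. RR q l" q n r k] smooth_matD[OF RRs[OF that(2)] that(1)]
      by (simp_all add: smooth_mat_on_def mat_Dx_eq mat_Dt_eq)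
    have "((\<lambda>s. R1 (s, snd p) $$ (r, k)) has_vector_derivative (\<lambda>q l. Bx q) (fst p, snd p) 0 $$ (r, k)) (at (fst p))"
    proof (rule line[where \<kappa> = "\<lambda>s. (s, snd p)" and B = "\<lambda>q l. Bx q", OF d(1)])
      fix s :: real and l :: complex and r k :: nat assume s: "\<bar>s - fst p\<bar> < \<delta>" and l: "l \<in> ball 0 \<rho>" and rk: "r < n" "k < n"
      have q: "(s, snd p) \<in> S" using d s by simp
      show "((\<lambda>s. RR (s, snd p) l $$ (r, k)) has_vector_derivative (l \<cdot>\<^sub>m (RR (s, snd p) l * Bx (s, snd p))) $$ (r, k)) (at s)"
        using RRd(1)[OF q l rk] unfolding RRx[OF l q] by simp
    next
      fix m k assume "m < n" "k < n"
      then show "((\<lambda>(s, l). Bx (s, snd p) $$ (m, k)) \<longlongrightarrow> Bx (fst p, snd p) $$ (m, k)) (nhds (fst p, 0::complex))"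
        using tendsto_along_curve[where f = "\<lambda>q. Bx q $$ (m, k)" and \<kappa> = "\<lambda>s. (s, snd p)" and x = "fst p"] cont[OF Bxs p, of m k]
        by (simp add: continuous_intros)
    qed (use d rk Bc in auto)
    then show "((\<lambda>s. R1 (s, snd p) $$ (r, k)) has_vector_derivative Bx p $$ (r, k)) (at (fst p))" by simp
    have "((\<lambda>s. R1 (fst p, s) $$ (r, k)) has_vector_derivative Bt (fst p, snd p) 0 $$ (r, k)) (at (snd p))"
    proof (rule line[where \<kappa> = "\<lambda>s. (fst p, s)" and B = Bt, OF d(1)])
      fix s :: real and l :: complex and r k :: nat assume s: "\<bar>s - snd p\<bar> < \<delta>" and l: "l \<in> ball 0 \<rho>" and rk: "r < n" "k < n"
      have q: "(fst p, s) \<in> S" using d s by simp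
      show "((\<lambda>s. RR (fst p, s) l $$ (r, k)) has_vector_derivative (l \<cdot>\<^sub>m (RR (fst p, s) l * Bt (fst p, s) l)) $$ (r, k)) (at s)"
        using RRd(2)[OF q l rk] unfolding RRt[OF l q] by simp
    next
      fix m k assume "m < n" "k < n"
      then show "((\<lambda>(s, l). Bt (fst p, s) l $$ (m, k)) \<longlongrightarrow> Bt (fst p, snd p) 0 $$ (m, k)) (nhds (snd p, 0))"
        using d p by (intro lim_Bt[where \<kappa> = "\<lambda>s. (fst p, s)" and \<delta> = \<delta>]) (auto intro: continuous_intros)
    qed (use d rk Bc in auto)
    then show "((\<lambda>s. R1 (fst p, s) $$ (r, k)) has_vector_derivative Bt p 0 $$ (r, k)) (at (snd p))" by simp
  qed
  \<comment> \<open>The sum runs over i < j, so j \<ge> 1 is what puts the coefficient of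
    \<lambda>^1 into it.\<close>
  have ZZ0: "ZZ q 0 = map_mat complex_of_real (Z_coeff Z 1 q)" if "q \<in> S" for q
  proof (rule eqI)
    fix r k assume rk: "r < n" "k < n"
    obtain j' where j': "j = Suc j'" using j by (cases j) auto
    show "ZZ q 0 $$ (r, k) = map_mat complex_of_real (Z_coeff Z 1 q) $$ (r, k)"
      using rk Zc[OF that, of 1] by (simp add: ZZ_def j' sum.lessThan_Suc_shift index del: sum.lessThan_Suc)
  qed (use Zc[OF that] in simp_all)
  have Bts: "smooth_mat_on n S (\<lambda>q. Bt q 0)"
    unfolding c_C_mat_iff(1)[symmetric]
    by (rule cx.C_mat_cong[of "\<lambda>q. cg q * (map_mat complex_of_real (Z_coeff Z 1 q) * cH q)"])
      (use cgs cHs Zi[of 1] in \<open>auto simp: Bt_def ZZ0 c_C_mat_iff(1)[symmetric] intro!: cx.C_mat_mult\<close>)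
  have R1s: "smooth_mat_on n S R1"
    unfolding smooth_mat_on_def
  proof (intro conjI ballI allI impI)
    fix r k assume rk: "r < n" "k < n"
    show "smooth_on S (\<lambda>q. R1 q $$ (r, k))"
      by (rule smooth_on_if_partials[OF open_S par(1)[OF _ rk] par(2)[OF _ rk]])
        (use Bxs Bts rk in \<open>auto simp: smooth_mat_on_def\<close>)
  qed (rule R1c)
  have R1D: "mat_Dx R1 q = Bx q" "mat_Dt R1 q = Bt q 0" if q: "q \<in> S" for q
  proof -
    show "mat_Dx R1 q = Bx q"
    proof (rule eqI)
      fix r k assume rk: "r < n" "k < n"
      show "mat_Dx R1 q $$ (r, k) = Bx q $$ (r, k)"
        using rk R1c[OF q] vector_derivative_at[OF par(1)[OF q rk]]
        by (simp add: mat_Dx_eq cx.mat_D_index[where n = n] Dx_def)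
    qed (use R1c[OF q] Bc[OF q] in \<open>simp_all add: mat_Dx_eq\<close>)
    show "mat_Dt R1 q = Bt q 0"
    proof (rule eqI)
      fix r k assume rk: "r < n" "k < n"
      show "mat_Dt R1 q $$ (r, k) = Bt q 0 $$ (r, k)"
        using rk R1c[OF q] vector_derivative_at[OF par(2)[OF q rk]]
        by (simp add: mat_Dt_eq ct.mat_D_index[where n = n] Dt_def)
    qed (use R1c[OF q] Bc[OF q] in \<open>simp_all add: mat_Dt_eq\<close>)
  qed
  have D1R: "D1 q = R1 q * cg q" if "q \<in> S" for q
    using D1c[of q] cc[OF that] cHg[OF that] by (simp add: R1_def assoc)
  have D1s: "smooth_mat_on n S D1"
    unfolding c_C_mat_iff(1)[symmetric]
    by (rule cx.C_mat_cong[OF _ cx.C_mat_mult[of n R1 cg]]) (use R1s cgs in \<open>auto simp: c_C_mat_iff D1R\<close>)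
  have D1x: "mat_Dx D1 q = D1 q * map_mat complex_of_real (A q) + cg q * e"
    and D1t: "mat_Dt D1 q = D1 q * map_mat complex_of_real (Z_coeff Z 0 q) + cg q * map_mat complex_of_real (Z_coeff Z 1 q)"
    if q: "q \<in> S" for q
  proof -
    note c = R1c[OF q] cc[OF q] ec Zc[OF q] gc[OF q]
    have Ac: "A q \<in> carrier_mat n n" by (simp add: A_def)
    have com: "X + Y = Y + X" if "X \<in> carrier_mat n n" "Y \<in> carrier_mat n n" for X Y :: "complex mat"
      using that by (intro eqI) simp_all
    have gD: "mat_D Dx cg q = cg q * map_mat complex_of_real (A q)"
      "mat_D Dt cg q = cg q * map_mat complex_of_real (Z_coeff Z 0 q)"
      using cmat_D[OF g q] gx[OF q] gt[OF q] c Ac by (simp_all add: mat_Dx_eq mat_Dt_eq cg_def[abs_def] A_def cmat_mult)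
    have "mat_Dx D1 q = mat_D Dx (\<lambda>q. R1 q * cg q) q"
      unfolding mat_Dx_eq by (rule cx.mat_D_cong[OF q D1R])
    also have "\<dots> = Bx q * cg q + R1 q * (cg q * map_mat complex_of_real (A q))"
      using cx.mat_D_mult[OF q, of n R1 cg] R1s cgs R1D(1)[OF q] gD by (simp add: c_C_mat_iff mat_Dx_eq)
    also have "\<dots> = cg q * e + D1 q * map_mat complex_of_real (A q)"
      using c Ac cHg[OF q] by (simp add: Bx_def assoc D1R[OF q])
    also have "\<dots> = D1 q * map_mat complex_of_real (A q) + cg q * e"
      by (rule com) (use c Ac D1c[of q] in simp_all)
    finally show "mat_Dx D1 q = \<dots>" .
    have "mat_Dt D1 q = mat_D Dt (\<lambda>q. R1 q * cg q) q"
      unfolding mat_Dt_eq by (rule ct.mat_D_cong[OF q D1R])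
    also have "\<dots> = Bt q 0 * cg q + R1 q * (cg q * map_mat complex_of_real (Z_coeff Z 0 q))"
      using ct.mat_D_mult[OF q, of n R1 cg] R1s cgs R1D(2)[OF q] gD by (simp add: c_C_mat_iff mat_Dt_eq)
    also have "\<dots> = cg q * map_mat complex_of_real (Z_coeff Z 1 q) + D1 q * map_mat complex_of_real (Z_coeff Z 0 q)"
      using c cHg[OF q] by (simp add: Bt_def ZZ0[OF q] assoc D1R[OF q])
    also have "\<dots> = D1 q * map_mat complex_of_real (Z_coeff Z 0 q) + cg q * map_mat complex_of_real (Z_coeff Z 1 q)"
      by (rule com) (use c D1c[of q] in simp_all)
    finally show "mat_Dt D1 q = \<dots>" .
  qed
  have E1c: "E1 q \<in> carrier_mat n n" for q using D1c[of q] by (simp add: E1_def D1_def)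
  show cE1: "map_mat complex_of_real (E1 q) = lam_deriv_mat n E q" if q: "q \<in> S" for q
  proof (rule eqI)
    fix r k assume rk: "r < n" "k < n"
    have "Im (deriv (\<lambda>l. E q l $$ (r, k)) 0) = 0"
    proof (rule deriv_real_on_reals[OF hol[OF q rk] \<rho>])
      fix l :: complex assume l: "l \<in> ball 0 \<rho>"
      then have "cnj l \<in> ball 0 \<rho>" by simp
      from Ec[OF this q] show "cnj (E q (cnj l) $$ (r, k)) = E q l $$ (r, k)"
        using arg_cong[OF real[OF l q], of "\<lambda>X. X $$ (r, k)"] rk by simp
    qed
    then show "map_mat complex_of_real (E1 q) $$ (r, k) = lam_deriv_mat n E q $$ (r, k)"
      using rk by (simp add: E1_def lam_deriv_mat_def complex_eq_iff)
  qed (use E1c[of q] D1c[of q] in \<open>simp_all add: D1_def\<close>)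
  show E1s: "smooth_mat_on n S E1"
    unfolding smooth_mat_on_def
  proof (intro conjI ballI allI impI)
    fix r k assume rk: "r < n" "k < n"
    have "smooth_on S (\<lambda>q. Re (D1 q $$ (r, k)))"
      using D1s rk by (intro smooth_on_bounded_linear[OF open_S bounded_linear_Re]) (simp add: smooth_mat_on_def)
    then show "smooth_on S (\<lambda>q. E1 q $$ (r, k))"
      by (rule x.C_cong[rotated]) (use rk D1c in \<open>simp add: E1_def D1_def lam_deriv_mat_def\<close>)
  qed (rule E1c)
  have inj: "X = Y" if "map_mat complex_of_real X = map_mat complex_of_real Y" "X \<in> carrier_mat n n" "Y \<in> carrier_mat n n" for X Y
  proof (rule eqI[OF that(2,3)])
    fix r k assume rk: "r < n" "k < n"
    have "map_mat complex_of_real X $$ (r, k) = map_mat complex_of_real Y $$ (r, k)"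
      by (simp only: that(1))
    then show "X $$ (r, k) = Y $$ (r, k)" using that(2,3) rk by simp
  qed
  fix q assume q: "q \<in> S"
  note c = E1c[of q] gc[OF q] Zc[OF q]
  have cD1: "map_mat complex_of_real (E1 q) = D1 q" if "q \<in> S" for q using cE1[OF that] by (simp add: D1_def)
  show "mat_Dx E1 q = E1 q * connection u q + g q * elem_mat n 1 n"
  proof (rule inj)
    have "map_mat complex_of_real (mat_Dx E1 q) = mat_Dx D1 q"
      using cmat_D(1)[OF E1s q] cx.mat_D_cong[OF q cD1] by (simp add: mat_Dx_eq)
    then show "map_mat complex_of_real (mat_Dx E1 q) = map_mat complex_of_real (E1 q * connection u q + g q * elem_mat n 1 n)"
      using c by (simp add: D1x[OF q] cmat_lin cmat_mult cD1[OF q] cmat_elem cg_def e_def A_def)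
  qed (use c in \<open>simp_all add: mat_Dx_eq\<close>)
  show "mat_Dt E1 q = E1 q * Z_coeff Z 0 q + g q * Z_coeff Z 1 q"
  proof (rule inj)
    have "map_mat complex_of_real (mat_Dt E1 q) = mat_Dt D1 q"
      using cmat_D(2)[OF E1s q] ct.mat_D_cong[OF q cD1] by (simp add: mat_Dt_eq)
    then show "map_mat complex_of_real (mat_Dt E1 q) = map_mat complex_of_real (E1 q * Z_coeff Z 0 q + g q * Z_coeff Z 1 q)"
      using c by (simp add: D1t[OF q] cmat_lin cmat_mult cD1[OF q] cg_def)
  qed (use c in \<open>simp_all add: mat_Dt_eq\<close>)
qed

end

section \<open>The Darboux transformation\<close>

text \<open>The vector w is g^{-1} c_0 divided by its last entry v_n. Since (v_n)_x = -v_{n-1} = h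
  v_n, the function h is the logarithmic x-derivative of v_n, and the normalisation adds the term -h
  w to the equation w_x = -(b + u) w.\<close>

locale darboux = kdv_domain n S for n S +
  fixes u :: "nat \<Rightarrow> real \<times> real \<Rightarrow> real" and h :: "real \<times> real \<Rightarrow> real" and w :: "nat \<Rightarrow> real \<times> real \<Rightarrow> real"
  assumes u_smooth: "i \<in> {1..n - 1} \<Longrightarrow> smooth_on S (u i)"
    and h_smooth: "smooth_on S h"
    and w_smooth: "r < n \<Longrightarrow> smooth_on S (w r)"
    and w_last: "p \<in> S \<Longrightarrow> w (n - 1) p = 1"
    and w_Dx: "p \<in> S \<Longrightarrow> r < n \<Longrightarrow> Dx (w r) p = - (\<Sum>k<n. connection u p $$ (r, k) * w k p) - h p * w r p"
begin

lemma connection_row: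
  assumes "r < n"
  shows "(\<Sum>k<n. connection v p $$ (r, k) * x k)
    = (if r = 0 then 0 else x (r - 1)) + (if r + 1 < n then v (r + 1) p * x (n - 1) else 0)"
proof -
  have "(\<Sum>k<n. connection v p $$ (r, k) * x k)
      = (\<Sum>k<n. (if k + 1 = r then x k else 0) + (if k + 1 = n then if r + 1 < n then v (r + 1) p * x k else 0 else 0))"
    using assms by (intro sum.cong refl) (auto simp: connection_index)
  also have "\<dots> = (\<Sum>k<n. if k + 1 = r then x k else 0) + (\<Sum>k<n. if k = n - 1 then if r + 1 < n then v (r + 1) p * x k else 0 else 0)"
    using n_ge by (subst sum.distrib) (intro arg_cong2[of _ _ _ _ "(+)"] sum.cong refl, auto)
  also have "(\<Sum>k<n. if k + 1 = r then x k else 0) = (if r = 0 then 0 else x (r - 1))"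
  proof (cases r)
    case (Suc m)
    then show ?thesis using assms by (simp add: sum.delta)
  qed simp
  finally show ?thesis using n_ge by simp
qed

text \<open>The last entry of w is constant, so the last row of its differential equation is
  algebraic.\<close>

lemma w_penultimate: "p \<in> S \<Longrightarrow> w (n - 2) p = - h p"
proof -
  assume p: "p \<in> S"
  have n1: "n - 1 < n" "n - 1 \<noteq> 0" "n - 1 - 1 = n - 2" "\<not> n - 1 + 1 < n" using n_ge by auto
  have "Dx (w (n - 1)) p = Dx (\<lambda>_. 1) p" by (rule x.D_cong[OF _ p]) (rule w_last)
  then have "Dx (w (n - 1)) p = 0" using x.D_const[OF p] by simp
  then show ?thesis using w_Dx[OF p n1(1)] connection_row[OF n1(1), of u p "\<lambda>k. w k p"] w_last[OF p] n1 by simp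
qed

text \<open>Row r of the equation for w, solved for the entry above, is the recursion that defines
  the w_i, because the last entry of w is 1. The indices differ by one, the recursion being
  1-based.\<close>

lemma bt_w_eq:
  assumes "p \<in> S" "r < n"
  shows "bt_w n u h (r + 1) p = w r p"
proof -
  have aux: "\<forall>p\<in>S. bt_w_aux n u h k p = w (n - 1 - k) p" if "k < n" for k
    using that
  proof (induction k rule: less_induct)
    case (less k)
    consider "k = 0" | "k = 1" | m where "k = Suc (Suc m)"
      by (metis One_nat_def not0_implies_Suc)
    then show ?case
    proof cases
      case 1
      then show ?thesis using w_last by simp
    next
      case 2
      then show ?thesis using w_penultimate by (simp add: numeral_2_eq_2)
    next
      case 3
      show ?thesis
      proof
        fix p assume p: "p \<in> S"
        define r where "r = n - 1 - Suc m"
        have r: "r < n" "r \<noteq> 0" "r + 1 < n" "r - 1 = n - 1 - k" "r + 1 = n - Suc m"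
          using less.prems 3 by (auto simp: r_def)
        have IH: "bt_w_aux n u h (Suc m) q = w r q" if "q \<in> S" for q
          using less.IH[of "Suc m"] less.prems 3 that by (simp add: r_def)
        have "Dx (bt_w_aux n u h (Suc m)) p = Dx (w r) p"
          by (rule x.D_cong[OF _ p]) (rule IH)
        then show "bt_w_aux n u h k p = w (n - 1 - k) p"
          using w_Dx[OF p r(1)] connection_row[OF r(1), of u p "\<lambda>k. w k p"] w_last[OF p] r IH[OF p]
          by (simp add: 3)
      qed
    qed
  qed
  show ?thesis unfolding bt_w_def using aux[of "n - (r + 1)"] assms by simp
qed

text \<open>The curvature after the transformation. It is visible in the last column of f_{u,h},
  next to the binomial term.\<close>

definition ut :: "nat \<Rightarrow> real \<times> real \<Rightarrow> real"
  where "ut i p = u i p + bt_s n u h i p"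

definition f0 :: "real \<times> real \<Rightarrow> real mat"
  where "f0 p = b_mat n + h p \<cdot>\<^sub>m 1\<^sub>m n + bt_N n u h p"

definition e :: "real mat"
  where "e = elem_mat n 1 n"

lemma carriers [simp]: "f0 p \<in> carrier_mat n n" "e \<in> carrier_mat n n"
  by (auto simp: f0_def bt_N_def e_def)

text \<open>The diagonal h is the case r = c of the binomial term, so one formula covers the
  diagonal and the part above it.\<close>

lemma f0_index:
  "r < n \<Longrightarrow> c < n \<Longrightarrow> f0 p $$ (r, c) = (if r = c + 1 then 1 else 0)
    + (if r \<le> c then real (c choose r) * (Dx ^^ (c - r)) h p else 0) + (if c + 1 = n \<and> r + 1 < n then ut (r + 1) p else 0)"
  by (auto simp: f0_def b_mat_def bt_N_def ut_def)

lemma ut_smooth: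
  assumes "i \<in> {1..n - 1}"
  shows "smooth_on S (ut i)"
proof -
  have w: "smooth_on S (bt_w n u h m)" if "m \<in> {1..n}" for m
    by (rule x.C_cong[of "w (m - 1)"]) (use that bt_w_eq[of _ "m - 1"] w_smooth[of "m - 1"] in auto)
  have "smooth_on S (\<lambda>p. Dx (bt_w n u h i) p
    - (\<Sum>m=i + 1..n. real ((m - 1) choose (i - 1)) * bt_w n u h m p * (Dx ^^ (m - i)) h p))"
    by (intro x.C_diff x.C_D x.C_sum x.C_mult x.C_const w iterated_Dx_smooth h_smooth) (use assms in auto)
  then show ?thesis using assms u_smooth unfolding ut_def bt_s_def by (intro x.C_add) auto
qed

lemma f0_smooth: "smooth_mat_on n S f0"
  unfolding x_C_mat_iff[symmetric]
proof (rule x.C_matI)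
  fix r c assume rc: "r < n" "c < n"
  have "smooth_on S (\<lambda>p. (if r = c + 1 then 1 else 0)
    + (if r \<le> c then real (c choose r) * (Dx ^^ (c - r)) h p else 0) + (if c + 1 = n \<and> r + 1 < n then ut (r + 1) p else 0))"
  proof (intro x.C_add)
    show "smooth_on S (\<lambda>p. if r = c + 1 then 1 else (0::real))" by (rule x.C_const)
    show "smooth_on S (\<lambda>p. if r \<le> c then real (c choose r) * (Dx ^^ (c - r)) h p else 0)"
      by (cases "r \<le> c") (simp_all add: x.C_const x.C_mult iterated_Dx_smooth h_smooth)
    show "smooth_on S (\<lambda>p. if c + 1 = n \<and> r + 1 < n then ut (r + 1) p else 0)"
    proof (cases "c + 1 = n \<and> r + 1 < n")
      case True
      then have "smooth_on S (ut (r + 1))" by (intro ut_smooth) auto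
      with True show ?thesis by (simp only: if_True simp_thms)
    next
      case False
      then show ?thesis by (simp only: if_False x.C_const)
    qed
  qed
  then show "smooth_on S (\<lambda>p. f0 p $$ (r, c))" using rc by (simp add: f0_index)
qed simp

text \<open>The correction s_{r+1} is exactly what makes row r vanish: substituting it cancels the
  binomial sum and leaves row r of the differential equation for w. The last row carries no
  correction and reduces to the value -h of the penultimate entry.\<close>

lemma f0_kernel:
  assumes p: "p \<in> S" and r: "r < n"
  shows "(\<Sum>c<n. f0 p $$ (r, c) * w c p) = 0"
proof -
  have "(\<Sum>c<n. f0 p $$ (r, c) * w c p)
    = (\<Sum>c<n. (if c + 1 = r then w c p else 0)) + (\<Sum>c<n. if r \<le> c then real (c choose r) * (Dx ^^ (c - r)) h p * w c p else 0)
      + (\<Sum>c<n. if c = n - 1 then if r + 1 < n then ut (r + 1) p * w c p else 0 else 0)"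
    unfolding sum.distrib[symmetric] using r n_ge
    by (intro sum.cong refl) (auto simp: f0_index algebra_simps)
  also have "(\<Sum>c<n. (if c + 1 = r then w c p else 0)) = (if r = 0 then 0 else w (r - 1) p)"
    using r by (cases r) (simp_all add: sum.delta)
  also have "(\<Sum>c<n. if c = n - 1 then if r + 1 < n then ut (r + 1) p * w c p else 0 else 0)
     = (if r + 1 < n then ut (r + 1) p else 0)"
    using n_ge w_last[OF p] by simp
  also have "(\<Sum>c<n. if r \<le> c then real (c choose r) * (Dx ^^ (c - r)) h p * w c p else 0)
     = (\<Sum>c=r..<n. real (c choose r) * (Dx ^^ (c - r)) h p * w c p)"
    by (rule sum.mono_neutral_cong_right) auto
  also have "\<dots> = h p * w r p + (\<Sum>c=r + 1..<n. real (c choose r) * (Dx ^^ (c - r)) h p * w c p)"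
    using r by (simp add: sum.atLeast_Suc_lessThan)
  finally have eq: "(\<Sum>c<n. f0 p $$ (r, c) * w c p) = (if r = 0 then 0 else w (r - 1) p)
    + (h p * w r p + (\<Sum>c=r + 1..<n. real (c choose r) * (Dx ^^ (c - r)) h p * w c p)) + (if r + 1 < n then ut (r + 1) p else 0)" .
  show ?thesis
  proof (cases "r + 1 < n")
    case True
    have bw: "bt_w n u h m p = w (m - 1) p" if "1 \<le> m" "m \<le> n" for m
      using bt_w_eq[OF p, of "m - 1"] that by simp
    have "(\<Sum>m=r + 1 + 1..n. real ((m - 1) choose (r + 1 - 1)) * bt_w n u h m p * (Dx ^^ (m - (r + 1))) h p)
      = (\<Sum>c=r + 1..<n. real (c choose r) * (Dx ^^ (c - r)) h p * w c p)"
      by (rule sum.reindex_bij_witness[of _ "\<lambda>c. c + 1" "\<lambda>m. m - 1"])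
        (use bw in \<open>auto simp: Suc_diff_le\<close>)
    moreover have "Dx (bt_w n u h (r + 1)) p = Dx (w r) p"
      by (rule x.D_cong[OF _ p]) (rule bt_w_eq[OF _ r])
    ultimately have "ut (r + 1) p = u (r + 1) p + Dx (w r) p
      - (\<Sum>c=r + 1..<n. real (c choose r) * (Dx ^^ (c - r)) h p * w c p)"
      unfolding ut_def bt_s_def by simp
    then show ?thesis
      unfolding eq using True w_Dx[OF p r] connection_row[OF r, of u p "\<lambda>k. w k p"] w_last[OF p] by simp
  next
    case False
    then have "r = n - 1" using r by simp
    then show ?thesis unfolding eq using n_ge w_last[OF p] w_penultimate[OF p] by (simp add: numeral_2_eq_2)
  qed
qed

text \<open>The vector w as the first column of a square matrix, so that the product rule and the
  ring laws for square matrices apply to it.\<close>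

definition Wm :: "real \<times> real \<Rightarrow> real mat"
  where "Wm p = mat n n (\<lambda>(r, c). if c = 0 then w r p else 0)"

lemma Wm_carrier [simp]: "Wm p \<in> carrier_mat n n"
  by (simp add: Wm_def)

lemma Wm_index: "r < n \<Longrightarrow> c < n \<Longrightarrow> Wm p $$ (r, c) = (if c = 0 then w r p else 0)"
  by (simp add: Wm_def)

lemma mult_Wm_index:
  assumes "M \<in> carrier_mat n n" "r < n" "c < n"
  shows "(M * Wm p) $$ (r, c) = (if c = 0 then \<Sum>k<n. M $$ (r, k) * w k p else 0)"
  using assms by (auto simp: mult_index Wm_index simp del: index_mult_mat)

lemma Wm_mult_index:
  assumes "M \<in> carrier_mat n n" "r < n" "c < n"
  shows "(Wm p * M) $$ (r, c) = w r p * M $$ (0, c)"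
proof -
  have "(Wm p * M) $$ (r, c) = (\<Sum>k<n. if k = 0 then w r p * M $$ (k, c) else 0)"
    unfolding mult_index[OF Wm_carrier assms] using assms by (intro sum.cong refl) (simp add: Wm_index)
  then show ?thesis using n_pos by simp
qed

lemma Wm_smooth: "smooth_mat_on n S Wm"
  unfolding x_C_mat_iff[symmetric]
proof (rule x.C_matI)
  fix r c assume "r < n" "c < n"
  then show "smooth_on S (\<lambda>p. Wm p $$ (r, c))"
    by (cases "c = 0") (simp_all add: Wm_index w_smooth x.C_const)
qed simp

lemma f0_Wm: "p \<in> S \<Longrightarrow> f0 p * Wm p = 0\<^sub>m n n"
  by (rule eqI) (simp_all add: mult_Wm_index f0_kernel del: index_mult_mat)

lemma Wm_Dx: "p \<in> S \<Longrightarrow> mat_Dx Wm p = - (connection u p * Wm p) - h p \<cdot>\<^sub>m Wm p"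
proof (rule eqI)
  fix r c assume p: "p \<in> S" and rc: "r < n" "c < n"
  show "mat_Dx Wm p $$ (r, c) = (- (connection u p * Wm p) - h p \<cdot>\<^sub>m Wm p) $$ (r, c)"
  proof (cases "c = 0")
    case True
    then show ?thesis using rc w_Dx[OF p rc(1)]
      by (simp add: mat_Dx_eq x.mat_D_index[where n = n] index mult_Wm_index Wm_index
        del: index_mult_mat index_minus_mat index_uminus_mat index_smult_mat)
  next
    case False
    then show ?thesis using rc x.D_const[OF p, of 0]
      by (simp add: mat_Dx_eq x.mat_D_index[where n = n] index mult_Wm_index Wm_index
        del: index_mult_mat index_minus_mat index_uminus_mat index_smult_mat)
  qed
qed (simp_all add: mat_Dx_eq)

lemma e_mult_index:
  assumes "M \<in> carrier_mat n n" "r < n" "c < n"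
  shows "(e * M) $$ (r, c) = (if r = 0 then M $$ (n - 1, c) else 0)"
proof -
  have "(e * M) $$ (r, c) = (\<Sum>k<n. if k = n - 1 then if r = 0 then M $$ (k, c) else 0 else 0)"
    unfolding mult_index[OF carriers(2) assms] using assms
    by (intro sum.cong refl) (auto simp: e_def elem_mat_def)
  then show ?thesis using n_pos by simp
qed

lemma mult_e_index:
  assumes "M \<in> carrier_mat n n" "r < n" "c < n"
  shows "(M * e) $$ (r, c) = (if c = n - 1 then M $$ (r, 0) else 0)"
proof -
  have "(M * e) $$ (r, c) = (\<Sum>k<n. if k = 0 then if c = n - 1 then M $$ (r, k) else 0 else 0)"
    unfolding mult_index[OF assms(1) carriers(2) assms(2,3)] using assms n_ge
    by (intro sum.cong refl) (auto simp: e_def elem_mat_def)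
  then show ?thesis using n_pos by simp
qed

lemma e_e: "e * e = 0\<^sub>m n n"
  by (rule eqI) (use n_ge in \<open>simp_all add: e_mult_index del: index_mult_mat\<close>, simp add: e_def elem_mat_def)

lemma e_index: "r < n \<Longrightarrow> c < n \<Longrightarrow> e $$ (r, c) = (if r = 0 \<and> c = n - 1 then 1 else 0)"
  by (auto simp: e_def elem_mat_def)

text \<open>Left multiplication by e_{1n} reads the bottom row only, and there f0 agrees with b + h
  I. Together with \<open>f0_e\<close> this settles the \<lambda>-linear part of the intertwining
  relation between the two x-connections.\<close>

lemma e_connection: "e * connection v p = e * f0 p - h p \<cdot>\<^sub>m e"
proof (rule eqI)
  fix r c assume rc: "r < n" "c < n"
  then show "(e * connection v p) $$ (r, c) = (e * f0 p - h p \<cdot>\<^sub>m e) $$ (r, c)"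
    using n_ge by (cases "c = n - 1") (simp_all add: index e_mult_index connection_index f0_index e_index
        del: index_mult_mat index_minus_mat index_smult_mat)
qed simp_all

lemma f0_e: "f0 p * e = connection v p * e + h p \<cdot>\<^sub>m e"
proof (rule eqI)
  fix r c assume rc: "r < n" "c < n"
  then show "(f0 p * e) $$ (r, c) = (connection v p * e + h p \<cdot>\<^sub>m e) $$ (r, c)"
    using n_ge by (cases "c = n - 1") (auto simp: index mult_e_index connection_index f0_index e_index
        simp del: index_mult_mat index_add_mat index_smult_mat)
qed simp_all

text \<open>Pascal's rule for the binomial coefficients. For c + 1 = n - 1 the bottom entry 1 of
  column c picks up the new curvature.\<close>

lemma f0_column_step:
  assumes p: "p \<in> S" and r: "r < n" and c: "c + 1 < n"
  shows "f0 p $$ (r, c + 1) = Dx (\<lambda>q. f0 q $$ (r, c)) p + (\<Sum>k<n. connection ut p $$ (r, k) * f0 p $$ (k, c))"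
proof -
  have f0c: "f0 q $$ (k, c) = (if k = c + 1 then 1 else 0) + (if k \<le> c then real (c choose k) * (Dx ^^ (c - k)) h q else 0)"
    if "k < n" for q k
    using that c by (simp add: f0_index)
  have D: "Dx (\<lambda>q. f0 q $$ (r, c)) p = (if r \<le> c then real (c choose r) * (Dx ^^ (c + 1 - r)) h p else 0)"
  proof (cases "r \<le> c")
    case True
    have "Dx (\<lambda>q. f0 q $$ (r, c)) p = Dx (\<lambda>q. real (c choose r) * (Dx ^^ (c - r)) h q) p"
      using True r by (simp add: f0c)
    also have "\<dots> = real (c choose r) * Dx ((Dx ^^ (c - r)) h) p"
      using x.D_mult[OF p x.C_const iterated_Dx_smooth[OF h_smooth]] x.D_const[OF p] by simp
    finally show ?thesis using True by (simp add: Suc_diff_le)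
  next
    case False
    then have "Dx (\<lambda>q. f0 q $$ (r, c)) p = Dx (\<lambda>q. if r = c + 1 then 1 else 0) p"
      using r by (simp add: f0c)
    then show ?thesis using False x.D_const[OF p] by simp
  qed
  have S: "(\<Sum>k<n. connection ut p $$ (r, k) * f0 p $$ (k, c))
    = (if r = 0 then 0 else f0 p $$ (r - 1, c)) + (if r + 1 < n then ut (r + 1) p * f0 p $$ (n - 1, c) else 0)"
    by (rule connection_row[OF r])
  have last: "f0 p $$ (n - 1, c) = (if c + 1 = n - 1 then 1 else 0)"
    using c n_ge by (auto simp: f0c)
  show ?thesis
  proof (cases r)
    case 0
    then show ?thesis unfolding S D last using c r by (auto simp: f0_index)
  next
    case (Suc m)
    have prev: "f0 p $$ (r - 1, c) = (if m = c + 1 then 1 else 0) + (if m \<le> c then real (c choose m) * (Dx ^^ (c - m)) h p else 0)"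
      using Suc r by (simp add: f0c)
    have cur: "f0 p $$ (r, c + 1) = (if m = c + 1 then 1 else 0)
      + (if m \<le> c then real ((c choose Suc m) + (c choose m)) * (Dx ^^ (c - m)) h p else 0) + (if c + 1 = n - 1 \<and> r + 1 < n then ut (r + 1) p else 0)"
      using Suc r c by (auto simp: f0_index)
    show ?thesis unfolding S D last prev cur using Suc by (auto simp: algebra_simps)
  qed
qed

text \<open>By \<open>f0_column_step\<close> the defect \<Delta> of the equation vanishes in all
  columns but the last. Differentiating f0 w = 0 gives \<Delta> w = 0, and as the last entry of w is
  1, the last column vanishes too.\<close>

lemma f0_Dx:
  assumes p: "p \<in> S"
  shows "mat_Dx f0 p = f0 p * connection u p - connection ut p * f0 p"
proof -
  define X where "X = mat_Dx f0 p"
  have Xc: "X \<in> carrier_mat n n" by (simp add: X_def mat_Dx_eq)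
  define \<Delta> where "\<Delta> = f0 p * connection u p - X - connection ut p * f0 p"
  have \<Delta>c: "\<Delta> \<in> carrier_mat n n" using Xc by (simp add: \<Delta>_def)
  have col: "\<Delta> $$ (r, c) = 0" if r: "r < n" and c: "c + 1 < n" for r c
  proof -
    have c': "c < n" using c by simp
    have "(f0 p * connection u p) $$ (r, c) = (\<Sum>k<n. if k = c + 1 then f0 p $$ (r, k) else 0)"
      unfolding mult_index[OF carriers(1) connection_carrier r c'] using c
      by (intro sum.cong refl) (simp add: connection_index)
    then have "(f0 p * connection u p) $$ (r, c) = f0 p $$ (r, c + 1)" using c by simp
    moreover have "X $$ (r, c) = Dx (\<lambda>q. f0 q $$ (r, c)) p"
      using r c' by (simp add: X_def mat_Dx_eq x.mat_D_index[where n = n])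
    ultimately show ?thesis
      using f0_column_step[OF p r c] r c' Xc mult_index[OF connection_carrier carriers(1) r c', of ut p p]
      by (simp add: \<Delta>_def index del: index_mult_mat index_minus_mat)
  qed
  have "mat_D Dx (\<lambda>q. f0 q * Wm q) p = mat_D Dx (\<lambda>q. 0\<^sub>m n n) p"
    by (rule x.mat_D_cong[OF p]) (rule f0_Wm)
  also have "\<dots> = 0\<^sub>m n n" by (rule x.mat_D_const[OF p]) simp
  finally have "X * Wm p + f0 p * mat_Dx Wm p = 0\<^sub>m n n"
    using x.mat_D_mult[OF p, of n f0 Wm] f0_smooth Wm_smooth by (simp add: x_C_mat_iff mat_Dx_eq X_def)
  then have XW: "X * Wm p + - (f0 p * (connection u p * Wm p)) = 0\<^sub>m n n"
    using f0_Wm[OF p] by (simp add: Wm_Dx[OF p] ring_distribs smult_mult)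
  have "\<Delta> * Wm p = 0\<^sub>m n n"
  proof (rule eqI)
    fix r c assume rc: "r < n" "c < n"
    have "\<Delta> * Wm p = f0 p * (connection u p * Wm p) - X * Wm p"
      using Xc f0_Wm[OF p] by (simp add: \<Delta>_def ring_distribs assoc)
    then show "(\<Delta> * Wm p) $$ (r, c) = 0\<^sub>m n n $$ (r, c)"
      using arg_cong[OF XW, of "\<lambda>M. M $$ (r, c)"] rc Xc
      by (simp add: index del: index_mult_mat index_minus_mat index_add_mat index_uminus_mat)
  qed (use \<Delta>c in simp_all)
  then have W: "(\<Sum>k<n. \<Delta> $$ (r, k) * w k p) = 0" if "r < n" for r
    using mult_Wm_index[OF \<Delta>c that n_pos, of p] that n_pos by simp
  have last: "\<Delta> $$ (r, n - 1) = 0" if r: "r < n" for r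
  proof -
    have "(\<Sum>k<n. \<Delta> $$ (r, k) * w k p) = (\<Sum>k<n. if k = n - 1 then \<Delta> $$ (r, k) else 0)"
      using col[OF r] w_last[OF p] by (intro sum.cong refl) auto
    then show ?thesis using W[OF r] n_pos by simp
  qed
  show ?thesis unfolding X_def[symmetric]
  proof (rule eqI)
    fix r c assume rc: "r < n" "c < n"
    have "\<Delta> $$ (r, c) = 0" using col[OF rc(1), of c] last[OF rc(1)] rc by (cases "c = n - 1") auto
    then show "X $$ (r, c) = (f0 p * connection u p - connection ut p * f0 p) $$ (r, c)"
      using rc Xc by (simp add: \<Delta>_def index del: index_mult_mat index_minus_mat)
  qed (use Xc in simp_all)
qed

end

lemma (in square_mat) lam_coeff_smult:
  assumes "M \<in> carrier_mat n n"
  shows "lam_coeff (fls_X_inv \<cdot>\<^sub>m M) i = lam_coeff M (i - 1)" "lam_coeff (fls_X \<cdot>\<^sub>m M) i = lam_coeff M (i + 1)"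
  by (rule lam_coeff_lin(4)[OF assms assms], rule lam_coeff_lin(5)[OF assms assms])

lemma (in square_mat) lam_coeff_plus_mult:
  fixes A B :: "real mat"
  assumes "A \<in> carrier_mat n n" "B \<in> carrier_mat n n" "M \<in> carrier_mat n n"
  shows "lam_coeff ((fls_X_inv \<cdot>\<^sub>m map_mat fls_const A + map_mat fls_const B) * M) i = A * lam_coeff M (i - 1) + B * lam_coeff M i"
    "lam_coeff (M * (fls_X_inv \<cdot>\<^sub>m map_mat fls_const A + map_mat fls_const B)) i = lam_coeff M (i - 1) * A + lam_coeff M i * B"
  using assms by (simp_all add: ring_distribs smult_mult lam_coeff_lin lam_coeff_const_mult)

lemma (in square_mat) lam_coeff_minus_mult:
  fixes A B :: "real mat"
  assumes "A \<in> carrier_mat n n" "B \<in> carrier_mat n n" "M \<in> carrier_mat n n"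
  shows "lam_coeff ((map_mat fls_const A + fls_X \<cdot>\<^sub>m map_mat fls_const B) * M) i = A * lam_coeff M i + B * lam_coeff M (i + 1)"
    "lam_coeff (M * (map_mat fls_const A + fls_X \<cdot>\<^sub>m map_mat fls_const B)) i = lam_coeff M i * A + lam_coeff M (i + 1) * B"
  using assms by (simp_all add: ring_distribs smult_mult lam_coeff_lin lam_coeff_const_mult)

lemma (in function_derivation) mat_D_right_inverse:
  assumes p: "p \<in> S" and F: "C_mat n F" and K: "C_mat n K"
    and inv: "\<And>q. q \<in> S \<Longrightarrow> K q * F q = 1\<^sub>m n" "\<And>q. q \<in> S \<Longrightarrow> F q * K q = 1\<^sub>m n"
  shows "mat_D D K p = - (K p * (mat_D D F p * K p))"
proof -
  interpret square_mat n .
  note c = C_matD(1)[OF F p] C_matD(1)[OF K p]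
  have FX: "mat_D D F p = F p * (K p * mat_D D F p)"
    using c inv(2)[OF p] assoc[of "F p" "K p" "mat_D D F p"] by simp
  have "mat_D D K p = - (K p * mat_D D F p * K p)"
    by (rule mat_D_inverse[OF p F K inv _ FX]) (use c in simp_all)
  then show ?thesis using c by (simp add: assoc)
qed

section \<open>The inverse of the Darboux matrix and the intertwining of the x-connections\<close>

context darboux begin

text \<open>The coefficients of \<open>(\<lambda> e + f0)\<^sup>-\<^sup>1 = B0 + \<lambda>\<^sup>-\<^sup>1 Bm\<close>, where \<open>Bm\<close> is supported on the kernel \<open>w\<close> of \<open>f0\<close>.\<close>

definition Um :: "real \<times> real \<Rightarrow> real mat"
  where "Um p = mat n n (\<lambda>(r, c). if r + 1 < n then f0 p $$ (r + 1, c) else if c = r then 1 else 0)"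

definition bT :: "real mat"
  where "bT = transpose_mat (b_mat n)"

text \<open>An inverse of the form B0 + \<lambda>^{-1} Bm requires that e B0 = 0 and that f0 B0
  agree with the identity outside the first row. With rows 2 to n of f0 and the last unit row
  collected in \<open>Um\<close>, this is the triangular system Um B0 = b^t.\<close>

definition B0 :: "real \<times> real \<Rightarrow> real mat"
  where "B0 p = adj_mat (Um p) * bT"

text \<open>The product is w times the first row of I - f0 B0. As w ends in 1, multiplication by
  e_{1n} returns exactly that first row.\<close>

definition Bm :: "real \<times> real \<Rightarrow> real mat"
  where "Bm p = Wm p * (1\<^sub>m n - f0 p * B0 p)"

lemma Um_carrier [simp]: "Um p \<in> carrier_mat n n" "bT \<in> carrier_mat n n"
  by (simp_all add: Um_def bT_def)

lemma bT_index: "r < n \<Longrightarrow> c < n \<Longrightarrow> bT $$ (r, c) = (if c = r + 1 then 1 else 0)"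
  by (simp add: bT_def b_mat_def)

lemma Um_index:
  assumes "r < n" "c < n"
  shows "c < r \<Longrightarrow> Um p $$ (r, c) = 0" "Um p $$ (r, r) = 1"
    "r + 1 < n \<Longrightarrow> Um p $$ (r, c) = f0 p $$ (r + 1, c)" "Um p $$ (n - 1, c) = (if c = n - 1 then 1 else 0)"
  using assms n_ge by (auto simp: Um_def f0_index)

lemma det_Um: "det (Um p) = 1"
proof -
  have "upper_triangular (Um p)" by (auto simp: upper_triangular_def Um_index)
  then have "det (Um p) = prod_list (diag_mat (Um p))"
    by (rule det_upper_triangular) (rule Um_carrier)
  also have "diag_mat (Um p) = map (\<lambda>r. 1) [0..<n]"
    unfolding diag_mat_def by (intro map_cong) (auto simp: Um_index)
  finally show ?thesis by (simp add: map_replicate_const)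
qed

lemma Um_inverse: "adj_mat (Um p) \<in> carrier_mat n n" "Um p * adj_mat (Um p) = 1\<^sub>m n"
  by (rule det_one_inverse[OF Um_carrier(1) det_Um])+

lemma B_carrier [simp]: "B0 p \<in> carrier_mat n n" "Bm p \<in> carrier_mat n n"
  using Um_inverse(1) by (simp_all add: B0_def Bm_def)

lemma Um_B0: "Um p * B0 p = bT"
  using Um_inverse[of p] by (simp add: B0_def flip: assoc)

text \<open>Back substitution from the bottom row: \<open>Um\<close> is upper triangular with unit
  diagonal and b^t is strictly upper triangular. The strictness yields e B0 = 0, the vanishing first
  column of B0 and, later, the shape of the new \<zeta>.\<close>

lemma B0_upper:
  assumes "c \<le> r" "r < n"
  shows "B0 p $$ (r, c) = 0"
  using assms
proof (induction "n - r" arbitrary: r rule: less_induct)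
  case less
  have c: "c < n" using less.prems by simp
  have "0 = (Um p * B0 p) $$ (r, c)" unfolding Um_B0 using less.prems c by (simp add: bT_index)
  also have "\<dots> = (\<Sum>k<n. Um p $$ (r, k) * B0 p $$ (k, c))"
    by (rule mult_index) (use less.prems c in auto)
  also have "\<dots> = (\<Sum>k<n. if k = r then B0 p $$ (k, c) else 0)"
  proof (intro sum.cong refl)
    fix k assume k: "k \<in> {..<n}"
    consider "k < r" | "k = r" | "k > r" by linarith
    then show "Um p $$ (r, k) * B0 p $$ (k, c) = (if k = r then B0 p $$ (k, c) else 0)"
    proof cases
      case 3
      then have "B0 p $$ (k, c) = 0" using less.hyps[of k] less.prems k by auto
      then show ?thesis using 3 by simp
    qed (use less.prems k in \<open>auto simp: Um_index\<close>)
  qed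
  also have "\<dots> = B0 p $$ (r, c)" using less.prems by simp
  finally show ?case by simp
qed

lemma e_B0: "e * B0 p = 0\<^sub>m n n"
proof (rule eqI)
  fix r c assume rc: "r < n" "c < n"
  then have "B0 p $$ (n - 1, c) = 0" by (intro B0_upper) auto
  then show "(e * B0 p) $$ (r, c) = 0\<^sub>m n n $$ (r, c)" using rc by (simp add: e_mult_index del: index_mult_mat)
qed simp_all

lemma f0_B0_row:
  assumes "r + 1 < n" "c < n"
  shows "(f0 p * B0 p) $$ (r + 1, c) = (if c = r + 1 then 1 else 0)"
proof -
  have "(f0 p * B0 p) $$ (r + 1, c) = (\<Sum>k<n. f0 p $$ (r + 1, k) * B0 p $$ (k, c))"
    by (rule mult_index) (use assms in auto)
  also have "\<dots> = (\<Sum>k<n. Um p $$ (r, k) * B0 p $$ (k, c))"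
    using assms by (intro sum.cong refl) (simp add: Um_index)
  also have "\<dots> = (Um p * B0 p) $$ (r, c)" by (rule mult_index[symmetric]) (use assms in auto)
  finally show ?thesis unfolding Um_B0 using assms by (simp add: bT_index)
qed

lemma e_Bm: "p \<in> S \<Longrightarrow> e * Bm p + f0 p * B0 p = 1\<^sub>m n"
proof (rule eqI)
  fix r c assume p: "p \<in> S" and rc: "r < n" "c < n"
  have "(e * Bm p) $$ (r, c) = (if r = 0 then (1\<^sub>m n - f0 p * B0 p) $$ (0, c) else 0)"
    using rc n_ge w_last[OF p] by (simp add: e_mult_index Bm_def Wm_mult_index del: index_mult_mat index_minus_mat)
  moreover have "(f0 p * B0 p) $$ (r, c) = (if c = r then 1 else 0)" if "r \<noteq> 0"
    using f0_B0_row[of "r - 1" c p] that rc by simp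
  ultimately show "(e * Bm p + f0 p * B0 p) $$ (r, c) = 1\<^sub>m n $$ (r, c)"
    using rc n_ge by (auto simp: index simp del: index_mult_mat index_add_mat index_minus_mat)
qed simp_all

lemma f0_Bm: "p \<in> S \<Longrightarrow> f0 p * Bm p = 0\<^sub>m n n"
  using f0_Wm[of p] by (simp add: Bm_def flip: assoc)

text \<open>The first column of the inverse of f_{u,h} is \<lambda>^{-1} w. The first column of the
  new frame therefore involves w alone.\<close>

lemma B_first_column:
  assumes "r < n"
  shows "B0 p $$ (r, 0) = 0" "Bm p $$ (r, 0) = w r p"
proof -
  have z: "B0 p $$ (r, 0) = 0" if "r < n" for r using that by (intro B0_upper) auto
  show "B0 p $$ (r, 0) = 0" by (rule z[OF assms])
  have "(f0 p * B0 p) $$ (0, 0) = 0"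
    using n_pos mult_index[of "f0 p" "B0 p" 0 0] z by simp
  then show "Bm p $$ (r, 0) = w r p"
    using assms n_pos by (simp add: Bm_def Wm_mult_index index del: index_mult_mat index_minus_mat)
qed

lemma Um_smooth: "smooth_mat_on n S Um"
  unfolding x_C_mat_iff[symmetric]
proof (rule x.C_matI)
  fix r c assume rc: "r < n" "c < n"
  show "smooth_on S (\<lambda>p. Um p $$ (r, c))"
  proof (cases "r + 1 < n")
    case True
    then show ?thesis using f0_smooth rc by (simp add: Um_index smooth_mat_on_def)
  next
    case False
    then show ?thesis using rc by (simp add: Um_def x.C_const)
  qed
qed simp

lemma B_smooth: "smooth_mat_on n S B0" "smooth_mat_on n S Bm"
proof -
  show B0: "smooth_mat_on n S B0"
    unfolding B0_def x_C_mat_iff[symmetric]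
    by (intro x.C_mat_mult x.C_mat_adj x.C_mat_const Um_carrier) (simp add: x_C_mat_iff Um_smooth)
  show "smooth_mat_on n S Bm"
    unfolding Bm_def x_C_mat_iff[symmetric]
    by (intro x.C_mat_mult x.C_mat_diff x.C_mat_const) (simp_all add: x_C_mat_iff Wm_smooth f0_smooth B0)
qed

definition F :: "real \<times> real \<Rightarrow> real fls mat"
  where "F p = fls_X_inv \<cdot>\<^sub>m map_mat fls_const e + map_mat fls_const (f0 p)"

definition K :: "real \<times> real \<Rightarrow> real fls mat"
  where "K p = map_mat fls_const (B0 p) + fls_X \<cdot>\<^sub>m map_mat fls_const (Bm p)"

lemma FK_carrier [simp]: "F p \<in> carrier_mat n n" "K p \<in> carrier_mat n n"
  by (simp_all add: F_def K_def)

lemma F_mult: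
  "M \<in> carrier_mat n n \<Longrightarrow> lam_coeff (F p * M) i = e * lam_coeff M (i - 1) + f0 p * lam_coeff M i"
  "M \<in> carrier_mat n n \<Longrightarrow> lam_coeff (M * F p) i = lam_coeff M (i - 1) * e + lam_coeff M i * f0 p"
  unfolding F_def by (rule lam_coeff_plus_mult; simp)+

lemma K_mult:
  "M \<in> carrier_mat n n \<Longrightarrow> lam_coeff (K p * M) i = B0 p * lam_coeff M i + Bm p * lam_coeff M (i + 1)"
  "M \<in> carrier_mat n n \<Longrightarrow> lam_coeff (M * K p) i = lam_coeff M i * B0 p + lam_coeff M (i + 1) * Bm p"
  unfolding K_def by (rule lam_coeff_minus_mult; simp)+

lemma Lax_eq: "Lax v p = fls_X_inv \<cdot>\<^sub>m map_mat fls_const e + map_mat fls_const (connection v p)"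
  unfolding Lax_def J_mat_fls connection_def e_def const_add(1)[OF elem_carrier(2) elem_carrier(4)]
  by (rule assoc_add_mat) auto

lemma Lax_mult:
  "M \<in> carrier_mat n n \<Longrightarrow> lam_coeff (Lax v p * M) i = e * lam_coeff M (i - 1) + connection v p * lam_coeff M i"
  "M \<in> carrier_mat n n \<Longrightarrow> lam_coeff (M * Lax v p) i = lam_coeff M (i - 1) * e + lam_coeff M i * connection v p"
  unfolding Lax_eq by (rule lam_coeff_plus_mult; simp)+

lemma lam_coeff_FK:
  "lam_coeff (F p) i = (if i = 1 then e else if i = 0 then f0 p else 0\<^sub>m n n)"
  "lam_coeff (K p) i = (if i = 0 then B0 p else if i = -1 then Bm p else 0\<^sub>m n n)"
  "lam_coeff (Lax v p) i = (if i = 1 then e else if i = 0 then connection v p else 0\<^sub>m n n)"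
  by (auto simp: F_def K_def Lax_eq lam_coeff_lin(1) lam_coeff_smult lam_coeff_const)

text \<open>The coefficients of \<lambda>, 1 and \<lambda>^{-1} in the product are given by e B0 =
  0, e Bm + f0 B0 = I and f0 Bm = 0.\<close>

lemma FK_inverse:
  assumes "p \<in> S"
  shows "F p * K p = 1\<^sub>m n" "K p * F p = 1\<^sub>m n"
proof -
  have one: "lam_coeff (1\<^sub>m n :: real fls mat) i = (if i = 0 then 1\<^sub>m n else 0\<^sub>m n n)" for i
    by (rule eqI) (auto simp: lam_coeff_index)
  have c: "(if i = 0 then B0 p else if i = -1 then Bm p else 0\<^sub>m n n) \<in> carrier_mat n n" for i :: int by simp
  show FK: "F p * K p = 1\<^sub>m n"
  proof (rule lam_coeff_eqI)
    fix i :: int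
    consider "i = 1" | "i = 0" | "i = -1" | "i \<noteq> 1" "i \<noteq> 0" "i \<noteq> -1" by blast
    then show "lam_coeff (F p * K p) i = lam_coeff (1\<^sub>m n) i"
      unfolding F_mult(1)[OF FK_carrier(2)] lam_coeff_FK one
      by cases (auto simp: e_B0 e_Bm[OF assms] f0_Bm[OF assms])
  qed simp_all
  show "K p * F p = 1\<^sub>m n" by (rule right_inverse_imp_left[OF _ _ FK]) simp_all
qed

lemma FK_C_mat: "fx.C_mat n F" "fx.C_mat n K"
proof -
  have X: "fx.C_mat n (\<lambda>p. k \<cdot>\<^sub>m M p)" if M: "fx.C_mat n M" for k and M :: "real \<times> real \<Rightarrow> real fls mat"
  proof (rule fx.C_matI)
    fix r c assume rc: "r < n" "c < n"
    show "fls_smooth_on S (\<lambda>p. (k \<cdot>\<^sub>m M p) $$ (r, c))"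
      by (rule fx.C_cong[OF _ fx.C_mult[OF fx.C_const[of k] fx.C_matD(2)[OF M rc]]])
        (use rc fx.C_matD(1)[OF M] in \<open>simp add: index\<close>)
  qed (use fx.C_matD(1)[OF M] in simp)
  show "fx.C_mat n F" unfolding F_def
    by (intro fx.C_mat_add fx.C_mat_const const_C_mat f0_smooth) simp
  show "fx.C_mat n K" unfolding K_def
    by (intro fx.C_mat_add X const_C_mat B_smooth)
qed

text \<open>Coefficientwise: at \<lambda>^2 only the product e e = 0 occurs, at \<lambda> the
  relations \<open>e_connection\<close> and \<open>f0_e\<close>, and at \<lambda>^0 the differential
  equation of \<open>f0\<close>.\<close>

lemma F_Dx:
  assumes p: "p \<in> S"
  shows "mat_D (fls_D Dx) F p = F p * Lax u p - Lax ut p * F p"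
proof (rule lam_coeff_eqI)
  fix i :: int
  have L: "lam_coeff (mat_D (fls_D Dx) F p) i = mat_Dx (\<lambda>q. if i = 1 then e else if i = 0 then f0 q else 0\<^sub>m n n) p"
    unfolding lam_coeff_D[OF FK_C_mat(1) p] lam_coeff_FK by (rule refl)
  have R: "lam_coeff (F p * Lax u p - Lax ut p * F p) i
    = (e * lam_coeff (Lax u p) (i - 1) + f0 p * lam_coeff (Lax u p) i)
      - (e * lam_coeff (F p) (i - 1) + connection ut p * lam_coeff (F p) i)"
    unfolding lam_coeff_lin(2)[OF carrier_closed(1)[OF FK_carrier(1) Lax_carrier] carrier_closed(1)[OF Lax_carrier FK_carrier(1)]]
      F_mult(1)[OF Lax_carrier] Lax_mult(1)[OF FK_carrier(1)] by (rule refl)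
  have 1: "e * connection u p + f0 p * e - (e * f0 p + connection ut p * e) = 0\<^sub>m n n"
    unfolding e_connection[of u p] f0_e[of p ut]
    by (rule eqI) (simp_all add: index del: index_add_mat index_minus_mat index_mult_mat index_smult_mat)
  consider "i = 2" | "i = 1" | "i = 0" | "i \<noteq> 2" "i \<noteq> 1" "i \<noteq> 0" by blast
  then show "lam_coeff (mat_D (fls_D Dx) F p) i = lam_coeff (F p * Lax u p - Lax ut p * F p) i"
  proof cases
    case 1
    then show ?thesis unfolding L R lam_coeff_FK by (simp add: mat_Dx_eq x.mat_D_const[OF p] e_e)
  next
    case 2
    then show ?thesis unfolding L R lam_coeff_FK using \<open>e * connection u p + f0 p * e - _ = _\<close>
      by (simp add: mat_Dx_eq x.mat_D_const[OF p])
  next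
    case 3
    then show ?thesis unfolding L R lam_coeff_FK using f0_Dx[OF p] by (simp add: mat_Dx_eq)
  next
    case 4
    then show ?thesis unfolding L R lam_coeff_FK by (simp add: mat_Dx_eq x.mat_D_const[OF p])
  qed
qed simp_all

lemma K_Dx:
  assumes p: "p \<in> S"
  shows "mat_D (fls_D Dx) K p = K p * Lax ut p - Lax u p * K p"
proof -
  have KF: "K p * (F p * X) = X" if "X \<in> carrier_mat n n" for X
    using that FK_inverse[OF p] assoc[of "K p" "F p" X] by simp
  have "mat_D (fls_D Dx) K p = - (K p * (mat_D (fls_D Dx) F p * K p))"
    by (rule fx.mat_D_right_inverse[OF p FK_C_mat FK_inverse(2) FK_inverse(1)])
  also have "\<dots> = - (Lax u p * K p - K p * Lax ut p)"
    using FK_inverse[OF p] by (simp add: F_Dx[OF p] ring_distribs assoc KF)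
  also have "\<dots> = K p * Lax ut p - Lax u p * K p"
    by (rule eqI) (simp_all add: index del: index_minus_mat index_mult_mat index_uminus_mat)
  finally show ?thesis .
qed

text \<open>The coefficients of \<lambda>^0 and \<lambda>^{-1} in the equation for the inverse
  series, in the form in which the new frame is differentiated.\<close>

lemma B_Dx:
  assumes p: "p \<in> S"
  shows "mat_Dx B0 p = B0 p * connection ut p + Bm p * e - (e * Bm p + connection u p * B0 p)"
    "mat_Dx Bm p = Bm p * connection ut p - connection u p * Bm p"
proof -
  have "mat_Dx (\<lambda>q. lam_coeff (K q) i) p = lam_coeff (K p * Lax ut p - Lax u p * K p) i" for i
    using lam_coeff_D(1)[OF FK_C_mat(2) p, of i] K_Dx[OF p] by simp
  from this[of 0] this[of "-1"] show "mat_Dx B0 p = B0 p * connection ut p + Bm p * e - (e * Bm p + connection u p * B0 p)"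
    "mat_Dx Bm p = Bm p * connection ut p - connection u p * Bm p"
    by (simp_all add: lam_coeff_FK lam_coeff_lin(2) K_mult(1)[OF Lax_carrier] Lax_mult(1)[OF FK_carrier(2)])
qed

end

section \<open>The transformed series, t-connection and \<zeta>\<close>

locale darboux_flow = darboux n S u h w for n S u h w +
  fixes j :: nat and Y :: "real \<times> real \<Rightarrow> real fls mat" and \<zeta> :: "real \<times> real \<Rightarrow> real mat"
    and \<mu> :: "real \<times> real \<Rightarrow> real"
  assumes Y: "is_Y n S u Y" and zeta: "is_zeta n j S u Y \<zeta>"
    and w_Dt: "p \<in> S \<Longrightarrow> r < n \<Longrightarrow> Dt (w r) p
      = - (\<Sum>k<n. (lam_coeff (Y p ^\<^sub>m j) 0 - \<zeta> p) $$ (r, k) * w k p) + \<mu> p * w r p"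
begin

definition Z0 :: "real \<times> real \<Rightarrow> real mat"
  where "Z0 p = lam_coeff (Y p ^\<^sub>m j) 0 - \<zeta> p"

definition Yt :: "real \<times> real \<Rightarrow> real fls mat"
  where "Yt p = F p * Y p * K p"

lemma Y_carrier: "p \<in> S \<Longrightarrow> Y p \<in> carrier_mat n n"
  by (rule is_Y_carrier[OF Y])

lemma zeta_carrier: "p \<in> S \<Longrightarrow> \<zeta> p \<in> carrier_mat n n"
  using zeta by (simp add: is_zeta_def smooth_mat_on_def)

lemma Z0_carrier: "p \<in> S \<Longrightarrow> Z0 p \<in> carrier_mat n n"
  using zeta_carrier by (simp add: Z0_def)

lemma Yj_smooth: "smooth_mat_on n S (\<lambda>p. lam_coeff (Y p ^\<^sub>m j) i)"
  by (rule fls_C_matD[OF fx.C_mat_pow[OF is_Y_C_mat[OF Y]]])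

lemma zeta_smooth: "smooth_mat_on n S \<zeta>"
  using zeta by (simp add: is_zeta_def)

lemma Z0_smooth: "smooth_mat_on n S Z0"
  unfolding Z0_def x_C_mat_iff[symmetric]
  by (intro x.C_mat_diff) (simp_all add: x_C_mat_iff Yj_smooth zeta_smooth)

lemma Yt_carrier: "p \<in> S \<Longrightarrow> Yt p \<in> carrier_mat n n"
  using Y_carrier by (simp add: Yt_def)

lemma Yt_C_mat: "fx.C_mat n Yt"
  unfolding Yt_def by (intro fx.C_mat_mult FK_C_mat is_Y_C_mat[OF Y])

lemma Y_D: "p \<in> S \<Longrightarrow> mat_D (fls_D Dx) Y p = Y p * Lax u p - Lax u p * Y p"
proof (rule lam_coeff_eqI)
  fix i assume p: "p \<in> S"
  note c = Y_carrier[OF p]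
  have D: "mat_Dx (\<lambda>q. lam_coeff (Y q) i) p \<in> carrier_mat n n" using c by (simp add: mat_Dx_eq)
  have z: "mat_Dx (\<lambda>q. lam_coeff (Y q) i) p + lam_coeff (Lax u p * Y p - Y p * Lax u p) i = 0\<^sub>m n n"
    using is_Y_flat[OF Y] p by (simp add: flat_def)
  have "mat_Dx (\<lambda>q. lam_coeff (Y q) i) p = lam_coeff (Y p * Lax u p - Lax u p * Y p) i"
  proof (rule eqI)
    fix r k assume "r < n" "k < n"
    then show "mat_Dx (\<lambda>q. lam_coeff (Y q) i) p $$ (r, k) = lam_coeff (Y p * Lax u p - Lax u p * Y p) i $$ (r, k)"
      using arg_cong[OF z, of "\<lambda>X. X $$ (r, k)"] c D
      by (simp add: index lam_coeff_lin(2) del: index_add_mat index_minus_mat index_mult_mat)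
  qed (use c D in simp_all)
  then show "lam_coeff (mat_D (fls_D Dx) Y p) i = lam_coeff (Y p * Lax u p - Lax u p * Y p) i"
    by (simp add: lam_coeff_D[OF is_Y_C_mat[OF Y] p])
qed (use Y_carrier in auto)

lemma Yt_D:
  assumes p: "p \<in> S"
  shows "mat_D (fls_D Dx) Yt p = Yt p * Lax ut p - Lax ut p * Yt p"
proof -
  note c = Y_carrier[OF p]
  note sm = FK_C_mat is_Y_C_mat[OF Y]
  have "mat_D (fls_D Dx) Yt p = mat_D (fls_D Dx) (\<lambda>q. F q * Y q) p * K p + (F p * Y p) * mat_D (fls_D Dx) K p"
    unfolding Yt_def[abs_def] by (rule fx.mat_D_mult[OF p fx.C_mat_mult[OF sm(1) sm(3)] sm(2)])
  also have "mat_D (fls_D Dx) (\<lambda>q. F q * Y q) p = mat_D (fls_D Dx) F p * Y p + F p * mat_D (fls_D Dx) Y p"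
    by (rule fx.mat_D_mult[OF p sm(1) sm(3)])
  finally have "mat_D (fls_D Dx) Yt p =
    ((F p * Lax u p - Lax ut p * F p) * Y p + F p * (Y p * Lax u p - Lax u p * Y p)) * K p
      + F p * Y p * (K p * Lax ut p - Lax u p * K p)"
    unfolding F_Dx[OF p] K_Dx[OF p] Y_D[OF p] .
  also have "\<dots> = Yt p * Lax ut p - Lax ut p * Yt p"
  proof (rule eqI)
    fix r k assume "r < n" "k < n"
    then show "(((F p * Lax u p - Lax ut p * F p) * Y p + F p * (Y p * Lax u p - Lax u p * Y p)) * K p
      + F p * Y p * (K p * Lax ut p - Lax u p * K p)) $$ (r, k) = (Yt p * Lax ut p - Lax ut p * Yt p) $$ (r, k)"
      using c by (simp add: Yt_def ring_distribs assoc index del: index_add_mat index_minus_mat index_mult_mat)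
  qed (use c in \<open>simp_all add: Yt_def\<close>)
  finally show ?thesis .
qed

lemma Yt_coeff:
  assumes p: "p \<in> S"
  shows "lam_coeff (Yt p) i = (e * lam_coeff (Y p) (i - 1) + f0 p * lam_coeff (Y p) i) * B0 p
    + (e * lam_coeff (Y p) i + f0 p * lam_coeff (Y p) (i + 1)) * Bm p"
  using Y_carrier[OF p] by (simp add: Yt_def K_mult F_mult)

text \<open>At \<lambda>^1 the equation of Y reads e Y_0 + (b + u) e = Y_0 e + e (b + u). Right
  multiplication by B0 removes every term ending in e and leaves e Y_0 B0 = e (b + u) B0 = e f0 B0 =
  e (I - e Bm) = e, which is the coefficient of \<lambda> in the conjugated series. At \<lambda>^2
  only e e = 0 remains.\<close>

lemma Yt_top:
  assumes p: "p \<in> S"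
  shows "i > 1 \<Longrightarrow> lam_coeff (Yt p) i = 0\<^sub>m n n" "lam_coeff (Yt p) 1 = e"
proof -
  note c = Y_carrier[OF p]
  have top: "lam_coeff (Y p) i = 0\<^sub>m n n" if "i > 1" for i using Y p that by (simp add: is_Y_def)
  have Y1: "lam_coeff (Y p) 1 = e" using Y p by (simp add: is_Y_def e_def)
  show "lam_coeff (Yt p) i = 0\<^sub>m n n" if "i > 1"
  proof (cases "i = 2")
    case True
    then show ?thesis unfolding Yt_coeff[OF p] using top[of 3] top[of 2] by (simp add: Y1 e_e)
  next
    case False
    then show ?thesis unfolding Yt_coeff[OF p] using that top[of i] top[of "i - 1"] top[of "i + 1"] by simp
  qed
  define Y0 where "Y0 = lam_coeff (Y p) 0"
  have Y0c: "Y0 \<in> carrier_mat n n" using c by (simp add: Y0_def)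
  have ee: "M + N - (N' + M') = 0\<^sub>m n n \<Longrightarrow> M = N' + M' - N"
    if "M \<in> carrier_mat n n" "N \<in> carrier_mat n n" "N' \<in> carrier_mat n n" "M' \<in> carrier_mat n n" for M N N' M' :: "real mat"
  proof (rule eqI)
    fix r k assume z: "M + N - (N' + M') = 0\<^sub>m n n" and rk: "r < n" "k < n"
    show "M $$ (r, k) = (N' + M' - N) $$ (r, k)"
      using arg_cong[OF z, of "\<lambda>X. X $$ (r, k)"] that rk by (simp add: index del: index_add_mat index_minus_mat)
  qed (use that in simp_all)
  have "mat_D (fls_D Dx) Y p \<in> carrier_mat n n" using c by simp
  have "lam_coeff (mat_D (fls_D Dx) Y p) 1 = mat_D Dx (\<lambda>q. lam_coeff (Y q) 1) p"
    unfolding lam_coeff_D[OF is_Y_C_mat[OF Y] p] mat_Dx_eq ..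
  also have "\<dots> = mat_D Dx (\<lambda>q. e) p"
    by (rule x.mat_D_cong[OF p]) (use Y in \<open>simp add: is_Y_def e_def\<close>)
  also have "\<dots> = 0\<^sub>m n n" by (rule x.mat_D_const[OF p]) simp
  finally have "lam_coeff (Y p * Lax u p) 1 - lam_coeff (Lax u p * Y p) 1 = 0\<^sub>m n n"
    using c by (simp add: Y_D[OF p] lam_coeff_lin(2))
  then have "Y0 * e + e * connection u p - (e * Y0 + connection u p * e) = 0\<^sub>m n n"
    using c by (simp add: Lax_mult Y1 Y0_def)
  then have "e * Y0 + connection u p * e = Y0 * e + e * connection u p"
    using minus_eq_zero[of "Y0 * e + e * connection u p" "e * Y0 + connection u p * e"] Y0c by simp
  then have "(e * Y0 + connection u p * e) * B0 p = (Y0 * e + e * connection u p) * B0 p" by simp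
  then have "e * (Y0 * B0 p) = e * (connection u p * B0 p)"
    using Y0c by (simp add: ring_distribs assoc e_B0)
  also have "\<dots> = (e * f0 p - h p \<cdot>\<^sub>m e) * B0 p"
    unfolding e_connection[where v = u, symmetric] by (simp add: assoc)
  also have "\<dots> = e * (f0 p * B0 p) - h p \<cdot>\<^sub>m (0\<^sub>m n n)"
    by (simp add: ring_distribs assoc smult_mult e_B0)
  also have "f0 p * B0 p = 1\<^sub>m n - e * Bm p"
  proof (rule eqI)
    fix r k assume "r < n" "k < n"
    then show "(f0 p * B0 p) $$ (r, k) = (1\<^sub>m n - e * Bm p) $$ (r, k)"
      using arg_cong[OF e_Bm[OF p], of "\<lambda>X. X $$ (r, k)"]
      by (simp add: index del: index_add_mat index_minus_mat index_mult_mat)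
  qed simp_all
  also have "e * (1\<^sub>m n - e * Bm p) - h p \<cdot>\<^sub>m 0\<^sub>m n n = e"
  proof -
    have "e * (e * Bm p) = 0\<^sub>m n n" using e_e assoc[of e e "Bm p"] by simp
    then show ?thesis by (simp add: ring_distribs)
  qed
  finally have "e * (Y0 * B0 p) = e" .
  moreover have "f0 p * (e * B0 p) = 0\<^sub>m n n" by (simp add: e_B0)
  ultimately show "lam_coeff (Yt p) 1 = e"
    unfolding Yt_coeff[OF p] using Y0c top[of 2] by (simp add: Y1 Y0_def[symmetric] ring_distribs assoc e_e)
qed

text \<open>Conjugation preserves the trace, the n-th power \<lambda> I, which is central, and, by
  the intertwining relation, the flatness equation. Only the highest coefficients call for a
  computation.\<close>

lemma Yt_is_Y: "is_Y n S ut Yt"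
  unfolding is_Y_def Let_def
proof (intro conjI allI ballI impI)
  show "smooth_mat_on n S (\<lambda>p. lam_coeff (Yt p) i)" for i by (rule fls_C_matD[OF Yt_C_mat])
  fix p assume p: "p \<in> S"
  note c = Y_carrier[OF p] Yt_carrier[OF p]
  show "lam_coeff (Yt p) i = 0\<^sub>m n n" if "i > 1" for i by (rule Yt_top(1)[OF p that])
  show "lam_coeff (Yt p) 1 = elem_mat n 1 n" using Yt_top(2)[OF p] by (simp add: e_def)
  show "(\<Sum>r<n. lam_coeff (Yt p) i $$ (r, r)) = 0" for i
  proof -
    have tr: "(\<Sum>r<n. lam_coeff M i $$ (r, r)) = fls_nth (\<Sum>r<n. M $$ (r, r)) (- i)" if "M \<in> carrier_mat n n" for M
      using that by (simp add: fls_nth_sum lam_coeff_index)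
    have "(\<Sum>r<n. Yt p $$ (r, r)) = (\<Sum>r<n. (F p * (Y p * K p)) $$ (r, r))"
      using c by (simp add: Yt_def assoc)
    also have "\<dots> = (\<Sum>r<n. (Y p * K p * F p) $$ (r, r))"
      by (rule trace_mult_comm) (use c in simp_all)
    also have "Y p * K p * F p = Y p" using c FK_inverse[OF p] by (simp add: assoc)
    finally have "(\<Sum>r<n. lam_coeff (Yt p) i $$ (r, r)) = (\<Sum>r<n. lam_coeff (Y p) i $$ (r, r))"
      unfolding tr[OF c(1)] tr[OF c(2)] by simp
    then show ?thesis using Y p by (simp add: is_Y_def)
  qed
  show "mat_Dx (\<lambda>q. lam_coeff (Yt q) i) p
      + lam_coeff ((J_mat n fls_X_inv + map_mat fls_const (u_mat n (\<lambda>i. ut i p))) * Yt p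
        - Yt p * (J_mat n fls_X_inv + map_mat fls_const (u_mat n (\<lambda>i. ut i p)))) i = 0\<^sub>m n n" for i
    unfolding Lax_def[symmetric] lam_coeff_D(1)[OF Yt_C_mat p, symmetric] Yt_D[OF p]
  proof (rule eqI)
    fix r k assume "r < n" "k < n"
    then show "(lam_coeff (Yt p * Lax ut p - Lax ut p * Yt p) i + lam_coeff (Lax ut p * Yt p - Yt p * Lax ut p) i) $$ (r, k)
       = 0\<^sub>m n n $$ (r, k)"
      using c by (simp add: lam_coeff_lin(2) index del: index_add_mat index_minus_mat index_mult_mat)
  qed (use c in simp_all)
  have "Yt p ^\<^sub>m n = F p * Y p ^\<^sub>m n * K p"
    unfolding Yt_def by (rule conj_pow) (use c FK_inverse[OF p] in simp_all)
  also have "Y p ^\<^sub>m n = fls_X_inv \<cdot>\<^sub>m 1\<^sub>m n" using Y p by (simp add: is_Y_def)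
  also have "F p * (fls_X_inv \<cdot>\<^sub>m 1\<^sub>m n) * K p = fls_X_inv \<cdot>\<^sub>m 1\<^sub>m n"
    using FK_inverse[OF p] by (simp add: smult_mult)
  finally show "Yt p ^\<^sub>m n = fls_X_inv \<cdot>\<^sub>m 1\<^sub>m n" .
qed

text \<open>Z_j(u, \<lambda>) once more, now as a matrix of Laurent series, so that it can be
  multiplied by the inverse of f_{u,h}.\<close>

definition Zf :: "real \<times> real \<Rightarrow> real fls mat"
  where "Zf p = mat n n (\<lambda>rc. fls_prpart_as_fls ((Y p ^\<^sub>m j) $$ rc) + fls_const (Z0 p $$ rc))"

lemma Zf_carrier [simp]: "Zf p \<in> carrier_mat n n"
  by (simp add: Zf_def)

lemma Zf_coeff:
  assumes "p \<in> S"
  shows "lam_coeff (Zf p) i = (if i > 0 then lam_coeff (Y p ^\<^sub>m j) i else if i = 0 then Z0 p else 0\<^sub>m n n)"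
proof (rule eqI)
  fix r c assume rc: "r < n" "c < n"
  define P where "P = Y p ^\<^sub>m j"
  have P: "P \<in> carrier_mat n n" using Y_carrier[OF assms] by (simp add: P_def)
  show "lam_coeff (Zf p) i $$ (r, c)
      = (if i > 0 then lam_coeff (Y p ^\<^sub>m j) i else if i = 0 then Z0 p else 0\<^sub>m n n) $$ (r, c)"
  proof -
    have "lam_coeff (Zf p) i $$ (r, c) = (if i > 0 then fls_nth (P $$ (r, c)) (- i) else 0) + (if i = 0 then Z0 p $$ (r, c) else 0)"
    proof -
      have "Zf p $$ (r, c) = fls_prpart_as_fls (P $$ (r, c)) + fls_const (Z0 p $$ (r, c))"
        using rc by (simp add: Zf_def P_def)
      then show ?thesis
        by (simp only: lam_coeff_index[OF Zf_carrier rc] fls_plus_nth fls_prpart_as_fls_nth fls_const_nth) simp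
    qed
    then show ?thesis unfolding P_def[symmetric] using rc P by (simp add: lam_coeff_index)
  qed
qed (use Y_carrier[OF assms] Z0_carrier[OF assms] in auto)

definition f0t :: "real \<times> real \<Rightarrow> real mat"
  where "f0t = mat_Dt f0"

lemma f0t_carrier [simp]: "f0t p \<in> carrier_mat n n"
  by (simp add: f0t_def mat_Dt_eq)

lemma F_Dt:
  assumes p: "p \<in> S"
  shows "mat_D (fls_D Dt) F p = map_mat fls_const (f0t p)"
proof (rule lam_coeff_eqI)
  fix i
  have "lam_coeff (mat_D (fls_D Dt) F p) i = mat_Dt (\<lambda>q. if i = 1 then e else if i = 0 then f0 q else 0\<^sub>m n n) p"
    unfolding lam_coeff_D[OF FK_C_mat(1) p] lam_coeff_FK ..
  also have "\<dots> = lam_coeff (map_mat fls_const (f0t p)) i"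
  proof -
    consider "i = 1" | "i = 0" | "i \<noteq> 1" "i \<noteq> 0" by blast
    then show ?thesis
      by cases (simp_all add: lam_coeff_const mat_Dt_eq f0t_def t.mat_D_const[OF p])
  qed
  finally show "lam_coeff (mat_D (fls_D Dt) F p) i = \<dots>" .
qed simp_all

text \<open>The gauge transform of the t-connection: if \<Psi>_t = \<Psi> Z_j, then \<Psi>
  f_{u,h}^{-1} has the t-connection R.\<close>

definition R :: "real \<times> real \<Rightarrow> real fls mat"
  where "R p = (F p * Zf p - map_mat fls_const (f0t p)) * K p"

lemma R_carrier [simp]: "R p \<in> carrier_mat n n"
  by (simp add: R_def)

lemma R_coeff:
  "lam_coeff (R p) i = (e * lam_coeff (Zf p) (i - 1) + f0 p * lam_coeff (Zf p) i - (if i = 0 then f0t p else 0\<^sub>m n n)) * B0 p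
    + (e * lam_coeff (Zf p) i + f0 p * lam_coeff (Zf p) (i + 1) - (if i = - 1 then f0t p else 0\<^sub>m n n)) * Bm p"
proof -
  have "i + 1 = 0 \<longleftrightarrow> i = -1" by auto
  then show ?thesis by (simp add: R_def K_mult F_mult lam_coeff_lin(2) lam_coeff_const)
qed

lemma Wm_Dt: "p \<in> S \<Longrightarrow> mat_Dt Wm p = - (Z0 p * Wm p) + \<mu> p \<cdot>\<^sub>m Wm p"
proof (rule eqI)
  fix r c assume p: "p \<in> S" and rc: "r < n" "c < n"
  note z = Z0_carrier[OF p]
  show "mat_Dt Wm p $$ (r, c) = (- (Z0 p * Wm p) + \<mu> p \<cdot>\<^sub>m Wm p) $$ (r, c)"
  proof (cases "c = 0")
    case True
    then show ?thesis using rc w_Dt[OF p rc(1)] z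
      by (simp add: mat_Dt_eq t.mat_D_index[where n = n] index mult_Wm_index Wm_index Z0_def
        del: index_mult_mat index_add_mat index_uminus_mat index_smult_mat index_minus_mat)
  next
    case False
    then show ?thesis using rc t.D_const[OF p, of 0] z
      by (simp add: mat_Dt_eq t.mat_D_index[where n = n] index mult_Wm_index Wm_index
        del: index_mult_mat index_add_mat index_uminus_mat index_smult_mat)
  qed
qed (use Z0_carrier in \<open>simp_all add: mat_Dt_eq\<close>)

text \<open>The pole of \<open>R\<close> at \<open>\<lambda> = 0\<close> cancels because the kernel of \<open>f0\<close> evolves by \<open>- Z0\<close>.\<close>

lemma R_pole:
  assumes p: "p \<in> S"
  shows "lam_coeff (R p) (-1) = 0\<^sub>m n n"
proof -
  note z = Z0_carrier[OF p]
  have "mat_D Dt (\<lambda>q. f0 q * Wm q) p = mat_D Dt (\<lambda>q. 0\<^sub>m n n) p"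
    by (rule t.mat_D_cong[OF p]) (rule f0_Wm)
  also have "\<dots> = 0\<^sub>m n n" by (rule t.mat_D_const[OF p]) simp
  finally have "f0t p * Wm p + f0 p * mat_Dt Wm p = 0\<^sub>m n n"
    using t.mat_D_mult[OF p, of n f0 Wm] f0_smooth Wm_smooth by (simp add: x_C_mat_iff mat_Dt_eq f0t_def)
  then have fW: "f0t p * Wm p + - (f0 p * (Z0 p * Wm p)) = 0\<^sub>m n n"
    using z f0_Wm[OF p] by (simp add: Wm_Dt[OF p] ring_distribs smult_mult)
  have "(f0 p * Z0 p - f0t p) * Wm p = 0\<^sub>m n n"
  proof (rule eqI)
    fix r k assume "r < n" "k < n"
    then show "((f0 p * Z0 p - f0t p) * Wm p) $$ (r, k) = 0\<^sub>m n n $$ (r, k)"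
      using arg_cong[OF fW, of "\<lambda>X. X $$ (r, k)"] z
      by (simp add: ring_distribs assoc index del: index_add_mat index_minus_mat index_mult_mat index_uminus_mat)
  qed (use z in simp_all)
  then have "(f0 p * Z0 p - f0t p) * Bm p = 0\<^sub>m n n"
    using z by (simp add: Bm_def flip: assoc)
  then show ?thesis
    unfolding R_coeff Zf_coeff[OF p] using z by simp
qed

definition R0 :: "real \<times> real \<Rightarrow> real mat"
  where "R0 p = lam_coeff (R p) 0"

lemma R0_carrier [simp]: "R0 p \<in> carrier_mat n n"
  by (simp add: R0_def)

lemma R0_smooth: "smooth_mat_on n S R0"
  unfolding x_C_mat_iff[symmetric]
proof (rule x.C_mat_cong)
  have "x.C_mat n (mat_D Dt f0)"
    using t.C_mat_D[of n f0] f0_smooth by (simp add: x_C_mat_iff)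
  then have f0t: "x.C_mat n f0t" by (simp add: f0t_def mat_Dt_eq)
  show "x.C_mat n (\<lambda>p. (f0 p * Z0 p - f0t p) * B0 p + (e * Z0 p + f0 p * lam_coeff (Y p ^\<^sub>m j) 1) * Bm p)"
    by (intro x.C_mat_add x.C_mat_mult x.C_mat_diff x.C_mat_const f0t carriers)
      (simp_all add: x_C_mat_iff f0_smooth Z0_smooth B_smooth Yj_smooth)
  show "(f0 p * Z0 p - f0t p) * B0 p + (e * Z0 p + f0 p * lam_coeff (Y p ^\<^sub>m j) 1) * Bm p = R0 p" if "p \<in> S" for p
    using Z0_carrier[OF that] Y_carrier[OF that] by (simp add: R0_def R_coeff Zf_coeff[OF that])
qed

lemma K_Dt:
  assumes p: "p \<in> S"
  shows "mat_D (fls_D Dt) K p = K p * R p - Zf p * K p"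
proof -
  have KF: "K p * (F p * X) = X" if "X \<in> carrier_mat n n" for X
    using that FK_inverse[OF p] assoc[of "K p" "F p" X] by simp
  have "mat_D (fls_D Dt) K p = - (K p * (mat_D (fls_D Dt) F p * K p))"
    by (rule ft.mat_D_right_inverse[OF p FK_C_mat FK_inverse(2) FK_inverse(1)])
  also have "\<dots> = - (K p * (map_mat fls_const (f0t p) * K p))" unfolding F_Dt[OF p] ..
  also have "\<dots> = K p * R p - Zf p * K p"
    by (rule eqI) (simp_all add: R_def ring_distribs assoc KF index del: index_minus_mat index_mult_mat index_uminus_mat)
  finally show ?thesis .
qed

text \<open>In the equation for \<open>Bm\<close> the coefficient of \<lambda>^{-1} in R would
  appear next to B0; \<open>R_pole\<close> makes it vanish.\<close>

lemma B_Dt: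
  assumes p: "p \<in> S"
  shows "mat_Dt B0 p = B0 p * R0 p + Bm p * lam_coeff (R p) 1 - (Z0 p * B0 p + lam_coeff (Y p ^\<^sub>m j) 1 * Bm p)"
    "mat_Dt Bm p = Bm p * R0 p - Z0 p * Bm p"
proof -
  note c = Z0_carrier[OF p] Y_carrier[OF p]
  have eq: "mat_Dt (\<lambda>q. lam_coeff (K q) i) p = lam_coeff (K p * R p - Zf p * K p) i" for i
    using lam_coeff_D(2)[OF FK_C_mat(2) p, of i] K_Dt[OF p] by simp
  have co: "lam_coeff (K p * R p - Zf p * K p) i
    = B0 p * lam_coeff (R p) i + Bm p * lam_coeff (R p) (i + 1) - (lam_coeff (Zf p) i * B0 p + lam_coeff (Zf p) (i + 1) * Bm p)" for i
    by (simp add: lam_coeff_lin(2) K_mult(1)[OF R_carrier] K_mult(2)[OF Zf_carrier])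
  show "mat_Dt B0 p = B0 p * R0 p + Bm p * lam_coeff (R p) 1 - (Z0 p * B0 p + lam_coeff (Y p ^\<^sub>m j) 1 * Bm p)"
    using eq[of 0] unfolding co by (simp add: lam_coeff_FK Zf_coeff[OF p] R0_def)
  show "mat_Dt Bm p = Bm p * R0 p - Z0 p * Bm p"
    using eq[of "-1"] c unfolding co by (simp add: lam_coeff_FK Zf_coeff[OF p] R0_def R_pole[OF p])
qed

text \<open>Chosen so that the constant term of the j-th power of the new series minus
  \<open>zetat\<close> is R0, whose bracket is controlled by the new frame. What has to be shown is
  that it is strictly upper triangular.\<close>

definition zetat :: "real \<times> real \<Rightarrow> real mat"
  where "zetat p = lam_coeff (Yt p ^\<^sub>m j) 0 - R0 p"

text \<open>Subtracting the two expansions leaves only terms ending in B0. Those ending in Bm cancel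
  because e \<zeta> = 0, the last row of \<zeta> being zero.\<close>

lemma zetat_eq:
  assumes p: "p \<in> S"
  shows "zetat p = (e * lam_coeff (Y p ^\<^sub>m j) (-1) + f0 p * \<zeta> p + f0t p) * B0 p"
proof -
  define P where "P = Y p ^\<^sub>m j"
  have c: "P \<in> carrier_mat n n" "\<zeta> p \<in> carrier_mat n n" "Z0 p \<in> carrier_mat n n"
    using Y_carrier[OF p] zeta_carrier[OF p] Z0_carrier[OF p] by (simp_all add: P_def)
  have Z0P: "lam_coeff P 0 = \<zeta> p + Z0 p"
    unfolding Z0_def P_def[symmetric] by (rule eqI) (use c in simp_all)
  have e\<zeta>: "e * \<zeta> p = 0\<^sub>m n n"
  proof (rule eqI)
    fix r k assume rk: "r < n" "k < n"
    have "\<zeta> p $$ (n - 1, k) = 0" using zeta p rk by (simp add: is_zeta_def)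
    then show "(e * \<zeta> p) $$ (r, k) = 0\<^sub>m n n $$ (r, k)"
      using rk c by (simp add: e_mult_index del: index_mult_mat)
  qed (use c in simp_all)
  have "Yt p ^\<^sub>m j = F p * P * K p"
    unfolding Yt_def P_def by (rule conj_pow) (use Y_carrier[OF p] FK_inverse[OF p] in simp_all)
  then have "lam_coeff (Yt p ^\<^sub>m j) 0 = (e * lam_coeff P (-1) + f0 p * lam_coeff P 0) * B0 p
      + (e * lam_coeff P 0 + f0 p * lam_coeff P 1) * Bm p"
    using c by (simp add: K_mult F_mult)
  moreover have "R0 p = (f0 p * Z0 p - f0t p) * B0 p + (e * Z0 p + f0 p * lam_coeff P 1) * Bm p"
    using c by (simp add: R0_def R_coeff Zf_coeff[OF p] P_def)
  ultimately have z: "zetat p = (e * lam_coeff P (-1) + f0 p * lam_coeff P 0) * B0 p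
      + (e * lam_coeff P 0 + f0 p * lam_coeff P 1) * Bm p
      - ((f0 p * Z0 p - f0t p) * B0 p + (e * Z0 p + f0 p * lam_coeff P 1) * Bm p)"
    by (simp add: zetat_def)
  have eP: "e * lam_coeff P 0 = e * Z0 p" using c by (simp add: Z0P ring_distribs e\<zeta>)
  have z0: "zetat p = (e * lam_coeff P (-1) + (f0 p * \<zeta> p + f0 p * Z0 p)) * B0 p
      + (e * Z0 p + f0 p * lam_coeff P 1) * Bm p
      - ((f0 p * Z0 p - f0t p) * B0 p + (e * Z0 p + f0 p * lam_coeff P 1) * Bm p)"
    unfolding z eP using c by (simp add: Z0P ring_distribs(2))
  show ?thesis unfolding P_def[symmetric] z0
  proof (rule eqI)
    fix r k assume "r < n" "k < n"
    then show "((e * lam_coeff P (-1) + (f0 p * \<zeta> p + f0 p * Z0 p)) * B0 p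
      + (e * Z0 p + f0 p * lam_coeff P 1) * Bm p
      - ((f0 p * Z0 p - f0t p) * B0 p + (e * Z0 p + f0 p * lam_coeff P 1) * Bm p)) $$ (r, k)
      = ((e * lam_coeff P (-1) + f0 p * \<zeta> p + f0t p) * B0 p) $$ (r, k)"
      using c by (simp add: ring_distribs index del: index_add_mat index_minus_mat index_mult_mat)
  qed (use c in simp_all)
qed

text \<open>The factor in front of B0 is upper triangular: left multiplication by e_{1n} fills the
  first row only, a Hessenberg matrix times a strictly upper triangular one is upper triangular, and
  the entries of f0 below the diagonal are constant in t. The strictly upper triangular B0 makes the
  product strict.\<close>

lemma zetat_upper:
  assumes p: "p \<in> S" and r: "r < n" and k: "k \<le> r"
  shows "zetat p $$ (r, k) = 0"
proof -
  define M where "M = e * lam_coeff (Y p ^\<^sub>m j) (-1) + f0 p * \<zeta> p + f0t p"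
  have c: "lam_coeff (Y p ^\<^sub>m j) (-1) \<in> carrier_mat n n" "\<zeta> p \<in> carrier_mat n n"
    using Y_carrier[OF p] zeta_carrier[OF p] by simp_all
  have Mc: "M \<in> carrier_mat n n" using c by (simp add: M_def)
  have kn: "k < n" using k r by simp
  have low: "M $$ (r, m) = 0" if m: "m < r" for m
  proof -
    have mn: "m < n" using m r by simp
    have 1: "(e * lam_coeff (Y p ^\<^sub>m j) (-1)) $$ (r, m) = 0"
      using m r mn c by (simp add: e_mult_index del: index_mult_mat)
    have 2: "(f0 p * \<zeta> p) $$ (r, m) = 0"
      unfolding mult_index[OF carriers(1) c(2) r mn]
    proof (rule sum.neutral, rule)
      fix i assume i: "i \<in> {..<n}"
      show "f0 p $$ (r, i) * \<zeta> p $$ (i, m) = 0"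
      proof (cases "m \<le> i")
        case True
        then have "\<zeta> p $$ (i, m) = 0" using zeta p i by (simp add: is_zeta_def)
        then show ?thesis by simp
      next
        case False
        then show ?thesis using i r m by (simp add: f0_index)
      qed
    qed
    have "f0t p $$ (r, m) = Dt (\<lambda>q. f0 q $$ (r, m)) p"
      using r mn by (simp add: f0t_def mat_Dt_eq t.mat_D_index[where n = n])
    also have "\<dots> = Dt (\<lambda>q. if r = m + 1 then 1 else 0) p"
      using r mn m by (simp add: f0_index)
    also have "\<dots> = 0" by (rule t.D_const[OF p])
    finally show ?thesis using 1 2 r mn c by (simp add: M_def index del: index_mult_mat index_add_mat)
  qed
  have "zetat p $$ (r, k) = (\<Sum>m<n. M $$ (r, m) * B0 p $$ (m, k))"
    unfolding zetat_eq[OF p] M_def[symmetric] by (rule mult_index[OF Mc B_carrier(1) r kn])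
  also have "\<dots> = 0"
  proof (rule sum.neutral, rule)
    fix m assume "m \<in> {..<n}"
    then show "M $$ (r, m) * B0 p $$ (m, k) = 0"
      using low[of m] B0_upper[of k m p] k by (cases "m < r") auto
  qed
  finally show ?thesis .
qed

end

section \<open>Hessenberg matrices with unit subdiagonal\<close>

context square_mat begin

text \<open>The adjugate turns M N = 0 into (det M) N = 0; over an integral domain one nonzero entry
  of N decides.\<close>

lemma det_zero_of_kernel:
  fixes M N :: "'a::idom mat"
  assumes M: "M \<in> carrier_mat n n" and N: "N \<in> carrier_mat n n" and "M * N = 0\<^sub>m n n"
    and "r < n" "c < n" "N $$ (r, c) \<noteq> 0"
  shows "det M = 0"
proof -
  have "adj_mat M * (M * N) = (det M \<cdot>\<^sub>m 1\<^sub>m n) * N"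
    unfolding adj_mat(3)[OF M, symmetric] by (rule assoc[symmetric]) (use adj_mat(1)[OF M] M N in auto)
  then have "det M \<cdot>\<^sub>m N = 0\<^sub>m n n"
    using assms(3) adj_mat(1)[OF M] N by (simp add: smult_mult)
  then have "(det M \<cdot>\<^sub>m N) $$ (r, c) = 0" using assms by simp
  then show ?thesis using assms by simp
qed

text \<open>The common shape of A and f0, both being b plus an upper triangular matrix.\<close>

definition hessenberg :: "'a::comm_ring_1 mat \<Rightarrow> bool"
  where "hessenberg M \<longleftrightarrow> M \<in> carrier_mat n n \<and> (\<forall>r<n. \<forall>c<n. c + 1 < r \<longrightarrow> M $$ (r, c) = 0)
    \<and> (\<forall>c. c + 1 < n \<longrightarrow> M $$ (c + 1, c) = 1)"

text \<open>Deleting the first row and the last column leaves an upper triangular matrix whose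
  diagonal is the unit subdiagonal. This is the source of the sign (-1)^(n-1).\<close>

lemma hessenberg_cofactor:
  fixes M :: "'a::comm_ring_1 mat"
  assumes "hessenberg M" "n > 0"
  shows "cofactor M 0 (n - 1) = (-1) ^ (n - 1)"
proof -
  have M: "M \<in> carrier_mat n n" using assms(1) by (simp add: hessenberg_def)
  have idx: "mat_delete M 0 (n - 1) $$ (i, k) = M $$ (Suc i, k)" if "i < n - 1" "k < n - 1" for i k
    using that M by (simp add: mat_delete_def)
  have c: "mat_delete M 0 (n - 1) \<in> carrier_mat (n - 1) (n - 1)" by (rule mat_delete_carrier[OF M])
  have dim: "dim_row (mat_delete M 0 (n - 1)) = n - 1" using M by simp
  have "upper_triangular (mat_delete M 0 (n - 1))"
    unfolding upper_triangular_def dim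
  proof (intro allI impI)
    fix i k assume ik: "i < n - 1" "k < i"
    then have "M $$ (Suc i, k) = 0" using assms(1) unfolding hessenberg_def by auto
    then show "mat_delete M 0 (n - 1) $$ (i, k) = 0" using ik idx[of i k] by simp
  qed
  then have "det (mat_delete M 0 (n - 1)) = prod_list (diag_mat (mat_delete M 0 (n - 1)))"
    using c by (rule det_upper_triangular)
  also have "diag_mat (mat_delete M 0 (n - 1)) = map (\<lambda>r. 1) [0..<n - 1]"
    unfolding diag_mat_def dim
  proof (intro map_cong refl)
    fix i assume "i \<in> set [0..<n - 1]"
    then have i: "i < n - 1" by simp
    then have "M $$ (i + 1, i) = 1" using assms(1) unfolding hessenberg_def by auto
    then show "mat_delete M 0 (n - 1) $$ (i, i) = 1" using i idx[of i i] by simp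
  qed
  finally show ?thesis by (simp add: cofactor_def map_replicate_const)
qed

text \<open>Expansion along the first row: the corner entry adds l times that cofactor to det M = 0.
  The value is the same for every such M, which is why \<lambda> e + A and \<lambda> e + f0 have
  equal determinants.\<close>

lemma det_hessenberg_corner:
  fixes M :: "'a::comm_ring_1 mat"
  assumes M: "hessenberg M" and n: "n > 0" and d: "det M = 0"
  shows "det (l \<cdot>\<^sub>m elem_mat n 1 n + M) = l * (-1) ^ (n - 1)"
proof -
  have Mc: "M \<in> carrier_mat n n" using M by (simp add: hessenberg_def)
  define M' where "M' = l \<cdot>\<^sub>m elem_mat n 1 n + M"
  have M'c: "M' \<in> carrier_mat n n" using Mc by (simp add: M'_def)
  have cof: "cofactor M' 0 k = cofactor M 0 k" for k
  proof -
    have "mat_delete M' 0 k = mat_delete M 0 k"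
      using Mc M'c by (intro eq_matI) (auto simp: mat_delete_def M'_def elem_mat_def)
    then show ?thesis by (simp add: cofactor_def)
  qed
  have row: "M' $$ (0, k) = M $$ (0, k) + (if k = n - 1 then l else 0)" if "k < n" for k
    using that n Mc by (auto simp: M'_def elem_mat_def)
  have "det M' = (\<Sum>k<n. M $$ (0, k) * cofactor M 0 k + (if k = n - 1 then l * cofactor M 0 k else 0))"
    unfolding laplace_expansion_row[OF M'c n] cof
    by (intro sum.cong refl) (simp add: row algebra_simps)
  also have "\<dots> = det M + l * cofactor M 0 (n - 1)"
    unfolding laplace_expansion_row[OF Mc n] sum.distrib using n by simp
  finally show ?thesis using d hessenberg_cofactor[OF M n] by (simp add: M'_def)
qed

text \<open>Row r + 1, with its entry 1 in column r, expresses x_r through later entries, so a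
  kernel vector is determined by its last entry.\<close>

lemma hessenberg_kernel:
  fixes M :: "'a::comm_ring_1 mat"
  assumes M: "hessenberg M" and ker: "\<And>r. r < n \<Longrightarrow> (\<Sum>k<n. M $$ (r, k) * x k) = 0" and last: "x (n - 1) = 0"
    and r: "r < n"
  shows "x r = 0"
  using r
proof (induction "n - r" arbitrary: r rule: less_induct)
  case less
  show ?case
  proof (cases "r = n - 1")
    case True
    then show ?thesis using last by simp
  next
    case False
    then have r1: "r + 1 < n" using less.prems by simp
    have "0 = (\<Sum>k<n. M $$ (r + 1, k) * x k)" using ker[OF r1] by simp
    also have "\<dots> = (\<Sum>k<n. if k = r then x k else 0)"
    proof (intro sum.cong refl)
      fix k assume k: "k \<in> {..<n}"
      consider "k < r" | "k = r" | "k > r" by linarith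
      then show "M $$ (r + 1, k) * x k = (if k = r then x k else 0)"
      proof cases
        case 1
        then show ?thesis using M k r1 by (simp add: hessenberg_def)
      next
        case 2
        then show ?thesis using M r1 by (simp add: hessenberg_def)
      next
        case 3
        then have "x k = 0" using less.hyps[of k] less.prems k by auto
        then show ?thesis using 3 by simp
      qed
    qed
    also have "\<dots> = x r" using less.prems by simp
    finally show ?thesis by simp
  qed
qed

text \<open>As det M = 0, the columns of the adjugate lie in the kernel of M, where a vector is
  determined by its last entry. For the first column that entry is the cofactor (-1)^(n-1), for x it
  is 1.\<close>

lemma adj_hessenberg_column:
  fixes M :: "'a::idom mat"
  assumes M: "hessenberg M" and n: "n > 0" and ker: "\<And>r. r < n \<Longrightarrow> (\<Sum>k<n. M $$ (r, k) * x k) = 0"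
    and last: "x (n - 1) = 1" and r: "r < n"
  shows "adj_mat M $$ (r, 0) = (-1) ^ (n - 1) * x r"
proof -
  have Mc: "M \<in> carrier_mat n n" using M by (simp add: hessenberg_def)
  define N where "N = mat n n (\<lambda>(r, c). if c = 0 then x r else 0)"
  have Nc: "N \<in> carrier_mat n n" by (simp add: N_def)
  have "M * N = 0\<^sub>m n n"
  proof (rule eqI)
    fix r c assume "r < n" "c < n"
    then show "(M * N) $$ (r, c) = 0\<^sub>m n n $$ (r, c)"
      using ker[of r] unfolding mult_index[OF Mc Nc \<open>r < n\<close> \<open>c < n\<close>] by (cases "c = 0") (simp_all add: N_def)
  qed (use Mc Nc in simp_all)
  then have "det M = 0"
    by (rule det_zero_of_kernel[OF Mc Nc, of "n - 1" 0]) (use n last in \<open>simp_all add: N_def\<close>)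
  then have "M * adj_mat M = 0 \<cdot>\<^sub>m 1\<^sub>m n" using adj_mat(2)[OF Mc] by simp
  then have z: "(M * adj_mat M) $$ (k, 0) = 0" if "k < n" for k using that n by simp
  define y where "y k = adj_mat M $$ (k, 0) - (-1) ^ (n - 1) * x k" for k
  have "y r = 0"
  proof (rule hessenberg_kernel[OF M _ _ r])
    fix k assume k: "k < n"
    have "(\<Sum>m<n. M $$ (k, m) * adj_mat M $$ (m, 0)) = 0"
      using z[OF k] mult_index[OF Mc adj_mat(1)[OF Mc] k n] by simp
    then show "(\<Sum>m<n. M $$ (k, m) * y m) = 0"
    proof -
      assume a: "(\<Sum>m<n. M $$ (k, m) * adj_mat M $$ (m, 0)) = 0"
      have "(\<Sum>m<n. M $$ (k, m) * y m)
        = (\<Sum>m<n. M $$ (k, m) * adj_mat M $$ (m, 0)) - (-1) ^ (n - 1) * (\<Sum>m<n. M $$ (k, m) * x m)"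
        by (simp add: y_def right_diff_distrib sum_subtractf sum_distrib_left mult_ac)
      then show ?thesis using a ker[OF k] by simp
    qed
  next
    have "adj_mat M $$ (n - 1, 0) = cofactor M 0 (n - 1)" using Mc n by (simp add: adj_mat_def)
    then show "y (n - 1) = 0" using hessenberg_cofactor[OF M n] last by (simp add: y_def)
  qed
  then show ?thesis by (simp add: y_def)
qed

end

section \<open>From the transformed frame to the transformed curve\<close>

context kdv_domain begin

lemma mult_connection_index:
  assumes M: "M \<in> carrier_mat n n" and rc: "r < n" "c < n"
  shows "(M * connection v p) $$ (r, c) = (if c + 1 < n then M $$ (r, c + 1) else \<Sum>i=1..n - 1. v i p * M $$ (r, i - 1))"
proof (cases "c + 1 < n")
  case True
  have "(M * connection v p) $$ (r, c) = (\<Sum>k<n. if k = c + 1 then M $$ (r, k) else 0)"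
    unfolding mult_index[OF M connection_carrier rc] using rc True
    by (intro sum.cong refl) (simp add: connection_index)
  then show ?thesis using True by simp
next
  case False
  then have c: "c + 1 = n" using rc by simp
  have "(M * connection v p) $$ (r, c) = (\<Sum>k<n. if k + 1 < n then M $$ (r, k) * v (k + 1) p else 0)"
    unfolding mult_index[OF M connection_carrier rc] using rc c
    by (intro sum.cong refl) (simp add: connection_index)
  also have "\<dots> = (\<Sum>k<n - 1. M $$ (r, k) * v (k + 1) p)"
    by (rule sum.mono_neutral_cong_right) auto
  also have "\<dots> = (\<Sum>i=1..n - 1. v i p * M $$ (r, i - 1))"
    by (rule sum.reindex_bij_witness[of _ "\<lambda>i. i - 1" "\<lambda>k. k + 1"]) auto
  finally show ?thesis using False by simp
qed

lemma mat_D_entry: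
  fixes M :: "real \<times> real \<Rightarrow> real mat"
  assumes "M p \<in> carrier_mat n n" "r < n" "c < n"
  shows "Dx (\<lambda>q. M q $$ (r, c)) p = mat_Dx M p $$ (r, c)" "Dt (\<lambda>q. M q $$ (r, c)) p = mat_Dt M p $$ (r, c)"
  using assms by (simp_all add: mat_Dx_eq mat_Dt_eq x.mat_D_index[where n = n] t.mat_D_index[where n = n])

end

context darboux_flow begin

text \<open>\<open>W0\<close> and \<open>W1\<close> stand for the first two \<lambda>-coefficients
  of (\<lambda> e_{1n} + A) E, and G is the constant term of its product with B0 + \<lambda>^{-1}
  Bm. The hypothesis \<open>ker\<close> says that this product has no pole. The factor a carries the
  sign of the cofactors, and a^n = 1 keeps the determinant equal to 1.\<close>

lemma new_solution:
  assumes W: "smooth_mat_on n S W0" "smooth_mat_on n S W1"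
    and Wx: "\<And>p. p \<in> S \<Longrightarrow> mat_Dx W0 p = W0 p * connection u p"
      "\<And>p. p \<in> S \<Longrightarrow> mat_Dx W1 p = W1 p * connection u p + W0 p * e"
    and Wt: "\<And>p. p \<in> S \<Longrightarrow> mat_Dt W0 p = W0 p * Z0 p"
      "\<And>p. p \<in> S \<Longrightarrow> mat_Dt W1 p = W1 p * Z0 p + W0 p * lam_coeff (Y p ^\<^sub>m j) 1"
    and ker: "\<And>p. p \<in> S \<Longrightarrow> W0 p * Wm p = 0\<^sub>m n n"
    and det: "\<And>p. p \<in> S \<Longrightarrow> det (W1 p * Bm p + W0 p * B0 p) = 1"
    and a: "a ^ n = 1"
  shows "ca_flow_solution n j S (\<lambda>p. vec n (\<lambda>r. a * (\<Sum>k<n. W1 p $$ (r, k) * w k p)))"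
    (is "ca_flow_solution n j S ?\<gamma>")
proof -
  define G where "G p = W1 p * Bm p + W0 p * B0 p" for p
  note Wc = smooth_matD[OF W(1)] smooth_matD[OF W(2)]
  have Gc: "G p \<in> carrier_mat n n" if "p \<in> S" for p using Wc[OF that] by (simp add: G_def)
  have C: "x.C_mat n W0" "x.C_mat n W1" "x.C_mat n Bm" "x.C_mat n B0"
    "t.C_mat n W0" "t.C_mat n W1" "t.C_mat n Bm" "t.C_mat n B0"
    using W B_smooth by (simp_all add: x_C_mat_iff)
  have Gs: "smooth_mat_on n S G"
    unfolding G_def x_C_mat_iff[symmetric] by (intro x.C_mat_add x.C_mat_mult C)
  have WB: "W0 p * Bm p = 0\<^sub>m n n" if p: "p \<in> S" for p
    using ker[OF p] Wc[OF p] assoc[of "W0 p" "Wm p" "1\<^sub>m n - f0 p * B0 p"] by (simp add: Bm_def)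
  have WBX: "W0 p * (Bm p * X) = 0\<^sub>m n n" if p: "p \<in> S" and X: "X \<in> carrier_mat n n" for p X
    using WB[OF p] Wc[OF p] X assoc[of "W0 p" "Bm p" X] by simp
  \<comment> \<open>The equations of B0 and Bm exchange the old x-connection for the new one; the
    remaining term contains W0 Bm = 0.\<close>
  have Gx: "mat_Dx G p = G p * connection ut p" if p: "p \<in> S" for p
  proof -
    note c = Wc[OF p]
    have "mat_Dx G p = mat_Dx W1 p * Bm p + W1 p * mat_Dx Bm p + (mat_Dx W0 p * B0 p + W0 p * mat_Dx B0 p)"
      unfolding G_def[abs_def] mat_Dx_eq
      using x.mat_D_add[OF p x.C_mat_mult[OF C(2,3)] x.C_mat_mult[OF C(1,4)]]
        x.mat_D_mult[OF p C(2,3)] x.mat_D_mult[OF p C(1,4)] by simp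
    also have "\<dots> = G p * connection ut p"
    proof (rule eqI)
      fix r k assume "r < n" "k < n"
      then show "(mat_Dx W1 p * Bm p + W1 p * mat_Dx Bm p + (mat_Dx W0 p * B0 p + W0 p * mat_Dx B0 p)) $$ (r, k)
        = (G p * connection ut p) $$ (r, k)"
        unfolding Wx(1)[OF p] Wx(2)[OF p] B_Dx[OF p] using c
        by (simp add: G_def ring_distribs assoc WBX[OF p] index del: index_add_mat index_minus_mat index_mult_mat)
    qed (use c in \<open>simp_all add: Wx[OF p] B_Dx[OF p] G_def\<close>)
    finally show ?thesis .
  qed
  \<comment> \<open>The coefficient of \<lambda> in R enters only through W0 Bm R1, which
    vanishes.\<close>
  have Gt: "mat_Dt G p = G p * R0 p" if p: "p \<in> S" for p
  proof -
    note c = Wc[OF p] Z0_carrier[OF p] Y_carrier[OF p]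
    define Z1 where "Z1 = lam_coeff (Y p ^\<^sub>m j) 1"
    have Z1c: "Z1 \<in> carrier_mat n n" using c by (simp add: Z1_def)
    define R1 where "R1 = lam_coeff (R p) 1"
    have R1c: "R1 \<in> carrier_mat n n" by (simp add: R1_def)
    have "mat_Dt G p = mat_Dt W1 p * Bm p + W1 p * mat_Dt Bm p + (mat_Dt W0 p * B0 p + W0 p * mat_Dt B0 p)"
      unfolding G_def[abs_def] mat_Dt_eq
      using t.mat_D_add[OF p t.C_mat_mult[OF C(6,7)] t.C_mat_mult[OF C(5,8)]]
        t.mat_D_mult[OF p C(6,7)] t.mat_D_mult[OF p C(5,8)] by simp
    also have "\<dots> = (W1 p * Z0 p + W0 p * Z1) * Bm p + W1 p * (Bm p * R0 p - Z0 p * Bm p)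
       + (W0 p * Z0 p * B0 p + W0 p * (B0 p * R0 p + Bm p * R1 - (Z0 p * B0 p + Z1 * Bm p)))"
      unfolding Wt(1)[OF p] Wt(2)[OF p] B_Dt[OF p] Z1_def R1_def ..
    also have "\<dots> = G p * R0 p"
    proof (rule eqI)
      fix r k assume "r < n" "k < n"
      then show "((W1 p * Z0 p + W0 p * Z1) * Bm p + W1 p * (Bm p * R0 p - Z0 p * Bm p)
       + (W0 p * Z0 p * B0 p + W0 p * (B0 p * R0 p + Bm p * R1 - (Z0 p * B0 p + Z1 * Bm p)))) $$ (r, k)
        = (G p * R0 p) $$ (r, k)"
        using c Z1c R1c
        by (simp add: G_def ring_distribs assoc WBX[OF p] index del: index_add_mat index_minus_mat index_mult_mat)
    qed (use c Z1c R1c in \<open>simp_all add: G_def\<close>)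
    finally show ?thesis .
  qed
  have n0: "0 < n" using n_ge by simp
  have G0: "(\<Sum>k<n. W1 p $$ (r, k) * w k p) = G p $$ (r, 0)" if p: "p \<in> S" and r: "r < n" for p r
    using Wc[OF p] r n0 B_first_column
    by (simp add: G_def index mult_index del: index_add_mat index_mult_mat)
  have gam: "?\<gamma> p $ r = a * G p $$ (r, 0)" if "p \<in> S" "r < n" for p r
    using that G0[OF that] by simp
  have sm: "smooth_on S (\<lambda>p. G p $$ (r, c))" if "r < n" "c < n" for r c
    using Gs that by (simp add: smooth_mat_on_def)
  have DaG: "Dx (\<lambda>q. a * G q $$ (r, c)) p = a * (G p * connection ut p) $$ (r, c)"
    "Dt (\<lambda>q. a * G q $$ (r, c)) p = a * (G p * R0 p) $$ (r, c)" if "p \<in> S" "r < n" "c < n" for p r c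
    using x.D_mult[OF that(1) x.C_const sm[OF that(2,3)], of a] t.D_mult[OF that(1) t.C_const sm[OF that(2,3)], of a]
      x.D_const[OF that(1), of a] t.D_const[OF that(1), of a] mat_D_entry[where M = G and p = p, OF Gc[OF that(1)] that(2,3)] Gx[OF that(1)] Gt[OF that(1)]
    by simp_all
  \<comment> \<open>Right multiplication by b shifts columns, so column c of G is the c-th
    x-derivative of its first column, and a G is a moving frame.\<close>
  have iter: "(Dx ^^ c) (\<lambda>q. ?\<gamma> q $ r) p = a * G p $$ (r, c)" if "c < n" "p \<in> S" "r < n" for c p r
    using that
  proof (induction c arbitrary: p)
    case 0
    then show ?case using gam by simp
  next
    case (Suc c)
    then have c: "c < n" "c + 1 < n" by auto
    have "(Dx ^^ Suc c) (\<lambda>q. ?\<gamma> q $ r) p = Dx (\<lambda>q. a * G q $$ (r, c)) p"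
      unfolding funpow.simps o_def by (rule x.D_cong[OF _ Suc.prems(2)]) (rule Suc.IH[OF c(1) _ Suc.prems(3)])
    then show ?case
      using DaG(1)[OF Suc.prems(2,3) c(1)] mult_connection_index[OF Gc[OF Suc.prems(2)] Suc.prems(3) c(1)] c by simp
  qed
  have frame: "ca_frame n ?\<gamma> p = a \<cdot>\<^sub>m G p" if p: "p \<in> S" for p
    by (rule eqI) (use Gc[OF p] iter[OF _ p] in \<open>simp_all add: ca_frame_index\<close>)
  have curv: "is_ca_curvature n S ?\<gamma> ut"
    unfolding is_ca_curvature_def
  proof (intro ballI allI impI)
    fix p r assume p: "p \<in> S" and r: "r < n"
    obtain m where m: "n = Suc m" using n0 by (cases n) auto
    have "(Dx ^^ n) (\<lambda>q. ?\<gamma> q $ r) p = Dx ((Dx ^^ (n - 1)) (\<lambda>q. ?\<gamma> q $ r)) p"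
      by (simp only: m funpow.simps o_def diff_Suc_1)
    also have "\<dots> = Dx (\<lambda>q. a * G q $$ (r, n - 1)) p"
      by (rule x.D_cong[OF _ p]) (rule iter, use n0 r in auto)
    also have "\<dots> = a * (\<Sum>i=1..n - 1. ut i p * G p $$ (r, i - 1))"
      using DaG(1)[OF p r, of "n - 1"] mult_connection_index[OF Gc[OF p] r, of "n - 1" ut p] n0 by simp
    also have "\<dots> = (\<Sum>i=1..n - 1. a * (ut i p * G p $$ (r, i - 1)))"
      by (rule sum_distrib_left)
    also have "\<dots> = (\<Sum>i=1..n - 1. ut i p * (Dx ^^ (i - 1)) (\<lambda>q. ?\<gamma> q $ r) p)"
    proof (rule sum.cong[OF refl])
      fix i assume "i \<in> {1..n - 1}"
      then have "i - 1 < n" by auto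
      from iter[OF this p r] show "a * (ut i p * G p $$ (r, i - 1)) = ut i p * (Dx ^^ (i - 1)) (\<lambda>q. ?\<gamma> q $ r) p"
        by (simp only: mult.left_commute)
    qed
    finally show "(Dx ^^ n) (\<lambda>q. ?\<gamma> q $ r) p = \<dots>" .
  qed
  have zt: "lam_coeff (Yt q ^\<^sub>m j) 0 - zetat q = R0 q" if "q \<in> S" for q
    unfolding zetat_def by (rule eqI) (use Yt_carrier[OF that] in simp_all)
  have detG: "det (G p) = 1" if "p \<in> S" for p using det[OF that] by (simp add: G_def)
  note H = det_one_inverse[OF Gc detG]
  \<comment> \<open>The bracket condition for the new \<zeta> needs no further computation: it
    follows from the existence of the frame G with t-connection R0.\<close>
  have zetat: "is_zeta n j S ut Yt zetat"
    unfolding is_zeta_def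
  proof (intro conjI ballI allI impI)
    show "smooth_mat_on n S zetat"
      unfolding zetat_def x_C_mat_iff[symmetric]
      by (intro x.C_mat_diff) (simp_all add: x_C_mat_iff R0_smooth fls_C_matD[OF fx.C_mat_pow[OF Yt_C_mat]])
    fix p assume p: "p \<in> S"
    show "zetat p $$ (r, c) = 0" if "r < n" "c \<le> r" for r c by (rule zetat_upper[OF p that])
    have "mat_D Dx (\<lambda>q. lam_coeff (Yt q ^\<^sub>m j) 0 - zetat q) p = mat_D Dx R0 p"
      by (rule x.mat_D_cong[OF p zt])
    then have "bracket_Dx (\<lambda>q. b_mat n + u_mat n (\<lambda>i. ut i q)) (\<lambda>q. lam_coeff (Yt q ^\<^sub>m j) 0 - zetat q) p
      = bracket_Dx (connection ut) R0 p"
      by (simp add: bracket_Dx_def mat_Dx_eq zt[OF p] connection_def)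
    also have "\<dots> \<in> V_space n"
      by (rule bracket_V[OF Gs ut_smooth R0_smooth Gx Gt p H(1)[OF p p] H(3)[OF p p]])
    finally show "bracket_Dx (\<lambda>q. b_mat n + u_mat n (\<lambda>i. ut i q)) (\<lambda>q. lam_coeff (Yt q ^\<^sub>m j) 0 - zetat q) p \<in> V_space n" .
  qed
  define Zt where "Zt p = map_mat lam_poly_part (Yt p ^\<^sub>m j) - map_mat (\<lambda>a. [: a :]) (zetat p)" for p
  have Zt0: "Z_zero (Zt p) = R0 p" if "p \<in> S" for p
    using is_Z_coeff(2)[OF Yt_is_Y zetat Zt_def that] zt[OF that] by (simp add: Z_zero_eq)
  have isZ: "is_Z n j S ut Zt" unfolding is_Z_def using Yt_is_Y zetat by (auto simp: Zt_def)
  show ?thesis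
    unfolding ca_flow_solution_def
  proof (intro conjI exI[of _ ut] exI[of _ Zt] ballI allI impI)
    show "open S" by (rule open_S)
    show "is_ca_curvature n S ?\<gamma> ut" by (rule curv)
    show "is_Z n j S ut Zt" by (rule isZ)
    show "smooth_on S (\<lambda>p. ?\<gamma> p $ r)" if r: "r < n" for r
      by (rule x.C_cong[OF _ x.C_mult[OF x.C_const[of a] sm[OF r n0]]]) (rule gam[OF _ r, symmetric])
    fix p assume p: "p \<in> S"
    show "?\<gamma> p \<in> carrier_vec n" by simp
    show "?\<gamma> p \<noteq> 0\<^sub>v n"
    proof
      assume z: "?\<gamma> p = 0\<^sub>v n"
      have "a \<noteq> 0" using a n0 by (auto simp: power_0_left)
      then have "G p $$ (r, 0) = 0" if "r < n" for r
        using gam[OF p that] that unfolding z by simp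
      then have "(adj_mat (G p) * G p) $$ (0, 0) = 0"
        unfolding mult_index[OF H(1)[OF p p] Gc[OF p] n0 n0] by simp
      then show False using H(3)[OF p p] n0 by simp
    qed
    show "det (ca_frame n ?\<gamma> p) = 1"
      unfolding frame[OF p] using detG[OF p] a Gc[OF p] by simp
    show "vec n (\<lambda>r. Dt (\<lambda>q. ?\<gamma> q $ r) p) = (ca_frame n ?\<gamma> p * Z_zero (Zt p)) *\<^sub>v unit_vec n 0"
    proof (rule eq_vecI)
      fix r assume "r < dim_vec ((ca_frame n ?\<gamma> p * Z_zero (Zt p)) *\<^sub>v unit_vec n 0)"
      then have r: "r < n" by simp
      have "Dt (\<lambda>q. ?\<gamma> q $ r) p = Dt (\<lambda>q. a * G q $$ (r, 0)) p"
        by (rule t.D_cong[OF _ p]) (rule gam[OF _ r])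
      also have "\<dots> = a * (G p * R0 p) $$ (r, 0)" by (rule DaG(2)[OF p r n0])
      also have "\<dots> = (ca_frame n ?\<gamma> p * Z_zero (Zt p)) $$ (r, 0)"
        unfolding frame[OF p] Zt0[OF p] using Gc[OF p] r n0 by (simp add: smult_mult)
      also have "\<dots> = ((ca_frame n ?\<gamma> p * Z_zero (Zt p)) *\<^sub>v unit_vec n 0) $ r"
        unfolding frame[OF p] Zt0[OF p] using Gc[OF p] r n0 by simp
      finally show "vec n (\<lambda>r. Dt (\<lambda>q. ?\<gamma> q $ r) p) $ r = ((ca_frame n ?\<gamma> p * Z_zero (Zt p)) *\<^sub>v unit_vec n 0) $ r"
        using r by simp
    qed simp
  qed
qed

end

section \<open>Restriction to smaller domains and the determinant of the new frame\<close>

lemma smooth_mat_on_subset: "smooth_mat_on n S M \<Longrightarrow> S' \<subseteq> S \<Longrightarrow> smooth_mat_on n S' M"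
  unfolding smooth_mat_on_def using smooth_on_subset[of S _ S'] by blast

lemma is_Y_subset: "is_Y n S u Y \<Longrightarrow> S' \<subseteq> S \<Longrightarrow> is_Y n S' u Y"
  unfolding is_Y_def using smooth_mat_on_subset[of n S _ S'] by blast

lemma is_zeta_subset: "is_zeta n j S u Y \<zeta> \<Longrightarrow> S' \<subseteq> S \<Longrightarrow> is_zeta n j S' u Y \<zeta>"
  unfolding is_zeta_def using smooth_mat_on_subset[of n S _ S'] by blast

text \<open>The family u enters only through \<open>u_mat\<close>, that is, through the indices 1 to
  n - 1; at other indices two curvatures of the same curve may differ.\<close>

lemma is_Z_cong:
  assumes eq: "\<And>p. p \<in> S \<Longrightarrow> u_mat n (\<lambda>i. u i p) = u_mat n (\<lambda>i. u' i p)" and Z: "is_Z n j S u Z"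
  shows "is_Z n j S u' Z"
proof -
  have "is_Y n S u Y = is_Y n S u' Y" for Y
    unfolding is_Y_def by (simp add: eq cong: ball_cong)
  moreover have "is_zeta n j S u Y \<zeta> = is_zeta n j S u' Y \<zeta>" for Y \<zeta>
    unfolding is_zeta_def bracket_Dx_def by (simp add: eq cong: ball_cong)
  ultimately show ?thesis using Z by (simp add: is_Z_def)
qed

context square_mat begin

lemma tendsto_det:
  fixes X :: "'b \<Rightarrow> complex mat"
  assumes lim: "\<And>r k. r < n \<Longrightarrow> k < n \<Longrightarrow> ((\<lambda>l. X l $$ (r, k)) \<longlongrightarrow> L $$ (r, k)) F"
    and c: "eventually (\<lambda>l. X l \<in> carrier_mat n n) F" and L: "L \<in> carrier_mat n n"
  shows "((\<lambda>l. det (X l)) \<longlongrightarrow> det L) F"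
proof -
  have "((\<lambda>l. \<Sum>\<pi> \<in> {\<pi>. \<pi> permutes {0..<n}}. signof \<pi> * (\<Prod>i = 0..<n. X l $$ (i, \<pi> i)))
    \<longlongrightarrow> (\<Sum>\<pi> \<in> {\<pi>. \<pi> permutes {0..<n}}. signof \<pi> * (\<Prod>i = 0..<n. L $$ (i, \<pi> i)))) F"
    by (intro tendsto_sum tendsto_mult tendsto_const tendsto_prod lim) (auto dest: permutes_in_image)
  then show ?thesis unfolding det_def'[OF L]
    by (rule Lim_transform_eventually) (use c in eventually_elim, simp only: det_def')
qed

lemma hessenberg_cmat: "hessenberg M \<Longrightarrow> hessenberg (map_mat complex_of_real M)"
  by (auto simp: hessenberg_def)

end

lemma (in darboux) hessenberg_f0: "hessenberg (f0 p)"
  by (auto simp: hessenberg_def f0_index)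

lemma (in darboux) det_f0: "p \<in> S \<Longrightarrow> det (f0 p) = 0"
  by (rule det_zero_of_kernel[OF carriers(1) Wm_carrier f0_Wm, of p "n - 1" 0])
    (use n_ge w_last in \<open>auto simp: Wm_index\<close>)

text \<open>
  The determinant of the new frame is the limit at \<open>\<lambda> = 0\<close> of
  \<open>det (\<lambda> e + A) * det E(\<lambda>) / det (\<lambda> e + f0)\<close>, and the outer two determinants agree.
\<close>

lemma (in darboux) det_new_frame:
  fixes E :: "complex \<Rightarrow> complex mat" and g E1 A :: "real mat"
  assumes p: "p \<in> S" and \<rho>: "\<rho> > 0"
    and Ec: "\<And>l. l \<in> ball 0 \<rho> \<Longrightarrow> E l \<in> carrier_mat n n"
    and ED: "\<And>r k. r < n \<Longrightarrow> k < n \<Longrightarrow> ((\<lambda>l. E l $$ (r, k)) has_field_derivative map_mat complex_of_real E1 $$ (r, k)) (at 0)"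
    and E0: "E 0 = map_mat complex_of_real g" and c: "g \<in> carrier_mat n n" "E1 \<in> carrier_mat n n"
    and det: "det g = 1" and A: "hessenberg A" "det A = 0" and ker: "A * g * Wm p = 0\<^sub>m n n"
  shows "det ((e * g + A * E1) * Bm p + A * g * B0 p) = 1"
proof -
  define G where "G = (e * g + A * E1) * Bm p + A * g * B0 p"
  have Ac: "A \<in> carrier_mat n n" using A by (simp add: hessenberg_def)
  have Gc: "G \<in> carrier_mat n n" using c Ac by (simp add: G_def)
  define cm where "cm = (map_mat complex_of_real :: real mat \<Rightarrow> complex mat)"
  have cc: "cm M \<in> carrier_mat n n" if "M \<in> carrier_mat n n" for M using that by (simp add: cm_def)
  have cmult: "cm M * cm N = cm (M * N)" and cadd: "cm M + cm N = cm (M + N)"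
    if "M \<in> carrier_mat n n" "N \<in> carrier_mat n n" for M N
    using that by (simp_all add: cm_def cmat_mult cmat_lin)
  note cs = cc[OF carriers(1)[of p]] cc[OF carriers(2)] cc[OF B_carrier(1)[of p]] cc[OF B_carrier(2)[of p]] cc[OF Ac] cc[OF c(1)] cc[OF c(2)]
  \<comment> \<open>The inverse of f_{u,h} at a nonzero complex value l of \<lambda>.\<close>
  define Kc where "Kc l = cm (B0 p) + inverse l \<cdot>\<^sub>m cm (Bm p)" for l
  define X where "X l = (l \<cdot>\<^sub>m cm e + cm A) * (E l * Kc l)" for l
  have Kcc: "Kc l \<in> carrier_mat n n" for l using cs by (simp add: Kc_def)
  have ce: "cm e = elem_mat n 1 n" by (simp add: cm_def e_def cmat_elem)
  have detM: "det (l \<cdot>\<^sub>m cm e + cm M) = l * (-1) ^ (n - 1)" if "hessenberg M" "det M = 0" for M l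
    unfolding ce by (rule det_hessenberg_corner) (use that n_ge in \<open>simp_all add: cm_def hessenberg_cmat\<close>)
  have FK: "(l \<cdot>\<^sub>m cm e + cm (f0 p)) * Kc l = 1\<^sub>m n" if "l \<noteq> 0" for l
  proof (rule eqI)
    fix r k assume rk: "r < n" "k < n"
    have s: "(l \<cdot>\<^sub>m cm e + cm (f0 p)) * Kc l = l \<cdot>\<^sub>m cm (e * B0 p) + cm (f0 p * B0 p)
      + inverse l \<cdot>\<^sub>m (l \<cdot>\<^sub>m cm (e * Bm p) + cm (f0 p * Bm p))"
      using cs by (simp add: Kc_def ring_distribs smult_mult cmult)
    have inv: "inverse l * (l * x) = x" for x using that by simp
    have "(e * Bm p) $$ (r, k) + (f0 p * B0 p) $$ (r, k) = 1\<^sub>m n $$ (r, k)"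
      using arg_cong[OF e_Bm[OF p], of "\<lambda>M. M $$ (r, k)"] rk by (simp add: index del: index_add_mat index_mult_mat)
    then have "complex_of_real ((e * Bm p) $$ (r, k)) + complex_of_real ((f0 p * B0 p) $$ (r, k)) = 1\<^sub>m n $$ (r, k)"
      using rk by (simp flip: of_real_add)
    then show "((l \<cdot>\<^sub>m cm e + cm (f0 p)) * Kc l) $$ (r, k) = 1\<^sub>m n $$ (r, k)"
      unfolding s e_B0 f0_Bm[OF p] using rk
      by (cases "r = k") (simp_all add: cm_def index inv add.commute del: index_add_mat index_mult_mat index_smult_mat index_map_mat)
  qed (use cs Kcc in simp_all)
  have detX: "det (X l) = det (E l)" if l: "l \<in> ball 0 \<rho>" "l \<noteq> 0" for l
  proof -
    have "det ((l \<cdot>\<^sub>m cm e + cm (f0 p)) * Kc l) = l * (-1) ^ (n - 1) * det (Kc l)"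
      using det_mult[of "l \<cdot>\<^sub>m cm e + cm (f0 p)" n "Kc l"] cs Kcc detM[OF hessenberg_f0 det_f0[OF p]] by simp
    then have 1: "l * (-1) ^ (n - 1) * det (Kc l) = 1" unfolding FK[OF l(2)] by simp
    have "det (X l) = det (l \<cdot>\<^sub>m cm e + cm A) * (det (E l) * det (Kc l))"
      unfolding X_def using det_mult[of "l \<cdot>\<^sub>m cm e + cm A" n "E l * Kc l"] det_mult[of "E l" n "Kc l"] cs Kcc Ec[OF l(1)] by simp
    also have "\<dots> = (l * (-1) ^ (n - 1) * det (Kc l)) * det (E l)" unfolding detM[OF A] by simp
    finally show ?thesis using 1 by simp
  qed
  have lim: "((\<lambda>l. X l $$ (r, k)) \<longlongrightarrow> cm G $$ (r, k)) (at 0)" if rk: "r < n" "k < n" for r k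
  proof -
    have Elim: "((\<lambda>l. E l $$ (i, m)) \<longlongrightarrow> cm g $$ (i, m)) (at 0)" if "i < n" "m < n" for i m
      using DERIV_isCont[OF ED[OF that]] by (simp add: isCont_def E0 cm_def)
    have ent: "(cm P * (M * cm N)) $$ (r, k) = (\<Sum>i<n. cm P $$ (r, i) * (\<Sum>m<n. M $$ (i, m) * cm N $$ (m, k)))"
      if "P \<in> carrier_mat n n" "M \<in> carrier_mat n n" "N \<in> carrier_mat n n" for P M N
      using that rk cc by (simp add: mult_index del: index_mult_mat)
    have ball: "eventually (\<lambda>l. l \<in> ball 0 \<rho>) (at (0::complex))"
      using \<rho> by (intro eventually_at_in_open') auto
    have entlim: "((\<lambda>l. (cm P * (E l * cm N)) $$ (r, k)) \<longlongrightarrow> (cm P * (cm g * cm N)) $$ (r, k)) (at 0)"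
      if P: "P \<in> carrier_mat n n" and N: "N \<in> carrier_mat n n" for P N
    proof -
      have "((\<lambda>l. \<Sum>i<n. cm P $$ (r, i) * (\<Sum>m<n. E l $$ (i, m) * cm N $$ (m, k))) \<longlongrightarrow>
          (\<Sum>i<n. cm P $$ (r, i) * (\<Sum>m<n. cm g $$ (i, m) * cm N $$ (m, k)))) (at 0)"
        by (intro tendsto_sum tendsto_mult tendsto_const Elim) auto
      then show ?thesis unfolding ent[OF P cc[OF c(1)] N]
        by (rule Lim_transform_eventually) (use ball in eventually_elim, simp only: ent[OF P Ec N])
    qed
    \<comment> \<open>Since A g Bm = 0, the quotient by l is a difference quotient at 0, and its
      limit contains the derivative of E. This is how \<open>E1\<close> enters the new
      frame.\<close>
    have D: "((\<lambda>l. (cm A * (E l * cm (Bm p))) $$ (r, k) / l) \<longlongrightarrow> (cm A * (cm E1 * cm (Bm p))) $$ (r, k)) (at 0)"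
    proof -
      have "((\<lambda>l. \<Sum>i<n. cm A $$ (r, i) * (\<Sum>m<n. E l $$ (i, m) * cm (Bm p) $$ (m, k))) has_field_derivative
          (\<Sum>i<n. cm A $$ (r, i) * (\<Sum>m<n. cm E1 $$ (i, m) * cm (Bm p) $$ (m, k)))) (at 0)"
        by (intro DERIV_sum DERIV_cmult DERIV_cmult_right) (use ED in \<open>auto simp: cm_def\<close>)
      then have "((\<lambda>l. (cm A * (E l * cm (Bm p))) $$ (r, k)) has_field_derivative (cm A * (cm E1 * cm (Bm p))) $$ (r, k)) (at 0)"
        unfolding ent[OF Ac cc[OF c(2)] B_carrier(2)]
        by (rule has_field_derivative_transform_within_open[of _ _ _ "ball 0 \<rho>"])
          (use \<rho> in \<open>simp_all add: ent[OF Ac Ec B_carrier(2)]\<close>)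
      moreover have "cm A * (E 0 * cm (Bm p)) = 0\<^sub>m n n"
      proof -
        have "A * (g * Bm p) = 0\<^sub>m n n"
          using ker c Ac assoc[of "A * g" "Wm p" "1\<^sub>m n - f0 p * B0 p"] by (simp add: Bm_def assoc)
        then have "cm A * (E 0 * cm (Bm p)) = cm (0\<^sub>m n n)"
          using c Ac by (simp add: E0 cm_def[symmetric] cmult)
        then show ?thesis by (simp add: cm_def cmat_one)
      qed
      ultimately show ?thesis using rk by (simp add: has_field_derivative_iff)
    qed
    have "((\<lambda>l. l * (cm e * (E l * cm (B0 p))) $$ (r, k) + (cm e * (E l * cm (Bm p))) $$ (r, k)
       + ((cm A * (E l * cm (B0 p))) $$ (r, k) + (cm A * (E l * cm (Bm p))) $$ (r, k) / l))
      \<longlongrightarrow> 0 * (cm e * (cm g * cm (B0 p))) $$ (r, k) + (cm e * (cm g * cm (Bm p))) $$ (r, k)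
       + ((cm A * (cm g * cm (B0 p))) $$ (r, k) + (cm A * (cm E1 * cm (Bm p))) $$ (r, k))) (at 0)"
      by (intro tendsto_add tendsto_mult tendsto_ident_at entlim D Ac carriers B_carrier)
    moreover have "0 * (cm e * (cm g * cm (B0 p))) $$ (r, k) + (cm e * (cm g * cm (Bm p))) $$ (r, k)
       + ((cm A * (cm g * cm (B0 p))) $$ (r, k) + (cm A * (cm E1 * cm (Bm p))) $$ (r, k)) = cm G $$ (r, k)"
      using rk c Ac by (simp add: G_def cmult ring_distribs assoc) (simp add: cm_def del: index_mult_mat(1))
    ultimately have "((\<lambda>l. l * (cm e * (E l * cm (B0 p))) $$ (r, k) + (cm e * (E l * cm (Bm p))) $$ (r, k)
       + ((cm A * (E l * cm (B0 p))) $$ (r, k) + (cm A * (E l * cm (Bm p))) $$ (r, k) / l)) \<longlongrightarrow> cm G $$ (r, k)) (at 0)"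
      by simp
    moreover have "eventually (\<lambda>l. l \<in> ball 0 \<rho> - {0}) (at (0::complex))"
      using \<rho> by (intro eventually_at_in_open) auto
    then have "eventually (\<lambda>l. l * (cm e * (E l * cm (B0 p))) $$ (r, k) + (cm e * (E l * cm (Bm p))) $$ (r, k)
       + ((cm A * (E l * cm (B0 p))) $$ (r, k) + (cm A * (E l * cm (Bm p))) $$ (r, k) / l) = X l $$ (r, k)) (at 0)"
    proof eventually_elim
      case (elim l)
      then have E: "E l \<in> carrier_mat n n" using Ec by simp
      have "X l = l \<cdot>\<^sub>m (cm e * (E l * cm (B0 p))) + cm A * (E l * cm (B0 p))
        + inverse l \<cdot>\<^sub>m (l \<cdot>\<^sub>m (cm e * (E l * cm (Bm p))) + cm A * (E l * cm (Bm p)))"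
        using cs E by (simp add: X_def Kc_def ring_distribs smult_mult)
      then show ?case
        using elim rk cs E by (simp add: index field_simps del: index_add_mat index_mult_mat index_smult_mat)
    qed
    ultimately show ?thesis by (rule Lim_transform_eventually)
  qed
  have ball0: "eventually (\<lambda>l. l \<in> ball 0 \<rho> - {0}) (at (0::complex))"
    using \<rho> by (intro eventually_at_in_open) auto
  have "((\<lambda>l. det (X l)) \<longlongrightarrow> det (cm G)) (at 0)"
  proof (rule tendsto_det[OF lim])
    show "eventually (\<lambda>l. X l \<in> carrier_mat n n) (at 0)"
      using ball0 by eventually_elim (use Ec Kcc cs in \<open>simp add: X_def\<close>)
  qed (use cc[OF Gc] in auto)
  moreover have "((\<lambda>l. det (E l)) \<longlongrightarrow> det (cm g)) (at 0)"
  proof (rule tendsto_det)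
    show "((\<lambda>l. E l $$ (r, k)) \<longlongrightarrow> cm g $$ (r, k)) (at 0)" if "r < n" "k < n" for r k
      using DERIV_isCont[OF ED[OF that]] by (simp add: isCont_def E0 cm_def)
    show "eventually (\<lambda>l. E l \<in> carrier_mat n n) (at 0)"
      using ball0 by eventually_elim (use Ec in simp)
  qed (use cc[OF c(1)] in auto)
  then have "((\<lambda>l. det (X l)) \<longlongrightarrow> det (cm g)) (at 0)"
    by (rule Lim_transform_eventually) (use ball0 in eventually_elim, simp add: detX)
  ultimately have "det (cm G) = det (cm g)"
    by (intro tendsto_unique[of "at (0::complex)"]) auto
  then show ?thesis using det by (simp add: cm_def of_real_hom.hom_det G_def)
qed

section \<open>The vector g^{-1} c_0\<close>

context kdv_domain begin

text \<open>With c_0 constant only g^{-1} is differentiated, and the inverse of a solution of g_x =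
  g A is multiplied by -A from the left.\<close>

lemma adjoint_solution:
  fixes g A M :: "real \<times> real \<Rightarrow> real mat" and c0 :: "real vec"
  assumes g: "smooth_mat_on n S g" "\<And>p. p \<in> S \<Longrightarrow> det (g p) = 1"
    and A: "\<And>p. p \<in> S \<Longrightarrow> A p \<in> carrier_mat n n" and M: "\<And>p. p \<in> S \<Longrightarrow> M p \<in> carrier_mat n n"
    and gx: "\<And>p. p \<in> S \<Longrightarrow> mat_Dx g p = g p * A p" and gt: "\<And>p. p \<in> S \<Longrightarrow> mat_Dt g p = g p * M p"
    and c0: "c0 \<in> carrier_vec n"
  defines "v \<equiv> \<lambda>p. inv_mat (g p) *\<^sub>v c0"
  shows "\<And>r. r < n \<Longrightarrow> smooth_on S (\<lambda>p. v p $ r)"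
    and "\<And>p r. p \<in> S \<Longrightarrow> r < n \<Longrightarrow> Dx (\<lambda>q. v q $ r) p = - (\<Sum>k<n. A p $$ (r, k) * v p $ k)"
    and "\<And>p r. p \<in> S \<Longrightarrow> r < n \<Longrightarrow> Dt (\<lambda>q. v q $ r) p = - (\<Sum>k<n. M p $$ (r, k) * v p $ k)"
    and "\<And>p r. p \<in> S \<Longrightarrow> r < n \<Longrightarrow> (\<Sum>k<n. g p $$ (r, k) * v p $ k) = c0 $ r"
proof -
  define H where "H q = adj_mat (g q)" for q
  note H = det_one_inverse[OF smooth_matD[OF g(1)] g(2), folded H_def]
  have Hs: "smooth_mat_on n S H" using x.C_mat_adj[of n g] g(1) unfolding x_C_mat_iff H_def by simp
  have Hx: "mat_Dx H q = - (A q * H q)" if "q \<in> S" for q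
    unfolding mat_Dx_eq by (rule x.mat_D_inverse[OF that, of n g])
      (use g Hs H A gx that in \<open>auto simp: x_C_mat_iff mat_Dx_eq\<close>)
  have Ht: "mat_Dt H q = - (M q * H q)" if "q \<in> S" for q
    unfolding mat_Dt_eq by (rule t.mat_D_inverse[OF that, of n g])
      (use g Hs H M gt that in \<open>auto simp: x_C_mat_iff mat_Dt_eq\<close>)
  define N where "N = mat n n (\<lambda>(r, c). if c = 0 then c0 $ r else 0)"
  have Nc: "N \<in> carrier_mat n n" by (simp add: N_def)
  define VM where "VM q = H q * N" for q
  have VMc: "VM q \<in> carrier_mat n n" if "q \<in> S" for q using H(1)[OF that that] Nc by (simp add: VM_def)
  have vVM: "v q $ r = VM q $$ (r, 0)" if "q \<in> S" "r < n" for q r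
  proof -
    have "inv_mat (g q) = H q"
      by (rule inv_mat_eq[OF smooth_matD[OF g(1) that(1)] H(1,2)[OF that(1) that(1)]])
    then have "v q $ r = (\<Sum>k<n. H q $$ (r, k) * c0 $ k)"
      using H(1)[OF that(1) that(1)] that(2) c0 by (simp add: v_def scalar_prod_def atLeast0LessThan)
    also have "\<dots> = VM q $$ (r, 0)"
      unfolding VM_def mult_index[OF H(1)[OF that(1) that(1)] Nc that(2) n_pos]
      using n_pos by (intro sum.cong refl) (simp add: N_def)
    finally show ?thesis .
  qed
  have Ns: "smooth_mat_on n S (\<lambda>q. N)" using x.C_mat_const[OF Nc] by (simp add: x_C_mat_iff)
  have VMs: "smooth_mat_on n S VM"
    using x.C_mat_mult[of n H "\<lambda>q. N"] Hs Ns unfolding x_C_mat_iff VM_def by simp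
  have VMx: "mat_Dx VM q = - (A q * VM q)" and VMt: "mat_Dt VM q = - (M q * VM q)" if q: "q \<in> S" for q
  proof -
    note c = H(1)[OF q q] Nc A[OF q] M[OF q]
    have "mat_Dx VM q = mat_Dx H q * N + H q * mat_D Dx (\<lambda>q. N) q"
      using x.mat_D_mult[OF q, of n H "\<lambda>q. N"] Hs Ns unfolding VM_def[abs_def] mat_Dx_eq by (simp add: x_C_mat_iff)
    then show "mat_Dx VM q = - (A q * VM q)"
      using c by (simp add: x.mat_D_const[OF q Nc] Hx[OF q] VM_def assoc)
    have "mat_Dt VM q = mat_Dt H q * N + H q * mat_D Dt (\<lambda>q. N) q"
      using t.mat_D_mult[OF q, of n H "\<lambda>q. N"] Hs Ns unfolding VM_def[abs_def] mat_Dt_eq by (simp add: x_C_mat_iff)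
    then show "mat_Dt VM q = - (M q * VM q)"
      using c by (simp add: t.mat_D_const[OF q Nc] Ht[OF q] VM_def assoc)
  qed
  show "smooth_on S (\<lambda>p. v p $ r)" if r: "r < n" for r
    by (rule x.C_cong[of "\<lambda>p. VM p $$ (r, 0)"]) (use VMs vVM r n_pos in \<open>auto simp: smooth_mat_on_def\<close>)
  fix p r assume p: "p \<in> S" and r: "r < n"
  have col: "(P * VM p) $$ (r, 0) = (\<Sum>k<n. P $$ (r, k) * v p $ k)" if "P \<in> carrier_mat n n" for P
    unfolding mult_index[OF that VMc[OF p] r n_pos] using vVM[OF p] by (intro sum.cong refl) simp
  have "Dx (\<lambda>q. v q $ r) p = Dx (\<lambda>q. VM q $$ (r, 0)) p"
    by (rule x.D_cong[OF _ p]) (rule vVM[OF _ r])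
  also have "\<dots> = - (A p * VM p) $$ (r, 0)"
    using mat_D_entry(1)[where M = VM and p = p, OF VMc[OF p] r n_pos] VMx[OF p] r n_pos A[OF p] VMc[OF p] by simp
  finally show "Dx (\<lambda>q. v q $ r) p = - (\<Sum>k<n. A p $$ (r, k) * v p $ k)"
    unfolding col[OF A[OF p]] .
  have "Dt (\<lambda>q. v q $ r) p = Dt (\<lambda>q. VM q $$ (r, 0)) p"
    by (rule t.D_cong[OF _ p]) (rule vVM[OF _ r])
  also have "\<dots> = - (M p * VM p) $$ (r, 0)"
    using mat_D_entry(2)[where M = VM and p = p, OF VMc[OF p] r n_pos] VMt[OF p] r n_pos M[OF p] VMc[OF p] by simp
  finally show "Dt (\<lambda>q. v q $ r) p = - (\<Sum>k<n. M p $$ (r, k) * v p $ k)"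
    unfolding col[OF M[OF p]] .
  have "(g p * VM p) $$ (r, 0) = N $$ (r, 0)"
    using H[OF p p] smooth_matD[OF g(1) p] Nc by (simp add: VM_def flip: assoc)
  then show "(\<Sum>k<n. g p $$ (r, k) * v p $ k) = c0 $ r"
    unfolding col[OF smooth_matD[OF g(1) p]] using r n_pos by (simp add: N_def)
qed

end

section \<open>The transformed curve on the set where v_n is nonzero\<close>

theorem theorem4p3:
  fixes n j :: nat
    and T :: "real set"
    and S S' :: "(real \<times> real) set"
    and \<gamma> :: "real \<times> real \<Rightarrow> real vec"
    and g :: "real \<times> real \<Rightarrow> real mat"
    and u :: "nat \<Rightarrow> real \<times> real \<Rightarrow> real"
    and E :: "real \<times> real \<Rightarrow> complex \<Rightarrow> complex mat"
    and E1 :: "real \<times> real \<Rightarrow> complex mat"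
    and \<rho> :: real
    and c :: "nat \<Rightarrow> real"
    and v :: "real \<times> real \<Rightarrow> real vec"
    and h :: "real \<times> real \<Rightarrow> real"
  assumes "n \<ge> 2" and "j \<ge> 1" and "\<not> n dvd j"
    and "open T" and "is_interval T" and "0 \<in> T"
    and "S = UNIV \<times> T"
    and "ca_flow_solution n j S \<gamma>"
    and "g = ca_frame n \<gamma>"
    and "is_ca_curvature n S \<gamma> u"
    and "\<rho> > 0"
    and "is_frame n j S (ball 0 \<rho>) u E"
    and "\<forall>p\<in>S. \<forall>r<n. \<forall>k<n. (\<lambda>l. E p l $$ (r, k)) holomorphic_on ball 0 \<rho>"
    and "E (0, 0) 0 = map_mat complex_of_real (g (0, 0))"
    and "E1 = lam_deriv_mat n E"
    and "v = (\<lambda>p. inv_mat (g p) *\<^sub>v bt_c0 n c)"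
    and "h = (\<lambda>p. - (v p $ (n - 2)) / (v p $ (n - 1)))"
    and "S' = {p \<in> S. v p $ (n - 1) \<noteq> 0}"
  shows "\<exists>\<gamma>'. (\<forall>p\<in>S'. map_vec complex_of_real (\<gamma>' p) =
             ((elem_mat n 1 n * map_mat complex_of_real (g p)
                + map_mat complex_of_real (bt_A n c) * E1 p)
              * adj_mat (bt_f n u h p 0)) *\<^sub>v unit_vec n 0)
           \<and> ca_flow_solution n j S' \<gamma>'"
proof -
  note n_ge = assms(1) and j_ge = assms(2)
  from assms(8) obtain u' Z' where open_S: "open S"
    and \<gamma>_carrier: "\<And>p. p \<in> S \<Longrightarrow> \<gamma> p \<in> carrier_vec n"
    and \<gamma>_smooth: "\<And>r. r < n \<Longrightarrow> smooth_on S (\<lambda>p. \<gamma> p $ r)"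
    and det_g: "\<And>p. p \<in> S \<Longrightarrow> det (g p) = 1"
    and u': "is_ca_curvature n S \<gamma> u'" and Z': "is_Z n j S u' Z'"
    and flow: "\<And>p. p \<in> S \<Longrightarrow> vec n (\<lambda>r. Dt (\<lambda>q. \<gamma> q $ r) p) = (g p * Z_zero (Z' p)) *\<^sub>v unit_vec n 0"
    unfolding ca_flow_solution_def assms(9) by blast
  interpret D: kdv_domain n S by unfold_locales (use open_S n_ge in auto)
  have u_smooth: "smooth_on S (u i)" if "i \<in> {1..n - 1}" for i
    using assms(12) that by (auto simp: is_frame_def kdv_solution_def)
  from assms(12) obtain Z where Z: "is_Z n j S u Z"
    and fr: "\<And>l. l \<in> ball 0 \<rho> \<Longrightarrow> smooth_mat_on n S (\<lambda>p. E p l)"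
      "\<And>l p. l \<in> ball 0 \<rho> \<Longrightarrow> p \<in> S \<Longrightarrow> invertible_mat (E p l)"
      "\<And>l p. l \<in> ball 0 \<rho> \<Longrightarrow> p \<in> S \<Longrightarrow> inv_mat (E p l) * mat_Dx (\<lambda>q. E q l) p
        = J_mat n l + map_mat complex_of_real (u_mat n (\<lambda>i. u i p))"
      "\<And>l p. l \<in> ball 0 \<rho> \<Longrightarrow> p \<in> S \<Longrightarrow> inv_mat (E p l) * mat_Dt (\<lambda>q. E q l) p = Z_eval (Z p) l"
      "\<And>l p. l \<in> ball 0 \<rho> \<Longrightarrow> p \<in> S \<Longrightarrow> map_mat cnj (E p (cnj l)) = E p l"
    unfolding is_frame_def by blast
  have g_smooth: "smooth_mat_on n S g" unfolding assms(9) by (rule D.ca_frame_smooth[OF \<gamma>_smooth])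
  have gc: "g p \<in> carrier_mat n n" for p by (simp add: assms(9))
  have gx: "mat_Dx g p = g p * D.connection u p" if "p \<in> S" for p
    unfolding assms(9) by (rule D.ca_frame_Dx[OF assms(10) that])
  have gx': "mat_Dx g p = g p * D.connection u' p" if "p \<in> S" for p
    unfolding assms(9) by (rule D.ca_frame_Dx[OF u' that])
  \<comment> \<open>The flow comes with a curvature u' of its own; both curvatures give the same
    g_x, and the invertible g cancels.\<close>
  have conn_eq: "D.connection u' p = D.connection u p" if p: "p \<in> S" for p
    by (rule D.mult_cancel_left[OF D.det_one_inverse(1)[OF gc det_g[OF p]] gc])
      (use D.det_one_inverse(3)[OF gc det_g[OF p]] gx[OF p] gx'[OF p] in simp_all)
  have u_mat_eq: "u_mat n (\<lambda>i. u' i p) = u_mat n (\<lambda>i. u i p)" if p: "p \<in> S" for p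
  proof (rule D.eqI)
    fix r k assume "r < n" "k < n"
    then show "u_mat n (\<lambda>i. u' i p) $$ (r, k) = u_mat n (\<lambda>i. u i p) $$ (r, k)"
      using arg_cong[OF conn_eq[OF p], of "\<lambda>X. X $$ (r, k)"] by (simp add: D.connection_def)
  qed simp_all
  have ZZ': "Z' p = Z p" if "p \<in> S" for p
    by (rule D.is_Z_unique[OF is_Z_cong[OF u_mat_eq Z'] Z that])
  have Z0c: "D.Z_coeff Z i p \<in> carrier_mat n n" if "p \<in> S" for p i
    using D.smooth_matD[OF D.Z_coeff_smooth[OF Z] that] .
  \<comment> \<open>The flow equation is only the first column of this identity; the other columns
    come from the uniqueness in \<open>frame_Dt\<close>.\<close>
  have gt: "mat_Dt g p = g p * D.Z_coeff Z 0 p" if "p \<in> S" for p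
  proof (rule D.frame_Dt[OF g_smooth u_smooth det_g gx Z0c D.is_Z_bracket[OF Z] _ that])
    fix q r assume q: "q \<in> S" and r: "r < n"
    have "Dt (\<lambda>p. g p $$ (r, 0)) q = Dt (\<lambda>p. \<gamma> p $ r) q"
      using r n_ge by (simp add: assms(9) D.ca_frame_index)
    also have "\<dots> = vec n (\<lambda>r. Dt (\<lambda>q. \<gamma> q $ r) q) $ r" using r by simp
    also have "\<dots> = (g q * D.Z_coeff Z 0 q) $$ (r, 0)"
      unfolding flow[OF q] ZZ'[OF q] D.Z_zero_eq using r n_ge gc Z0c[OF q] by simp
    finally show "Dt (\<lambda>p. g p $$ (r, 0)) q = (g q * D.Z_coeff Z 0 q) $$ (r, 0)" .
  qed
  have Ec: "E p l \<in> carrier_mat n n" if "l \<in> ball 0 \<rho>" "p \<in> S" for p l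
    using D.smooth_matD[OF fr(1)[OF that(1)] that(2)] .
  have Ex: "mat_Dx (\<lambda>q. E q l) p = E p l * (J_mat n l + map_mat complex_of_real (u_mat n (\<lambda>i. u i p)))"
    if "l \<in> ball 0 \<rho>" "p \<in> S" for l p
    by (rule D.inv_mat_mult_eq[OF Ec[OF that] fr(2)[OF that] _ _ fr(3)[OF that]])
      (use Ec[OF that] in \<open>simp_all add: mat_Dx_eq\<close>)
  have Et: "mat_Dt (\<lambda>q. E q l) p = E p l * Z_eval (Z p) l" if "l \<in> ball 0 \<rho>" "p \<in> S" for l p
    by (rule D.inv_mat_mult_eq[OF Ec[OF that] fr(2)[OF that] _ _ fr(4)[OF that]])
      (use Ec[OF that] D.is_Z_carrier[OF Z that(2)] in \<open>simp_all add: mat_Dt_eq Z_eval_def\<close>)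
  have 0: "0 \<in> ball (0::complex) \<rho>" using assms(11) by simp
  \<comment> \<open>Shown on all of S, where convexity is at hand; the set S' used below need not be
    connected.\<close>
  have E0: "E p 0 = map_mat complex_of_real (g p)" if p: "p \<in> S" for p
  proof (rule D.frame_at_zero[OF assms(7,5,6) g_smooth det_g _ Z0c gx gt fr(1)[OF 0] _ _ assms(14) p])
    fix q assume q: "q \<in> S"
    show "mat_Dx (\<lambda>p. E p 0) q = E q 0 * map_mat complex_of_real (D.connection u q)"
      unfolding Ex[OF 0 q] D.J_mat_split D.connection_def
      by (rule arg_cong[of _ _ "(*) (E q 0)"], rule D.eqI) simp_all
    have "Z_eval (Z q) 0 = map_mat complex_of_real (D.Z_coeff Z 0 q)"
    proof (rule D.eqI)
      fix r k assume "r < n" "k < n"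
      then show "Z_eval (Z q) 0 $$ (r, k) = map_mat complex_of_real (D.Z_coeff Z 0 q) $$ (r, k)"
        using Z0c[OF q, of 0] D.Z_eval_index[OF Z q, of r k 0] by simp
    qed (use Z0c[OF q] D.is_Z_carrier[OF Z q] in \<open>simp_all add: Z_eval_def\<close>)
    then show "mat_Dt (\<lambda>p. E p 0) q = E q 0 * map_mat complex_of_real (D.Z_coeff Z 0 q)"
      using Et[OF 0 q] by simp
  qed simp_all
  have hol: "(\<lambda>l. E p l $$ (r, k)) holomorphic_on ball 0 \<rho>" if "p \<in> S" "r < n" "k < n" for p r k
    using assms(13) that by blast
  define Er where "Er p = map_mat Re (lam_deriv_mat n E p)" for p
  note derivative = D.frame_lam_derivative[OF g_smooth det_g gx gt Z j_ge assms(11) fr(1) Ex Et E0 hol fr(5)]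
  have Er: "p \<in> S \<Longrightarrow> map_mat complex_of_real (Er p) = lam_deriv_mat n E p" "smooth_mat_on n S Er"
    "p \<in> S \<Longrightarrow> mat_Dx Er p = Er p * D.connection u p + g p * elem_mat n 1 n"
    "p \<in> S \<Longrightarrow> mat_Dt Er p = Er p * D.Z_coeff Z 0 p + g p * D.Z_coeff Z 1 p" for p
    unfolding Er_def[abs_def] by (rule derivative, assumption+)+
  have c0: "bt_c0 n c \<in> carrier_vec n" by (simp add: bt_c0_def)
  note adjoint = D.adjoint_solution[where A = "D.connection u" and M = "D.Z_coeff Z 0",
    OF g_smooth det_g D.connection_carrier Z0c gx gt c0]
  have v: "r < n \<Longrightarrow> smooth_on S (\<lambda>p. v p $ r)"
    "p \<in> S \<Longrightarrow> r < n \<Longrightarrow> Dx (\<lambda>q. v q $ r) p = - (\<Sum>k<n. D.connection u p $$ (r, k) * v p $ k)"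
    "p \<in> S \<Longrightarrow> r < n \<Longrightarrow> Dt (\<lambda>q. v q $ r) p = - (\<Sum>k<n. D.Z_coeff Z 0 p $$ (r, k) * v p $ k)"
    "p \<in> S \<Longrightarrow> r < n \<Longrightarrow> (\<Sum>k<n. g p $$ (r, k) * v p $ k) = bt_c0 n c $ r" for p r
    unfolding assms(16) by (rule adjoint, assumption+)+
  define vn where "vn p = v p $ (n - 1)" for p
  have n1: "n - 1 < n" "n - 2 < n" using n_ge by auto
  have S': "S' \<subseteq> S" "p \<in> S' \<Longrightarrow> vn p \<noteq> 0" for p by (auto simp: assms(18) vn_def)
  have open_S': "open S'"
  proof -
    have "S' = S \<inter> vn -` (- {0})" by (auto simp: assms(18) vn_def)
    moreover have "continuous_on S vn"
      using smooth_on_imp_continuous_on[OF v(1)[OF n1(1)]] by (simp add: vn_def[abs_def])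
    ultimately show ?thesis using continuous_open_preimage[OF _ open_S, of vn "- {0}"] by (simp add: open_Compl)
  qed
  interpret D': kdv_domain n S' by unfold_locales (use open_S' n_ge in auto)
  have vs: "smooth_on S' (\<lambda>p. v p $ r)" if "r < n" for r
    by (rule smooth_on_subset[OF v(1)[OF that] S'(1)])
  have vns: "smooth_on S' vn" using vs[OF n1(1)] by (simp add: vn_def[abs_def])
  define w where "w r p = v p $ r / vn p" for r p
  have ws: "smooth_on S' (w r)" if "r < n" for r
    unfolding w_def by (rule smooth_on_divide[OF open_S' S'(2) vs[OF that] vns])
  have h: "h p = - (v p $ (n - 2)) / vn p" for p by (simp add: assms(17) vn_def)
  have hs: "smooth_on S' h"
    unfolding h[abs_def] by (intro smooth_on_divide smooth_on_uminus open_S' vs vns n1 S'(2))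
  \<comment> \<open>The quotient rule in the form v = w v_n, which needs only the product
    rule.\<close>
  have Dw: "Dx (w r) p = (Dx (\<lambda>q. v q $ r) p - w r p * Dx vn p) / vn p"
    "Dt (w r) p = (Dt (\<lambda>q. v q $ r) p - w r p * Dt vn p) / vn p" if p: "p \<in> S'" and r: "r < n" for p r
  proof -
    have eq: "v q $ r = w r q * vn q" if "q \<in> S'" for q using S'(2)[OF that] by (simp add: w_def)
    have "Dx (\<lambda>q. v q $ r) p = Dx (\<lambda>q. w r q * vn q) p" "Dt (\<lambda>q. v q $ r) p = Dt (\<lambda>q. w r q * vn q) p"
      by (rule D'.x.D_cong[OF eq p], assumption, rule D'.t.D_cong[OF eq p], assumption)
    then show "Dx (w r) p = (Dx (\<lambda>q. v q $ r) p - w r p * Dx vn p) / vn p"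
      "Dt (w r) p = (Dt (\<lambda>q. v q $ r) p - w r p * Dt vn p) / vn p"
      using D'.x.D_mult[OF p ws[OF r] vns] D'.t.D_mult[OF p ws[OF r] vns] S'(2)[OF p] by (simp_all add: field_simps)
  qed
  have sum_w: "(\<Sum>k<n. a k * v p $ k) / vn p = (\<Sum>k<n. a k * w k p)" for a p
    by (simp add: w_def sum_divide_distrib)
  have w_last: "w (n - 1) p = 1" if "p \<in> S'" for p using S'(2)[OF that] by (simp add: w_def vn_def)
  have conn_last: "(\<Sum>k<n. D.connection u p $$ (n - 1, k) * v p $ k) = v p $ (n - 2)" for p
  proof -
    have "(\<Sum>k<n. D.connection u p $$ (n - 1, k) * v p $ k) = (\<Sum>k<n. if k = n - 2 then v p $ k else 0)"
      using n_ge by (intro sum.cong refl) (auto simp: D.connection_index)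
    then show ?thesis using n1 by simp
  qed
  \<comment> \<open>The last row of the equation for v gives (v_n)_x = -v_{n-1}, so that division by
    v_n contributes the term -h w.\<close>
  have w_Dx: "Dx (w r) p = - (\<Sum>k<n. D.connection u p $$ (r, k) * w k p) - h p * w r p" if p: "p \<in> S'" and r: "r < n" for p r
  proof -
    have pS: "p \<in> S" using p S'(1) by blast
    have "Dx vn p = - (v p $ (n - 2))"
      using v(2)[OF pS n1(1)] conn_last by (simp add: vn_def[abs_def])
    then have "Dx (w r) p = - ((\<Sum>k<n. D.connection u p $$ (r, k) * v p $ k) / vn p) - h p * w r p"
      unfolding Dw(1)[OF p r] v(2)[OF pS r] using S'(2)[OF p] by (simp add: h field_simps)
    then show ?thesis unfolding sum_w .
  qed
  obtain Y \<zeta> where Y: "is_Y n S u Y" and \<zeta>: "is_zeta n j S u Y \<zeta>"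
    and ZY: "\<And>p. p \<in> S \<Longrightarrow> Z p = map_mat lam_poly_part (Y p ^\<^sub>m j) - map_mat (\<lambda>a. [: a :]) (\<zeta> p)"
    using D.is_ZE[OF Z] by metis
  have Zc0: "D.Z_coeff Z 0 p = lam_coeff (Y p ^\<^sub>m j) 0 - \<zeta> p" if "p \<in> S" for p
    by (rule D.is_Z_coeff(2)[OF Y \<zeta> ZY that])
  have Zc1: "D.Z_coeff Z 1 p = lam_coeff (Y p ^\<^sub>m j) 1" if "p \<in> S" for p
    using D.is_Z_coeff(3)[OF Y \<zeta> ZY that, of 0] by simp
  \<comment> \<open>Minus the logarithmic t-derivative of v_n, introduced by the normalisation of w.
    The relation f0 w = 0 removes it when the pole of the t-connection is computed.\<close>
  define \<mu> where "\<mu> p = - (Dt vn p / vn p)" for p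
  interpret W: darboux_flow n S' u h w j Y \<zeta> \<mu>
  proof unfold_locales
    show "smooth_on S' (u i)" if "i \<in> {1..n - 1}" for i by (rule smooth_on_subset[OF u_smooth[OF that] S'(1)])
    show "is_Y n S' u Y" by (rule is_Y_subset[OF Y S'(1)])
    show "is_zeta n j S' u Y \<zeta>" by (rule is_zeta_subset[OF \<zeta> S'(1)])
    fix p r assume p: "p \<in> S'" and r: "r < n"
    have pS: "p \<in> S" using p S'(1) by blast
    have "Dt (w r) p = - ((\<Sum>k<n. D.Z_coeff Z 0 p $$ (r, k) * v p $ k) / vn p) + \<mu> p * w r p"
      unfolding Dw(2)[OF p r] v(3)[OF pS r] by (simp add: \<mu>_def diff_divide_distrib)
    then show "Dt (w r) p = - (\<Sum>k<n. (lam_coeff (Y p ^\<^sub>m j) 0 - \<zeta> p) $$ (r, k) * w k p) + \<mu> p * w r p"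
      unfolding sum_w Zc0[OF pS] .
  qed (use hs ws w_last w_Dx in auto)
  define A where "A = bt_A n c"
  have Ac: "A \<in> carrier_mat n n" by (simp add: A_def bt_A_def)
  have A_index: "A $$ (r, k) = (if r = k + 1 then 1 else 0) + (if k + 1 = n \<and> 1 \<le> r then c r else 0)" if "r < n" "k < n" for r k
    using that by (auto simp: A_def bt_A_def b_mat_def)
  \<comment> \<open>In row r \<ge> 1 the subdiagonal of b contributes c_r, and the last column
    contributes c_r times the entry -1 of c_0; row 0 of A is zero.\<close>
  have A_kernel: "(\<Sum>k<n. A $$ (r, k) * bt_c0 n c $ k) = 0" if r: "r < n" for r
  proof -
    have "(\<Sum>k<n. A $$ (r, k) * bt_c0 n c $ k)
      = (\<Sum>k<n. (if k + 1 = r then c r else 0) + (if k = n - 1 then if 1 \<le> r then - c r else 0 else 0))"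
      using r n_ge by (intro sum.cong refl) (auto simp: A_index bt_c0_def)
    also have "\<dots> = 0" unfolding sum.distrib using r n_ge by (cases r) (simp_all add: sum.delta)
    finally show ?thesis .
  qed
  have hessA: "D.hessenberg A" using Ac by (auto simp: D.hessenberg_def A_index)
  have gW: "(g p * W.Wm p) $$ (r, k) = (if k = 0 then bt_c0 n c $ r / vn p else 0)"
    if "p \<in> S'" "r < n" "k < n" for p r k
  proof -
    have pS: "p \<in> S" using that S'(1) by blast
    show ?thesis
      using W.mult_Wm_index[OF gc that(2,3), of p p] v(4)[OF pS that(2)] sum_w[of "\<lambda>k. g p $$ (r, k)" p] by simp
  qed
  \<comment> \<open>As w = g^{-1} c_0 / v_n, the product A g w is A c_0 / v_n = 0.\<close>
  have ker: "A * g p * W.Wm p = 0\<^sub>m n n" if p: "p \<in> S'" for p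
  proof -
    have "A * (g p * W.Wm p) = 0\<^sub>m n n"
    proof (rule D.eqI)
      fix r k assume rk: "r < n" "k < n"
      have "(A * (g p * W.Wm p)) $$ (r, k) = (\<Sum>m<n. A $$ (r, m) * (if k = 0 then bt_c0 n c $ m / vn p else 0))"
        unfolding D.mult_index[OF Ac D.carrier_closed(1)[OF gc W.Wm_carrier] rk] using rk
        by (intro sum.cong refl) (simp add: gW[OF p] del: index_mult_mat)
      also have "\<dots> = (if k = 0 then (\<Sum>m<n. A $$ (r, m) * bt_c0 n c $ m) / vn p else 0)"
        by (simp add: sum_divide_distrib)
      finally show "(A * (g p * W.Wm p)) $$ (r, k) = 0\<^sub>m n n $$ (r, k)" using A_kernel[OF rk(1)] rk by simp
    qed (use Ac gc in simp_all)
    then show ?thesis using Ac gc by (simp add: D.assoc)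
  qed
  have detA: "det A = 0"
  proof -
    define N where "N = mat n n (\<lambda>(r, k). if k = 0 then bt_c0 n c $ r else 0)"
    have "A * N = 0\<^sub>m n n"
    proof (rule D.eqI)
      fix r k assume rk: "r < n" "k < n"
      have "(A * N) $$ (r, k) = (\<Sum>m<n. A $$ (r, m) * (if k = 0 then bt_c0 n c $ m else 0))"
        by (subst D.mult_index) (use Ac rk in \<open>auto simp: N_def\<close>)
      then show "(A * N) $$ (r, k) = 0\<^sub>m n n $$ (r, k)" using A_kernel[OF rk(1)] rk by (cases "k = 0") simp_all
    qed (use Ac in \<open>simp_all add: N_def\<close>)
    then show ?thesis
      by (rule D.det_zero_of_kernel[OF Ac, of N "n - 1" 0, rotated]) (use n_ge in \<open>simp_all add: N_def bt_c0_def\<close>)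
  qed
  have Erc: "Er p \<in> carrier_mat n n" for p by (simp add: Er_def lam_deriv_mat_def)
  \<comment> \<open>\<open>W0\<close> and \<open>W1\<close> are the coefficients of \<lambda>^0 and
    \<lambda>^1 in the product of \<lambda> e_{1n} + A with the expansion g + \<lambda> E_1 of
    E.\<close>
  define W0 where "W0 p = A * g p" for p
  define W1 where "W1 p = W.e * g p + A * Er p" for p
  have Wc: "W0 p \<in> carrier_mat n n" "W1 p \<in> carrier_mat n n" for p using Ac gc Erc by (simp_all add: W0_def W1_def)
  have gs': "smooth_mat_on n S' g" and Ers': "smooth_mat_on n S' Er"
    by (rule smooth_mat_on_subset[OF g_smooth S'(1)], rule smooth_mat_on_subset[OF Er(2) S'(1)])
  have C: "D'.x.C_mat n g" "D'.x.C_mat n Er" "D'.t.C_mat n g" "D'.t.C_mat n Er"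
    using gs' Ers' by (simp_all add: D'.x_C_mat_iff)
  have Ws: "smooth_mat_on n S' W0" "smooth_mat_on n S' W1"
    unfolding W0_def W1_def D'.x_C_mat_iff[symmetric]
    by (intro D'.x.C_mat_add D'.x.C_mat_mult D'.x.C_mat_const C Ac W.carriers)+
  have const_mult: "mat_D Dx (\<lambda>q. K * M q) p = K * mat_D Dx M p" "mat_D Dt (\<lambda>q. K * M q) p = K * mat_D Dt M p"
    if K: "K \<in> carrier_mat n n" and M: "D'.x.C_mat n M" "D'.t.C_mat n M" and p: "p \<in> S'" for K M p
    using D'.x.mat_D_mult[OF p D'.x.C_mat_const[OF K] M(1)] D'.t.mat_D_mult[OF p D'.t.C_mat_const[OF K] M(2)]
      D'.x.mat_D_const[OF p K] D'.t.mat_D_const[OF p K] D'.x.C_matD(1)[OF M(1) p] K by simp_all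
  have WD: "mat_Dx W0 p = W0 p * D.connection u p" "mat_Dx W1 p = W1 p * D.connection u p + W0 p * W.e"
    "mat_Dt W0 p = W0 p * W.Z0 p" "mat_Dt W1 p = W1 p * W.Z0 p + W0 p * lam_coeff (Y p ^\<^sub>m j) 1"
    if p: "p \<in> S'" for p
  proof -
    have pS: "p \<in> S" using p S'(1) by blast
    note c = gc[of p] Erc[of p] Ac Z0c[OF pS, of 0] Z0c[OF pS, of 1]
    have Z: "W.Z0 p = D.Z_coeff Z 0 p" using Zc0[OF pS] by (simp add: W.Z0_def)
    have gD: "mat_D Dx g p = g p * D.connection u p" "mat_D Dt g p = g p * D.Z_coeff Z 0 p"
      using gx[OF pS] gt[OF pS] by (simp_all add: mat_Dx_eq mat_Dt_eq)
    have ErD: "mat_D Dx Er p = Er p * D.connection u p + g p * W.e" "mat_D Dt Er p = Er p * D.Z_coeff Z 0 p + g p * D.Z_coeff Z 1 p"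
      using Er(3)[OF pS] Er(4)[OF pS] by (simp_all add: mat_Dx_eq mat_Dt_eq W.e_def)
    have swap: "P + (Q + R) = P + Q + R" if "P \<in> carrier_mat n n" "Q \<in> carrier_mat n n" "R \<in> carrier_mat n n" for P Q R :: "real mat"
      using that by (intro assoc_add_mat[symmetric])
    show "mat_Dx W0 p = W0 p * D.connection u p" "mat_Dt W0 p = W0 p * W.Z0 p"
      unfolding mat_Dx_eq mat_Dt_eq W0_def[abs_def] const_mult[OF Ac C(1,3) p] gD Z using c
      by (simp_all add: D.assoc)
    have "mat_D Dx W1 p = W.e * mat_D Dx g p + A * mat_D Dx Er p" "mat_D Dt W1 p = W.e * mat_D Dt g p + A * mat_D Dt Er p"
      unfolding W1_def[abs_def]
      using D'.x.mat_D_add[OF p D'.x.C_mat_mult[OF D'.x.C_mat_const[OF W.carriers(2)] C(1)] D'.x.C_mat_mult[OF D'.x.C_mat_const[OF Ac] C(2)]]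
        D'.t.mat_D_add[OF p D'.t.C_mat_mult[OF D'.t.C_mat_const[OF W.carriers(2)] C(3)] D'.t.C_mat_mult[OF D'.t.C_mat_const[OF Ac] C(4)]]
        const_mult[OF W.carriers(2) C(1,3) p] const_mult[OF Ac C(2,4) p] by simp_all
    then show "mat_Dx W1 p = W1 p * D.connection u p + W0 p * W.e"
      "mat_Dt W1 p = W1 p * W.Z0 p + W0 p * lam_coeff (Y p ^\<^sub>m j) 1"
      unfolding mat_Dx_eq mat_Dt_eq gD ErD Z Zc1[OF pS, symmetric] W0_def W1_def using c
      by (simp_all add: D.ring_distribs D.assoc swap)
  qed
  have det_new: "det (W1 p * W.Bm p + W0 p * W.B0 p) = 1" if p: "p \<in> S'" for p
  proof -
    have pS: "p \<in> S" using p S'(1) by blast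
    show ?thesis unfolding W0_def W1_def
    proof (rule W.det_new_frame[where E = "E p" and ?E1.0 = "Er p" and g = "g p", OF p assms(11) Ec[OF _ pS] _ E0[OF pS] gc Erc det_g[OF pS] hessA detA ker[OF p]])
      fix r k assume rk: "r < n" "k < n"
      show "((\<lambda>l. E p l $$ (r, k)) has_field_derivative map_mat complex_of_real (Er p) $$ (r, k)) (at 0)"
        unfolding Er(1)[OF pS] using holomorphic_derivI[OF hol[OF pS rk], of 0] assms(11) rk
        by (simp add: lam_deriv_mat_def)
    qed
  qed
  \<comment> \<open>The sign of the cofactor column. Its n-th power is 1 since n (n - 1) is even, so
    the determinant condition is kept; the equations of the curve are linear once the curvature is
    fixed.\<close>
  define \<epsilon> :: real where "\<epsilon> = (-1) ^ (n - 1)"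
  have \<epsilon>: "\<epsilon> ^ n = 1"
  proof -
    have "even ((n - 1) * n)" by (cases n) auto
    then show ?thesis unfolding \<epsilon>_def power_mult[symmetric] by simp
  qed
  define \<gamma>' where "\<gamma>' p = vec n (\<lambda>r. \<epsilon> * (\<Sum>k<n. W1 p $$ (r, k) * w k p))" for p
  have "ca_flow_solution n j S' \<gamma>'"
    unfolding \<gamma>'_def[abs_def]
    by (rule W.new_solution[OF Ws WD _ det_new \<epsilon>]) (use ker in \<open>simp_all add: W0_def\<close>)
  moreover have "map_vec complex_of_real (\<gamma>' p) =
      ((elem_mat n 1 n * map_mat complex_of_real (g p) + map_mat complex_of_real (bt_A n c) * E1 p)
        * adj_mat (bt_f n u h p 0)) *\<^sub>v unit_vec n 0" if p: "p \<in> S'" for p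
  proof -
    have pS: "p \<in> S" using p S'(1) by blast
    have f: "bt_f n u h p 0 = map_mat complex_of_real (W.f0 p)"
      by (rule D.eqI) (auto simp: bt_f_def W.f0_def J_mat_def elem_mat_def b_mat_def bt_N_def)
    have W1c: "elem_mat n 1 n * map_mat complex_of_real (g p) + map_mat complex_of_real (bt_A n c) * E1 p = map_mat complex_of_real (W1 p)"
      using Er(1)[OF pS] gc[of p] Erc[of p] Ac
      by (simp add: W1_def D.cmat_lin D.cmat_mult A_def[symmetric] assms(15) W.e_def D.cmat_elem)
    have hf: "D.hessenberg (map_mat complex_of_real (W.f0 p))" by (rule D.hessenberg_cmat[OF W.hessenberg_f0])
    have adjc: "adj_mat (map_mat complex_of_real (W.f0 p)) \<in> carrier_mat n n" by (rule adj_mat(1)) simp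
    \<comment> \<open>The Hessenberg argument is applied over the complex numbers, where the
      cofactor matrix of the statement lives; the kernel relation is carried over from the
      reals.\<close>
    have adj: "adj_mat (map_mat complex_of_real (W.f0 p)) $$ (r, 0) = complex_of_real (\<epsilon> * w r p)" if "r < n" for r
    proof -
      have "(\<Sum>k<n. map_mat complex_of_real (W.f0 p) $$ (i, k) * complex_of_real (w k p)) = 0" if "i < n" for i
      proof -
        have "(\<Sum>k<n. map_mat complex_of_real (W.f0 p) $$ (i, k) * complex_of_real (w k p))
          = complex_of_real (\<Sum>k<n. W.f0 p $$ (i, k) * w k p)"
          using that by simp
        then show ?thesis using W.f0_kernel[OF p that] by simp
      qed
      then show ?thesis
        using D.adj_hessenberg_column[OF hf, of "\<lambda>k. complex_of_real (w k p)" r] that n_ge w_last[OF p]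
        by (simp add: \<epsilon>_def)
    qed
    show ?thesis unfolding W1c f
    proof (rule eq_vecI)
      fix r assume "r < dim_vec ((map_mat complex_of_real (W1 p) * adj_mat (map_mat complex_of_real (W.f0 p))) *\<^sub>v unit_vec n 0)"
      then have r: "r < n" using Wc by simp
      have n0: "0 < n" using n_ge by simp
      have "((map_mat complex_of_real (W1 p) * adj_mat (map_mat complex_of_real (W.f0 p))) *\<^sub>v unit_vec n 0) $ r
        = (map_mat complex_of_real (W1 p) * adj_mat (map_mat complex_of_real (W.f0 p))) $$ (r, 0)"
        using r n0 Wc adjc by simp
      also have "\<dots> = (\<Sum>k<n. map_mat complex_of_real (W1 p) $$ (r, k) * adj_mat (map_mat complex_of_real (W.f0 p)) $$ (k, 0))"
        by (rule D.mult_index[OF _ adjc r n0]) (use Wc in simp)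
      also have "\<dots> = (\<Sum>k<n. complex_of_real (\<epsilon> * (W1 p $$ (r, k) * w k p)))"
        using r Wc by (intro sum.cong refl) (simp add: adj)
      also have "\<dots> = map_vec complex_of_real (\<gamma>' p) $ r"
        using r by (simp add: \<gamma>'_def sum_distrib_left)
      finally show "map_vec complex_of_real (\<gamma>' p) $ r
        = ((map_mat complex_of_real (W1 p) * adj_mat (map_mat complex_of_real (W.f0 p))) *\<^sub>v unit_vec n 0) $ r" by simp
    qed (use Wc in \<open>simp add: \<gamma>'_def\<close>)
  qed
  ultimately show ?thesis by blast
qed

end
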